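(* Let $N \ge 3$ be an integer, let $H$ be a Finsler norm on $\mathbb{R}^{N-1}$ with dual norm $H^0$, and let $\Phi(\xi,t)=\sqrt{H(\xi)^2+t^2}$ and $\Phi^0(x,t)=\sqrt{H^0(x)^2+t^2}$. For $2\le\beta<N$ put $$K(N,\beta) = 2\,\frac{\Gamma\left(\frac{N+\beta}{4}-\frac12\right)\Gamma\left(\frac{N-\beta}{4}+\frac12\right)}{\Gamma\left(\frac{N+\beta}{4}-1\right)\Gamma\left(\frac{N-\beta}{4}\right)}.$$ Then for every $2\le\beta<N$ and every $u\in W^{1,2}(\mathbb{R}^N_+)$, $$K(N,\beta)\int_{\partial\mathbb{R}^N_+}\frac{u^2(x,0)}{\Phi^0(x,0)}\,dx \le \int_{\mathbb{R}^N_+}\Phi^2(\nabla u)\,dz-\frac{(\beta-2)^2}{4}\int_{\mathbb{R}^N_+}\frac{u^2(z)}{[\Phi^0(z)]^2}\,dz .$$ Moreover, $K(N,\beta)$ is sharp in the sense that $$K(N,\beta)=\inf_{u}\ \frac{\displaystyle\int_{\mathbb{R}^N_+}\Phi^2(\nabla u)\,dz-\frac{(\beta-2)^2}{4}\int_{\mathbb{R}^N_+}\frac{u^2(z)}{[\Phi^0(z)]^2}\,dz}{\displaystyle\int_{\partial\mathbb{R}^N_+}\frac{u^2(x,0)}{\Phi^0(x,0)}\,dx},$$ where the infimum is over all $u\in W^{1,2}(\mathbb{R}^N_+)$ whose trace on $\partial\mathbb{R}^N_+$ is not identically zero.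
   Context: Finsler norm: a function $H:\mathbb{R}^n\to[0,\infty)$, $H\in C^2(\mathbb{R}^n\setminus\{0\})$, continuous, with $H(\lambda\xi)=|\lambda|H(\xi)$ for all $\xi\in\mathbb{R}^n$, $\lambda\in\mathbb{R}$, with $\gamma_1|\xi|\le H(\xi)\le\gamma_2|\xi|$ for some constants $0<\gamma_1\le\gamma_2<\infty$, and strictly convex (in the sense appropriate to norms: $H$ is convex and its unit ball $\{H<1\}$ is strictly convex, equivalently $H^2$ is strictly convex). Its dual (polar) norm is $H^0(x)=\sup_{\xi\ne0}\langle\xi,x\rangle/H(\xi)$, where $\langle\cdot,\cdot\rangle$ is the Euclidean inner product on $\mathbb{R}^n$. Here $n=N-1$. $\mathbb{R}^N_+=\mathbb{R}^{N-1}\times[0,\infty)$, with points $z=(x,t)$, $x\in\mathbb{R}^{N-1}$, $t\ge0$; $dz=dx\,dt$ is Lebesgue measure; $\partial\mathbb{R}^N_+=\mathbb{R}^{N-1}\times\{0\}$. $W^{1,2}(\mathbb{R}^N_+)$ is the usual Sobolev space of real-valued functions (on the interior of $\mathbb{R}^N_+$), $\nabla u=(\nabla_x u,\partial u/\partial t)$ is the full gradient, and $u(x,0)$ denotes the trace of $u$. $\Gamma$ is the Euler Gamma function. *)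

theory Defs
  imports "HOL-Analysis.Analysis"
begin

text \<open>C^k functions on an open set, by iterating the partial derivatives along the standard basis.\<close>

primrec Ck_on :: "nat \<Rightarrow> ('a::euclidean_space \<Rightarrow> real) \<Rightarrow> 'a set \<Rightarrow> bool" where
  "Ck_on 0 f S \<longleftrightarrow> continuous_on S f"
| "Ck_on (Suc k) f S \<longleftrightarrow>
     (\<forall>x\<in>S. f differentiable (at x)) \<and>
     (\<forall>b\<in>Basis. Ck_on k (\<lambda>x. frechet_derivative f (at x) b) S)"

definition strictly_convex_set :: "'a::euclidean_space set \<Rightarrow> bool" where
  "strictly_convex_set S \<longleftrightarrow>
     (\<forall>x\<in>closure S. \<forall>y\<in>closure S. x \<noteq> y \<longrightarrow> open_segment x y \<subseteq> interior S)"

text \<open>A norm is never strictly convex as a function, being linear on rays; strict convexity refers to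
  the unit ball.\<close>

definition Finsler_norm :: "('a::euclidean_space \<Rightarrow> real) \<Rightarrow> bool" where
  "Finsler_norm H \<longleftrightarrow>
     (\<forall>\<xi>. 0 \<le> H \<xi>) \<and>
     continuous_on UNIV H \<and>
     Ck_on 2 H (- {0}) \<and>
     (\<forall>c \<xi>. H (c *\<^sub>R \<xi>) = \<bar>c\<bar> * H \<xi>) \<and>
     (\<exists>\<gamma>1 \<gamma>2. 0 < \<gamma>1 \<and> \<gamma>1 \<le> \<gamma>2 \<and> (\<forall>\<xi>. \<gamma>1 * norm \<xi> \<le> H \<xi> \<and> H \<xi> \<le> \<gamma>2 * norm \<xi>)) \<and>
     convex_on UNIV H \<and>
     strictly_convex_set {\<xi>. H \<xi> < 1}"

definition dual_norm :: "('a::euclidean_space \<Rightarrow> real) \<Rightarrow> 'a \<Rightarrow> real" where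
  "dual_norm H x = (SUP \<xi>\<in>- {0}. (\<xi> \<bullet> x) / H \<xi>)"

text \<open>The function \<open>\<Phi>\<close> is \<open>Phi H\<close>, and \<open>\<Phi>^0\<close> is \<open>Phi (dual_norm H)\<close>.\<close>

definition Phi :: "('a \<Rightarrow> real) \<Rightarrow> 'a \<times> real \<Rightarrow> real" where
  "Phi H = (\<lambda>(\<xi>, t). sqrt ((H \<xi>)\<^sup>2 + t\<^sup>2))"

definition K_const :: "nat \<Rightarrow> real \<Rightarrow> real" where
  "K_const N \<beta> =
     2 * ((Gamma ((real N + \<beta>) / 4 - 1 / 2) * Gamma ((real N - \<beta>) / 4 + 1 / 2)) /
          (Gamma ((real N + \<beta>) / 4 - 1) * Gamma ((real N - \<beta>) / 4)))"

text \<open>The open half-space; it differs from its closure by a Lebesgue null set.\<close>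

definition half_space :: "('a::euclidean_space \<times> real) set" where
  "half_space = {z. 0 < snd z}"

definition test_function :: "'a::euclidean_space set \<Rightarrow> ('a \<Rightarrow> real) \<Rightarrow> bool" where
  "test_function \<Omega> \<phi> \<longleftrightarrow>
     (\<forall>k. Ck_on k \<phi> UNIV) \<and>
     compact (closure {z. \<phi> z \<noteq> 0}) \<and> closure {z. \<phi> z \<noteq> 0} \<subseteq> \<Omega>"

definition locally_integrable ::
  "'a::euclidean_space set \<Rightarrow> ('a \<Rightarrow> 'b::euclidean_space) \<Rightarrow> bool" where
  "locally_integrable \<Omega> f \<longleftrightarrow> (\<forall>C. compact C \<and> C \<subseteq> \<Omega> \<longrightarrow> set_integrable lebesgue C f)"

definition L2_on :: "'a::euclidean_space set \<Rightarrow> ('a \<Rightarrow> 'b::euclidean_space) \<Rightarrow> bool" where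
  "L2_on \<Omega> f \<longleftrightarrow>
     set_borel_measurable lebesgue \<Omega> f \<and> set_integrable lebesgue \<Omega> (\<lambda>z. (norm (f z))\<^sup>2)"

definition has_weak_gradient ::
  "'a::euclidean_space set \<Rightarrow> ('a \<Rightarrow> real) \<Rightarrow> ('a \<Rightarrow> 'a) \<Rightarrow> bool" where
  "has_weak_gradient \<Omega> u g \<longleftrightarrow>
     locally_integrable \<Omega> u \<and> locally_integrable \<Omega> g \<and>
     (\<forall>\<phi>. test_function \<Omega> \<phi> \<longrightarrow>
        (\<forall>b\<in>Basis. (LINT z:\<Omega>|lebesgue. u z * frechet_derivative \<phi> (at z) b) =
                   - (LINT z:\<Omega>|lebesgue. (g z \<bullet> b) * \<phi> z)))"

text \<open>Functions are not identified almost everywhere, so weak gradients and traces are unique only up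
  to null sets; \<open>weak_gradient\<close> and \<open>boundary_trace\<close> below pick a representative.\<close>

definition weak_gradient :: "'a::euclidean_space set \<Rightarrow> ('a \<Rightarrow> real) \<Rightarrow> 'a \<Rightarrow> 'a" where
  "weak_gradient \<Omega> u = (SOME g. has_weak_gradient \<Omega> u g)"

definition W12 :: "'a::euclidean_space set \<Rightarrow> ('a \<Rightarrow> real) set" where
  "W12 \<Omega> = {u. L2_on \<Omega> u \<and> (\<exists>g. has_weak_gradient \<Omega> u g \<and> L2_on \<Omega> g)}"

definition W12_norm :: "'a::euclidean_space set \<Rightarrow> ('a \<Rightarrow> real) \<Rightarrow> real" where
  "W12_norm \<Omega> u =
     sqrt ((LINT z:\<Omega>|lebesgue. (u z)\<^sup>2) + (LINT z:\<Omega>|lebesgue. (norm (weak_gradient \<Omega> u z))\<^sup>2))"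

text \<open>The trace operator is the extension by density, continuous from \<open>W^{1,2}\<close> of the half-space to
  \<open>L^2\<close> of the boundary, of the restriction \<open>\<phi> \<mapsto> \<phi>(\<cdot>,0)\<close> on smooth compactly supported functions on the
  whole space (whose supports may meet the boundary).\<close>

definition has_trace :: "('a::euclidean_space \<times> real \<Rightarrow> real) \<Rightarrow> ('a \<Rightarrow> real) \<Rightarrow> bool" where
  "has_trace u f \<longleftrightarrow>
     u \<in> W12 half_space \<and> L2_on UNIV f \<and>
     (\<exists>\<phi> :: nat \<Rightarrow> 'a \<times> real \<Rightarrow> real.
        (\<forall>k. test_function UNIV (\<phi> k)) \<and>
        (\<lambda>k. W12_norm half_space (\<lambda>z. \<phi> k z - u z)) \<longlonglongrightarrow> 0 \<and>
        (\<lambda>k. LINT x|lebesgue. (\<phi> k (x, 0) - f x)\<^sup>2) \<longlonglongrightarrow> 0)"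

definition boundary_trace :: "('a::euclidean_space \<times> real \<Rightarrow> real) \<Rightarrow> 'a \<Rightarrow> real" where
  "boundary_trace u = (SOME f. has_trace u f)"

end

theory Submission
  imports Defs
begin

text \<open>Write \<open>\<mu> = (N - 2) / 2\<close>, \<open>\<kappa> = (\<beta> - 2) / 2\<close> and \<open>R = \<Phi>^0\<close>. The function \<open>v = R^(-\<mu>) f(t / R)\<close> with the profile
  \<open>f(s) = \<integral> w^(b/2-1) (1-w)^(a/2-1) (1 + 2 s (w (1-w))^(1/2))^(-\<mu>) dw\<close> over \<open>[0, 1]\<close>, \<open>a = \<mu> + \<kappa>\<close>, \<open>b = \<mu> - \<kappa>\<close>, is a positive solution
  of the Finsler Euler-Lagrange equation, and \<open>- f'(0) / f(0)\<close> is a quotient of Beta integrals equal to \<open>K(N, \<beta>)\<close>. The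
  Legendre image \<open>F\<close> of \<open>\<nabla>v / v\<close> satisfies \<open>div F + \<Phi>^0(F)^2 = - \<kappa>^2 / R^2\<close> and has \<open>t\<close>-component \<open>- K / R\<close> on the
  boundary. Integrating \<open>2 u \<langle>F, \<nabla>u\<rangle> \<le> \<Phi>(\<nabla>u)^2 + u^2 \<Phi>^0(F)^2\<close> by parts gives the inequality for test functions, the
  singularity at the origin being avoided by the shift \<open>t \<mapsto> t + e\<close> and Fatou's lemma as \<open>e\<close> tends to \<open>0\<close>. Density of
  test functions extends it to \<open>W^{1,2}\<close>. Truncating the shifted \<open>v\<close> at infinity gives a minimizing sequence.\<close>

section \<open>Smooth test functions\<close>

text \<open>The anisotropy drops out for the following reason. R grad R is (\<open>dual_grad\<close>
  x, t + e), and the Legendre map of \<Phi> sends it back to (x, t + e), so \<open>F\<close> is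
  horizontally a multiple of x. The pairing of \<open>dual_grad\<close> x with x and its
  \<open>H\<close>-norm are the same powers of the dual norm as in the Euclidean case, so div F
  depends on R and t alone. This asks for a C^1 dual norm off the origin, which strict convexity of
  the unit ball supplies. The profile comes from the Euclidean picture: poles of the fundamental
  solution |z|^(2-N), spread along the negative t-axis with density \<lambda>^(b-1), add up to a
  harmonic function R^(-a) f(t / R). The angular equation of f involves a and b only through a + b =
  2 \<mu> and a b = \<mu>^2 - \<kappa>^2, so the same f belongs to R^(-\<mu>) in the presence of the
  Hardy term. Sharpness is a borderline effect: on the boundary v^2 / H^0 decays like R^(1-N) in
  dimension N - 1, so its integral diverges logarithmically and v is only a limit of admissible
  functions.\<close>

definition smooth :: "('a::euclidean_space \<Rightarrow> real) \<Rightarrow> bool" where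
  "smooth f \<longleftrightarrow> (\<forall>k. Ck_on k f UNIV)"

lemma smooth_differentiable: "smooth f \<Longrightarrow> f differentiable (at x)"
  using Ck_on.simps(2)[of 0 f UNIV] by (simp add: smooth_def del: Ck_on.simps(1))

lemma smooth_partial: "smooth f \<Longrightarrow> b \<in> Basis \<Longrightarrow> smooth (\<lambda>x. frechet_derivative f (at x) b)"
  unfolding smooth_def by (metis Ck_on.simps(2))

text \<open>Derivatives of products and composites do not keep the original shape, so an induction
  on the order for a single function does not close. Passing to a whole family reduces smoothness to
  exhibiting one that is stable under differentiation.\<close>

lemma smooth_coinduct:
  assumes "f \<in> A" and d: "\<And>f x. f \<in> A \<Longrightarrow> f differentiable (at x)"
    and c: "\<And>f b. f \<in> A \<Longrightarrow> b \<in> Basis \<Longrightarrow> (\<lambda>x. frechet_derivative f (at x) b) \<in> A"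
  shows "smooth f"
proof -
  have "Ck_on k f UNIV" if "f \<in> A" for k f
    using that
  proof (induction k arbitrary: f)
    case 0
    then show ?case using d[OF 0]
      by (auto simp: continuous_on_eq_continuous_at intro: differentiable_imp_continuous_within)
  next
    case (Suc k)
    then show ?case using d c by auto
  qed
  then show ?thesis using assms(1) by (auto simp: smooth_def)
qed

lemma smoothI:
  assumes "\<And>x. (f has_derivative f' x) (at x)" "\<And>b. b \<in> Basis \<Longrightarrow> smooth (\<lambda>x. f' x b)"
  shows "smooth f"
proof (rule smooth_coinduct[where A="insert f {g. smooth g}"])
  have fd: "frechet_derivative f (at x) = f' x" for x
    using assms(1) by (metis frechet_derivative_at)
  show "g differentiable (at x)" if "g \<in> insert f {g. smooth g}" for g x
    using that assms(1) smooth_differentiable by (auto simp: differentiable_def)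
  show "(\<lambda>x. frechet_derivative g (at x) b) \<in> insert f {g. smooth g}"
    if "g \<in> insert f {g. smooth g}" "b \<in> Basis" for g b
    using that assms(2) smooth_partial fd by auto
qed auto

lemma smooth_continuous: "smooth f \<Longrightarrow> continuous_on S f"
  unfolding smooth_def by (metis Ck_on.simps(1) continuous_on_subset subset_UNIV)

lemma smooth_has_derivative: "smooth f \<Longrightarrow> (f has_derivative frechet_derivative f (at x)) (at x)"
  using smooth_differentiable frechet_derivative_works by blast

lemma smooth_const: "smooth (\<lambda>x. c)"
proof (rule smooth_coinduct[where A="range (\<lambda>c x. c)"])
  show "(\<lambda>x. frechet_derivative f (at x) b) \<in> range (\<lambda>c x. c)"
    if "f \<in> range (\<lambda>c x. c)" for f :: "'a \<Rightarrow> real" and b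
    using that by (auto simp: frechet_derivative_const)
qed auto

text \<open>By the Leibniz rule a partial derivative of a product is a sum of products. Finite sums
  of products are therefore the smallest natural family to which \<open>smooth_coinduct\<close>
  applies.\<close>

inductive_set product_sums :: "('a::euclidean_space \<Rightarrow> real) set" where
  "smooth f \<Longrightarrow> smooth g \<Longrightarrow> (\<lambda>x. f x * g x) \<in> product_sums"
| "f \<in> product_sums \<Longrightarrow> g \<in> product_sums \<Longrightarrow> (\<lambda>x. f x + g x) \<in> product_sums"

lemma smooth_mult:
  assumes "smooth f" "smooth g" shows "smooth (\<lambda>x. f x * g x)"
proof -
  have *: "(\<forall>x. h differentiable (at x)) \<and> (\<forall>b\<in>Basis. (\<lambda>x. frechet_derivative h (at x) b) \<in> product_sums)"
    if "h \<in> product_sums" for h :: "'a \<Rightarrow> real"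
    using that
  proof induction
    case (1 f g)
    have D: "((\<lambda>x. f x * g x) has_derivative
        (\<lambda>v. f x * frechet_derivative g (at x) v + frechet_derivative f (at x) v * g x)) (at x)" for x
      by (intro has_derivative_mult smooth_has_derivative 1)
    show ?case
      unfolding frechet_derivative_at[OF D, symmetric]
      using D by (auto simp: differentiable_def intro!: product_sums.intros 1 smooth_partial)
  next
    case (2 f g)
    have D: "((\<lambda>x. f x + g x) has_derivative
        (\<lambda>v. frechet_derivative f (at x) v + frechet_derivative g (at x) v)) (at x)" for x
      using 2 by (intro has_derivative_add) (auto simp: frechet_derivative_works[symmetric])
    show ?case
      unfolding frechet_derivative_at[OF D, symmetric]
      using D 2 by (auto simp: differentiable_def intro!: product_sums.intros)
  qed
  show ?thesis
    by (rule smooth_coinduct[where A=product_sums]) (use * assms product_sums.intros in auto)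
qed

lemma smooth_affine: "smooth (\<lambda>z. (z - c) \<bullet> b)"
proof (rule smoothI)
  show "((\<lambda>z. (z - c) \<bullet> b) has_derivative (\<lambda>v. v \<bullet> b)) (at x)" for x
    by (auto intro!: derivative_eq_intros)
qed (rule smooth_const)

lemma smooth_quadratic: "smooth (\<lambda>z. r - (z - c) \<bullet> (z - c))"
proof (rule smoothI)
  show "((\<lambda>z. r - (z - c) \<bullet> (z - c)) has_derivative (\<lambda>v. - 2 * ((x - c) \<bullet> v))) (at x)" for x
    by (auto intro!: derivative_eq_intros simp: inner_commute)
qed (intro smooth_mult smooth_const smooth_affine)

text \<open>The power of 1/x is a parameter because differentiating exp (-1/x) produces exactly such
  factors; with it the derivative stays in the span of these functions.\<close>

definition flat_exp :: "nat \<Rightarrow> real \<Rightarrow> real" where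
  "flat_exp m x = (if 0 < x then inverse x ^ m * exp (- inverse x) else 0)"

lemma flat_exp_DERIV: "DERIV (flat_exp m) x :> flat_exp (m + 2) x - real m * flat_exp (m + 1) x"
proof -
  consider "x > 0" | "x < 0" | "x = 0" by linarith
  then show ?thesis
  proof cases
    case 1
    have D: "DERIV (\<lambda>x. inverse x ^ m * exp (- inverse x)) x :> flat_exp (m + 2) x - real m * flat_exp (m + 1) x"
      using 1 by (cases m)
        (auto intro!: derivative_eq_intros simp: flat_exp_def field_simps power2_eq_square,
          metis power_eq_if One_nat_def)
    have "eventually (\<lambda>y. y > 0) (nhds x)"
      using 1 eventually_nhds_in_open[of "{0<..}" x] by simp
    then have "\<forall>\<^sub>F y in nhds x. inverse y ^ m * exp (- inverse y) = flat_exp m y"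
      by eventually_elim (auto simp: flat_exp_def)
    then show ?thesis using D by (rule DERIV_cong_ev[THEN iffD1, OF refl _ refl])
  next
    case 2
    have "eventually (\<lambda>y. y < 0) (nhds x)"
      using 2 eventually_nhds_in_open[of "{..<0}" x] by simp
    then have "\<forall>\<^sub>F y in nhds x. 0 = flat_exp m y"
      by eventually_elim (auto simp: flat_exp_def)
    then have "DERIV (flat_exp m) x :> 0"
      by (rule DERIV_cong_ev[THEN iffD1, OF refl _ refl]) simp
    then show ?thesis using 2 by (simp add: flat_exp_def)
  next
    case 3
    \<comment> \<open>To the right of 0 the difference quotient is y^(-(m+1)) exp (-1/y). In the
      variable 1/y this is a power divided by an exponential.\<close>
    have "((\<lambda>y::real. y ^ (m + 1) / exp y) \<longlongrightarrow> 0) at_top"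
      by (rule tendsto_power_div_exp_0)
    then have "((\<lambda>y::real. inverse y ^ (m + 1) / exp (inverse y)) \<longlongrightarrow> 0) (at_right 0)"
      by (rule filterlim_compose) (rule filterlim_inverse_at_top_right)
    then have r: "((\<lambda>y. flat_exp m y / y) \<longlongrightarrow> 0) (at_right 0)"
      by (rule Lim_transform_eventually)
         (auto simp: eventually_at_right_less flat_exp_def exp_minus divide_simps
            intro!: eventually_mono[OF eventually_at_right_less])
    have l: "((\<lambda>y. flat_exp m y / y) \<longlongrightarrow> 0) (at_left 0)"
      by (rule Lim_transform_eventually[OF tendsto_const])
         (auto simp: flat_exp_def eventually_at_left_field intro!: exI[of _ "-1"])
    have "((\<lambda>y. flat_exp m y / y) \<longlongrightarrow> 0) (at 0)"
      using r l by (simp add: filterlim_split_at)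
    then show ?thesis
      using 3 by (simp add: DERIV_def flat_exp_def)
  qed
qed

text \<open>The smooth factor h absorbs the derivatives of the inner function q, so the chain rule
  does not lead out of this family.\<close>

inductive_set flat_sums :: "('a::euclidean_space \<Rightarrow> real) \<Rightarrow> ('a \<Rightarrow> real) set" for q where
  "smooth h \<Longrightarrow> (\<lambda>x. flat_exp m (q x) * h x) \<in> flat_sums q"
| "f \<in> flat_sums q \<Longrightarrow> g \<in> flat_sums q \<Longrightarrow> (\<lambda>x. f x + g x) \<in> flat_sums q"

lemma smooth_flat_exp:
  assumes q: "smooth q" shows "smooth (\<lambda>x. flat_exp m (q x))"
proof -
  have *: "(\<forall>x. h differentiable (at x)) \<and> (\<forall>b\<in>Basis. (\<lambda>x. frechet_derivative h (at x) b) \<in> flat_sums q)"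
    if "h \<in> flat_sums q" for h
    using that
  proof induction
    case (1 h m)
    let ?D = "\<lambda>x v. flat_exp (m + 2) (q x) * (frechet_derivative q (at x) v * h x) +
            (flat_exp (m + 1) (q x) * (- real m * (frechet_derivative q (at x) v * h x)) +
             flat_exp m (q x) * frechet_derivative h (at x) v)"
    have D: "((\<lambda>x. flat_exp m (q x) * h x) has_derivative ?D x) (at x)" for x
    proof -
      have "((\<lambda>x. flat_exp m (q x)) has_derivative (\<lambda>v. (flat_exp (m + 2) (q x) - real m * flat_exp (m + 1) (q x)) * frechet_derivative q (at x) v)) (at x)"
        using has_derivative_compose[OF smooth_has_derivative[OF q] flat_exp_DERIV[unfolded has_field_derivative_def]]
        by simp
      from has_derivative_mult[OF this smooth_has_derivative[OF 1(1)]]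
      show ?thesis by (rule has_derivative_eq_rhs) (auto simp: algebra_simps)
    qed
    have "(\<lambda>x. ?D x b) \<in> flat_sums q" if "b \<in> Basis" for b
      by (intro flat_sums.intros smooth_mult smooth_partial smooth_const 1 q that)
    then show ?case
      unfolding frechet_derivative_at[OF D, symmetric]
      using D by (auto simp: differentiable_def)
  next
    case (2 f g)
    have D: "((\<lambda>x. f x + g x) has_derivative
        (\<lambda>v. frechet_derivative f (at x) v + frechet_derivative g (at x) v)) (at x)" for x
      using 2 by (intro has_derivative_add) (auto simp: frechet_derivative_works[symmetric])
    show ?case
      unfolding frechet_derivative_at[OF D, symmetric]
      using D 2 by (auto simp: differentiable_def intro!: flat_sums.intros)
  qed
  show ?thesis
    by (rule smooth_coinduct[where A="flat_sums q"])
       (use * flat_sums.intros(1)[OF smooth_const[of 1], of m q] in auto)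
qed

lemma test_functionI:
  assumes "smooth f" "compact C" "C \<subseteq> \<Omega>" "\<And>z. f z \<noteq> 0 \<Longrightarrow> z \<in> C"
  shows "test_function \<Omega> f"
proof -
  have "closure {z. f z \<noteq> 0} \<subseteq> C"
    using assms by (intro closure_minimal) (auto simp: compact_imp_closed)
  moreover have "compact (closure {z. f z \<noteq> 0})"
    using compact_Int_closed[OF assms(2) closed_closure, of "{z. f z \<noteq> 0}"] calculation
    by (simp add: Int_absorb1)
  ultimately show ?thesis
    using assms by (auto simp: test_function_def smooth_def)
qed

lemma test_function_smooth: "test_function \<Omega> f \<Longrightarrow> smooth f"
  by (auto simp: test_function_def smooth_def)

lemma test_function_support:
  assumes "test_function \<Omega> f"
  obtains C where "compact C" "C \<subseteq> \<Omega>" "\<And>z. z \<notin> C \<Longrightarrow> f z = 0"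
    "\<And>z b. z \<notin> C \<Longrightarrow> frechet_derivative f (at z) b = 0"
proof
  let ?C = "closure {z. f z \<noteq> 0}"
  show "compact ?C" "?C \<subseteq> \<Omega>" using assms by (auto simp: test_function_def)
  show z: "f z = 0" if "z \<notin> ?C" for z using that closure_subset[of "{z. f z \<noteq> 0}"] by auto
  show "frechet_derivative f (at z) b = 0" if "z \<notin> ?C" for z b
  proof -
    have "z \<in> - ?C" using that by simp
    then have "(f has_derivative (\<lambda>_. 0)) (at z)"
      by (rule has_derivative_transform_within_open[OF has_derivative_const[of 0] open_Compl[OF closed_closure]])
         (rule z[symmetric], rule ComplD)
    then show ?thesis by (metis frechet_derivative_at)
  qed
qed

lemma test_function_mult:
  assumes "test_function \<Omega> f" "smooth g" shows "test_function \<Omega> (\<lambda>x. f x * g x)"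
proof -
  obtain C where "compact C" "C \<subseteq> \<Omega>" "\<And>z. z \<notin> C \<Longrightarrow> f z = 0"
    using test_function_support[OF assms(1)] by metis
  then show ?thesis
    using test_function_smooth[OF assms(1)] assms(2) by (intro test_functionI[of _ C] smooth_mult) auto
qed

lemma test_function_mono: "test_function \<Omega> f \<Longrightarrow> \<Omega> \<subseteq> \<Omega>' \<Longrightarrow> test_function \<Omega>' f"
  by (auto simp: test_function_def)

lemma test_function_partial:
  assumes "test_function \<Omega> f" "b \<in> Basis" shows "test_function \<Omega> (\<lambda>x. frechet_derivative f (at x) b)"
proof -
  obtain C where "compact C" "C \<subseteq> \<Omega>" "\<And>z b. z \<notin> C \<Longrightarrow> frechet_derivative f (at z) b = 0"
    using test_function_support[OF assms(1)] by metis
  then show ?thesis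
    using test_function_smooth[OF assms(1)] assms(2) by (intro test_functionI[of _ C] smooth_partial) auto
qed

lemma frechet_derivative_shift:
  assumes "smooth f"
  shows "((\<lambda>w. f (w + c)) has_derivative frechet_derivative f (at (x + c))) (at x)"
proof -
  have "((\<lambda>w. w + c) has_derivative (\<lambda>v. v)) (at x)" by (auto intro!: derivative_eq_intros)
  from has_derivative_compose[OF this smooth_has_derivative[OF assms]] show ?thesis .
qed

lemma smooth_shift:
  assumes "smooth f" shows "smooth (\<lambda>w. f (w + c))"
proof (rule smooth_coinduct[where A="{\<lambda>w. f (w + c) |f. smooth f}"])
  fix h :: "'a \<Rightarrow> real" assume "h \<in> {\<lambda>w. f (w + c) |f. smooth f}"
  then obtain f where h: "h = (\<lambda>w. f (w + c))" "smooth f" by auto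
  note D = frechet_derivative_shift[OF h(2), of c, folded h(1)]
  show "h differentiable (at x)" for x using D by (auto simp: differentiable_def)
  show "(\<lambda>x. frechet_derivative h (at x) b) \<in> {\<lambda>w. f (w + c) |f. smooth f}" if "b \<in> Basis" for b
    unfolding frechet_derivative_at[OF D, symmetric] using smooth_partial[OF h(2) that]
    by (intro CollectI exI[of _ "\<lambda>x. frechet_derivative f (at x) b"]) simp
qed (use assms in auto)

lemma bump_exists:
  fixes c :: "'a::euclidean_space"
  assumes "0 < r"
  obtains f where "test_function UNIV f" "\<And>z. 0 \<le> f z" "\<And>z. f z \<noteq> 0 \<longleftrightarrow> z \<in> ball c r" "\<And>z. f z \<le> f c"
proof
  let ?f = "\<lambda>z. flat_exp 0 (r\<^sup>2 - (z - c) \<bullet> (z - c))"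
  have *: "r\<^sup>2 - (z - c) \<bullet> (z - c) > 0 \<longleftrightarrow> z \<in> ball c r" for z
  proof -
    have "r\<^sup>2 - (z - c) \<bullet> (z - c) > 0 \<longleftrightarrow> (norm (z - c))\<^sup>2 < r\<^sup>2"
      by (simp add: power2_norm_eq_inner)
    also have "\<dots> \<longleftrightarrow> norm (z - c) < r"
      using assms by (smt (verit) norm_ge_zero power2_less_imp_less power_strict_mono zero_less_numeral)
    finally show ?thesis by (simp add: dist_norm norm_minus_commute)
  qed
  show nz: "?f z \<noteq> 0 \<longleftrightarrow> z \<in> ball c r" for z
    using * by (simp add: flat_exp_def)
  show "test_function UNIV ?f"
    by (rule test_functionI[of _ "cball c r"]) (use nz in \<open>auto intro: smooth_flat_exp smooth_quadratic\<close>)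
  show "0 \<le> ?f z" for z by (simp add: flat_exp_def)
  show "?f z \<le> ?f c" for z
    using assms by (auto simp: flat_exp_def le_imp_inverse_le)
qed

section \<open>Mollification and density in \<open>L^2\<close>\<close>

lemma test_function_bounded:
  assumes "test_function UNIV k" obtains M where "0 \<le> M" "\<And>x. \<bar>k x\<bar> \<le> M"
proof -
  obtain C where C: "compact C" "\<And>z. z \<notin> C \<Longrightarrow> k z = 0"
    using test_function_support[OF assms] by metis
  have "bounded (k ` C)"
    by (intro compact_imp_bounded compact_continuous_image C smooth_continuous[OF test_function_smooth[OF assms]])
  then obtain M where "\<And>x. x \<in> C \<Longrightarrow> \<bar>k x\<bar> \<le> M" by (auto simp: bounded_iff)
  then have "\<bar>k x\<bar> \<le> max M 0" for x using C(2)[of x] by (cases "x \<in> C") (auto simp: le_max_iff_disj)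
  then show thesis by (intro that[of "max M 0"]) auto
qed

lemma test_function_radius:
  assumes "test_function UNIV k" obtains R where "0 \<le> R" "\<And>x. R < norm x \<Longrightarrow> k x = 0"
    "\<And>x b. R < norm x \<Longrightarrow> frechet_derivative k (at x) b = 0"
proof -
  obtain C where C: "compact C" "\<And>z. z \<notin> C \<Longrightarrow> k z = 0" "\<And>z b. z \<notin> C \<Longrightarrow> frechet_derivative k (at z) b = 0"
    using test_function_support[OF assms] by metis
  obtain R where R: "\<And>x. x \<in> C \<Longrightarrow> norm x \<le> R" using compact_imp_bounded[OF C(1)] by (auto simp: bounded_iff)
  show thesis
    by (rule that[of "max R 0"]) (use C R in \<open>fastforce+\<close>)
qed

lemma linear_sum_Basis:
  fixes f :: "'a::euclidean_space \<Rightarrow> real"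
  assumes "linear f" shows "f v = (\<Sum>b\<in>Basis. (v \<bullet> b) * f b)"
proof -
  have "f v = f (\<Sum>b\<in>Basis. (v \<bullet> b) *\<^sub>R b)" by (simp add: euclidean_representation)
  also have "\<dots> = (\<Sum>b\<in>Basis. (v \<bullet> b) * f b)"
    by (simp add: linear_sum[OF assms] linear_cmul[OF assms])
  finally show ?thesis .
qed

lemma test_function_derivative_bound:
  fixes k :: "'a::euclidean_space \<Rightarrow> real"
  assumes "test_function UNIV k"
  obtains B where "0 \<le> B" "\<And>x v. \<bar>frechet_derivative k (at x) v\<bar> \<le> B * norm v"
    "\<And>x y. \<bar>k x - k y\<bar> \<le> B * norm (x - y)"
proof -
  have "\<exists>M. 0 \<le> M \<and> (\<forall>x. \<bar>frechet_derivative k (at x) b\<bar> \<le> M)" if "b \<in> Basis" for b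
    using test_function_bounded[OF test_function_partial[OF assms that]] by metis
  then obtain M where M: "\<And>b. b \<in> Basis \<Longrightarrow> 0 \<le> M b"
      "\<And>b x. b \<in> Basis \<Longrightarrow> \<bar>frechet_derivative k (at x) b\<bar> \<le> M b" by metis
  define B where "B = (\<Sum>b\<in>Basis. M b)"
  have D: "(k has_derivative frechet_derivative k (at x)) (at x)" for x
    by (rule smooth_has_derivative[OF test_function_smooth[OF assms]])
  have b: "\<bar>frechet_derivative k (at x) v\<bar> \<le> B * norm v" for x v
  proof -
    have "\<bar>frechet_derivative k (at x) v\<bar> \<le> (\<Sum>b\<in>Basis. \<bar>(v \<bullet> b) * frechet_derivative k (at x) b\<bar>)"
      using linear_sum_Basis[OF has_derivative_linear[OF D], of x v] by simp
    also have "\<dots> \<le> (\<Sum>b\<in>Basis. norm v * M b)"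
      using M by (intro sum_mono) (auto simp: abs_mult Basis_le_norm intro!: mult_mono)
    finally show ?thesis by (simp add: B_def sum_distrib_left mult.commute)
  qed
  have B0: "0 \<le> B" unfolding B_def using M by (intro sum_nonneg) auto
  have "norm (k x - k y) \<le> B * norm (x - y)" for x y
  proof (rule differentiable_bound[of UNIV])
    show "onorm (frechet_derivative k (at x)) \<le> B" for x
      by (rule onorm_bound) (use b B0 in auto)
  qed (use D in auto)
  then show thesis using that B0 b by auto
qed

text \<open>The kernel is evaluated at w - z, not z - w: the support of \<open>k\<close> then shows
  where \<open>f\<close> is sampled relative to z, at the price of a sign in each
  derivative.\<close>

definition conv :: "('a::euclidean_space \<Rightarrow> real) \<Rightarrow> ('a \<Rightarrow> real) \<Rightarrow> 'a \<Rightarrow> real" where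
  "conv k f z = (LINT w|lborel. f w * k (w - z))"

text \<open>Local integrability, with Borel instead of Lebesgue measurability because translations
  and Fubini's theorem are applied on \<open>lborel\<close>.\<close>

definition ball_integrable :: "('a::euclidean_space \<Rightarrow> real) \<Rightarrow> bool" where
  "ball_integrable f \<longleftrightarrow> f \<in> borel_measurable borel \<and> (\<forall>R. integrable lborel (\<lambda>w. indicator (cball 0 R) w * f w))"

lemma integrable_cball: "integrable lborel (indicator (cball (c::'a::euclidean_space) R) :: 'a \<Rightarrow> real)"
  by (intro integrable_real_indicator emeasure_lborel_cball_finite) auto

lemma ball_integrable_one: "ball_integrable (\<lambda>_::'a::euclidean_space. 1)"
  using integrable_cball by (auto simp: ball_integrable_def)

lemma ball_integrable_mult:
  assumes f: "ball_integrable f" and k: "k \<in> borel_measurable borel" "\<And>x. \<bar>k x\<bar> \<le> M" "\<And>x. R < norm x \<Longrightarrow> k x = 0"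
  shows "integrable lborel (\<lambda>w. f w * k w)"
proof (rule Bochner_Integration.integrable_bound)
  show "integrable lborel (\<lambda>w. M * (indicator (cball 0 R) w * f w))"
    using f by (simp add: ball_integrable_def)
  show "(\<lambda>w. f w * k w) \<in> borel_measurable lborel"
    using f k(1) by (auto simp: ball_integrable_def intro: borel_measurable_times)
  have "0 \<le> M" using k(2)[of 0] by linarith
  then show "AE w in lborel. norm (f w * k w) \<le> norm (M * (indicator (cball 0 R) w * f w))"
    using k(2,3) mult_left_mono[OF k(2) abs_ge_zero]
    by (intro AE_I2) (auto simp: indicator_def abs_mult mult.commute[of M])
qed

lemma conv_integrable:
  assumes f: "ball_integrable f" and k: "test_function UNIV k"
  shows "integrable lborel (\<lambda>w. f w * k (w - z))"
proof -
  obtain M where "\<And>x. \<bar>k x\<bar> \<le> M" using test_function_bounded[OF k] by metis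
  moreover obtain R where R: "\<And>x. R < norm x \<Longrightarrow> k x = 0" using test_function_radius[OF k] by metis
  moreover have "k (w - z) = 0" if "R + norm z < norm w" for w
    by (rule R) (use that norm_triangle_ineq2[of w z] in auto)
  moreover have "continuous_on UNIV (\<lambda>w. k (w - z))"
    by (intro continuous_on_compose2[OF smooth_continuous[OF test_function_smooth[OF k], of UNIV]] continuous_intros) auto
  ultimately show ?thesis
    by (intro ball_integrable_mult[OF f, where M=M and R="R + norm z"])
       (auto intro: borel_measurable_continuous_onI)
qed

text \<open>Dominated convergence is sequential, so the Frechet quotient is tested along sequences X
  tending to z. The Lipschitz bound of the kernel dominates the quotient by 2 B |f|, and since the X
  i stay in a ball of radius K all shifted kernels live in one ball of radius R + K.\<close>

lemma conv_has_derivative: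
  assumes f: "ball_integrable f" and k: "test_function UNIV k"
  shows "(conv k f has_derivative (\<lambda>v. - (LINT w|lborel. f w * frechet_derivative k (at (w - z)) v))) (at z)"
proof -
  let ?D = "\<lambda>x. frechet_derivative k (at x)"
  let ?L = "\<lambda>v. - (LINT w|lborel. f w * ?D (w - z) v)"
  have D: "(k has_derivative ?D x) (at x)" for x
    by (rule smooth_has_derivative[OF test_function_smooth[OF k]])
  have Dsum: "?D x v = (\<Sum>b\<in>Basis. (v \<bullet> b) * ?D x b)" for x v
    by (rule linear_sum_Basis[OF has_derivative_linear[OF D]])
  have Dint: "integrable lborel (\<lambda>w. f w * ?D (w - z) v)" for v
  proof -
    have "integrable lborel (\<lambda>w. \<Sum>b\<in>Basis. (v \<bullet> b) * (f w * ?D (w - z) b))"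
      by (intro Bochner_Integration.integrable_sum integrable_mult_right conv_integrable[OF f test_function_partial[OF k]])
    then show ?thesis by (subst Dsum) (simp add: sum_distrib_left algebra_simps)
  qed
  have linL: "linear ?L"
  proof (rule linearI)
    note lin = linear_add[OF has_derivative_linear[OF D]] linear_cmul[OF has_derivative_linear[OF D]]
    show "?L (u + v) = ?L u + ?L v" for u v
      using Bochner_Integration.integral_add[OF Dint[of u] Dint[of v]] by (simp add: lin distrib_left)
    have "f w * (c *\<^sub>R ?D (w - z) v) = c * (f w * ?D (w - z) v)" for w c v by simp
    then show "?L (c *\<^sub>R v) = c *\<^sub>R ?L v" for c v
      by (simp only: lin integral_mult_right_zero real_scaleR_def mult_minus_right)
  qed
  obtain B where B: "0 \<le> B" "\<And>x v. \<bar>?D x v\<bar> \<le> B * norm v" "\<And>x y. \<bar>k x - k y\<bar> \<le> B * norm (x - y)"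
    using test_function_derivative_bound[OF k] by metis
  obtain R where R: "0 \<le> R" "\<And>x. R < norm x \<Longrightarrow> k x = 0" "\<And>x b. R < norm x \<Longrightarrow> ?D x b = 0"
    using test_function_radius[OF k] by metis
  have "((\<lambda>y. norm (conv k f y - conv k f z - ?L (y - z)) / norm (y - z)) \<longlongrightarrow> 0) (at z)"
  proof (subst tendsto_at_iff_sequentially, intro allI impI)
    fix X assume X: "\<forall>i. X i \<in> UNIV - {z}" "X \<longlonglongrightarrow> z"
    have Xz: "X i \<noteq> z" for i using X by auto
    obtain K where K: "\<And>i. norm (X i) \<le> K"
      using convergent_imp_Bseq[OF convergentI[OF X(2)]] by (auto simp: Bseq_def)
    have Kz: "norm z \<le> K" by (rule LIMSEQ_le_const2[OF tendsto_norm[OF X(2)]]) (use K in auto)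
    \<comment> \<open>Integrating \<open>q i\<close> gives the whole remainder quotient, so the
      differentiability claim becomes a single limit of integrals.\<close>
    define q where "q i w = f w * ((k (w - X i) - k (w - z) + ?D (w - z) (X i - z)) / norm (X i - z))" for i w
    have qint: "integrable lborel (q i)" for i
    proof -
      have "integrable lborel (\<lambda>w. (f w * k (w - X i) - f w * k (w - z) + f w * ?D (w - z) (X i - z)) / norm (X i - z))"
        by (intro integrable_divide Bochner_Integration.integrable_add Bochner_Integration.integrable_diff conv_integrable[OF f k] Dint)
      then show ?thesis by (simp add: q_def[abs_def] algebra_simps)
    qed
    have qeq: "(conv k f (X i) - conv k f z - ?L (X i - z)) / norm (X i - z) = (LINT w|lborel. q i w)" for i
    proof -
      have "(LINT w|lborel. q i w) =
        (LINT w|lborel. (f w * k (w - X i) - f w * k (w - z) + f w * ?D (w - z) (X i - z)) / norm (X i - z))"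
        by (intro Bochner_Integration.integral_cong) (auto simp: q_def algebra_simps)
      also have "\<dots> = (conv k f (X i) - conv k f z - ?L (X i - z)) / norm (X i - z)"
        by (simp add: conv_def conv_integrable[OF f k] Dint Bochner_Integration.integral_add
              Bochner_Integration.integral_diff Bochner_Integration.integrable_diff)
      finally show ?thesis by simp
    qed
    have "(\<lambda>i. LINT w|lborel. q i w) \<longlonglongrightarrow> (LINT w|(lborel::'a measure). (0::real))"
    proof (rule integral_dominated_convergence)
      show "integrable lborel (\<lambda>w. 2 * B * norm (indicator (cball 0 (R + K)) w * f w))"
        using f by (auto simp: ball_integrable_def intro!: integrable_mult_right integrable_norm[where f="\<lambda>w. indicator (cball 0 (R + K)) w * f w"])
      show "q i \<in> borel_measurable lborel" for i using qint by auto
      show "AE w in lborel. (\<lambda>i. q i w) \<longlonglongrightarrow> 0"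
      proof (rule AE_I2)
        fix w
        have "((\<lambda>y. norm (k y - k (w - z) - ?D (w - z) (y - (w - z))) / norm (y - (w - z))) \<longlongrightarrow> 0) (at (w - z))"
          using D[of "w - z"] by (simp add: has_derivative_iff_norm)
        moreover have "filterlim (\<lambda>i. w - X i) (at (w - z)) sequentially"
          using X by (auto simp: filterlim_at intro!: tendsto_intros)
        ultimately have "(\<lambda>i. norm (k (w - X i) - k (w - z) - ?D (w - z) (w - X i - (w - z))) / norm (w - X i - (w - z))) \<longlonglongrightarrow> 0"
          by (rule filterlim_compose)
        moreover have "w - X i - (w - z) = - (X i - z)" for i by simp
        ultimately have "(\<lambda>i. norm ((k (w - X i) - k (w - z) + ?D (w - z) (X i - z)) / norm (X i - z))) \<longlonglongrightarrow> 0"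
          by (simp only: linear_neg[OF has_derivative_linear[OF D]] norm_minus_cancel norm_divide abs_divide real_norm_def abs_norm_cancel diff_minus_eq_add)
        then have "(\<lambda>i. (k (w - X i) - k (w - z) + ?D (w - z) (X i - z)) / norm (X i - z)) \<longlonglongrightarrow> 0"
          by (rule tendsto_norm_zero_cancel)
        then show "(\<lambda>i. q i w) \<longlonglongrightarrow> 0" unfolding q_def by (rule tendsto_mult_right_zero)
      qed
      show "AE w in lborel. norm (q i w) \<le> 2 * B * norm (indicator (cball 0 (R + K)) w * f w)" for i
      proof (rule AE_I2)
        fix w
        show "norm (q i w) \<le> 2 * B * norm (indicator (cball 0 (R + K)) w * f w)"
        proof (cases "norm w \<le> R + K")
          case True
          have "\<bar>k (w - X i) - k (w - z)\<bar> \<le> B * norm (X i - z)"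
            using B(3)[of "w - X i" "w - z"] by (simp add: norm_minus_commute)
          moreover have "\<bar>?D (w - z) (X i - z)\<bar> \<le> B * norm (X i - z)" by (rule B)
          ultimately have "\<bar>k (w - X i) - k (w - z) + ?D (w - z) (X i - z)\<bar> \<le> 2 * B * norm (X i - z)" by linarith
          then have "\<bar>(k (w - X i) - k (w - z) + ?D (w - z) (X i - z)) / norm (X i - z)\<bar> \<le> 2 * B"
            using Xz[of i] by (simp add: divide_le_eq)
          from mult_left_mono[OF this, of "\<bar>f w\<bar>"]
          show ?thesis using True by (simp add: q_def abs_mult mult.commute mult.left_commute)
        next
          case False
          have "R < norm (w - X i)" "R < norm (w - z)"
            using False K[of i] Kz norm_triangle_ineq2[of w "X i"] norm_triangle_ineq2[of w z] by auto
          then show ?thesis using R B(1) by (simp add: q_def)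
        qed
      qed
    qed auto
    then have "(\<lambda>i. norm ((conv k f (X i) - conv k f z - ?L (X i - z)) / norm (X i - z))) \<longlonglongrightarrow> 0"
      unfolding qeq by (simp add: tendsto_rabs_zero_iff)
    then show "((\<lambda>y. norm (conv k f y - conv k f z - ?L (y - z)) / norm (y - z)) \<circ> X) \<longlonglongrightarrow> 0"
      by (simp add: o_def)
  qed
  then show ?thesis
    using linL by (simp add: has_derivative_iff_norm linear_conv_bounded_linear)
qed

text \<open>The derivative falls on the kernel and changes its sign. Letting the kernel range over
  all test functions therefore gives a family stable under differentiation.\<close>

lemma smooth_conv:
  assumes f: "ball_integrable f" and k: "test_function UNIV k"
  shows "smooth (conv k f)"
proof (rule smooth_coinduct[where A="{conv k f | k. test_function UNIV k}"])
  fix h assume "h \<in> {conv k f | k. test_function UNIV k}"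
  then obtain k where h: "h = conv k f" "test_function UNIV k" by auto
  note D = conv_has_derivative[OF f h(2), folded h(1)]
  show "h differentiable (at x)" for x using D by (auto simp: differentiable_def)
  fix b :: 'a assume b: "b \<in> Basis"
  have t: "test_function UNIV (\<lambda>x. frechet_derivative k (at x) b * - 1)"
    by (intro test_function_mult test_function_partial h b smooth_const)
  have "(\<lambda>x. frechet_derivative h (at x) b) = conv (\<lambda>x. frechet_derivative k (at x) b * - 1) f"
    unfolding frechet_derivative_at[OF D, symmetric] by (simp add: conv_def fun_eq_iff)
  with t show "(\<lambda>x. frechet_derivative h (at x) b) \<in> {conv k f | k. test_function UNIV k}"
    by (intro CollectI exI conjI)
qed (use k in auto)

lemma lborel_integral_shift: "(LINT w|lborel. f (w - z)) = (LINT w|lborel. f w)"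
  for f :: "'a::euclidean_space \<Rightarrow> real"
proof -
  have "(LINT w|lborel. f w) = (LINT w|distr lborel borel ((+) (- z)). f w)"
    by (simp add: lborel_distr_plus)
  also have "\<dots> = (LINT w|lborel. f (w - z))"
  proof (cases "f \<in> borel_measurable borel")
    case True then show ?thesis by (subst integral_distr) (auto simp: algebra_simps)
  next
    \<comment> \<open>A non-measurable integrand makes both integrals 0 by convention.\<close>
    case False
    have "f \<notin> borel_measurable (distr lborel borel ((+) (- z)))" using False by simp
    moreover have "(\<lambda>w. f (w - z)) \<notin> borel_measurable lborel"
    proof
      assume "(\<lambda>w. f (w - z)) \<in> borel_measurable lborel"
      then have "(\<lambda>w. f (w - z)) \<in> borel_measurable borel" by simp
      then have "(\<lambda>w. (\<lambda>w. f (w - z)) (w + z)) \<in> borel_measurable borel"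
        by (rule measurable_compose_rev) simp
      with False show False by simp
    qed
    ultimately show ?thesis
      by (metis borel_measurable_integrable not_integrable_integral_eq)
  qed
  finally show ?thesis by simp
qed

text \<open>The affine map with factor -1 has Jacobian 1. This is what lets Tonelli integrate k (w -
  z) over z and still find total mass 1.\<close>

lemma nn_integral_lborel_reflect:
  fixes f :: "'a::euclidean_space \<Rightarrow> ennreal"
  assumes [measurable]: "f \<in> borel_measurable borel"
  shows "(\<integral>\<^sup>+ z. f (w - z) \<partial>lborel) = (\<integral>\<^sup>+ z. f z \<partial>lborel)"
proof -
  have "(\<integral>\<^sup>+ z. f z \<partial>lborel) = (\<integral>\<^sup>+ z. f z \<partial>density (distr lborel borel (\<lambda>x. w + (-1) *\<^sub>R x)) (\<lambda>_. ennreal (\<bar>-1\<bar> ^ DIM('a))))"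
    using lborel_affine[of "-1" w] by simp
  also have "\<dots> = (\<integral>\<^sup>+ z. f (w - z) \<partial>lborel)"
    by (simp add: nn_integral_density nn_integral_distr)
  finally show ?thesis by simp
qed

definition kernel :: "('a::euclidean_space \<Rightarrow> real) \<Rightarrow> bool" where
  "kernel k \<longleftrightarrow> test_function UNIV k \<and> (\<forall>x. 0 \<le> k x) \<and> (LINT x|lborel. k x) = 1"

lemma test_function_integrable:
  assumes "test_function UNIV k" shows "integrable lborel k"
proof -
  from conv_integrable[OF ball_integrable_one assms, of 0] show ?thesis by simp
qed

lemma test_function_measurable: "test_function \<Omega> k \<Longrightarrow> k \<in> borel_measurable borel"
  by (intro borel_measurable_continuous_onI smooth_continuous test_function_smooth)

text \<open>The centre is free because the kernels used near the boundary must sit strictly above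
  the origin.\<close>

lemma kernel_exists:
  fixes c :: "'a::euclidean_space"
  assumes "0 < r" obtains k where "kernel k" "\<And>z. k z \<noteq> 0 \<Longrightarrow> z \<in> ball c r"
proof -
  obtain f where f: "test_function UNIV f" "\<And>z. 0 \<le> f z" "\<And>z. f z \<noteq> 0 \<longleftrightarrow> z \<in> ball c r"
    using bump_exists[OF assms, of c] by metis
  define I where "I = (LINT x|lborel. f x)"
  \<comment> \<open>Otherwise the open ball on which f is positive would be a null set.\<close>
  have "I \<noteq> 0"
  proof
    assume "I = 0"
    then have "AE x in lborel. f x = 0"
      using integral_nonneg_eq_0_iff_AE[OF test_function_integrable[OF f(1)]] f(2) by (simp add: I_def)
    then have "AE x in lebesgue. x \<notin> ball c r"
      using f(3) by (auto simp: AE_completion_iff elim!: AE_mp)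
    then have "negligible (ball c r)"
      by (simp add: negligible_iff_null_sets AE_iff_null_sets)
    then show False using assms open_not_negligible[of "ball c r"] by simp
  qed
  moreover have "0 \<le> I" unfolding I_def using f by (intro Bochner_Integration.integral_nonneg) auto
  ultimately have "kernel (\<lambda>x. f x * (1 / I))"
    using f test_function_mult[OF f(1) smooth_const[of "1 / I"]] by (auto simp: kernel_def I_def[symmetric])
  then show thesis by (rule that) (use f in auto)
qed

section \<open>Convergence of mollifications in L^2\<close>

definition L2b :: "('a::euclidean_space \<Rightarrow> real) \<Rightarrow> bool" where
  "L2b f \<longleftrightarrow> f \<in> borel_measurable borel \<and> integrable lborel (\<lambda>x. (f x)\<^sup>2)"

lemma L2b_add:
  assumes "L2b f" "L2b g" shows "L2b (\<lambda>x. f x + g x)"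
proof -
  have "integrable lborel (\<lambda>x. (f x + g x)\<^sup>2)"
  proof (rule Bochner_Integration.integrable_bound)
    show "integrable lborel (\<lambda>x. 2 * (f x)\<^sup>2 + 2 * (g x)\<^sup>2)" using assms by (auto simp: L2b_def)
    have "(f x + g x)\<^sup>2 \<le> 2 * (f x)\<^sup>2 + 2 * (g x)\<^sup>2" for x
      using sum_squares_bound[of "f x" "g x"] by (simp add: power2_sum)
    then show "AE x in lborel. norm ((f x + g x)\<^sup>2) \<le> norm (2 * (f x)\<^sup>2 + 2 * (g x)\<^sup>2)"
      by (intro AE_I2) simp
  qed (use assms in \<open>auto simp: L2b_def\<close>)
  then show ?thesis using assms by (auto simp: L2b_def)
qed

lemma L2b_cmult: "L2b f \<Longrightarrow> L2b (\<lambda>x. c * f x)"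
  by (auto simp: L2b_def power_mult_distrib)

lemma L2b_diff: "L2b f \<Longrightarrow> L2b g \<Longrightarrow> L2b (\<lambda>x. f x - g x)"
  using L2b_add[of f "\<lambda>x. (-1) * g x"] L2b_cmult[of g "-1"] by simp

lemma L2b_bounded:
  assumes "f \<in> borel_measurable borel" "\<And>x. \<bar>f x\<bar> \<le> M" "\<And>x. R < norm x \<Longrightarrow> f x = 0"
  shows "L2b f"
proof -
  have M: "0 \<le> M" using assms(2)[of 0] by linarith
  have "integrable lborel (\<lambda>x. (f x)\<^sup>2)"
  proof (rule Bochner_Integration.integrable_bound)
    show "integrable lborel (\<lambda>x. M\<^sup>2 * indicator (cball (0::'a) R) x)"
      by (intro integrable_mult_right integrable_cball)
    show "AE x in lborel. norm ((f x)\<^sup>2) \<le> norm (M\<^sup>2 * indicator (cball 0 R) x)"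
      using assms(2,3) M by (intro AE_I2) (auto simp: indicator_def abs_le_square_iff[symmetric])
  qed (use assms(1) in auto)
  then show ?thesis using assms(1) by (simp add: L2b_def)
qed

lemma L2b_ball_integrable:
  assumes "L2b f" shows "ball_integrable f"
proof -
  have "integrable lborel (\<lambda>w. indicator (cball 0 R) w * f w)" for R
  proof (rule Bochner_Integration.integrable_bound)
    show "integrable lborel (\<lambda>x. indicator (cball 0 R) x + (f x)\<^sup>2)"
      using assms by (intro Bochner_Integration.integrable_add integrable_cball; simp add: L2b_def)
    have "\<bar>x\<bar> \<le> 1 + x\<^sup>2" for x :: real
      using sum_squares_bound[of 1 "\<bar>x\<bar>"] zero_le_power2[of x] by (simp add: power2_eq_square)
    then show "AE x in lborel. norm (indicator (cball 0 R) x * f x) \<le> norm (indicator (cball 0 R) x + (f x)\<^sup>2)"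
      by (intro AE_I2) (auto simp: indicator_def)
    have "f \<in> borel_measurable lborel" using assms by (simp add: L2b_def)
    then show "(\<lambda>w. indicator (cball 0 R) w * f w) \<in> borel_measurable lborel"
      by (intro borel_measurable_times borel_measurable_indicator) auto
  qed
  then show ?thesis using assms by (auto simp: ball_integrable_def L2b_def)
qed

lemma kernel_integral_shift: "kernel k \<Longrightarrow> (LINT w|lborel. k (w - z)) = 1"
  by (simp add: kernel_def lborel_integral_shift)

lemma kernel_shift_integrable: "test_function UNIV k \<Longrightarrow> integrable lborel (\<lambda>w. k (w - z))"
  using conv_integrable[OF ball_integrable_one, of k z] by simp

lemma ball_integrable_sq: "L2b f \<Longrightarrow> ball_integrable (\<lambda>x. (f x)\<^sup>2)"
  by (auto simp: L2b_def ball_integrable_def intro!: integrable_mult_indicator[where 'b=real, simplified])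

text \<open>Jensen's inequality for the probability density k (w - z), in the form that the variance
  of f about its mean \<open>conv k f z\<close> is nonnegative.\<close>

lemma conv_sq_le:
  assumes f: "L2b f" and k: "kernel k"
  shows "(conv k f z)\<^sup>2 \<le> conv k (\<lambda>w. (f w)\<^sup>2) z"
proof -
  have t: "test_function UNIV k" and nn: "\<And>x. 0 \<le> k x" using k by (auto simp: kernel_def)
  let ?m = "conv k f z"
  note i = conv_integrable[OF L2b_ball_integrable[OF f] t, of z] conv_integrable[OF ball_integrable_sq[OF f] t, of z]
    kernel_shift_integrable[OF t, of z]
  have "0 \<le> (LINT w|lborel. (f w - ?m)\<^sup>2 * k (w - z))"
    using nn by (intro Bochner_Integration.integral_nonneg) auto
  also have "\<dots> = (LINT w|lborel. (f w)\<^sup>2 * k (w - z) - 2 * ?m * (f w * k (w - z)) + ?m\<^sup>2 * k (w - z))"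
    by (intro Bochner_Integration.integral_cong) (auto simp: algebra_simps power2_eq_square)
  also have "\<dots> = conv k (\<lambda>w. (f w)\<^sup>2) z - 2 * ?m * ?m + ?m\<^sup>2"
    using i kernel_integral_shift[OF k, of z]
    by (simp add: conv_def Bochner_Integration.integral_add Bochner_Integration.integral_diff)
  finally show ?thesis by (simp add: power2_eq_square)
qed

text \<open>After Jensen's inequality, Tonelli exchanges the integrals and every reflected translate
  of the kernel has mass 1.\<close>

lemma conv_L2_contraction:
  assumes f: "L2b f" and k: "kernel k"
  shows "(\<integral>\<^sup>+ z. ennreal ((conv k f z)\<^sup>2) \<partial>lborel) \<le> (\<integral>\<^sup>+ w. ennreal ((f w)\<^sup>2) \<partial>lborel)"
proof -
  have t: "test_function UNIV k" and nn: "\<And>x. 0 \<le> k x" using k by (auto simp: kernel_def)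
  have [measurable]: "f \<in> borel_measurable borel" using f by (simp add: L2b_def)
  have [measurable]: "k \<in> borel_measurable borel" by (rule test_function_measurable[OF t])
  have "(\<integral>\<^sup>+ z. ennreal ((conv k f z)\<^sup>2) \<partial>lborel) \<le> (\<integral>\<^sup>+ z. ennreal (conv k (\<lambda>w. (f w)\<^sup>2) z) \<partial>lborel)"
    by (intro nn_integral_mono ennreal_leI conv_sq_le f k)
  also have "\<dots> = (\<integral>\<^sup>+ z. (\<integral>\<^sup>+ w. ennreal ((f w)\<^sup>2) * ennreal (k (w - z)) \<partial>lborel) \<partial>lborel)"
    unfolding conv_def
    by (intro nn_integral_cong, subst nn_integral_eq_integral[symmetric])
       (use nn conv_integrable[OF ball_integrable_sq[OF f] t] in \<open>auto simp: ennreal_mult\<close>)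
  also have "\<dots> = (\<integral>\<^sup>+ w. (\<integral>\<^sup>+ z. ennreal ((f w)\<^sup>2) * ennreal (k (w - z)) \<partial>lborel) \<partial>lborel)"
    by (rule lborel_pair.Fubini') measurable
  also have "\<dots> = (\<integral>\<^sup>+ w. ennreal ((f w)\<^sup>2) * (\<integral>\<^sup>+ z. ennreal (k (w - z)) \<partial>lborel) \<partial>lborel)"
    by (intro nn_integral_cong nn_integral_cmult) measurable
  also have "(\<integral>\<^sup>+ w. ennreal ((f w)\<^sup>2) * (\<integral>\<^sup>+ z. ennreal (k (w - z)) \<partial>lborel) \<partial>lborel) = (\<integral>\<^sup>+ w. ennreal ((f w)\<^sup>2) \<partial>lborel)"
  proof (rule nn_integral_cong)
    fix w
    have "(\<integral>\<^sup>+ z. ennreal (k (w - z)) \<partial>lborel) = (\<integral>\<^sup>+ z. ennreal (k z) \<partial>lborel)"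
      by (rule nn_integral_lborel_reflect[of "\<lambda>z. ennreal (k z)"]) measurable
    also have "\<dots> = 1"
      using k nn test_function_integrable[OF t] by (subst nn_integral_eq_integral) (auto simp: kernel_def)
    finally show "ennreal ((f w)\<^sup>2) * (\<integral>\<^sup>+ z. ennreal (k (w - z)) \<partial>lborel) = ennreal ((f w)\<^sup>2)" by simp
  qed
  finally show ?thesis .
qed

definition clamp_real :: "real \<Rightarrow> real \<Rightarrow> real" where
  "clamp_real M y = max (- M) (min M y)"

lemma clamp_real: "0 \<le> M \<Longrightarrow> \<bar>clamp_real M y\<bar> \<le> M" "\<bar>y\<bar> \<le> M \<Longrightarrow> clamp_real M y = y"
  "0 \<le> M \<Longrightarrow> \<bar>clamp_real M y - y\<bar> \<le> \<bar>y\<bar>"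
  by (auto simp: clamp_real_def)

lemma continuous_clamp_real [continuous_intros]: "continuous_on S f \<Longrightarrow> continuous_on S (\<lambda>x. clamp_real M (f x))"
  unfolding clamp_real_def by (intro continuous_intros)

lemma measurable_clamp_real [measurable]: "clamp_real M \<in> borel_measurable borel"
  by (intro borel_measurable_continuous_onI continuous_clamp_real continuous_intros)

lemma nn_integral_sq_diff_le:
  assumes [measurable]: "f \<in> borel_measurable borel" "g \<in> borel_measurable borel" "h \<in> borel_measurable borel"
  shows "(\<integral>\<^sup>+ x. ennreal ((f x - h x)\<^sup>2) \<partial>lborel) \<le>
    2 * (\<integral>\<^sup>+ x. ennreal ((f x - g x)\<^sup>2) \<partial>lborel) + 2 * (\<integral>\<^sup>+ x. ennreal ((g x - h x)\<^sup>2) \<partial>lborel)"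
proof -
  have "(f x - h x)\<^sup>2 \<le> 2 * (f x - g x)\<^sup>2 + 2 * (g x - h x)\<^sup>2" for x
    using sum_squares_bound[of "f x - g x" "g x - h x"] by (auto simp: power2_eq_square algebra_simps)
  then have "(\<integral>\<^sup>+ x. ennreal ((f x - h x)\<^sup>2) \<partial>lborel) \<le> (\<integral>\<^sup>+ x. 2 * ennreal ((f x - g x)\<^sup>2) + 2 * ennreal ((g x - h x)\<^sup>2) \<partial>lborel)"
    by (intro nn_integral_mono)
       (simp add: ennreal_mult'[of 2, simplified, symmetric] ennreal_plus[symmetric] ennreal_leI del: ennreal_plus)
  also have "\<dots> = 2 * (\<integral>\<^sup>+ x. ennreal ((f x - g x)\<^sup>2) \<partial>lborel) + 2 * (\<integral>\<^sup>+ x. ennreal ((g x - h x)\<^sup>2) \<partial>lborel)"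
    by (simp add: nn_integral_add nn_integral_cmult)
  finally show ?thesis .
qed

text \<open>The truncation error is at most |f| at every point and vanishes there for large n, so
  f^2 dominates.\<close>

lemma L2_bounded_dense:
  fixes f :: "'a::euclidean_space \<Rightarrow> real"
  assumes f: "L2b f" and d: "0 < \<delta>"
  obtains n :: nat where "(\<integral>\<^sup>+ x. ennreal ((f x - indicator (cball 0 (real n)) x * clamp_real (real n) (f x))\<^sup>2) \<partial>lborel) < ennreal \<delta>"
proof -
  have [measurable]: "f \<in> borel_measurable borel" using f by (simp add: L2b_def)
  define g where "g n x = (f x - indicator (cball 0 (real n)) x * clamp_real (real n) (f x))\<^sup>2" for n :: nat and x
  have [measurable]: "g n \<in> borel_measurable borel" for n unfolding g_def[abs_def]
    by (intro borel_measurable_power borel_measurable_diff borel_measurable_times borel_measurable_indicator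
        measurable_compose[OF _ measurable_clamp_real]) auto
  have le: "g n x \<le> (f x)\<^sup>2" for n x
    using clamp_real(3)[of "real n" "f x"] by (auto simp: g_def indicator_def abs_le_square_iff[symmetric])
  have "(\<lambda>n. LINT x|lborel. g n x) \<longlonglongrightarrow> (LINT x|(lborel::'a measure). (0::real))"
  proof (rule integral_dominated_convergence)
    show "integrable lborel (\<lambda>x. (f x)\<^sup>2)" using f by (simp add: L2b_def)
    show "AE x in lborel. (\<lambda>n. g n x) \<longlonglongrightarrow> 0"
    proof (rule AE_I2)
      fix x
      have "\<forall>\<^sub>F n in sequentially. max \<bar>f x\<bar> (norm x) < real n"
        using filterlim_real_sequentially by (simp only: filterlim_at_top_dense)
      then have "\<forall>\<^sub>F n in sequentially. g n x = 0"
        by eventually_elim (auto simp: g_def clamp_real)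
      then show "(\<lambda>n. g n x) \<longlonglongrightarrow> 0" by (rule tendsto_eventually)
    qed
    show "AE x in lborel. norm (g n x) \<le> (f x)\<^sup>2" for n
      using le by (auto simp: g_def)
  qed auto
  then have "\<forall>\<^sub>F n in sequentially. (LINT x|lborel. g n x) < \<delta>"
    using d by (auto intro: order_tendstoD)
  then obtain n where n: "(LINT x|lborel. g n x) < \<delta>" by (auto simp: eventually_sequentially)
  have "integrable lborel (g n)"
    by (rule Bochner_Integration.integrable_bound[of _ "\<lambda>x. (f x)\<^sup>2"]) (use f le in \<open>auto simp: L2b_def g_def\<close>)
  then have "(\<integral>\<^sup>+ x. ennreal (g n x) \<partial>lborel) = ennreal (LINT x|lborel. g n x)"
    by (rule nn_integral_eq_integral) (simp add: g_def)
  also have "\<dots> < ennreal \<delta>" using n d by (intro ennreal_lessI)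
  finally have "(\<integral>\<^sup>+ x. ennreal (g n x) \<partial>lborel) < ennreal \<delta>" .
  then show thesis by (intro that[of n]) (simp add: g_def)
qed

text \<open>Bounded functions of bounded support are almost everywhere limits of continuous
  functions. Clamping the approximants and multiplying them by a continuous cut-off gives them a
  common bound and a common support, which upgrades the convergence to L^2.\<close>

lemma L2_continuous_dense:
  fixes f :: "'a::euclidean_space \<Rightarrow> real"
  assumes f: "L2b f" and d: "0 < \<delta>"
  obtains g R where "continuous_on UNIV g" "\<And>x. R < norm x \<Longrightarrow> g x = 0"
    "(\<integral>\<^sup>+ x. ennreal ((f x - g x)\<^sup>2) \<partial>lborel) \<le> ennreal \<delta>"
proof -
  have [measurable]: "f \<in> borel_measurable borel" using f by (simp add: L2b_def)
  obtain n :: nat where n: "(\<integral>\<^sup>+ x. ennreal ((f x - indicator (cball 0 (real n)) x * clamp_real (real n) (f x))\<^sup>2) \<partial>lborel) < ennreal (\<delta>/4)"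
    using L2_bounded_dense[OF f, of "\<delta>/4"] d by auto
  define b where "b x = indicator (cball 0 (real n)) x * clamp_real (real n) (f x)" for x
  have [measurable]: "b \<in> borel_measurable borel" unfolding b_def[abs_def]
    by (intro borel_measurable_times borel_measurable_indicator measurable_compose[OF _ measurable_clamp_real]) auto
  have b0: "b x = 0" if "real n + 1 < norm x" for x using that by (simp add: b_def)
  have bn: "\<bar>b x\<bar> \<le> real n" for x by (auto simp: b_def indicator_def clamp_real)
  \<comment> \<open>Measurability in this sense yields continuous functions converging to b off a
    negligible set.\<close>
  have "b measurable_on UNIV"
    by (rule lebesgue_measurable_imp_measurable_on) (auto intro: measurable_completion)
  then obtain N h where N: "negligible N" and h: "\<And>i::nat. continuous_on UNIV (h i)"
      "\<And>x. x \<notin> N \<Longrightarrow> (\<lambda>i. h i x) \<longlonglongrightarrow> b x"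
    by (auto simp: measurable_on_def)
  have AE: "AE x in lborel. (\<lambda>i. h i x) \<longlonglongrightarrow> b x"
  proof -
    have "AE x in lebesgue. x \<notin> N" using N by (simp add: negligible_iff_null_sets AE_not_in)
    then have "AE x in lborel. x \<notin> N" by (simp add: AE_completion_iff)
    then show ?thesis using h(2) by auto
  qed
  define cut :: "'a \<Rightarrow> real" where "cut x = max 0 (min 1 (real n + 1 - norm x))" for x
  define g where "g i x = clamp_real (real n) (h i x) * cut x" for i x
  have gc: "continuous_on UNIV (g i)" for i
    unfolding g_def cut_def by (intro continuous_intros h)
  then have [measurable]: "g i \<in> borel_measurable borel" for i by (intro borel_measurable_continuous_onI)
  have g0: "g i x = 0" if "real n + 1 < norm x" for i x using that by (auto simp: g_def cut_def)
  have gn: "\<bar>g i x\<bar> \<le> real n" for i x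
  proof -
    have "\<bar>clamp_real (real n) (h i x)\<bar> * \<bar>cut x\<bar> \<le> real n * 1"
      by (intro mult_mono clamp_real) (auto simp: cut_def)
    then show ?thesis by (simp add: g_def abs_mult)
  qed
  have "(\<lambda>i. LINT x|lborel. (b x - g i x)\<^sup>2) \<longlonglongrightarrow> (LINT x|(lborel::'a measure). (0::real))"
  proof (rule integral_dominated_convergence)
    show "integrable lborel (\<lambda>x. (2 * real n)\<^sup>2 * indicator (cball (0::'a) (real n + 1)) x)"
      by (intro integrable_mult_right integrable_cball)
    show "AE x in lborel. (\<lambda>i. (b x - g i x)\<^sup>2) \<longlonglongrightarrow> 0"
      using AE
    proof (rule AE_mp, intro AE_I2 impI)
      fix x assume x: "(\<lambda>i. h i x) \<longlonglongrightarrow> b x"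
      have "(\<lambda>i. clamp_real (real n) (h i x)) \<longlonglongrightarrow> clamp_real (real n) (b x)"
        unfolding clamp_real_def by (intro tendsto_intros x)
      then have c: "(\<lambda>i. clamp_real (real n) (h i x)) \<longlonglongrightarrow> b x"
        using bn by (simp add: clamp_real(2))
      have "(\<lambda>i. b x - g i x) \<longlonglongrightarrow> b x - b x * cut x"
        unfolding g_def by (intro tendsto_intros c)
      \<comment> \<open>\<open>cut\<close> equals 1 on the ball of radius n, outside which b
        vanishes.\<close>
      also have "b x - b x * cut x = 0" by (auto simp: b_def cut_def indicator_def)
      finally show "(\<lambda>i. (b x - g i x)\<^sup>2) \<longlonglongrightarrow> 0"
        using tendsto_power[of "\<lambda>i. b x - g i x" 0 sequentially 2] by simp
    qed
    show "AE x in lborel. norm ((b x - g i x)\<^sup>2) \<le> (2 * real n)\<^sup>2 * indicator (cball 0 (real n + 1)) x" for i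
    proof (rule AE_I2)
      fix x
      have "\<bar>b x - g i x\<bar> \<le> \<bar>2 * real n\<bar>" using bn[of x] gn[of i x] by linarith
      then have "(b x - g i x)\<^sup>2 \<le> (2 * real n)\<^sup>2" by (simp only: abs_le_square_iff)
      then show "norm ((b x - g i x)\<^sup>2) \<le> (2 * real n)\<^sup>2 * indicator (cball 0 (real n + 1)) x"
        using g0[of x i] by (auto simp: indicator_def b_def)
    qed
  qed auto
  then have "\<forall>\<^sub>F i in sequentially. (LINT x|lborel. (b x - g i x)\<^sup>2) < \<delta>/4"
    by (rule order_tendstoD) (use d in auto)
  then obtain i where i: "(LINT x|lborel. (b x - g i x)\<^sup>2) < \<delta>/4" by (auto simp: eventually_sequentially)
  have "L2b (\<lambda>x. b x - g i x)"
    by (rule L2b_diff; rule L2b_bounded[where R="real n + 1"]) (use bn gn g0 b0 in auto)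
  then have 2: "(\<integral>\<^sup>+ x. ennreal ((b x - g i x)\<^sup>2) \<partial>lborel) < ennreal (\<delta>/4)"
    using i d by (subst nn_integral_eq_integral) (auto simp: L2b_def ennreal_less_iff)
  have "(\<integral>\<^sup>+ x. ennreal ((f x - g i x)\<^sup>2) \<partial>lborel) \<le>
     2 * (\<integral>\<^sup>+ x. ennreal ((f x - b x)\<^sup>2) \<partial>lborel) + 2 * (\<integral>\<^sup>+ x. ennreal ((b x - g i x)\<^sup>2) \<partial>lborel)"
    by (rule nn_integral_sq_diff_le) measurable
  also have "\<dots> \<le> 2 * ennreal (\<delta>/4) + 2 * ennreal (\<delta>/4)"
    using n 2 unfolding b_def[symmetric]
    by (intro add_mono mult_left_mono) auto
  also have "\<dots> = ennreal \<delta>" using d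
    by (simp add: ennreal_mult'[of 2, simplified, symmetric] ennreal_plus[symmetric] del: ennreal_plus)
  finally show thesis using that[of "g i" "real n + 1"] gc g0 by auto
qed

text \<open>If x lies beyond radius R + 1, a neighbour within distance 1 still lies beyond R and
  both values are 0. The remaining pairs lie in the compact ball of radius R + 2.\<close>

lemma continuous_compact_support_uniform:
  fixes g :: "'a::euclidean_space \<Rightarrow> real"
  assumes "continuous_on UNIV g" "\<And>x. R < norm x \<Longrightarrow> g x = 0" "0 < e"
  obtains d where "0 < d" "d \<le> 1" "\<And>x y. norm (x - y) \<le> d \<Longrightarrow> \<bar>g x - g y\<bar> < e"
proof -
  have "uniformly_continuous_on (cball 0 (R + 2)) g"
    by (intro compact_uniformly_continuous continuous_on_subset[OF assms(1)]) auto
  then obtain d where d: "0 < d" "\<And>x y. x \<in> cball 0 (R + 2) \<Longrightarrow> y \<in> cball 0 (R + 2) \<Longrightarrow> dist x y < d \<Longrightarrow> dist (g x) (g y) < e"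
    using assms(3) unfolding uniformly_continuous_on_def by metis
  show thesis
  proof (rule that[of "min (d / 2) 1"])
    fix x y :: 'a assume xy: "norm (x - y) \<le> min (d / 2) 1"
    show "\<bar>g x - g y\<bar> < e"
    proof (cases "norm x \<le> R + 1")
      case True
      then have "norm y \<le> R + 2" using xy norm_triangle_ineq2[of y x] by (simp add: norm_minus_commute)
      then show ?thesis using True d(2)[of x y] d(1) xy by (simp add: dist_norm)
    next
      case False
      then have "R < norm x" "R < norm y" using xy norm_triangle_ineq2[of x y] by auto
      then show ?thesis using assms by simp
    qed
  qed (use d in auto)
qed

lemma conv_uniform:
  assumes g: "continuous_on UNIV g" "\<And>x y. norm (x - y) \<le> d \<Longrightarrow> \<bar>g x - g y\<bar> \<le> e"
    and k: "kernel k" "\<And>z. k z \<noteq> 0 \<Longrightarrow> norm z \<le> d" and gi: "ball_integrable g"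
  shows "\<bar>conv k g z - g z\<bar> \<le> e"
proof -
  have t: "test_function UNIV k" and nn: "\<And>x. 0 \<le> k x" using k by (auto simp: kernel_def)
  have "conv k g z - g z = (LINT w|lborel. g w * k (w - z)) - (LINT w|lborel. g z * k (w - z))"
    using kernel_integral_shift[OF k(1)] by (simp add: conv_def)
  also have "\<dots> = (LINT w|lborel. g w * k (w - z) - g z * k (w - z))"
    by (subst Bochner_Integration.integral_diff) (auto intro: conv_integrable gi t kernel_shift_integrable)
  finally have "\<bar>conv k g z - g z\<bar> \<le> (LINT w|lborel. norm (g w * k (w - z) - g z * k (w - z)))"
    using integral_norm_bound[of lborel "\<lambda>w. g w * k (w - z) - g z * k (w - z)"] by simp
  also have "\<dots> \<le> (LINT w|lborel. e * k (w - z))"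
  proof (rule integral_mono)
    show "integrable lborel (\<lambda>w. norm (g w * k (w - z) - g z * k (w - z)))"
      by (intro integrable_norm Bochner_Integration.integrable_diff conv_integrable gi t integrable_mult_right kernel_shift_integrable)
    show "integrable lborel (\<lambda>w. e * k (w - z))" by (intro integrable_mult_right kernel_shift_integrable t)
    show "norm (g w * k (w - z) - g z * k (w - z)) \<le> e * k (w - z)" for w
    proof (cases "k (w - z) = 0")
      case False
      then have "\<bar>g w - g z\<bar> \<le> e" using k(2) g(2) by blast
      then have "\<bar>g w - g z\<bar> * k (w - z) \<le> e * k (w - z)" by (rule mult_right_mono) (rule nn)
      then show ?thesis using nn by (simp add: left_diff_distrib[symmetric] abs_mult)
    qed auto
  qed
  also have "\<dots> = e" using kernel_integral_shift[OF k(1)] by simp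
  finally show ?thesis .
qed

lemma conv_support:
  assumes "\<And>x. R < norm x \<Longrightarrow> f x = 0" "\<And>z. k z \<noteq> 0 \<Longrightarrow> norm z \<le> d" "R + d < norm z"
  shows "conv k f z = 0"
proof -
  have "f w = 0 \<or> k (w - z) = 0" for w
    using assms(1)[of w] assms(2)[of "w - z"] assms(3) norm_triangle_ineq2[of z w] by (auto simp: norm_minus_commute)
  then have "(\<lambda>w. f w * k (w - z)) = (\<lambda>w. 0)" by auto
  then show ?thesis by (simp only: conv_def) simp
qed

lemma conv_diff:
  assumes "ball_integrable f" "ball_integrable g" "test_function UNIV k"
  shows "conv k (\<lambda>x. f x - g x) z = conv k f z - conv k g z"
  unfolding conv_def using conv_integrable[OF assms(1,3), of z] conv_integrable[OF assms(2,3), of z]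
  by (simp add: left_diff_distrib Bochner_Integration.integral_diff)

text \<open>Since \<open>conv k\<close> contracts L^2, replacing f by a continuous compactly
  supported g costs the same before and after mollification, and for g uniform continuity suffices.
  The kernel is only required to have small support; it may be off-centre, which the one-sided
  kernels at the boundary rely on.\<close>

lemma conv_L2_tendsto:
  fixes f :: "'a::euclidean_space \<Rightarrow> real"
  assumes f: "L2b f" and d: "0 < \<delta>"
  obtains \<epsilon> where "0 < \<epsilon>" "\<And>k. kernel k \<Longrightarrow> (\<And>z. k z \<noteq> 0 \<Longrightarrow> norm z \<le> \<epsilon>) \<Longrightarrow>
    (\<integral>\<^sup>+ x. ennreal ((conv k f x - f x)\<^sup>2) \<partial>lborel) \<le> ennreal \<delta>"
proof -
  have fm [measurable]: "f \<in> borel_measurable borel" using f by (simp add: L2b_def)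
  \<comment> \<open>Three errors of \<delta>/12 pass through two nested uses of (a + b)^2 <= 2 a^2 +
    2 b^2, which gives 10/12 of \<delta> in total.\<close>
  obtain g R where g: "continuous_on UNIV g" "\<And>x. R < norm x \<Longrightarrow> g x = 0"
    "(\<integral>\<^sup>+ x. ennreal ((f x - g x)\<^sup>2) \<partial>lborel) \<le> ennreal (\<delta>/12)"
    using L2_continuous_dense[OF f, of "\<delta>/12"] d by auto
  have gm [measurable]: "g \<in> borel_measurable borel" using g(1) by (intro borel_measurable_continuous_onI)
  define V where "V = measure lborel (cball (0::'a) (R + 1))"
  have V0: "0 \<le> V" by (simp add: V_def)
  \<comment> \<open>Chosen so that e^2 times the volume of the enlarged support is at most
    \<delta>/12; V + 1 keeps the denominator positive.\<close>
  define e where "e = sqrt (\<delta> / (12 * (V + 1)))"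
  have e: "0 < e" "e\<^sup>2 * V \<le> \<delta> / 12"
    using d V0 by (auto simp: e_def field_simps)
  obtain \<epsilon> where eps: "0 < \<epsilon>" "\<epsilon> \<le> 1" "\<And>x y. norm (x - y) \<le> \<epsilon> \<Longrightarrow> \<bar>g x - g y\<bar> < e"
    using continuous_compact_support_uniform[OF g(1,2) e(1)] by metis
  have gL: "L2b g"
  proof -
    have "bounded (g ` cball 0 R)"
      by (intro compact_imp_bounded compact_continuous_image continuous_on_subset[OF g(1)]) auto
    then obtain M where "\<forall>x\<in>cball 0 R. \<bar>g x\<bar> \<le> M" by (auto simp: bounded_iff)
    then have "\<bar>g x\<bar> \<le> max M 0" for x using g(2)[of x] by (cases "x \<in> cball 0 R") (auto simp: le_max_iff_disj)
    then show ?thesis using g(2) by (intro L2b_bounded[of g "max M 0" R]) auto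
  qed
  note gi = L2b_ball_integrable[OF gL] and fi = L2b_ball_integrable[OF f]
  show thesis
  proof (rule that[OF eps(1)])
    fix k :: "'a \<Rightarrow> real" assume k: "kernel k" "\<And>z. k z \<noteq> 0 \<Longrightarrow> norm z \<le> \<epsilon>"
    have t: "test_function UNIV k" using k by (auto simp: kernel_def)
    have cm [measurable]: "conv k h \<in> borel_measurable borel" if "ball_integrable h" for h
      by (intro borel_measurable_continuous_onI smooth_continuous smooth_conv that t)
    note [measurable] = cm[OF gi] cm[OF fi]
    have "(\<integral>\<^sup>+ x. ennreal ((conv k f x - conv k g x)\<^sup>2) \<partial>lborel) \<le> (\<integral>\<^sup>+ x. ennreal ((f x - g x)\<^sup>2) \<partial>lborel)"
      using conv_L2_contraction[OF L2b_diff[OF f gL] k(1)] by (simp add: conv_diff[OF fi gi t])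
    then have 1: "(\<integral>\<^sup>+ x. ennreal ((conv k f x - conv k g x)\<^sup>2) \<partial>lborel) \<le> ennreal (\<delta>/12)"
      using g(3) by simp
    have "(\<integral>\<^sup>+ x. ennreal ((conv k g x - g x)\<^sup>2) \<partial>lborel) \<le> (\<integral>\<^sup>+ x. ennreal (e\<^sup>2) * indicator (cball (0::'a) (R + 1)) x \<partial>lborel)"
    proof (intro nn_integral_mono)
      fix x
      have "\<bar>conv k g x - g x\<bar> \<le> e"
        by (rule conv_uniform[OF g(1) _ k gi]) (use eps(3) less_imp_le in auto)
      then have "(conv k g x - g x)\<^sup>2 \<le> e\<^sup>2" using e(1) by (simp add: abs_le_square_iff[symmetric])
      moreover have "conv k g x = 0" "g x = 0" if "R + 1 < norm x"
        using that eps(2) conv_support[OF g(2) k(2)] g(2) by auto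
      ultimately show "ennreal ((conv k g x - g x)\<^sup>2) \<le> ennreal (e\<^sup>2) * indicator (cball 0 (R + 1)) x"
        by (auto simp: indicator_def intro!: ennreal_leI)
    qed
    also have "\<dots> = ennreal (e\<^sup>2) * emeasure lborel (cball (0::'a) (R + 1))"
      by (simp add: nn_integral_cmult_indicator)
    also have "emeasure lborel (cball (0::'a) (R + 1)) = ennreal V"
      unfolding V_def by (rule emeasure_eq_ennreal_measure) (use emeasure_lborel_cball_finite[of "0::'a" "R + 1"] in auto)
    also have "ennreal (e\<^sup>2) * ennreal V \<le> ennreal (\<delta>/12)"
      using e(2) V0 by (simp add: ennreal_mult[symmetric] ennreal_leI)
    finally have 2: "(\<integral>\<^sup>+ x. ennreal ((conv k g x - g x)\<^sup>2) \<partial>lborel) \<le> ennreal (\<delta>/12)" .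
    have "(\<integral>\<^sup>+ x. ennreal ((g x - f x)\<^sup>2) \<partial>lborel) \<le> ennreal (\<delta>/12)"
      using g(3) by (simp add: power2_commute)
    then have "(\<integral>\<^sup>+ x. ennreal ((conv k g x - f x)\<^sup>2) \<partial>lborel) \<le> 2 * ennreal (\<delta>/12) + 2 * ennreal (\<delta>/12)"
      using nn_integral_sq_diff_le[OF cm[OF gi] gm fm] 2
      by (meson add_mono mult_left_mono order_trans zero_le)
    then have "(\<integral>\<^sup>+ x. ennreal ((conv k f x - f x)\<^sup>2) \<partial>lborel) \<le> 2 * ennreal (\<delta>/12) + 2 * (2 * ennreal (\<delta>/12) + 2 * ennreal (\<delta>/12))"
      using nn_integral_sq_diff_le[OF cm[OF fi] cm[OF gi] fm] 1
      by (meson add_mono mult_left_mono order_trans zero_le)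
    also have "\<dots> \<le> ennreal \<delta>" using d
      by (simp add: ennreal_mult'[of 2, simplified, symmetric] ennreal_plus[symmetric] del: ennreal_plus)
    finally show "(\<integral>\<^sup>+ x. ennreal ((conv k f x - f x)\<^sup>2) \<partial>lborel) \<le> ennreal \<delta>" .
  qed
qed

section \<open>Integration by parts on the half-space\<close>

text \<open>The margin \<open>e\<close> below the boundary makes boundary values and normal derivatives at \<open>t = 0\<close> ordinary ones.\<close>

definition C1c :: "real \<Rightarrow> ('a::euclidean_space \<times> real \<Rightarrow> real) \<Rightarrow> ('a \<times> real \<Rightarrow> 'a \<times> real) \<Rightarrow> bool" where
  "C1c e u g \<longleftrightarrow> (\<forall>z. - e < snd z \<longrightarrow> GDERIV u z :> g z) \<and> continuous_on {z. - e < snd z} g \<and>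
     (\<exists>R. \<forall>z. R < norm z \<longrightarrow> u z = 0)"

lemma open_upper: "open {z::'a::euclidean_space \<times> real. c < snd z}"
  by (intro open_Collect_less continuous_intros)

lemma half_space_borel [measurable]: "half_space \<in> sets borel"
  unfolding half_space_def by (rule borel_open[OF open_upper])

lemma C1c_GDERIV: "C1c e u g \<Longrightarrow> - e < snd z \<Longrightarrow> GDERIV u z :> g z"
  unfolding C1c_def by blast

lemma C1c_continuous: "C1c e u g \<Longrightarrow> continuous_on {z. - e < snd z} u"
  by (auto simp: C1c_def gderiv_def continuous_on_eq_continuous_at[OF open_upper] intro: has_derivative_continuous)

lemma C1c_radius:
  assumes "C1c e u g" obtains R where "0 \<le> R" "\<And>z. R < norm z \<Longrightarrow> u z = 0"
    "\<And>z. R < norm z \<Longrightarrow> - e < snd z \<Longrightarrow> g z = 0"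
proof -
  obtain R where R: "\<And>z. R < norm z \<Longrightarrow> u z = 0" using assms by (auto simp: C1c_def)
  show thesis
  proof (rule that[of "max R 0"])
    fix z :: "'a \<times> real" assume z: "max R 0 < norm z" "- e < snd z"
    have "open {z::'a \<times> real. R < norm z}" by (intro open_Collect_less continuous_intros)
    then have "GDERIV u z :> 0"
      unfolding gderiv_def inner_zero_right
      by (rule has_derivative_transform_within_open[OF has_derivative_const[of 0]]) (use z R in auto)
    moreover have "GDERIV u z :> g z" using assms z(2) unfolding C1c_def by blast
    ultimately have "(\<lambda>h. inner h (g z)) = (\<lambda>h. inner h 0)"
      unfolding gderiv_def by (rule has_derivative_unique[rotated])
    then have "inner (g z) (g z) = inner (g z) 0" by metis
    then show "g z = 0" by simp
  qed (use R in auto)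
qed

lemma upper_bounded:
  fixes w :: "'a::euclidean_space \<times> real \<Rightarrow> 'b::euclidean_space"
  assumes w: "continuous_on {z. - e < snd z} w" "0 < e"
    and R: "\<And>z. R < norm z \<Longrightarrow> - e < snd z \<Longrightarrow> w z = 0"
  obtains M where "0 \<le> M" "\<And>z. 0 \<le> snd z \<Longrightarrow> norm (w z) \<le> M"
proof -
  have "closed {z::'a \<times> real. 0 \<le> snd z}" by (intro closed_Collect_le continuous_intros)
  then have "compact (cball 0 R \<inter> {z::'a \<times> real. 0 \<le> snd z})" by (intro compact_Int_closed) auto
  then have "bounded (w ` (cball 0 R \<inter> {z. 0 \<le> snd z}))"
    using w(2) by (intro compact_imp_bounded compact_continuous_image continuous_on_subset[OF w(1)]) auto
  then obtain M where "\<forall>z\<in>cball 0 R \<inter> {z. 0 \<le> snd z}. norm (w z) \<le> M" by (auto simp: bounded_iff)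
  then show thesis using R w(2)
    by (intro that[of "max M 0"]) (force simp: le_max_iff_disj not_le[symmetric])+
qed

lemma upper_integrable:
  fixes w :: "'a::euclidean_space \<times> real \<Rightarrow> 'b::euclidean_space"
  assumes w: "continuous_on {z. - e < snd z} w" "0 < e"
    and R: "\<And>z. R < norm z \<Longrightarrow> - e < snd z \<Longrightarrow> w z = 0"
  shows "set_integrable lborel half_space w" "integrable lborel (\<lambda>x. w (x, 0))"
proof -
  obtain M where M: "0 \<le> M" "\<And>z. 0 \<le> snd z \<Longrightarrow> norm (w z) \<le> M" using upper_bounded[OF assms] by metis
  have cb: "integrable lborel (\<lambda>z. M * indicator (cball (c::'c::euclidean_space) R) z)" for c
    by (intro integrable_mult_right integrable_real_indicator emeasure_lborel_cball_finite) auto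
  show "set_integrable lborel half_space w"
    unfolding set_integrable_def
  proof (rule Bochner_Integration.integrable_bound[OF cb[of 0]])
    show "(\<lambda>z. indicator half_space z *\<^sub>R w z) \<in> borel_measurable lborel"
      using w(2) by (auto simp: half_space_def intro!: borel_measurable_continuous_on_indicator continuous_on_subset[OF w(1)]
          borel_open open_upper)
    show "AE z in lborel. norm (indicator half_space z *\<^sub>R w z) \<le> norm (M * indicator (cball 0 R) z)"
      using M R w(2) by (intro AE_I2) (force simp: indicator_def half_space_def not_le[symmetric])
  qed
  show "integrable lborel (\<lambda>x. w (x, 0))"
  proof (rule Bochner_Integration.integrable_bound[OF cb[of 0]])
    have "continuous_on UNIV (\<lambda>x. w (x, 0))"
      by (rule continuous_on_compose2[OF w(1)]) (use w(2) in \<open>auto intro!: continuous_intros\<close>)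
    then show "(\<lambda>x. w (x, 0)) \<in> borel_measurable lborel" by (simp add: borel_measurable_continuous_onI)
    show "AE x in lborel. norm (w (x, 0)) \<le> norm (M * indicator (cball 0 R) x)"
      using M R[of "(_, 0)"] w(2) by (intro AE_I2) (force simp: indicator_def norm_Pair not_le[symmetric])
  qed
qed

lemma C1c_Lipschitz:
  assumes "C1c e u g" "0 < e"
  obtains B where "0 \<le> B" "\<And>y z. 0 \<le> snd y \<Longrightarrow> 0 \<le> snd z \<Longrightarrow> \<bar>u y - u z\<bar> \<le> B * norm (y - z)"
proof -
  obtain R where R: "\<And>z. R < norm z \<Longrightarrow> - e < snd z \<Longrightarrow> g z = 0" using C1c_radius[OF assms(1)] by metis
  obtain B where B: "0 \<le> B" "\<And>z. 0 \<le> snd z \<Longrightarrow> norm (g z) \<le> B"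
    using upper_bounded[of e g R] R assms by (auto simp: C1c_def)
  have "norm (u y - u z) \<le> B * norm (y - z)" if "0 \<le> snd y" "0 \<le> snd z" for y z
  proof (rule differentiable_bound[of "{z. 0 \<le> snd z}" u "\<lambda>z h. inner h (g z)"])
    show "convex {z::'a \<times> real. 0 \<le> snd z}"
      by (auto simp: convex_def)
    show "(u has_derivative (\<lambda>h. inner h (g z))) (at z within {z. 0 \<le> snd z})" if "z \<in> {z. 0 \<le> snd z}" for z
    proof (rule has_derivative_at_withinI)
      have "- e < snd z" using that assms(2) by simp
      then show "(u has_derivative (\<lambda>h. inner h (g z))) (at z)"
        using assms(1) unfolding C1c_def gderiv_def by blast
    qed
    show "onorm (\<lambda>h. inner h (g z)) \<le> B" if "z \<in> {z. 0 \<le> snd z}" for z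
    proof (rule onorm_le)
      fix h
      have "norm (inner h (g z)) \<le> norm h * norm (g z)" by (rule Cauchy_Schwarz_ineq2[folded real_norm_def])
      also have "\<dots> \<le> norm h * B" using B(2)[of z] that by (intro mult_left_mono) auto
      finally show "norm (inner h (g z)) \<le> B * norm h" by (simp add: mult.commute)
    qed
  qed (use that in auto)
  then show thesis using that B(1) by simp
qed

lemma lborel_integral_translate:
  fixes f :: "'a::euclidean_space \<Rightarrow> 'b::euclidean_space"
  assumes [measurable]: "f \<in> borel_measurable borel"
  shows "(LINT z|lborel. f (z + c)) = (LINT z|lborel. f z)"
proof -
  have "(LINT z|lborel. f z) = (LINT z|distr lborel borel ((+) c). f z)"
    by (simp add: lborel_distr_plus)
  also have "\<dots> = (LINT z|lborel. f (c + z))" by (subst integral_distr) auto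
  finally show ?thesis by (simp add: add.commute)
qed

text \<open>A horizontal translation preserves both the half-space and Lebesgue measure, so every
  difference quotient along b has integral 0. The Lipschitz bound of u dominates these quotients and
  the limit inherits the value 0.\<close>

lemma integral_tangential:
  fixes u :: "'a::euclidean_space \<times> real \<Rightarrow> real"
  assumes "C1c e u g" "0 < e"
  shows "(LINT z:half_space|lborel. fst (g z) \<bullet> b) = 0"
proof -
  let ?c = "\<lambda>i. (inverse (real (Suc i)) *\<^sub>R (b, 0)) :: 'a \<times> real"
  define q where "q i z = indicator half_space z * ((u (z + ?c i) - u z) / inverse (real (Suc i)))" for i z
  obtain R where R: "0 \<le> R" "\<And>z. R < norm z \<Longrightarrow> u z = 0" using C1c_radius[OF assms(1)] by metis
  obtain B where B: "0 \<le> B" "\<And>y z. 0 \<le> snd y \<Longrightarrow> 0 \<le> snd z \<Longrightarrow> \<bar>u y - u z\<bar> \<le> B * norm (y - z)"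
    using C1c_Lipschitz[OF assms] by metis
  have int: "integrable lborel (\<lambda>z. indicator half_space z * u z)"
    using upper_integrable(1)[OF C1c_continuous[OF assms(1)] assms(2), of R] R by (simp add: set_integrable_def)
  then have m: "(\<lambda>z. indicator half_space z * u z) \<in> borel_measurable borel" by auto
  have ind: "indicator half_space (z + ?c i) = (indicator half_space z :: real)" for z i
    by (simp add: indicator_def half_space_def)
  have m2: "(\<lambda>z. indicator half_space z * u (z + ?c i)) \<in> borel_measurable borel" for i
    using measurable_compose[OF _ m, of "\<lambda>z. z + ?c i" borel] by (simp only: ind) simp
  have q0: "(LINT z|lborel. q i z) = 0" for i
  proof -
    have "(LINT z|lborel. indicator half_space z * u (z + ?c i)) = (LINT z|lborel. indicator half_space z * u z)"
      using lborel_integral_translate[OF m, of "?c i"] by (simp only: ind)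
    moreover have "integrable lborel (\<lambda>z. indicator half_space z * u (z + ?c i))"
    proof -
      have "integrable (distr lborel borel ((+) (?c i))) (\<lambda>z. indicator half_space z * u z)"
        using int by (simp add: lborel_distr_plus)
      then have "integrable lborel (\<lambda>z. indicator half_space (?c i + z) * u (?c i + z))"
        by (subst (asm) integrable_distr_eq) (use m in auto)
      then show ?thesis by (simp only: add.commute[of "?c i"] ind)
    qed
    ultimately have "(LINT z|lborel. (indicator half_space z * u (z + ?c i) - indicator half_space z * u z) / inverse (real (Suc i))) = 0"
      using int by (simp only: integral_divide_zero Bochner_Integration.integral_diff) simp
    moreover have "q i = (\<lambda>z. (indicator half_space z * u (z + ?c i) - indicator half_space z * u z) / inverse (real (Suc i)))"
      by (auto simp: q_def fun_eq_iff algebra_simps)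
    ultimately show ?thesis by simp
  qed
  have "(\<lambda>i. LINT z|lborel. q i z) \<longlonglongrightarrow> (LINT z|lborel. indicator half_space z * (fst (g z) \<bullet> b))"
  proof (rule integral_dominated_convergence)
    show "integrable lborel (\<lambda>z. B * norm b * indicator (cball (0::'a \<times> real) (R + norm b)) z)"
      by (intro integrable_mult_right integrable_real_indicator emeasure_lborel_cball_finite) auto
    show "q i \<in> borel_measurable lborel" for i
    proof -
      have "q i = (\<lambda>z. (indicator half_space z * u (z + ?c i) - indicator half_space z * u z) / inverse (real (Suc i)))"
        by (auto simp: q_def fun_eq_iff algebra_simps)
      then show ?thesis using m m2[of i] by simp
    qed
    have "continuous_on half_space (\<lambda>z. fst (g z) \<bullet> b)"
    proof (rule continuous_on_subset)
      show "continuous_on {z. - e < snd z} (\<lambda>z. fst (g z) \<bullet> b)"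
        using assms(1) by (intro continuous_intros) (simp add: C1c_def)
      show "half_space \<subseteq> {z. - e < snd z}" using assms(2) by (auto simp: half_space_def)
    qed
    from borel_measurable_continuous_on_indicator[OF _ this]
    show "(\<lambda>z. indicator half_space z * (fst (g z) \<bullet> b)) \<in> borel_measurable lborel"
      by (simp add: half_space_borel)
    show "AE z in lborel. (\<lambda>i. q i z) \<longlonglongrightarrow> indicator half_space z * (fst (g z) \<bullet> b)"
    proof (rule AE_I2)
      fix z :: "'a \<times> real"
      show "(\<lambda>i. q i z) \<longlonglongrightarrow> indicator half_space z * (fst (g z) \<bullet> b)"
      proof (cases "z \<in> half_space")
        case True
        have "GDERIV u z :> g z" using True assms by (intro C1c_GDERIV[OF assms(1)]) (auto simp: half_space_def)
        then have "(u has_derivative (\<lambda>h. inner h (g z))) (at (z + 0 *\<^sub>R (b, 0)))"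
          by (simp add: gderiv_def zero_prod_def[symmetric])
        moreover have "((\<lambda>h. z + h *\<^sub>R (b, 0)) has_derivative (\<lambda>h. h *\<^sub>R (b, 0))) (at (0::real))"
          by (rule derivative_eq_intros refl | simp)+
        ultimately have "((\<lambda>h. u (z + h *\<^sub>R (b, 0))) has_derivative (\<lambda>h. inner (h *\<^sub>R (b, 0)) (g z))) (at 0)"
          using has_derivative_compose[of "\<lambda>h. z + h *\<^sub>R (b, 0)" "\<lambda>h. h *\<^sub>R (b, 0)" 0 UNIV u "\<lambda>h. inner h (g z)"]
          by simp
        then have "((\<lambda>h. u (z + h *\<^sub>R (b, 0))) has_field_derivative fst (g z) \<bullet> b) (at 0)"
          by (rule has_derivative_imp_has_field_derivative) (simp add: inner_prod_def inner_commute)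
        then have "((\<lambda>h. (u (z + h *\<^sub>R (b, 0)) - u z) / h) \<longlongrightarrow> fst (g z) \<bullet> b) (at 0)"
          by (simp add: DERIV_def zero_prod_def[symmetric])
        moreover have "filterlim (\<lambda>i. inverse (real (Suc i))) (at 0) sequentially"
          using LIMSEQ_inverse_real_of_nat by (auto simp: filterlim_at)
        ultimately have "(\<lambda>i. (u (z + ?c i) - u z) / inverse (real (Suc i))) \<longlonglongrightarrow> fst (g z) \<bullet> b"
          by (rule filterlim_compose)
        then show ?thesis using True by (simp add: q_def)
      qed (simp add: q_def)
    qed
    show "AE z in lborel. norm (q i z) \<le> B * norm b * indicator (cball 0 (R + norm b)) z" for i
    proof (rule AE_I2)
      fix z :: "'a \<times> real"
      have nc: "norm (?c i) = inverse (real (Suc i)) * norm b" by (simp add: norm_Pair)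
      have "inverse (real (Suc i)) * norm b \<le> 1 * norm b" by (intro mult_right_mono) (auto simp: field_simps)
      then have ncb: "norm (?c i) \<le> norm b" using nc by simp
      show "norm (q i z) \<le> B * norm b * indicator (cball 0 (R + norm b)) z"
      proof (cases "z \<in> half_space \<and> norm z \<le> R + norm b")
        case True
        have "\<bar>u (z + ?c i) - u z\<bar> \<le> B * norm (?c i)"
          using B(2)[of "z + ?c i" z] True by (simp add: half_space_def)
        then have "\<bar>(u (z + ?c i) - u z) / inverse (real (Suc i))\<bar> \<le> B * norm b"
          unfolding nc abs_divide by (subst pos_divide_le_eq) (auto simp: mult_ac)
        then show ?thesis using True by (simp add: q_def)
      next
        case False
        have "R < norm z \<and> R < norm (z + ?c i)" if "R + norm b < norm z"
          using that ncb norm_diff_ineq[of z "?c i"] norm_ge_zero[of b] by linarith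
        then have "z \<notin> half_space \<or> u z = 0 \<and> u (z + ?c i) = 0" using False R(2) not_le by blast
        then have "q i z = 0" by (auto simp: q_def)
        then show ?thesis using B(1) by simp
      qed
    qed
  qed
  then have "(LINT z|lborel. indicator half_space z * (fst (g z) \<bullet> b)) = 0"
    unfolding q0 using LIMSEQ_unique tendsto_const by blast
  then show ?thesis by (simp add: set_lebesgue_integral_def)
qed

text \<open>By Fubini the integral is taken along vertical lines, on each of which the fundamental
  theorem of calculus leaves only the value at t = 0.\<close>

lemma integral_normal:
  fixes u :: "'a::euclidean_space \<times> real \<Rightarrow> real"
  assumes "C1c e u g" "0 < e"
  shows "(LINT z:half_space|lborel. snd (g z)) = - (LINT x|lborel. u (x, 0))"
proof -
  obtain R where R: "0 \<le> R" "\<And>z. R < norm z \<Longrightarrow> u z = 0" "\<And>z. R < norm z \<Longrightarrow> - e < snd z \<Longrightarrow> g z = 0"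
    using C1c_radius[OF assms(1)] by metis
  have gc: "continuous_on {z. - e < snd z} g" using assms by (simp add: C1c_def)
  have "continuous_on {z. - e < snd z} (\<lambda>z. snd (g z))" by (intro continuous_intros gc)
  from upper_integrable(1)[OF this assms(2), of R]
  have int: "integrable (lborel \<Otimes>\<^sub>M lborel) (\<lambda>z. indicator half_space z * snd (g z))"
    using R by (simp add: set_integrable_def lborel_prod)
  have inner: "(LINT t|lborel. indicator half_space (x, t) * snd (g (x, t))) = - u (x, 0)" for x
  proof -
    have D: "DERIV (\<lambda>t. u (x, t)) t :> snd (g (x, t))" if "- e < t" for t
    proof -
      have "GDERIV u (x, t) :> g (x, t)" using assms that by (auto simp: C1c_def)
      then have "((\<lambda>t. u (x, t)) has_derivative (\<lambda>h. inner (0, h) (g (x, t)))) (at t)"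
        unfolding gderiv_def by (intro has_derivative_compose[of "\<lambda>t. (x, t)" "\<lambda>h. (0, h)" t UNIV u])
          (auto intro!: derivative_eq_intros)
      then show ?thesis by (rule has_derivative_imp_has_field_derivative) (simp add: inner_prod_def)
    qed
    have C: "isCont (\<lambda>t. snd (g (x, t))) t" if "- e < t" for t
    proof -
      have "isCont g (x, t)" using gc that by (simp add: continuous_on_eq_continuous_at[OF open_upper])
      then have "isCont (\<lambda>z. snd (g z)) (x, t)" by (intro continuous_intros)
      moreover have "isCont (\<lambda>t. (x, t)) t" by (intro continuous_intros)
      ultimately show ?thesis by (rule isCont_o2[rotated])
    qed
    have "(LINT t|lborel. indicator half_space (x, t) * snd (g (x, t))) = (LINT t|lborel. snd (g (x, t)) * indicator {0..R + 1} t)"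
    proof (rule integral_cong_AE)
      have 1: "continuous_on {0..R+1} (\<lambda>t. snd (g (x, t)))" "continuous_on {0<..} (\<lambda>t. snd (g (x, t)))"
        using C assms(2) by (auto intro!: continuous_at_imp_continuous_on)
      have "(\<lambda>t. indicator {0<..} t *\<^sub>R snd (g (x, t))) \<in> borel_measurable borel"
        by (intro borel_measurable_continuous_on_indicator 1) auto
      then show "(\<lambda>t. indicator half_space (x, t) * snd (g (x, t))) \<in> borel_measurable lborel"
        by (simp add: half_space_def indicator_def)
      have "(\<lambda>t. indicator {0..R+1} t *\<^sub>R snd (g (x, t))) \<in> borel_measurable borel"
        by (intro borel_measurable_continuous_on_indicator 1) auto
      then show "(\<lambda>t. snd (g (x, t)) * indicator {0..R + 1} t) \<in> borel_measurable lborel"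
        by (simp add: mult.commute)
      have g0: "g (x, t) = 0" if "t > R + 1" for t
        using R(1) R(3)[of "(x, t)"] that assms(2) norm_snd_le[of t x] by auto
      show "AE t in lborel. indicator half_space (x, t) * snd (g (x, t)) = snd (g (x, t)) * indicator {0..R + 1} t"
        using AE_lborel_singleton[of "0::real"]
        by eventually_elim (use g0 in \<open>auto simp: indicator_def half_space_def not_le\<close>)
    qed
    \<comment> \<open>The upper end R + 1 lies strictly outside the support, so it contributes
      nothing.\<close>
    also have "\<dots> = u (x, R + 1) - u (x, 0)"
      by (rule integral_FTC_Icc_real) (use D C R(1) assms(2) in auto)
    also have "u (x, R + 1) = 0"
      using R(1) R(2)[of "(x, R + 1)"] norm_snd_le[of "R + 1" x] by auto
    finally show ?thesis by simp
  qed
  have "(LINT z:half_space|lborel. snd (g z)) = (LINT z|(lborel \<Otimes>\<^sub>M lborel). indicator half_space z * snd (g z))"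
    by (simp add: set_lebesgue_integral_def lborel_prod)
  also have "\<dots> = (LINT x|lborel. LINT t|lborel. indicator half_space (x, t) * snd (g (x, t)))"
    by (rule lborel_pair.integral_fst'[OF int, symmetric])
  finally show ?thesis by (simp add: inner)
qed

lemma C1c_mult:
  assumes "C1c e u g" "\<And>z. - e < snd z \<Longrightarrow> GDERIV v z :> h z" "continuous_on {z. - e < snd z} h"
  shows "C1c e (\<lambda>z. u z * v z) (\<lambda>z. u z *\<^sub>R h z + v z *\<^sub>R g z)"
proof -
  have "isCont v z" if "- e < snd z" for z
    using has_derivative_continuous[OF assms(2)[OF that, unfolded gderiv_def]] .
  then have "continuous_on {z. - e < snd z} v"
    by (simp add: continuous_on_eq_continuous_at[OF open_upper])
  moreover obtain R where "\<And>z. R < norm z \<Longrightarrow> u z = 0" using C1c_radius[OF assms(1)] by metis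
  moreover have "GDERIV (\<lambda>z. u z * v z) z :> u z *\<^sub>R h z + v z *\<^sub>R g z" if "- e < snd z" for z
    by (intro GDERIV_mult C1c_GDERIV[OF assms(1)] assms(2) that)
  moreover have "continuous_on {z. - e < snd z} g" using assms(1) by (simp add: C1c_def)
  ultimately show ?thesis
    unfolding C1c_def using C1c_continuous[OF assms(1)] assms(3)
    by (intro conjI exI[of _ R] allI impI continuous_intros) auto
qed

section \<open>Gradients of functions smooth up to the boundary, and the trace bound\<close>

definition grad :: "('a::euclidean_space \<Rightarrow> real) \<Rightarrow> 'a \<Rightarrow> 'a" where
  "grad f z = (\<Sum>b\<in>Basis. frechet_derivative f (at z) b *\<^sub>R b)"

lemma grad_inner: "b \<in> Basis \<Longrightarrow> grad f z \<bullet> b = frechet_derivative f (at z) b"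
  by (simp add: grad_def inner_sum_left inner_Basis if_distrib cong: if_cong)

lemma smooth_GDERIV: assumes "smooth f" shows "GDERIV f z :> grad f z"
proof -
  have D: "(f has_derivative frechet_derivative f (at z)) (at z)" by (rule smooth_has_derivative[OF assms])
  have "frechet_derivative f (at z) h = h \<bullet> grad f z" for h
  proof -
    have "frechet_derivative f (at z) h = frechet_derivative f (at z) (\<Sum>b\<in>Basis. (h \<bullet> b) *\<^sub>R b)"
      by (simp add: euclidean_representation)
    also have "\<dots> = h \<bullet> grad f z"
      by (simp add: linear_sum[OF has_derivative_linear[OF D]] linear_cmul[OF has_derivative_linear[OF D]] grad_def inner_sum_right mult.commute)
    finally show ?thesis .
  qed
  then have "frechet_derivative f (at z) = (\<lambda>h. h \<bullet> grad f z)" by auto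
  then show ?thesis using D by (simp add: gderiv_def)
qed

lemma smooth_grad_continuous: "smooth f \<Longrightarrow> continuous_on S (grad f)"
  unfolding grad_def by (intro continuous_intros smooth_continuous smooth_partial)

lemma test_function_C1c: assumes "test_function UNIV \<phi>" shows "C1c e \<phi> (grad \<phi>)"
proof -
  obtain C where C: "compact C" "\<And>z. z \<notin> C \<Longrightarrow> \<phi> z = 0"
    using test_function_support[OF assms] by metis
  obtain R where "\<And>x. x \<in> C \<Longrightarrow> norm x \<le> R" using compact_imp_bounded[OF C(1)] by (auto simp: bounded_iff)
  then have "\<phi> z = 0" if "R < norm z" for z using C(2)[of z] that not_le by blast
  then show ?thesis
    unfolding C1c_def using smooth_GDERIV smooth_grad_continuous test_function_smooth[OF assms] by blast
qed

lemma half_space_measurable: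
  fixes w :: "'a::euclidean_space \<times> real \<Rightarrow> 'b::euclidean_space"
  assumes "continuous_on {z. - e < snd z} w" "0 < e"
  shows "(\<lambda>z. indicator half_space z *\<^sub>R w z) \<in> borel_measurable borel"
proof (rule borel_measurable_continuous_on_indicator)
  show "continuous_on half_space w" by (rule continuous_on_subset[OF assms(1)]) (use assms(2) in \<open>auto simp: half_space_def\<close>)
qed (rule half_space_borel)

lemma half_space_lebesgue_lborel:
  fixes w :: "'a::euclidean_space \<times> real \<Rightarrow> 'b::euclidean_space"
  assumes "continuous_on {z. - e < snd z} w" "0 < e"
  shows "(LINT z:half_space|lebesgue. w z) = (LINT z:half_space|lborel. w z)"
    "set_integrable lebesgue half_space w \<longleftrightarrow> set_integrable lborel half_space w"
  using half_space_measurable[OF assms]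
  by (simp_all add: set_lebesgue_integral_def set_integrable_def integral_completion integrable_completion)

lemma integral_divergence_zero:
  fixes u :: "'a::euclidean_space \<times> real \<Rightarrow> real"
  assumes "C1c e u g" "0 < e" "\<And>x. u (x, 0) = 0" "b \<in> Basis"
  shows "(LINT z:half_space|lborel. g z \<bullet> b) = 0"
proof -
  from assms(4) consider b' where "b = (b', 0)" | "b = (0, 1)" by (auto simp: Basis_prod_def)
  then show ?thesis
  proof cases
    case 1 then show ?thesis using integral_tangential[OF assms(1,2), of b'] by (simp add: inner_prod_def)
  next
    case 2 then show ?thesis using integral_normal[OF assms(1,2)] assms(3) by (simp add: inner_prod_def)
  qed
qed

text \<open>Tested against \<phi>, the weak identity says that the integral of a partial derivative
  of u \<phi> vanishes.\<close>

lemma C1c_has_weak_gradient: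
  assumes "C1c e u g" "0 < e" shows "has_weak_gradient half_space u g"
  unfolding has_weak_gradient_def locally_integrable_def
proof (intro conjI allI impI ballI)
  obtain R where R: "\<And>z. R < norm z \<Longrightarrow> u z = 0" "\<And>z. R < norm z \<Longrightarrow> - e < snd z \<Longrightarrow> g z = 0"
    using C1c_radius[OF assms(1)] by metis
  note uc = C1c_continuous[OF assms(1)]
  have gc: "continuous_on {z. - e < snd z} g" using assms by (simp add: C1c_def)
  have "set_integrable lebesgue half_space u" "set_integrable lebesgue half_space g"
    using upper_integrable(1)[OF uc assms(2), of R] upper_integrable(1)[OF gc assms(2), of R] R
    by (simp_all add: half_space_lebesgue_lborel(2)[OF uc assms(2)] half_space_lebesgue_lborel(2)[OF gc assms(2)])
  then show "set_integrable lebesgue C u" "set_integrable lebesgue C g" if "compact C \<and> C \<subseteq> half_space" for C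
    using that by (auto elim!: set_integrable_subset simp: compact_imp_closed)
  fix \<phi> :: "'a \<times> real \<Rightarrow> real" and b :: "'a \<times> real" assume phi: "test_function half_space \<phi>" and b: "b \<in> Basis"
  have phi': "test_function UNIV \<phi>" using phi by (rule test_function_mono) simp
  have pc: "smooth \<phi>" by (rule test_function_smooth[OF phi])
  have C: "C1c e (\<lambda>z. u z * \<phi> z) (\<lambda>z. u z *\<^sub>R grad \<phi> z + \<phi> z *\<^sub>R g z)"
    by (intro C1c_mult assms smooth_GDERIV smooth_grad_continuous pc)
  \<comment> \<open>The support of \<phi> stays inside the open half-space, so the boundary term
    disappears whatever the boundary values of u are.\<close>
  have "u (x, 0) * \<phi> (x, 0) = 0" for x
  proof -
    obtain K where "K \<subseteq> half_space" "\<And>z. z \<notin> K \<Longrightarrow> \<phi> z = 0" using test_function_support[OF phi] by metis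
    then have "\<phi> (x, 0) = 0" by (force simp: half_space_def)
    then show ?thesis by simp
  qed
  from integral_divergence_zero[OF C assms(2) this b]
  have 0: "(LINT z:half_space|lborel. u z * frechet_derivative \<phi> (at z) b + (g z \<bullet> b) * \<phi> z) = 0"
    using b by (simp add: inner_add_left grad_inner mult.commute)
  have c1: "continuous_on {z. - e < snd z} (\<lambda>z. u z * frechet_derivative \<phi> (at z) b)"
    by (intro continuous_intros uc smooth_continuous smooth_partial pc b)
  have c2: "continuous_on {z. - e < snd z} (\<lambda>z. (g z \<bullet> b) * \<phi> z)"
    by (intro continuous_intros gc smooth_continuous pc)
  have "set_integrable lborel half_space (\<lambda>z. u z * frechet_derivative \<phi> (at z) b)"
    "set_integrable lborel half_space (\<lambda>z. (g z \<bullet> b) * \<phi> z)"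
    using upper_integrable(1)[OF c1 assms(2), of R] upper_integrable(1)[OF c2 assms(2), of R] R by simp_all
  then show "(LINT z:half_space|lebesgue. u z * frechet_derivative \<phi> (at z) b) = - (LINT z:half_space|lebesgue. (g z \<bullet> b) * \<phi> z)"
    unfolding half_space_lebesgue_lborel(1)[OF c1 assms(2)] half_space_lebesgue_lborel(1)[OF c2 assms(2)]
    using 0 by (simp add: set_integral_add)
qed

lemma C1c_L2_on:
  assumes "C1c e u g" "0 < e" shows "L2_on half_space u" "L2_on half_space g"
proof -
  obtain R where R: "\<And>z. R < norm z \<Longrightarrow> u z = 0" "\<And>z. R < norm z \<Longrightarrow> - e < snd z \<Longrightarrow> g z = 0"
    using C1c_radius[OF assms(1)] by metis
  have *: "L2_on half_space w" if w: "continuous_on {z. - e < snd z} w" and R: "\<And>z. R < norm z \<Longrightarrow> - e < snd z \<Longrightarrow> w z = 0"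
    for w :: "'a \<times> real \<Rightarrow> 'b::euclidean_space"
  proof -
    have c: "continuous_on {z. - e < snd z} (\<lambda>z. (norm (w z))\<^sup>2)" by (intro continuous_intros w)
    have "set_integrable lborel half_space (\<lambda>z. (norm (w z))\<^sup>2)"
      using upper_integrable(1)[OF c assms(2), of R] R by simp
    moreover have "(\<lambda>z. indicator half_space z *\<^sub>R w z) \<in> borel_measurable lebesgue"
      by (rule measurable_completion) (use half_space_measurable[OF w assms(2)] in simp)
    ultimately show ?thesis
      by (simp add: L2_on_def set_borel_measurable_def half_space_lebesgue_lborel(2)[OF c assms(2)])
  qed
  show "L2_on half_space u" using R C1c_continuous[OF assms(1)] by (intro *)
  show "L2_on half_space g" using R assms by (intro *) (auto simp: C1c_def)
qed

lemma C1c_W12: "C1c e u g \<Longrightarrow> 0 < e \<Longrightarrow> u \<in> W12 half_space"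
  unfolding W12_def using C1c_has_weak_gradient C1c_L2_on by blast

lemma C1c_diff:
  assumes "C1c e u g" "C1c e v h" shows "C1c e (\<lambda>z. u z - v z) (\<lambda>z. g z - h z)"
proof -
  obtain R where R: "\<And>z. R < norm z \<Longrightarrow> u z = 0" using C1c_radius[OF assms(1)] by metis
  obtain R' where R': "\<And>z. R' < norm z \<Longrightarrow> v z = 0" using C1c_radius[OF assms(2)] by metis
  show ?thesis unfolding C1c_def
    using assms C1c_GDERIV[OF assms(1)] C1c_GDERIV[OF assms(2)] R R'
    by (intro conjI exI[of _ "max R R'"] allI impI continuous_intros GDERIV_diff) (auto simp: C1c_def)
qed

text \<open>The boundary integral of u^2 is minus the integral of its normal derivative, and - 2 u
  u_t is at most u^2 + u_t^2. This estimate makes the trace continuous on W^{1,2}.\<close>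

lemma C1c_trace_inequality:
  assumes "C1c e u g" "0 < e"
  shows "(LINT x|lborel. (u (x, 0))\<^sup>2) \<le> (LINT z:half_space|lborel. (u z)\<^sup>2) + (LINT z:half_space|lborel. (norm (g z))\<^sup>2)"
proof -
  obtain R where R: "\<And>z. R < norm z \<Longrightarrow> u z = 0" "\<And>z. R < norm z \<Longrightarrow> - e < snd z \<Longrightarrow> g z = 0"
    using C1c_radius[OF assms(1)] by metis
  note uc = C1c_continuous[OF assms(1)]
  have gc: "continuous_on {z. - e < snd z} g" using assms by (simp add: C1c_def)
  have C: "C1c e (\<lambda>z. u z * u z) (\<lambda>z. u z *\<^sub>R g z + u z *\<^sub>R g z)"
    by (rule C1c_mult[OF assms(1) C1c_GDERIV[OF assms(1)] gc])
  have i: "set_integrable lborel half_space (\<lambda>z. (u z)\<^sup>2)" "set_integrable lborel half_space (\<lambda>z. (norm (g z))\<^sup>2)"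
      "set_integrable lborel half_space (\<lambda>z. - (2 * u z * snd (g z)))"
    by (rule upper_integrable(1)[OF _ assms(2), of _ R]; use R in \<open>auto intro!: continuous_intros uc gc\<close>)+
  have "(LINT x|lborel. (u (x, 0))\<^sup>2) = - (LINT z:half_space|lborel. snd (u z *\<^sub>R g z + u z *\<^sub>R g z))"
    using integral_normal[OF C assms(2)] by (simp add: power2_eq_square)
  also have "\<dots> = (LINT z:half_space|lborel. - (2 * u z * snd (g z)))"
    by (subst set_integral_uminus[symmetric]) (use i(3) in \<open>auto simp: set_integrable_def algebra_simps\<close>)
  also have "\<dots> \<le> (LINT z:half_space|lborel. (u z)\<^sup>2 + (norm (g z))\<^sup>2)"
  proof (rule set_integral_mono)
    show "- (2 * u z * snd (g z)) \<le> (u z)\<^sup>2 + (norm (g z))\<^sup>2" for z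
    proof -
      have "(snd (g z))\<^sup>2 \<le> (norm (g z))\<^sup>2"
        using norm_snd_le[of "snd (g z)" "fst (g z)"] by (simp add: abs_le_square_iff[symmetric])
      then show ?thesis using sum_squares_bound[of "- u z" "snd (g z)"] by simp
    qed
  qed (use i set_integral_add in auto)
  also have "\<dots> = (LINT z:half_space|lborel. (u z)\<^sup>2) + (LINT z:half_space|lborel. (norm (g z))\<^sup>2)"
    using i by (simp add: set_integral_add)
  finally show ?thesis .
qed

section \<open>The profile function\<close>

text \<open>Differentiating in s raises both the exponent \<nu> and the power j of q by one, so
  carrying both as parameters makes all derivatives members of the same family.\<close>

definition param_integral :: "'b measure \<Rightarrow> ('b \<Rightarrow> real) \<Rightarrow> ('b \<Rightarrow> real) \<Rightarrow> real \<Rightarrow> nat \<Rightarrow> real \<Rightarrow> real" where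
  "param_integral M m q \<nu> j s = (LINT w|M. m w * q w ^ j * (1 + 2 * s * q w) powr (- \<nu>))"

text \<open>The margin down to s = -1/2 makes s = 0, the slope on the boundary, an interior point.
  Together with q <= 1/2 it keeps the base of the power away from 0.\<close>

lemma base_ge_half:
  assumes "0 \<le> q" "q \<le> 1/2" "-1/2 < s" shows "1/2 \<le> 1 + 2 * s * (q::real)"
proof -
  have "- q \<le> 2 * s * q" using assms mult_right_mono[of "-1" "2 * s" q] by simp
  then show ?thesis using assms by linarith
qed

lemma param_integrable:
  fixes s :: real
  assumes [measurable]: "integrable M m" "q \<in> borel_measurable M"
    and q: "\<And>w. w \<in> space M \<Longrightarrow> 0 \<le> q w \<and> q w \<le> 1/2" and s: "-1/2 < s" and nu: "0 \<le> \<nu>"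
  shows "integrable M (\<lambda>w. m w * q w ^ j * (1 + 2 * s * q w) powr (- \<nu>))"
proof (rule Bochner_Integration.integrable_bound)
  show "integrable M (\<lambda>w. (1/2) powr (- \<nu>) * m w)" using assms by simp
  show "(\<lambda>w. m w * q w ^ j * (1 + 2 * s * q w) powr (- \<nu>)) \<in> borel_measurable M" by measurable
  show "AE w in M. norm (m w * q w ^ j * (1 + 2 * s * q w) powr (- \<nu>)) \<le> norm ((1/2) powr (- \<nu>) * m w)"
  proof (rule AE_I2)
    fix w assume w: "w \<in> space M"
    have "(1 + 2 * s * q w) powr (- \<nu>) \<le> (1/2) powr (- \<nu>)"
      using base_ge_half[of "q w" s] q[OF w] s nu by (intro powr_mono2') auto
    moreover have "q w ^ j \<le> 1" using q[OF w] by (intro power_le_one) auto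
    ultimately have "\<bar>m w\<bar> * (q w ^ j * (1 + 2 * s * q w) powr (- \<nu>)) \<le> \<bar>m w\<bar> * (1 * (1/2) powr (- \<nu>))"
      using q[OF w] by (intro mult_left_mono mult_mono) auto
    then show "norm (m w * q w ^ j * (1 + 2 * s * q w) powr (- \<nu>)) \<le> norm ((1/2) powr (- \<nu>) * m w)"
      using q[OF w] by (simp add: abs_mult mult_ac)
  qed
qed

text \<open>On s > -1/2 the powers are Lipschitz in s, uniformly in w, because their bases are at
  least 1/2. A multiple of |m| therefore dominates all difference quotients.\<close>

lemma param_integral_DERIV:
  assumes [measurable]: "integrable M m" "q \<in> borel_measurable M"
    and q: "\<And>w. w \<in> space M \<Longrightarrow> 0 \<le> q w \<and> q w \<le> 1/2" and s: "-1/2 < s" and nu: "0 \<le> \<nu>"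
  shows "DERIV (param_integral M m q \<nu> j) s :> - (2 * \<nu>) * param_integral M m q (\<nu> + 1) (Suc j) s"
proof -
  let ?I = "param_integral M m q \<nu> j"
  let ?p = "\<lambda>w s. (1 + 2 * s * q w) powr (- \<nu>)"
  let ?C = "2 * \<nu> * (1/2) powr (- (\<nu> + 1))"
  have D: "DERIV (?p w) s :> - (2 * \<nu>) * q w * (1 + 2 * s * q w) powr (- (\<nu> + 1))"
    if "w \<in> space M" "-1/2 < s" for w s
  proof -
    have "((\<lambda>s. 1 + 2 * s * q w) has_real_derivative 2 * q w) (at s)"
      by (auto intro!: derivative_eq_intros)
    from DERIV_fun_powr[OF this, of "- \<nu>"] show ?thesis
      using base_ge_half[of "q w" s] q[OF that(1)] that(2) by (simp add: mult_ac)
  qed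
  have B: "\<bar>- (2 * \<nu>) * q w * (1 + 2 * s * q w) powr (- (\<nu> + 1))\<bar> \<le> ?C" if "w \<in> space M" "-1/2 < s" for w s
  proof -
    have "(1 + 2 * s * q w) powr (- (\<nu> + 1)) \<le> (1/2) powr (- (\<nu> + 1))"
      using base_ge_half[of "q w" s] q[OF that(1)] that nu by (intro powr_mono2') auto
    then have "q w * (1 + 2 * s * q w) powr (- (\<nu> + 1)) \<le> 1 * (1/2) powr (- (\<nu> + 1))"
      using q[OF that(1)] by (intro mult_mono) auto
    from mult_left_mono[OF this, of "2 * \<nu>"] show ?thesis
      using nu q[OF that(1)] by (simp add: abs_mult mult.assoc)
  qed
  have L: "\<bar>?p w s - ?p w t\<bar> \<le> ?C * \<bar>s - t\<bar>" if "w \<in> space M" "-1/2 < s" "-1/2 < t" for w s t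
  proof -
    have "norm (?p w s - ?p w t) \<le> ?C * norm (s - t)"
    proof (rule field_differentiable_bound[of "{-1/2<..}"])
      show "(?p w has_field_derivative - (2 * \<nu>) * q w * (1 + 2 * s * q w) powr (- (\<nu> + 1))) (at s within {-1/2<..})"
        if "s \<in> {-1/2<..}" for s using D[OF \<open>w \<in> space M\<close>, of s] that by (auto intro: has_field_derivative_at_within)
      show "norm (- (2 * \<nu>) * q w * (1 + 2 * s * q w) powr (- (\<nu> + 1))) \<le> ?C"
        if "s \<in> {-1/2<..}" for s using B[OF \<open>w \<in> space M\<close>, of s] that by simp
    qed (use that in auto)
    then show ?thesis by simp
  qed
  have int: "integrable M (\<lambda>w. m w * q w ^ j * ?p w s)" if "-1/2 < s" for s
    by (rule param_integrable) (use assms that in auto)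
  show ?thesis
    unfolding DERIV_def
  proof (subst tendsto_at_iff_sequentially, intro allI impI)
    fix X :: "nat \<Rightarrow> real" assume X: "\<forall>i. X i \<in> UNIV - {0}" "X \<longlonglongrightarrow> 0"
    have "\<forall>\<^sub>F i in sequentially. -1/2 - s < X i" by (rule order_tendstoD[OF X(2)]) (use s in auto)
    then obtain i0 where i0: "\<And>i. i \<ge> i0 \<Longrightarrow> -1/2 - s < X i" by (auto simp: eventually_sequentially)
    \<comment> \<open>Initial terms are dropped so that s + Y i stays in the range where the powers
      are controlled.\<close>
    define Y where "Y i = X (i + i0)" for i
    have Y: "Y i \<noteq> 0" "-1/2 < s + Y i" for i using X(1) i0[of "i + i0"] by (auto simp: Y_def)
    have Y0: "Y \<longlonglongrightarrow> 0" unfolding Y_def by (rule LIMSEQ_ignore_initial_segment[OF X(2)])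
    define G where "G i w = m w * q w ^ j * ((?p w (s + Y i) - ?p w s) / Y i)" for i w
    have "(\<lambda>i. LINT w|M. G i w) \<longlonglongrightarrow> (LINT w|M. - (2 * \<nu>) * (m w * q w ^ Suc j * (1 + 2 * s * q w) powr (- (\<nu> + 1))))"
    proof (rule integral_dominated_convergence)
      show "integrable M (\<lambda>w. ?C * \<bar>m w\<bar>)" using assms by (intro integrable_mult_right integrable_abs)
      show "(\<lambda>w. - (2 * \<nu>) * (m w * q w ^ Suc j * (1 + 2 * s * q w) powr (- (\<nu> + 1)))) \<in> borel_measurable M"
        by measurable
      show "G i \<in> borel_measurable M" for i unfolding G_def by measurable
      show "AE w in M. (\<lambda>i. G i w) \<longlonglongrightarrow> - (2 * \<nu>) * (m w * q w ^ Suc j * (1 + 2 * s * q w) powr (- (\<nu> + 1)))"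
      proof (rule AE_I2)
        fix w assume w: "w \<in> space M"
        have "((\<lambda>h. (?p w (s + h) - ?p w s) / h) \<longlongrightarrow> - (2 * \<nu>) * q w * (1 + 2 * s * q w) powr (- (\<nu> + 1))) (at 0)"
          using D[OF w s] by (simp add: DERIV_def)
        moreover have "filterlim Y (at 0) sequentially" using Y Y0 by (auto simp: filterlim_at)
        ultimately have "(\<lambda>i. (?p w (s + Y i) - ?p w s) / Y i) \<longlonglongrightarrow> - (2 * \<nu>) * q w * (1 + 2 * s * q w) powr (- (\<nu> + 1))"
          by (rule filterlim_compose)
        from tendsto_mult_left[OF this, of "m w * q w ^ j"]
        show "(\<lambda>i. G i w) \<longlonglongrightarrow> - (2 * \<nu>) * (m w * q w ^ Suc j * (1 + 2 * s * q w) powr (- (\<nu> + 1)))"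
          unfolding G_def by (rule tendsto_eq_rhs) simp
      qed
      show "AE w in M. norm (G i w) \<le> ?C * \<bar>m w\<bar>" for i
      proof (rule AE_I2)
        fix w assume w: "w \<in> space M"
        have "\<bar>(?p w (s + Y i) - ?p w s) / Y i\<bar> \<le> ?C"
          using L[OF w Y(2)[of i] s] Y(1)[of i] by (simp add: divide_le_eq)
        moreover have "\<bar>q w ^ j\<bar> \<le> 1" using q[OF w] by (simp add: power_abs power_le_one)
        ultimately have "\<bar>m w\<bar> * (\<bar>q w ^ j\<bar> * \<bar>(?p w (s + Y i) - ?p w s) / Y i\<bar>) \<le> \<bar>m w\<bar> * (1 * ?C)"
          using nu by (intro mult_left_mono mult_mono) auto
        then show "norm (G i w) \<le> ?C * \<bar>m w\<bar>" by (simp add: G_def abs_mult mult_ac)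
      qed
    qed
    also have "(LINT w|M. - (2 * \<nu>) * (m w * q w ^ Suc j * (1 + 2 * s * q w) powr (- (\<nu> + 1))))
        = - (2 * \<nu>) * param_integral M m q (\<nu> + 1) (Suc j) s"
      by (simp only: integral_mult_right_zero param_integral_def)
    also have "(\<lambda>i. LINT w|M. G i w) = (\<lambda>i. (?I (s + Y i) - ?I s) / Y i)"
    proof
      fix i
      have "(LINT w|M. G i w) = (LINT w|M. (m w * q w ^ j * ?p w (s + Y i) - m w * q w ^ j * ?p w s) / Y i)"
        by (intro Bochner_Integration.integral_cong) (auto simp: G_def field_simps)
      also have "\<dots> = (?I (s + Y i) - ?I s) / Y i"
        using int[OF Y(2)[of i]] int[OF s] by (simp add: param_integral_def Bochner_Integration.integral_diff)
      finally show "(LINT w|M. G i w) = (?I (s + Y i) - ?I s) / Y i" .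
    qed
    finally have "(\<lambda>i. (?I (s + X (i + i0)) - ?I s) / X (i + i0)) \<longlonglongrightarrow> - (2 * \<nu>) * param_integral M m q (\<nu> + 1) (Suc j) s"
      by (simp add: Y_def)
    then show "((\<lambda>h. (?I (s + h) - ?I s) / h) \<circ> X) \<longlonglongrightarrow> - (2 * \<nu>) * param_integral M m q (\<nu> + 1) (Suc j) s"
      unfolding o_def by (rule LIMSEQ_offset)
  qed
qed

text \<open>With w = \<lambda>^2 / (1 + \<lambda>^2) the profile integral becomes twice the integral
  of \<lambda>^(b-1) (1 + 2 s \<lambda> + \<lambda>^2)^(-(a+b)/2) over \<lambda> > 0, a Mellin
  transform of the Gegenbauer generating function. The form on (0, 1) makes its values at s = 0 Beta
  integrals.\<close>

definition beta_density :: "real \<Rightarrow> real \<Rightarrow> real \<Rightarrow> real" where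
  "beta_density a b w = w powr (b/2 - 1) * (1 - w) powr (a/2 - 1)"

abbreviation unit_interval :: "real measure" where
  "unit_interval \<equiv> lebesgue_on {0<..<1}"

lemma unit_interval_integral:
  fixes g :: "real \<Rightarrow> real"
  assumes "(g has_integral I) {0..1::real}" "\<And>w. w \<in> {0<..<1} \<Longrightarrow> 0 \<le> g w"
  shows "integrable unit_interval g" "(LINT w|unit_interval. g w) = I"
proof -
  have g: "(g has_integral I) {0<..<1}" using assms(1) by (simp add: has_integral_Icc_iff_Ioo)
  then have "g absolutely_integrable_on {0<..<1}"
    using assms(2) by (intro nonnegative_absolutely_integrable_1) auto
  then show i: "integrable unit_interval g"
    by (simp add: integrable_restrict_space set_integrable_def)
  show "(LINT w|unit_interval. g w) = I"
    using lebesgue_integral_eq_integral[OF i] g by (simp add: integral_unique)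
qed

lemma beta_integral:
  assumes "0 < a" "0 < b"
  shows "integrable unit_interval (beta_density a b)" "(LINT w|unit_interval. beta_density a b w) = Beta (b/2) (a/2)"
proof -
  have "(beta_density a b has_integral Beta (b/2) (a/2)) {0..1}"
    using has_integral_Beta_real[of "b/2" "a/2"] assms by (simp add: beta_density_def[abs_def])
  from unit_interval_integral[OF this]
  show "integrable unit_interval (beta_density a b)" "(LINT w|unit_interval. beta_density a b w) = Beta (b/2) (a/2)"
    by (auto simp: beta_density_def)
qed

definition geo :: "real \<Rightarrow> real" where "geo w = sqrt (w * (1 - w))"

lemma geo_bounds: assumes "w \<in> {0..1}" shows "0 \<le> geo w \<and> geo w \<le> 1/2"
proof -
  have "w * (1 - w) \<le> (1/2)\<^sup>2" using zero_le_power2[of "w - 1/2"] by (simp add: power2_eq_square algebra_simps)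
  then have "sqrt (w * (1 - w)) \<le> sqrt ((1/2)\<^sup>2)" by (rule real_sqrt_le_mono)
  then show ?thesis using assms by (simp add: geo_def)
qed

lemma geo_measurable: "geo \<in> borel_measurable unit_interval"
  unfolding geo_def by (intro continuous_imp_measurable_on_sets_lebesgue continuous_intros) auto

text \<open>This is what remains of the derivative of the primitive in
  \<open>profile_primitive\<close> once the common powers are removed; the relation q^2 = w (1 - w)
  is the only input.\<close>

lemma profile_polynomial_identity:
  fixes a b s w q :: real
  assumes "q * q = w * (1 - w)"
  defines "A \<equiv> a * (1 - w) - b * w + (a - b) * s * q" and "Q \<equiv> 1 + 2 * s * q"
  shows "(b * (1 - w) - a * w) * Q * A - (a + b + 2) * q * s * (1 - 2 * w) * A
      + Q * (- 2 * (a + b) * (q * q) + (a - b) * s * q * (1 - 2 * w))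
    = - ((1 - s\<^sup>2) * (a + b) * (a + b + 2) * (q * q) + (a + b + 1) * (a + b) * s * q * Q - a * b * Q\<^sup>2)"
  using assms unfolding A_def Q_def by algebra

text \<open>In the variable \<lambda> with w = \<lambda>^2 / (1 + \<lambda>^2) put G = (1 + 2 s
  \<lambda> + \<lambda>^2)^(-\<mu>) and D = \<lambda> d/d\<lambda>. Harmonicity of the fundamental
  solution reads (1 - s^2) G_ss - (2 \<mu> + 1) s G_s = - D (D + 2 \<mu>) G. Integrating
  \<lambda>^(b-1) D (D + 2 \<mu>) G by parts produces the factor - a b and the boundary term
  \<lambda>^b (D + a) G, which vanishes at both ends since a and b are positive. That boundary term
  is \<open>E\<close>.\<close>

lemma profile_primitive:
  fixes a b s :: real
  assumes a: "0 < a" and b: "0 < b" and s: "-1/2 < s"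
  defines "\<mu> \<equiv> (a + b) / 2"
  shows "((\<lambda>w. beta_density a b w * ((1 - s\<^sup>2) * (a + b) * (a + b + 2) * geo w ^ 2 * (1 + 2 * s * geo w) powr (- (\<mu> + 2))
      + (a + b + 1) * (a + b) * s * geo w * (1 + 2 * s * geo w) powr (- (\<mu> + 1))
      - a * b * (1 + 2 * s * geo w) powr (- \<mu>))) has_integral 0) {0..1}"
proof -
  let ?Q = "\<lambda>w. 1 + 2 * s * geo w"
  \<comment> \<open>(D + a) G contributes the polynomial a + (a - b) s \<lambda> - b \<lambda>^2;
    divided by 1 + \<lambda>^2 it becomes \<open>A\<close>.\<close>
  define A where "A w = a * (1 - w) - b * w + (a - b) * s * geo w" for w
  define E where "E w = w powr (b/2) * (1 - w) powr (a/2) * ?Q w powr (- (\<mu> + 1)) * A w" for w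
  let ?G = "\<lambda>w. (1 - s\<^sup>2) * (a + b) * (a + b + 2) * geo w ^ 2 * ?Q w powr (- (\<mu> + 2))
      + (a + b + 1) * (a + b) * s * geo w * ?Q w powr (- (\<mu> + 1)) - a * b * ?Q w powr (- \<mu>)"
  have Q: "0 < ?Q w" if "w \<in> {0..1}" for w
    using base_ge_half[of "geo w" s] geo_bounds[OF that] s by linarith
  have "((\<lambda>w. - (1/2) * (beta_density a b w * ?G w)) has_integral (E 1 - E 0)) {0..1}"
  proof (rule fundamental_theorem_of_calculus_interior)
    show "continuous_on {0..1} E"
      unfolding E_def A_def geo_def using Q[unfolded geo_def] a b
      by (intro continuous_intros continuous_on_powr') (auto simp: less_le)
    fix w :: real assume w: "w \<in> {0<..<1}"
    define q where "q = geo w"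
    have q: "0 < q" "q * q = w * (1 - w)" using w by (auto simp: q_def geo_def)
    have Qw: "0 < ?Q w" using Q w by auto
    have dq: "(geo has_real_derivative (1 - 2 * w) / (2 * q)) (at w)"
    proof -
      have "0 < w * (1 - w)" using w by simp
      then show ?thesis unfolding geo_def[abs_def] q_def geo_def
      by (auto intro!: derivative_eq_intros simp: divide_simps)
    qed
    have dp: "((\<lambda>w. ?Q w powr (- (\<mu> + 1))) has_real_derivative - (\<mu> + 1) * ?Q w powr (- (\<mu> + 1) - 1) * (2 * s * ((1 - 2 * w) / (2 * q)))) (at w)"
    proof -
      have "(?Q has_real_derivative 2 * s * ((1 - 2 * w) / (2 * q))) (at w)"
        by (auto intro!: derivative_eq_intros dq)
      from DERIV_fun_powr[OF this Qw, of "- (\<mu> + 1)"] show ?thesis by (rule DERIV_cong) simp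
    qed
    have d1: "((\<lambda>w. w powr (b/2)) has_real_derivative b/2 * w powr (b/2 - 1)) (at w)"
      using w by (auto intro!: derivative_eq_intros)
    have d2: "((\<lambda>w. (1 - w) powr (a/2)) has_real_derivative a/2 * (1 - w) powr (a/2 - 1) * (- 1)) (at w)"
      using w DERIV_fun_powr[of "\<lambda>w. 1 - w" "-1" w "a/2"] by (auto intro!: derivative_eq_intros)
    have dA: "(A has_real_derivative - (a + b) + (a - b) * s * ((1 - 2 * w) / (2 * q))) (at w)"
      unfolding A_def[abs_def] by (auto intro!: derivative_eq_intros dq)
    have pw: "x powr y = x * x powr (y - 1)" if "0 < x" for x y :: real using that by (simp add: powr_diff)
    have mu: "- (\<mu> + 1) - 1 = - (\<mu> + 2)" "- \<mu> - 1 = - (\<mu> + 1)" by simp_all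
    have e: "w powr (b/2) = w * w powr (b/2 - 1)" "(1 - w) powr (a/2) = (1 - w) * (1 - w) powr (a/2 - 1)"
      "?Q w powr (- (\<mu> + 1)) = ?Q w * ?Q w powr (- (\<mu> + 2))"
      "?Q w powr (- (\<mu> + 1) - 1) = ?Q w powr (- (\<mu> + 2))"
      using pw[of w "b/2"] pw[of "1 - w" "a/2"] pw[OF Qw, of "- (\<mu> + 1)"] w unfolding mu by simp_all
    have e': "?Q w powr (- \<mu>) = ?Q w ^ 2 * ?Q w powr (- (\<mu> + 2))"
      using pw[OF Qw, of "- \<mu>"] unfolding mu e(3) by (simp add: power2_eq_square)
    note e = e e'
    define X where "X = w powr (b/2 - 1)"
    define Y where "Y = (1 - w) powr (a/2 - 1)"
    define P where "P = ?Q w powr (- (\<mu> + 2))"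
    have id: "(b * (1 - w) - a * w) * ?Q w * A w - (a + b + 2) * q * s * (1 - 2 * w) * A w
      + ?Q w * (- 2 * (a + b) * (q * q) + (a - b) * s * q * (1 - 2 * w))
    = - ((1 - s\<^sup>2) * (a + b) * (a + b + 2) * (q * q) + (a + b + 1) * (a + b) * s * q * ?Q w - a * b * (?Q w)\<^sup>2)"
      using profile_polynomial_identity[OF q(2), of b a s] by (simp add: A_def q_def)
    have "(E has_real_derivative
       ((b/2 * X * ((1 - w) * Y) + (a/2 * Y * (-1)) * (w * X)) * (?Q w * P) + (- (\<mu> + 1) * P * (2 * s * ((1 - 2 * w) / (2 * q)))) * ((w * X) * ((1 - w) * Y))) * A w
        + (- (a + b) + (a - b) * s * ((1 - 2 * w) / (2 * q))) * ((w * X) * ((1 - w) * Y) * (?Q w * P))) (at w)"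
    proof -
      note f = X_def[symmetric] Y_def[symmetric] P_def[symmetric]
      show ?thesis unfolding E_def[abs_def]
        using DERIV_mult'[OF DERIV_mult'[OF DERIV_mult'[OF d1 d2] dp] dA]
        by (rule DERIV_cong) (simp only: e[unfolded f] f, simp add: mult_ac)
    qed
    also have "((b/2 * X * ((1 - w) * Y) + (a/2 * Y * (-1)) * (w * X)) * (?Q w * P) + (- (\<mu> + 1) * P * (2 * s * ((1 - 2 * w) / (2 * q)))) * ((w * X) * ((1 - w) * Y))) * A w
        + (- (a + b) + (a - b) * s * ((1 - 2 * w) / (2 * q))) * ((w * X) * ((1 - w) * Y) * (?Q w * P))
      = X * Y * P * (1/2) * ((b * (1 - w) - a * w) * ?Q w * A w - (a + b + 2) * q * s * (1 - 2 * w) * A w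
      + ?Q w * (- 2 * (a + b) * (q * q) + (a - b) * s * q * (1 - 2 * w)))"
    proof -
      \<comment> \<open>The factor 1/(2 q) from the derivative of \<open>geo\<close> is singular at
        the ends of the interval; w (1 - w) = q^2 from the outer powers cancels it.\<close>
      have r: "(1 - 2 * w) / (2 * q) * (w * (1 - w)) = q * (1 - 2 * w) / 2"
        unfolding q(2)[symmetric] using q(1) by (simp add: field_simps)
      have mu: "\<mu> + 1 = (a + b + 2) / 2" by (simp add: \<mu>_def)
      define k where "k = (1 - 2 * w) / (2 * q)"
      have r': "k * (w * (1 - w)) = q * (1 - 2 * w) / 2" using r by (simp add: k_def)
      have "((b/2 * X * ((1 - w) * Y) + (a/2 * Y * (-1)) * (w * X)) * (?Q w * P) + (- (\<mu> + 1) * P * (2 * s * k)) * ((w * X) * ((1 - w) * Y))) * A w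
        + (- (a + b) + (a - b) * s * k) * ((w * X) * ((1 - w) * Y) * (?Q w * P))
       = X * Y * P * (1/2) * ((b * (1 - w) - a * w) * ?Q w * A w - 2 * (a + b + 2) * s * (k * (w * (1 - w))) * A w
      + ?Q w * (- 2 * (a + b) * (w * (1 - w)) + 2 * (a - b) * s * (k * (w * (1 - w)))))"
        unfolding mu by (simp add: field_simps)
      also have "\<dots> = X * Y * P * (1/2) * ((b * (1 - w) - a * w) * ?Q w * A w - (a + b + 2) * q * s * (1 - 2 * w) * A w
      + ?Q w * (- 2 * (a + b) * (q * q) + (a - b) * s * q * (1 - 2 * w)))"
        by (simp only: r' q(2)) (simp add: field_simps)
      finally show ?thesis unfolding k_def .
    qed
    also have "\<dots> = - (1/2) * (beta_density a b w * ?G w)"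
    proof -
      have "?G w = P * ((1 - s\<^sup>2) * (a + b) * (a + b + 2) * (q * q) + (a + b + 1) * (a + b) * s * q * ?Q w - a * b * (?Q w)\<^sup>2)"
        unfolding e(3) e' unfolding P_def[symmetric] by (simp add: q_def power2_eq_square algebra_simps)
      moreover have "beta_density a b w = X * Y" by (simp add: beta_density_def X_def Y_def)
      ultimately show ?thesis by (simp only: id)
    qed
    finally show "(E has_vector_derivative - (1/2) * (beta_density a b w * ?G w)) (at w)"
      by (simp add: has_real_derivative_iff_has_vector_derivative)
  qed auto
  moreover have "E 1 = 0" "E 0 = 0" using a b by (auto simp: E_def)
  ultimately have "((\<lambda>w. - (1/2) * (beta_density a b w * ?G w)) has_integral 0) {0..1}" by simp
  from has_integral_mult_right[OF this, of "-2"] show ?thesis by simp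
qed

text \<open>\<open>f = profile a b 0\<close> solves \<open>(1 - s^2) f'' - (a + b + 1) s f' = a b f\<close>, and \<open>profile a b j\<close> is its \<open>j\<close>-th derivative up to a
  constant factor.\<close>

definition profile :: "real \<Rightarrow> real \<Rightarrow> nat \<Rightarrow> real \<Rightarrow> real" where
  "profile a b j = param_integral unit_interval (beta_density a b) geo ((a + b) / 2 + real j) j"

lemma profile_DERIV:
  assumes "0 < a" "0 < b" "-1/2 < s"
  shows "DERIV (profile a b j) s :> - (a + b + 2 * real j) * profile a b (Suc j) s"
proof -
  have "DERIV (profile a b j) s :> - (2 * ((a + b) / 2 + real j)) * param_integral unit_interval (beta_density a b) geo ((a + b) / 2 + real j + 1) (Suc j) s"
    unfolding profile_def using assms geo_bounds
    by (intro param_integral_DERIV beta_integral geo_measurable) auto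
  moreover have "- (2 * ((a + b) / 2 + real j)) = - (a + b + 2 * real j)" by (simp add: field_simps)
  moreover have "param_integral unit_interval (beta_density a b) geo ((a + b) / 2 + real j + 1) (Suc j) s = profile a b (Suc j) s"
    by (simp add: profile_def add_ac)
  ultimately show ?thesis by simp
qed

lemma profile_integrable:
  assumes "0 < a" "0 < b" "-1/2 < s"
  shows "integrable unit_interval (\<lambda>w. beta_density a b w * geo w ^ j * (1 + 2 * s * geo w) powr (- ((a + b) / 2 + real j)))"
  using assms geo_bounds by (intro param_integrable beta_integral geo_measurable) auto

text \<open>The left side minus the right side is the integral of an exact derivative. The
  coefficients (a + b) (a + b + 2) and a + b convert \<open>profile\<close> of orders 2 and 1 into
  f'' and - f'.\<close>

lemma profile_ODE:
  assumes "0 < a" "0 < b" "-1/2 < s"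
  shows "(1 - s\<^sup>2) * (a + b) * (a + b + 2) * profile a b 2 s + (a + b + 1) * (a + b) * s * profile a b 1 s
     = a * b * profile a b 0 s"
proof -
  let ?Q = "\<lambda>w. 1 + 2 * s * geo w"
  let ?I = "\<lambda>j w. beta_density a b w * geo w ^ j * ?Q w powr (- ((a + b) / 2 + real j))"
  let ?G = "\<lambda>w. beta_density a b w * ((1 - s\<^sup>2) * (a + b) * (a + b + 2) * geo w ^ 2 * ?Q w powr (- ((a + b) / 2 + 2))
      + (a + b + 1) * (a + b) * s * geo w * ?Q w powr (- ((a + b) / 2 + 1))
      - a * b * ?Q w powr (- ((a + b) / 2)))"
  have eq: "?G = (\<lambda>w. (1 - s\<^sup>2) * (a + b) * (a + b + 2) * ?I 2 w + (a + b + 1) * (a + b) * s * ?I 1 w - a * b * ?I 0 w)"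
    by (auto simp: fun_eq_iff algebra_simps)
  note i = profile_integrable[OF assms]
  have "integrable unit_interval ?G" unfolding eq
    by (intro Bochner_Integration.integrable_add Bochner_Integration.integrable_diff integrable_mult_right i)
  from lebesgue_integral_eq_integral[OF this]
  have "(LINT w|unit_interval. ?G w) = integral {0<..<1} ?G" by simp
  also have "\<dots> = 0"
    using profile_primitive[OF assms] by (intro integral_unique) (simp only: has_integral_Icc_iff_Ioo)
  finally have "(LINT w|unit_interval. ?G w) = 0" .
  moreover have "(LINT w|unit_interval. ?G w) = (1 - s\<^sup>2) * (a + b) * (a + b + 2) * profile a b 2 s + (a + b + 1) * (a + b) * s * profile a b 1 s - a * b * profile a b 0 s"
    unfolding eq profile_def param_integral_def
    by (simp only: Bochner_Integration.integral_add Bochner_Integration.integral_diff Bochner_Integration.integrable_add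
        Bochner_Integration.integrable_diff integrable_mult_right i integral_mult_right_zero)
  ultimately show ?thesis by simp
qed

lemma profile_nonneg: "-1/2 < s \<Longrightarrow> 0 \<le> profile a b j s"
  unfolding profile_def param_integral_def using geo_bounds
  by (intro Bochner_Integration.integral_nonneg) (auto simp: beta_density_def)

text \<open>For fixed s the base is at most 1 + |s|, so the integral is bounded below by a positive
  multiple of a Beta integral.\<close>

lemma profile_pos:
  assumes "0 < a" "0 < b" "-1/2 < s" shows "0 < profile a b 0 s"
proof -
  have B: "0 < Beta (b/2) (a/2)" using assms by (simp add: Beta_def Gamma_real_pos)
  have "(1 + \<bar>s\<bar>) powr (- ((a + b) / 2)) * Beta (b/2) (a/2) = (LINT w|unit_interval. (1 + \<bar>s\<bar>) powr (- ((a + b) / 2)) * beta_density a b w)"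
    using beta_integral(2)[OF assms(1,2)] by simp
  also have "\<dots> \<le> profile a b 0 s"
    unfolding profile_def param_integral_def
  proof (rule integral_mono)
    show "integrable unit_interval (\<lambda>w. (1 + \<bar>s\<bar>) powr (- ((a + b) / 2)) * beta_density a b w)"
      using beta_integral(1)[OF assms(1,2)] by simp
    show "integrable unit_interval (\<lambda>w. beta_density a b w * geo w ^ 0 * (1 + 2 * s * geo w) powr (- ((a + b) / 2 + real 0)))"
      by (rule profile_integrable[OF assms])
    fix w assume w: "w \<in> space unit_interval"
    then have g: "0 \<le> geo w" "geo w \<le> 1/2" using geo_bounds[of w] by auto
    have "2 * s * geo w \<le> \<bar>s\<bar>"
      using mult_mono[of "s" "\<bar>s\<bar>" "2 * geo w" 1] g by (simp add: mult.assoc mult.left_commute)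
    then have "(1 + \<bar>s\<bar>) powr (- ((a + b) / 2)) \<le> (1 + 2 * s * geo w) powr (- ((a + b) / 2))"
      using base_ge_half[OF g assms(3)] assms by (intro powr_mono2') auto
    then have "(1 + \<bar>s\<bar>) powr (- ((a + b) / 2)) * beta_density a b w \<le> (1 + 2 * s * geo w) powr (- ((a + b) / 2)) * beta_density a b w"
      by (rule mult_right_mono) (simp add: beta_density_def)
    then show "(1 + \<bar>s\<bar>) powr (- ((a + b) / 2)) * beta_density a b w
        \<le> beta_density a b w * geo w ^ 0 * (1 + 2 * s * geo w) powr (- ((a + b) / 2 + real 0))"
      by (simp add: mult.commute)
  qed
  finally show ?thesis using B by (smt (verit) assms(3) mult_pos_pos powr_gt_zero)
qed

text \<open>At s = 0 the power is 1, and at order 1 the factor \<open>geo\<close> supplies half a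
  power each of w and 1 - w, which raises both parameters by 1.\<close>

lemma profile_at_0:
  assumes "0 < a" "0 < b"
  shows "profile a b 0 0 = Beta (b/2) (a/2)" "profile a b 1 0 = Beta ((b + 1)/2) ((a + 1)/2)"
proof -
  show "profile a b 0 0 = Beta (b/2) (a/2)"
    using beta_integral(2)[OF assms] by (simp add: profile_def param_integral_def)
  have "profile a b 1 0 = (LINT w|unit_interval. beta_density (a + 1) (b + 1) w)"
    unfolding profile_def param_integral_def
  proof (intro Bochner_Integration.integral_cong refl)
    fix w assume "w \<in> space unit_interval"
    then have w: "0 < w" "w < 1" by auto
    have "geo w = w powr (1/2) * (1 - w) powr (1/2)" using w by (simp add: geo_def powr_half_sqrt real_sqrt_mult)
    then have "beta_density a b w * geo w = (w powr (b/2 - 1) * w powr (1/2)) * ((1 - w) powr (a/2 - 1) * (1 - w) powr (1/2))"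
      by (simp only: beta_density_def mult_ac)
    also have "\<dots> = beta_density (a + 1) (b + 1) w"
      unfolding powr_add[symmetric] beta_density_def by (simp add: add_divide_distrib)
    finally show "beta_density a b w * geo w ^ 1 * (1 + 2 * 0 * geo w) powr (- ((a + b) / 2 + real 1)) = beta_density (a + 1) (b + 1) w"
      by simp
  qed
  also have "\<dots> = Beta ((b + 1)/2) ((a + 1)/2)" using assms by (intro beta_integral) auto
  finally show "profile a b 1 0 = Beta ((b + 1)/2) ((a + 1)/2)" .
qed

text \<open>The two Beta integrals have Gamma denominators whose arguments differ by 1. The
  functional equation turns their quotient into (a + b)/2, which against a + b leaves the factor 2
  of the sharp constant.\<close>

lemma profile_ratio:
  assumes "0 < a" "0 < b"
  shows "(a + b) * profile a b 1 0 =
    2 * (Gamma ((a + 1)/2) * Gamma ((b + 1)/2) / (Gamma (a/2) * Gamma (b/2))) * profile a b 0 0"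
proof -
  have G: "Gamma ((a + b)/2 + 1) = (a + b)/2 * Gamma ((a + b)/2)"
    using assms by (intro Gamma_plus1) (auto elim: nonpos_Ints_cases)
  have e: "(b + 1)/2 + (a + 1)/2 = (a + b)/2 + 1" "b/2 + a/2 = (a + b)/2" by (simp_all add: field_simps)
  have p: "0 < Gamma ((a + b)/2)" "0 < Gamma (a/2)" "0 < Gamma (b/2)" using assms by (auto intro!: Gamma_real_pos)
  have "(a + b) * (G2 * G1 / ((a + b)/2 * g)) = 2 * (G1 * G2 / (ga * gb)) * (gb * ga / g)"
    if "0 < g" "0 < ga" "0 < gb" for G1 G2 g ga gb :: real
    using that assms by (simp add: divide_simps)
  from this[OF p] show ?thesis unfolding profile_at_0[OF assms] Beta_def e G .
qed

section \<open>The dual norm of a Finsler norm\<close>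

locale finsler =
  fixes H :: "'a::euclidean_space \<Rightarrow> real"
  assumes finsler: "Finsler_norm H"
begin

abbreviation H0 :: "'a \<Rightarrow> real" where "H0 \<equiv> dual_norm H"

lemma H_nonneg: "0 \<le> H x" and H_cont: "continuous_on UNIV H" and H_scale: "H (c *\<^sub>R x) = \<bar>c\<bar> * H x"
  and H_convex: "convex_on UNIV H" and H_strict: "strictly_convex_set {\<xi>. H \<xi> < 1}"
  using finsler by (auto simp: Finsler_norm_def)

lemma H_bounds: obtains c C where "0 < c" "c \<le> C" "\<And>x. c * norm x \<le> H x" "\<And>x. H x \<le> C * norm x"
  using finsler by (auto simp: Finsler_norm_def)

lemma H_zero [simp]: "H 0 = 0" using H_scale[of 0 0] by simp

lemma H_minus: "H (- x) = H x" using H_scale[of "-1" x] by simp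

lemma H_pos: "x \<noteq> 0 \<Longrightarrow> 0 < H x"
proof -
  assume x: "x \<noteq> 0"
  obtain c where "0 < c" "c * norm x \<le> H x" using H_bounds by metis
  moreover have "0 < c * norm x" using x \<open>0 < c\<close> by simp
  ultimately show ?thesis by linarith
qed

lemma H_triangle: "H (x + y) \<le> H x + H y"
proof -
  have "H ((1/2) *\<^sub>R x + (1/2) *\<^sub>R y) \<le> (1/2) * H x + (1/2) * H y"
    using convex_onD[OF H_convex, of "1/2" x y] by simp
  moreover have "(1/2) *\<^sub>R x + (1/2) *\<^sub>R y = (1/2) *\<^sub>R (x + y)" by (simp add: scaleR_add_right)
  ultimately show ?thesis by (simp add: H_scale)
qed

lemma unit_sphere_compact: "compact {\<xi>. H \<xi> = 1}"
proof -
  obtain c where c: "0 < c" "\<And>x. c * norm x \<le> H x" using H_bounds by metis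
  have "norm x \<le> 1 / c" if "H x = 1" for x
    using c(2)[of x] c(1) that by (simp add: field_simps)
  then have "bounded {\<xi>. H \<xi> = 1}" by (auto simp: bounded_iff)
  moreover have "closed {\<xi>. H \<xi> = 1}"
    using H_cont by (intro closed_Collect_eq continuous_intros)
  ultimately show ?thesis by (simp add: compact_eq_bounded_closed)
qed

lemma normalize: "x \<noteq> 0 \<Longrightarrow> H ((1 / H x) *\<^sub>R x) = 1"
  using H_pos[of x] by (simp add: H_scale)

lemma unit_sphere_bound: obtains c where "0 < c" "\<And>\<xi>. H \<xi> = 1 \<Longrightarrow> norm \<xi> \<le> 1 / c" "\<And>x. norm x \<le> H x / c"
proof -
  obtain c where c: "0 < c" "\<And>x. c * norm x \<le> H x" using H_bounds by metis
  have "norm x \<le> H x / c" for x using c(2)[of x] c(1) by (simp add: pos_le_divide_eq mult.commute)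
  then show thesis using that[of c] c(1) by metis
qed

lemma dual_norm_bdd: "bdd_above ((\<lambda>\<xi>. (\<xi> \<bullet> x) / H \<xi>) ` (- {0}))"
proof -
  obtain c where c: "0 < c" "\<And>x. norm x \<le> H x / c" using unit_sphere_bound by metis
  have "(\<xi> \<bullet> x) / H \<xi> \<le> norm x / c" if "\<xi> \<noteq> 0" for \<xi>
  proof -
    have "\<xi> \<bullet> x \<le> norm \<xi> * norm x" by (rule norm_cauchy_schwarz)
    also have "\<dots> \<le> (H \<xi> / c) * norm x" by (intro mult_right_mono c) auto
    finally show ?thesis using H_pos[OF that] c(1) by (simp add: field_simps)
  qed
  then show ?thesis by (auto simp: bdd_above_def)
qed

lemma inner_le_dual: "p \<bullet> x \<le> H p * H0 x"
proof (cases "p = 0")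
  case False
  then have "(p \<bullet> x) / H p \<le> H0 x" unfolding dual_norm_def by (intro cSUP_upper dual_norm_bdd) auto
  then show ?thesis using H_pos[OF False] by (simp add: field_simps)
qed simp

lemma abs_inner_le_dual: "\<bar>p \<bullet> x\<bar> \<le> H p * H0 x"
  using inner_le_dual[of p x] inner_le_dual[of "- p" x] by (simp add: H_minus)

text \<open>The quotient is homogeneous of degree 0, so the supremum can be taken over the unit
  sphere of \<open>H\<close>, which is compact.\<close>

lemma dual_attained: "\<exists>\<xi>. H \<xi> = 1 \<and> \<xi> \<bullet> x = H0 x"
proof -
  have ne: "{\<xi>. H \<xi> = 1} \<noteq> {}" using normalize[of "SOME b. b \<in> Basis"] nonzero_Basis[OF SOME_Basis] by auto
  obtain \<xi> where xi: "H \<xi> = 1" "\<And>\<eta>. H \<eta> = 1 \<Longrightarrow> \<eta> \<bullet> x \<le> \<xi> \<bullet> x"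
    using continuous_attains_sup[OF unit_sphere_compact ne, of "\<lambda>\<xi>. \<xi> \<bullet> x"] continuous_on_inner[OF continuous_on_id continuous_on_const]
    by auto
  have "H0 x \<le> \<xi> \<bullet> x"
    unfolding dual_norm_def
  proof (rule cSUP_least)
    show "- {0::'a} \<noteq> {}" using nonzero_Basis[OF SOME_Basis] by auto
    show "(\<eta> \<bullet> x) / H \<eta> \<le> \<xi> \<bullet> x" if "\<eta> \<in> - {0}" for \<eta>
      using xi(2)[OF normalize[of \<eta>]] that by simp
  qed
  moreover have "\<xi> \<bullet> x \<le> H0 x" using inner_le_dual[of \<xi> x] xi(1) by simp
  ultimately show ?thesis using xi(1) by force
qed

lemma dual_bounds: obtains c C where "0 < c" "0 < C" "\<And>x. c * norm x \<le> H0 x" "\<And>x. H0 x \<le> C * norm x"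
proof -
  obtain c C where c: "0 < c" "c \<le> C" "\<And>x. c * norm x \<le> H x" "\<And>x. H x \<le> C * norm x" using H_bounds by metis
  have C: "0 < C" using c by linarith
  have "H0 x \<le> 1 / c * norm x" for x
  proof -
    obtain \<xi> where xi: "H \<xi> = 1" "\<xi> \<bullet> x = H0 x" using dual_attained by metis
    have "norm \<xi> \<le> 1 / c" using c(3)[of \<xi>] xi(1) c(1) by (simp add: field_simps)
    then have "norm \<xi> * norm x \<le> 1 / c * norm x" by (intro mult_right_mono) auto
    then show ?thesis using norm_cauchy_schwarz[of \<xi> x] xi(2) by linarith
  qed
  moreover have "1 / C * norm x \<le> H0 x" for x
  proof (cases "x = 0")
    case True
    obtain \<xi> where "H \<xi> = 1" "\<xi> \<bullet> x = H0 x" using dual_attained by metis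
    then show ?thesis using True by simp
  next
    case False
    have 0: "0 \<le> H0 x" using inner_le_dual[of x x] H_pos[OF False] False
      by (smt (verit) inner_gt_zero_iff zero_less_mult_pos)
    have "norm x * norm x = x \<bullet> x" by (simp add: power2_norm_eq_inner[symmetric] power2_eq_square)
    also have "\<dots> \<le> H x * H0 x" by (rule inner_le_dual)
    also have "\<dots> \<le> (C * norm x) * H0 x" by (intro mult_right_mono c 0)
    finally have "norm x * norm x \<le> norm x * (C * H0 x)" by (simp add: mult_ac)
    then have "norm x \<le> C * H0 x" using False by simp
    then show ?thesis using C by (simp add: field_simps)
  qed
  ultimately show thesis using that[of "1 / C" "1 / c"] c C by auto
qed

lemma dual_nonneg: "0 \<le> H0 x" and dual_pos: "x \<noteq> 0 \<Longrightarrow> 0 < H0 x"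
proof -
  obtain c where c: "0 < c" "c * norm x \<le> H0 x" using dual_bounds by metis
  then show "0 \<le> H0 x" by (smt (verit) mult_nonneg_nonneg norm_ge_zero)
  assume "x \<noteq> 0"
  then have "0 < c * norm x" using c by simp
  then show "0 < H0 x" using c(2) by linarith
qed

lemma dual_zero [simp]: "H0 0 = 0"
proof -
  obtain C where "H0 0 \<le> C * norm (0::'a)" using dual_bounds by metis
  then show ?thesis using dual_nonneg[of 0] by simp
qed

text \<open>Testing the dual norm at y with the maximiser for x bounds the difference by a pairing
  with x - y, and maximisers have bounded length. One constant serves all estimates.\<close>

lemma dual_Lipschitz: obtains L where "0 < L" "\<And>x y. \<bar>H0 x - H0 y\<bar> \<le> L * norm (x - y)"
    "\<And>\<xi>. H \<xi> = 1 \<Longrightarrow> norm \<xi> \<le> L" "\<And>x. H0 x \<le> L * norm x"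
proof -
  obtain c where c: "0 < c" "\<And>\<xi>. H \<xi> = 1 \<Longrightarrow> norm \<xi> \<le> 1 / c" using unit_sphere_bound by metis
  have *: "H0 x - H0 y \<le> 1 / c * norm (x - y)" for x y
  proof -
    obtain \<xi> where xi: "H \<xi> = 1" "\<xi> \<bullet> x = H0 x" using dual_attained by metis
    have "\<xi> \<bullet> y \<le> H0 y" using inner_le_dual[of \<xi> y] xi by simp
    then have "H0 x - H0 y \<le> \<xi> \<bullet> (x - y)" using xi by (simp add: inner_diff_right)
    also have "\<dots> \<le> norm \<xi> * norm (x - y)" by (rule norm_cauchy_schwarz)
    also have "\<dots> \<le> 1 / c * norm (x - y)" by (intro mult_right_mono c xi) auto
    finally show ?thesis .
  qed
  have "\<bar>H0 x - H0 y\<bar> \<le> 1 / c * norm (x - y)" for x y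
    using *[of x y] *[of y x] by (simp add: norm_minus_commute abs_le_iff)
  moreover have "H0 x \<le> 1 / c * norm x" for x using *[of x 0] by simp
  ultimately show thesis using that[of "1 / c"] c by simp
qed

lemma dual_continuous: "continuous_on S H0"
proof -
  obtain L where L: "0 < L" "\<And>x y. \<bar>H0 x - H0 y\<bar> \<le> L * norm (x - y)" using dual_Lipschitz by metis
  have "L-lipschitz_on S H0" using L by (auto simp: lipschitz_on_def dist_norm)
  then show ?thesis by (rule lipschitz_on_continuous_on)
qed

text \<open>The midpoint of two distinct maximisers would be an interior point of the unit ball with
  the same maximal pairing, which is impossible for \<open>H\<close> below 1. Uniqueness of the
  maximiser is what makes the dual norm differentiable away from the origin.\<close>

lemma dual_unique:
  assumes x: "x \<noteq> 0" and 1: "H \<xi> = 1" "\<xi> \<bullet> x = H0 x" and 2: "H \<eta> = 1" "\<eta> \<bullet> x = H0 x"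
  shows "\<xi> = \<eta>"
proof (rule ccontr)
  assume ne: "\<xi> \<noteq> \<eta>"
  \<comment> \<open>Strict convexity speaks about the closure of the open unit ball; points of the
    unit sphere are reached radially from inside.\<close>
  have cl: "\<zeta> \<in> closure {\<xi>. H \<xi> < 1}" if "H \<zeta> = 1" for \<zeta>
  proof (rule closed_sequentially[OF closed_closure])
    show "(1 - inverse (real (Suc i))) *\<^sub>R \<zeta> \<in> closure {\<xi>. H \<xi> < 1}" for i
    proof (rule subsetD[OF closure_subset], rule CollectI)
      have "0 \<le> 1 - inverse (real (Suc i))" "1 - inverse (real (Suc i)) < 1" by (simp_all add: field_simps)
      then show "H ((1 - inverse (real (Suc i))) *\<^sub>R \<zeta>) < 1" by (simp only: H_scale that) simp
    qed
    have "(\<lambda>i. (1 - inverse (real (Suc i))) *\<^sub>R \<zeta>) \<longlonglongrightarrow> (1 - 0) *\<^sub>R \<zeta>"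
      by (intro tendsto_intros LIMSEQ_inverse_real_of_nat)
    then show "(\<lambda>i. (1 - inverse (real (Suc i))) *\<^sub>R \<zeta>) \<longlonglongrightarrow> \<zeta>" by simp
  qed
  let ?m = "midpoint \<xi> \<eta>"
  have "?m \<in> open_segment \<xi> \<eta>" using ne by simp
  then have "?m \<in> interior {\<xi>. H \<xi> < 1}"
    using H_strict cl[OF 1(1)] cl[OF 2(1)] ne unfolding strictly_convex_set_def by blast
  then have m: "H ?m < 1" using interior_subset by fastforce
  have "?m \<bullet> x = H0 x" using 1(2) 2(2) by (simp add: midpoint_def inner_add_left)
  then have "H0 x \<le> H ?m * H0 x" using inner_le_dual[of ?m x] by simp
  then show False using m dual_pos[OF x] by (simp add: mult_less_cancel_right)
qed

definition dual_point :: "'a \<Rightarrow> 'a" where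
  "dual_point x = (SOME \<xi>. H \<xi> = 1 \<and> \<xi> \<bullet> x = H0 x)"

lemma dual_point: "H (dual_point x) = 1" "dual_point x \<bullet> x = H0 x"
  using someI_ex[OF dual_attained[of x]] by (auto simp: dual_point_def)

text \<open>Compactness and uniqueness give a gap: unit vectors at distance at least e from the
  maximiser for x fall short of the supremum by a fixed d. For y near x such a vector cannot be
  maximal.\<close>

lemma dual_point_continuous:
  assumes x: "x \<noteq> 0" shows "isCont dual_point x"
  unfolding continuous_at_eps_delta
proof (intro allI impI)
  fix e :: real assume e: "0 < e"
  let ?T = "{\<xi>. H \<xi> = 1} \<inter> {\<xi>. e \<le> norm (\<xi> - dual_point x)}"
  obtain L where L: "0 < L" "\<And>x y. \<bar>H0 x - H0 y\<bar> \<le> L * norm (x - y)" "\<And>\<xi>. H \<xi> = 1 \<Longrightarrow> norm \<xi> \<le> L"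
    using dual_Lipschitz by metis
  have cT: "compact ?T"
    by (intro compact_Int_closed unit_sphere_compact closed_Collect_le continuous_intros)
  obtain d where d: "0 < d" "\<And>\<eta>. \<eta> \<in> ?T \<Longrightarrow> \<eta> \<bullet> x \<le> H0 x - d"
  proof (cases "?T = {}")
    case True then show ?thesis using that[of 1] by auto
  next
    case False
    then obtain \<eta>0 where eta: "\<eta>0 \<in> ?T" "\<And>\<eta>. \<eta> \<in> ?T \<Longrightarrow> \<eta> \<bullet> x \<le> \<eta>0 \<bullet> x"
      using continuous_attains_sup[OF cT False, of "\<lambda>\<xi>. \<xi> \<bullet> x"] continuous_on_inner[OF continuous_on_id continuous_on_const]
      by metis
    have "\<eta>0 \<bullet> x \<noteq> H0 x" using dual_unique[OF x, of \<eta>0 "dual_point x"] dual_point[of x] eta(1) e by auto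
    moreover have "\<eta>0 \<bullet> x \<le> H0 x" using inner_le_dual[of \<eta>0 x] eta(1) by simp
    ultimately show ?thesis using that[of "H0 x - \<eta>0 \<bullet> x"] eta(2) by auto
  qed
  show "\<exists>r>0. \<forall>y. dist y x < r \<longrightarrow> dist (dual_point y) (dual_point x) < e"
  \<comment> \<open>Moving from x to y costs L |y - x| once in the dual norm and once in the
    pairing, and both losses together must stay below d.\<close>
  proof (intro exI[of _ "d / (2 * L)"] conjI allI impI)
    show "0 < d / (2 * L)" using d L by simp
    fix y assume y: "dist y x < d / (2 * L)"
    then have Ly: "2 * (L * norm (y - x)) < d" using L(1) by (simp add: dist_norm field_simps)
    have "dual_point y \<bullet> (y - x) \<le> norm (dual_point y) * norm (y - x)" by (rule norm_cauchy_schwarz)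
    also have "\<dots> \<le> L * norm (y - x)" by (intro mult_right_mono L dual_point) auto
    finally have "H0 y - L * norm (y - x) \<le> dual_point y \<bullet> x"
      using dual_point(2)[of y] by (simp add: inner_diff_right)
    then have "H0 x - d < dual_point y \<bullet> x" using L(2)[of y x] Ly by (auto simp: abs_le_iff)
    then have "dual_point y \<notin> ?T" using d(2) by (meson not_le)
    then show "dist (dual_point y) (dual_point x) < e" using dual_point(1)[of y] by (simp add: dist_norm)
  qed
qed

text \<open>Half the gradient of the squared dual norm. Unlike the gradient of the dual norm itself
  it extends continuously to the origin, so points on the vertical axis through the pole are not
  exceptional.\<close>

definition dual_grad :: "'a \<Rightarrow> 'a" where "dual_grad x = H0 x *\<^sub>R dual_point x"

lemma H_dual_grad: "H (dual_grad x) = H0 x"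
  using dual_nonneg[of x] by (simp add: dual_grad_def H_scale dual_point)

lemma dual_grad_inner: "dual_grad x \<bullet> x = (H0 x)\<^sup>2"
  by (simp add: dual_grad_def dual_point power2_eq_square)

lemma dual_grad_continuous: "continuous_on S dual_grad"
proof -
  obtain L where L: "0 < L" "\<And>\<xi>. H \<xi> = 1 \<Longrightarrow> norm \<xi> \<le> L" "\<And>x. H0 x \<le> L * norm x"
    using dual_Lipschitz by metis
  have "isCont dual_grad x" for x
  proof (cases "x = 0")
    case False
    have "isCont H0 x" using dual_continuous[of UNIV] by (simp add: continuous_on_eq_continuous_at)
    then show ?thesis unfolding dual_grad_def[abs_def] by (intro continuous_intros dual_point_continuous False)
  next
    case True
    have "((\<lambda>y. norm (dual_grad y)) \<longlongrightarrow> 0) (at 0)"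
    proof (rule tendsto_sandwich[of "\<lambda>_. 0" _ _ "\<lambda>y. L * norm y * L"])
      show "\<forall>\<^sub>F y in at 0. norm (dual_grad y) \<le> L * norm y * L"
        using L dual_nonneg by (intro always_eventually allI) (auto simp: dual_grad_def dual_point intro!: mult_mono)
      show "((\<lambda>y::'a. L * norm y * L) \<longlongrightarrow> 0) (at 0)"
        by (rule tendsto_eq_intros refl | simp)+
    qed auto
    then have "(dual_grad \<longlongrightarrow> 0) (at 0)" by (rule tendsto_norm_zero_cancel)
    then show ?thesis using True by (simp add: isCont_def dual_grad_def)
  qed
  then show ?thesis by (simp add: continuous_at_imp_continuous_on)
qed

text \<open>The maximiser \<open>dual_point\<close> x is a subgradient of the dual norm at x, and
  the one at y is a subgradient at y. The linearisation error \<rho> is thus trapped between 0 and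
  the pairing of the difference of maximisers with y - x, and continuity of \<open>dual_grad\<close>
  finishes the estimate.\<close>

lemma dual_square_GDERIV: "GDERIV (\<lambda>x. (H0 x)\<^sup>2) x :> 2 *\<^sub>R dual_grad x"
proof -
  obtain L where L: "0 < L" "\<And>x y. \<bar>H0 x - H0 y\<bar> \<le> L * norm (x - y)" "\<And>\<xi>. H \<xi> = 1 \<Longrightarrow> norm \<xi> \<le> L"
    using dual_Lipschitz by metis
  have key: "norm ((H0 y)\<^sup>2 - (H0 x)\<^sup>2 - inner (y - x) (2 *\<^sub>R dual_grad x)) / norm (y - x)
      \<le> 3 * L\<^sup>2 * norm (y - x) + 2 * norm (dual_grad y - dual_grad x)" if "y \<noteq> x" for y
  proof -
    define d where "d = y - x"
    define \<rho> where "\<rho> = H0 y - H0 x - dual_point x \<bullet> d"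
    have r0: "0 \<le> \<rho>" using inner_le_dual[of "dual_point x" y] dual_point[of x]
      by (simp add: \<rho>_def d_def inner_diff_right)
    have "dual_point y \<bullet> x \<le> H0 x" using inner_le_dual[of "dual_point y" x] dual_point[of y] by simp
    then have "\<rho> \<le> (dual_point y - dual_point x) \<bullet> d"
      using dual_point[of y] by (simp add: \<rho>_def d_def inner_diff_right inner_diff_left)
    \<comment> \<open>Multiplying by H0 x first trades differences of \<open>dual_point\<close>,
      which is not controlled near 0, for differences of \<open>dual_grad\<close>, which is
      continuous everywhere.\<close>
    then have "H0 x * \<rho> \<le> H0 x * ((dual_point y - dual_point x) \<bullet> d)" by (intro mult_left_mono dual_nonneg)
    also have "\<dots> = ((dual_grad y - dual_grad x) - (H0 y - H0 x) *\<^sub>R dual_point y) \<bullet> d"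
      by (simp add: dual_grad_def algebra_simps inner_diff_left)
    also have "\<dots> \<le> norm ((dual_grad y - dual_grad x) - (H0 y - H0 x) *\<^sub>R dual_point y) * norm d"
      by (rule norm_cauchy_schwarz)
    also have "\<dots> \<le> (norm (dual_grad y - dual_grad x) + (L * norm d) * L) * norm d"
    proof (intro mult_right_mono norm_ge_zero order_trans[OF norm_triangle_ineq4] add_left_mono)
      show "norm ((H0 y - H0 x) *\<^sub>R dual_point y) \<le> L * norm d * L"
        using L(1) L(2)[of y x] L(3)[OF dual_point(1)[of y]] by (auto simp: d_def intro!: mult_mono)
    qed
    finally have 1: "H0 x * \<rho> \<le> (norm (dual_grad y - dual_grad x) + L\<^sup>2 * norm d) * norm d"
      by (simp add: power2_eq_square mult_ac)
    have 2: "(H0 y - H0 x)\<^sup>2 \<le> L\<^sup>2 * norm d * norm d"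
      using power_mono[OF L(2)[of y x], of 2] by (simp add: d_def power_mult_distrib power2_eq_square mult_ac)
    have "(H0 y)\<^sup>2 - (H0 x)\<^sup>2 - inner d (2 *\<^sub>R dual_grad x) = (H0 y - H0 x)\<^sup>2 + 2 * (H0 x * \<rho>)"
      by (simp add: \<rho>_def dual_grad_def inner_commute power2_eq_square algebra_simps)
    moreover have "0 \<le> H0 x * \<rho>" using r0 dual_nonneg by simp
    ultimately have "norm ((H0 y)\<^sup>2 - (H0 x)\<^sup>2 - inner d (2 *\<^sub>R dual_grad x)) = (H0 y - H0 x)\<^sup>2 + 2 * (H0 x * \<rho>)"
      by simp
    also have "\<dots> \<le> (3 * L\<^sup>2 * norm d + 2 * norm (dual_grad y - dual_grad x)) * norm d"
      using 1 2 by (simp add: algebra_simps)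
    finally show ?thesis using that by (simp add: d_def divide_le_eq)
  qed
  have "((\<lambda>y. norm ((H0 y)\<^sup>2 - (H0 x)\<^sup>2 - inner (y - x) (2 *\<^sub>R dual_grad x)) / norm (y - x)) \<longlongrightarrow> 0) (at x)"
  proof (rule tendsto_sandwich)
    show "\<forall>\<^sub>F y in at x. 0 \<le> norm ((H0 y)\<^sup>2 - (H0 x)\<^sup>2 - inner (y - x) (2 *\<^sub>R dual_grad x)) / norm (y - x)"
      by (intro always_eventually allI) simp
    show "\<forall>\<^sub>F y in at x. norm ((H0 y)\<^sup>2 - (H0 x)\<^sup>2 - inner (y - x) (2 *\<^sub>R dual_grad x)) / norm (y - x)
      \<le> 3 * L\<^sup>2 * norm (y - x) + 2 * norm (dual_grad y - dual_grad x)"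
      unfolding eventually_at_topological using key by (intro exI[of _ UNIV]) auto
    have "(dual_grad \<longlongrightarrow> dual_grad x) (at x)"
      using dual_grad_continuous[of UNIV] by (simp add: continuous_on_eq_continuous_at isCont_def)
    then have "((\<lambda>y. 3 * L\<^sup>2 * norm (y - x) + 2 * norm (dual_grad y - dual_grad x)) \<longlongrightarrow> 3 * L\<^sup>2 * norm (x - x) + 2 * norm (dual_grad x - dual_grad x)) (at x)"
      by (intro tendsto_intros)
    then show "((\<lambda>y. 3 * L\<^sup>2 * norm (y - x) + 2 * norm (dual_grad y - dual_grad x)) \<longlongrightarrow> 0) (at x)" by simp
  qed auto
  moreover have "bounded_linear (\<lambda>h. inner h (2 *\<^sub>R dual_grad x))" by (rule bounded_linear_inner_left)
  ultimately show ?thesis by (simp add: gderiv_def has_derivative_iff_norm)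
qed

end

section \<open>The ground state field\<close>

lemma ennreal_liminf_add: "liminf a + liminf b \<le> liminf (\<lambda>i. a i + b i :: ennreal)"
proof -
  have "liminf a + liminf b = (SUP n. INF m\<in>{n..}. a m) + (SUP n. INF m\<in>{n..}. b m)"
    by (simp add: liminf_SUP_INF)
  also have "\<dots> = (SUP n. (INF m\<in>{n..}. a m) + (INF m\<in>{n..}. b m))"
    by (rule ennreal_SUP_add[symmetric]) (auto intro!: incseq_SucI INF_superset_mono)
  also have "\<dots> \<le> (SUP n. INF m\<in>{n..}. a m + b m)"
    by (intro SUP_mono' INF_greatest add_mono INF_lower) auto
  finally show ?thesis by (simp add: liminf_SUP_INF)
qed

text \<open>Only the sum of the boundary integral and the bulk integral is bounded, so Fatou's lemma
  is applied to both along the same sequence, using superadditivity of the lower limit.\<close>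

lemma fatou_two:
  fixes C :: "nat \<Rightarrow> ennreal"
  assumes "\<And>i. A i \<in> borel_measurable M" "\<And>i. B i \<in> borel_measurable M'"
    and le: "\<And>i. (\<integral>\<^sup>+ x. A i x \<partial>M) + (\<integral>\<^sup>+ y. B i y \<partial>M') \<le> C i"
    and A: "AE x in M. A' x \<le> liminf (\<lambda>i. A i x)" and B: "AE y in M'. B' y \<le> liminf (\<lambda>i. B i y)"
  shows "(\<integral>\<^sup>+ x. A' x \<partial>M) + (\<integral>\<^sup>+ y. B' y \<partial>M') \<le> liminf C"
proof -
  have "(\<integral>\<^sup>+ x. A' x \<partial>M) \<le> (\<integral>\<^sup>+ x. liminf (\<lambda>i. A i x) \<partial>M)" by (rule nn_integral_mono_AE[OF A])
  also have "\<dots> \<le> liminf (\<lambda>i. \<integral>\<^sup>+ x. A i x \<partial>M)" by (rule nn_integral_liminf) (rule assms)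
  finally have 1: "(\<integral>\<^sup>+ x. A' x \<partial>M) \<le> liminf (\<lambda>i. \<integral>\<^sup>+ x. A i x \<partial>M)" .
  have "(\<integral>\<^sup>+ y. B' y \<partial>M') \<le> (\<integral>\<^sup>+ y. liminf (\<lambda>i. B i y) \<partial>M')" by (rule nn_integral_mono_AE[OF B])
  also have "\<dots> \<le> liminf (\<lambda>i. \<integral>\<^sup>+ y. B i y \<partial>M')" by (rule nn_integral_liminf) (rule assms)
  finally have "(\<integral>\<^sup>+ x. A' x \<partial>M) + (\<integral>\<^sup>+ y. B' y \<partial>M') \<le> liminf (\<lambda>i. \<integral>\<^sup>+ x. A i x \<partial>M) + liminf (\<lambda>i. \<integral>\<^sup>+ y. B i y \<partial>M')"
    using 1 by (rule add_mono[rotated])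
  also have "\<dots> \<le> liminf (\<lambda>i. (\<integral>\<^sup>+ x. A i x \<partial>M) + (\<integral>\<^sup>+ y. B i y \<partial>M'))" by (rule ennreal_liminf_add)
  also have "\<dots> \<le> liminf C" by (intro Liminf_mono always_eventually allI le)
  finally show ?thesis .
qed

lemma le_liminf_of_tendsto: "(f \<longlonglongrightarrow> l) \<Longrightarrow> l \<le> liminf f" for f :: "nat \<Rightarrow> ennreal"
  by (simp add: lim_imp_Liminf)

text \<open>The space of x has dimension N - 1 = 2 \<mu> + 1. With \<kappa> = (\<beta> - 2)/2 the
  last assumption is \<kappa> < \<mu>, that is \<beta> < N.\<close>

locale finsler_hardy = finsler H for H :: "'a::euclidean_space \<Rightarrow> real" +
  fixes \<kappa> :: real
  assumes dim: "2 \<le> DIM('a)" and kappa_nonneg: "0 \<le> \<kappa>" and kappa_less: "\<kappa> < (real DIM('a) - 1) / 2"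
begin

definition "\<mu> = (real DIM('a) - 1) / 2"

definition "f = profile (\<mu> + \<kappa>) (\<mu> - \<kappa>) 0"
definition "f1 s = - (2 * \<mu>) * profile (\<mu> + \<kappa>) (\<mu> - \<kappa>) 1 s"
definition "f2 s = 2 * \<mu> * (2 * \<mu> + 2) * profile (\<mu> + \<kappa>) (\<mu> - \<kappa>) 2 s"
text \<open>The logarithmic derivative of the profile and, next, its derivative. They replace the
  linear second-order equation by a first-order Riccati equation, the form in which the profile
  enters the divergence of the field.\<close>

definition "h s = f1 s / f s"
definition "hp s = f2 s / f s - (h s)\<^sup>2"
text \<open>With N = 2 \<mu> + 2 and \<beta> = 2 \<kappa> + 2 these Gamma arguments become those of
  \<open>K_const\<close>.\<close>

definition "K = 2 * (Gamma ((\<mu> + \<kappa> + 1) / 2) * Gamma ((\<mu> - \<kappa> + 1) / 2) / (Gamma ((\<mu> + \<kappa>) / 2) * Gamma ((\<mu> - \<kappa>) / 2)))"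

lemma mu_pos: "0 < \<mu>" "0 < \<mu> + \<kappa>" "0 < \<mu> - \<kappa>"
proof -
  have "2 \<le> real DIM('a)" using dim by simp
  then show "0 < \<mu>" unfolding \<mu>_def by argo
  then show "0 < \<mu> + \<kappa>" using kappa_nonneg by linarith
  show "0 < \<mu> - \<kappa>" using kappa_less by (simp add: \<mu>_def)
qed

lemma dim_mu: "real DIM('a) = 2 * \<mu> + 1" unfolding \<mu>_def by argo

lemma K_pos: "0 < K"
  using mu_pos kappa_nonneg by (auto simp: K_def intro!: mult_pos_pos divide_pos_pos Gamma_real_pos)

lemma f_pos: "-1/2 < s \<Longrightarrow> 0 < f s" using profile_pos[OF mu_pos(2,3)] by (simp add: f_def)

lemma f_DERIV: "-1/2 < s \<Longrightarrow> DERIV f s :> f1 s"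
  using profile_DERIV[OF mu_pos(2,3), of s 0] by (simp add: f_def f1_def)

lemma f1_DERIV: "-1/2 < s \<Longrightarrow> DERIV f1 s :> f2 s"
  unfolding f1_def[abs_def]
  by (rule DERIV_cong[OF DERIV_cmult[OF profile_DERIV[OF mu_pos(2,3)]]]) (simp_all add: f2_def numeral_2_eq_2 algebra_simps)

lemma f2_continuous: "-1/2 < s \<Longrightarrow> isCont f2 s"
  unfolding f2_def[abs_def] by (intro continuous_intros DERIV_isCont[OF profile_DERIV[OF mu_pos(2,3)]])

lemma f1_nonpos: "-1/2 < s \<Longrightarrow> f1 s \<le> 0"
  using profile_nonneg[of s] mu_pos(1) by (simp add: f1_def)

lemma f_antimono: "0 \<le> s \<Longrightarrow> s \<le> t \<Longrightarrow> f t \<le> f s"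
proof -
  assume st: "0 \<le> s" "s \<le> t"
  have "\<exists>y. DERIV f x :> y \<and> y \<le> 0" if "s \<le> x" "x \<le> t" for x
    using f_DERIV[of x] f1_nonpos[of x] st that by auto
  then show "f t \<le> f s" by (rule DERIV_nonpos_imp_nonincreasing[OF st(2)])
qed

lemma h_DERIV: "-1/2 < s \<Longrightarrow> DERIV h s :> hp s"
  unfolding h_def[abs_def] hp_def h_def using f_pos[of s]
  by (auto intro!: derivative_eq_intros f_DERIV f1_DERIV simp: field_simps power2_eq_square)

lemma hp_continuous: "-1/2 < s \<Longrightarrow> isCont hp s"
  unfolding hp_def[abs_def] using f_pos[of s]
  by (intro continuous_intros f2_continuous DERIV_isCont[OF h_DERIV] DERIV_isCont[OF f_DERIV]) auto

lemma h_nonpos: "-1/2 < s \<Longrightarrow> h s \<le> 0"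
  using f_pos[of s] f1_nonpos[of s] by (simp add: h_def divide_nonpos_pos)

text \<open>With the pole at the origin the slope t / R vanishes on the boundary, so this value
  becomes the coefficient of the boundary term.\<close>

lemma h_0: "h 0 = - K"
  using profile_ratio[OF mu_pos(2,3)] f_pos[of 0] by (simp add: h_def f1_def f_def K_def)

lemma riccati:
  assumes "-1/2 < s" shows "(1 - s\<^sup>2) * (hp s + (h s)\<^sup>2) = (2 * \<mu> + 1) * s * h s + (\<mu>\<^sup>2 - \<kappa>\<^sup>2)"
proof -
  have "(1 - s\<^sup>2) * f2 s - (2 * \<mu> + 1) * s * f1 s = (\<mu>\<^sup>2 - \<kappa>\<^sup>2) * f s"
    using profile_ODE[OF mu_pos(2,3) assms] by (simp add: f1_def f2_def f_def power2_eq_square algebra_simps)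
  then have "(1 - s\<^sup>2) * f2 s = (2 * \<mu> + 1) * s * f1 s + (\<mu>\<^sup>2 - \<kappa>\<^sup>2) * f s" by simp
  then have "(1 - s\<^sup>2) * f2 s / f s = ((2 * \<mu> + 1) * s * f1 s + (\<mu>\<^sup>2 - \<kappa>\<^sup>2) * f s) / f s" by simp
  then show ?thesis using f_pos[OF assms] by (simp add: hp_def h_def add_divide_distrib)
qed

section \<open>The field around the shifted pole and its divergence\<close>

definition "Rad e z = sqrt ((H0 (fst z))\<^sup>2 + (snd z + e)\<^sup>2)"
definition "slope e z = (snd z + e) / Rad e z"
text \<open>The field \<open>F = (VA x, VB)\<close> is the Legendre image of \<open>\<nabla>v / v\<close>, where \<open>v = R^(-\<mu>) f((t + e) / R)\<close> and \<open>R\<close> is the dual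
  distance to the pole \<open>(0, -e)\<close>. It satisfies \<open>div F + \<Phi>^0(F)^2 = - \<kappa>^2 / R^2\<close>; for \<open>e > 0\<close> it is smooth enough up to the boundary.\<close>

definition "VA e z = - \<mu> / (Rad e z)\<^sup>2 - h (slope e z) * (snd z + e) / Rad e z ^ 3"
definition "VB e z = - \<mu> * (snd z + e) / (Rad e z)\<^sup>2 + h (slope e z) * ((Rad e z)\<^sup>2 - (snd z + e)\<^sup>2) / Rad e z ^ 3"

lemma Rad_pos: "- e < snd z \<Longrightarrow> 0 < Rad e z"
  unfolding Rad_def by (intro real_sqrt_gt_zero add_nonneg_pos) auto

lemma Rad_nonzero: "- e < snd z \<Longrightarrow> Rad e z \<noteq> 0"
  using Rad_pos[of e z] by simp

lemma Rad_square: "(Rad e z)\<^sup>2 = (H0 (fst z))\<^sup>2 + (snd z + e)\<^sup>2"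
  by (simp add: Rad_def)

lemma slope_bounds: "- e < snd z \<Longrightarrow> 0 < slope e z" "slope e z \<le> 1"
proof -
  show "- e < snd z \<Longrightarrow> 0 < slope e z" using Rad_pos[of e z] by (simp add: slope_def)
  have "\<bar>snd z + e\<bar> \<le> Rad e z" unfolding Rad_def by (rule real_le_rsqrt) simp
  then show "slope e z \<le> 1" by (auto simp: slope_def divide_le_eq_1)
qed

definition "gradR e z = (1 / Rad e z) *\<^sub>R (dual_grad (fst z), snd z + e)"

lemma Rad_GDERIV:
  assumes "- e < snd z" shows "GDERIV (Rad e) z :> gradR e z"
proof -
  have "((\<lambda>z. (H0 (fst z))\<^sup>2) has_derivative (\<lambda>v. inner (fst v) (2 *\<^sub>R dual_grad (fst z)))) (at z)"
    by (rule has_derivative_compose[OF has_derivative_fst[OF has_derivative_ident] dual_square_GDERIV[unfolded gderiv_def]])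
  then have 1: "GDERIV (\<lambda>z. (H0 (fst z))\<^sup>2) z :> (2 *\<^sub>R dual_grad (fst z), 0)"
    unfolding gderiv_def by (rule has_derivative_eq_rhs) (auto simp: inner_prod_def)
  have "((\<lambda>z. (snd z + e)\<^sup>2) has_derivative (\<lambda>v. 2 * (snd z + e) * snd v)) (at z)"
    by (auto intro!: derivative_eq_intros)
  then have 2: "GDERIV (\<lambda>z. (snd z + e)\<^sup>2) z :> (0, 2 * (snd z + e))"
    unfolding gderiv_def by (rule has_derivative_eq_rhs) (auto simp: inner_prod_def)
  have p: "0 < (H0 (fst z))\<^sup>2 + (snd z + e)\<^sup>2" using Rad_pos[OF assms] by (simp add: Rad_def)
  from GDERIV_DERIV_compose[OF GDERIV_add[OF 1 2] DERIV_real_sqrt[OF p]]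
  have "GDERIV (Rad e) z :> (inverse (sqrt ((H0 (fst z))\<^sup>2 + (snd z + e)\<^sup>2)) / 2) *\<^sub>R ((2 *\<^sub>R dual_grad (fst z), 0) + (0, 2 * (snd z + e)))"
    by (simp add: Rad_def[abs_def])
  then show ?thesis
    unfolding Rad_def[symmetric] by (rule GDERIV_subst) (simp add: gradR_def Rad_nonzero[OF assms] field_simps)
qed

lemma Rad_continuous: "continuous_on S (Rad e)"
proof -
  have "continuous_on S (\<lambda>z. H0 (fst z))"
    by (rule continuous_on_compose2[OF dual_continuous[of UNIV] continuous_on_fst[OF continuous_on_id]]) simp
  then show ?thesis unfolding Rad_def by (intro continuous_intros)
qed

lemma slope_continuous: "continuous_on {z. - e < snd z} (slope e)"
  unfolding slope_def by (intro continuous_intros Rad_continuous) (simp add: Rad_nonzero)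

lemma gradR_continuous: "continuous_on {z. - e < snd z} (gradR e)"
proof -
  have "continuous_on {z. - e < snd z} (\<lambda>z. dual_grad (fst z))"
    by (rule continuous_on_compose2[OF dual_grad_continuous[of UNIV] continuous_on_fst[OF continuous_on_id]]) simp
  then show ?thesis unfolding gradR_def
    by (intro continuous_on_scaleR continuous_on_divide continuous_on_const Rad_continuous continuous_on_Pair
        continuous_on_add continuous_on_snd continuous_on_id) (simp_all add: Rad_nonzero)
qed

lemma slope_comp_continuous:
  assumes "\<And>s. -1/2 < s \<Longrightarrow> isCont \<phi> s"
  shows "continuous_on {z. - e < snd z} (\<lambda>z. \<phi> (slope e z))"
proof (rule continuous_on_compose2[of "{-1/2<..}" \<phi>, OF _ slope_continuous])
  show "continuous_on {-1/2<..} \<phi>" using assms by (simp add: continuous_at_imp_continuous_on)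
  show "slope e ` {z. - e < snd z} \<subseteq> {- 1 / 2<..}"
  proof (rule image_subsetI)
    show "slope e z \<in> {- 1 / 2<..}" if "z \<in> {z. - e < snd z}" for z
      using slope_bounds(1)[of e z] that by simp
  qed
qed

text \<open>The coefficients of the field depend on the point only through R and T = t + e. This
  chain rule moves all their calculus to two real variables and confines the norm to
  \<open>gradR\<close>.\<close>

lemma two_variable_GDERIV:
  fixes G :: "real \<times> real \<Rightarrow> real"
  assumes "- e < snd z" "(G has_derivative (\<lambda>(r, t). Gr * r + Gt * t)) (at (Rad e z, snd z + e))"
  shows "GDERIV (\<lambda>z. G (Rad e z, snd z + e)) z :> Gr *\<^sub>R gradR e z + Gt *\<^sub>R (0, 1)"
proof -
  have "((\<lambda>z. (Rad e z, snd z + e)) has_derivative (\<lambda>v. (inner v (gradR e z), snd v))) (at z)"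
    using Rad_GDERIV[OF assms(1)] by (auto simp: gderiv_def intro!: derivative_eq_intros)
  from has_derivative_compose[OF this assms(2)] show ?thesis
    unfolding gderiv_def by (rule has_derivative_eq_rhs)
      (rule ext, simp add: inner_add_right, simp add: inner_prod_def)
qed

text \<open>Partial derivatives, in R and in T, of the coefficients \<open>VA\<close> and
  \<open>VB\<close> written as functions of R and T = t + e.\<close>

definition "VAr R T = 2 * \<mu> / R ^ 3 + hp (T / R) * T\<^sup>2 / R ^ 5 + 3 * h (T / R) * T / R ^ 4"
definition "VAt R T = - hp (T / R) * T / R ^ 4 - h (T / R) / R ^ 3"
definition "VBr R T = 2 * \<mu> * T / R ^ 3 - hp (T / R) * T * (R\<^sup>2 - T\<^sup>2) / R ^ 5 + h (T / R) * (3 * T\<^sup>2 / R ^ 4 - 1 / R\<^sup>2)"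
definition "VBt R T = - \<mu> / R\<^sup>2 + hp (T / R) * (R\<^sup>2 - T\<^sup>2) / R ^ 4 - 2 * h (T / R) * T / R ^ 3"

lemma slope_comp_derivative:
  assumes "0 < R" "0 < T"
  shows "((\<lambda>p. h (snd p / fst p)) has_derivative (\<lambda>(r, t). hp (T / R) * (t / R - T * r / R\<^sup>2))) (at (R, T))"
proof -
  have "((\<lambda>p. snd p / fst p) has_derivative (\<lambda>(r, t). t / R - T * r / R\<^sup>2)) (at (R, T))"
    using assms by (auto intro!: derivative_eq_intros simp: fun_eq_iff field_simps power2_eq_square)
  moreover have "(h has_derivative (\<lambda>v. hp (T / R) * v)) (at (snd (R, T) / fst (R, T)))"
    using h_DERIV[of "T / R"] assms by (simp add: has_field_derivative_def divide_pos_pos less_trans[of _ 0])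
  ultimately show ?thesis by (rule has_derivative_eq_rhs[OF has_derivative_compose]) auto
qed

lemma VA_GDERIV:
  assumes "- e < snd z"
  shows "GDERIV (VA e) z :> VAr (Rad e z) (snd z + e) *\<^sub>R gradR e z + VAt (Rad e z) (snd z + e) *\<^sub>R (0, 1)"
proof -
  define R T where "R = Rad e z" and "T = snd z + e"
  have p: "0 < R" "0 < T" using assms Rad_pos[OF assms] by (auto simp: R_def T_def)
  have "((\<lambda>p. - \<mu> / (fst p)\<^sup>2 - h (snd p / fst p) * snd p / fst p ^ 3) has_derivative (\<lambda>(r, t). VAr R T * r + VAt R T * t)) (at (R, T))"
    using p by (auto intro!: derivative_eq_intros slope_comp_derivative)
      (simp add: VAr_def VAt_def fun_eq_iff field_simps power2_eq_square power3_eq_cube eval_nat_numeral)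
  from two_variable_GDERIV[OF assms this[unfolded R_def T_def]]
  show ?thesis by (simp add: VA_def[abs_def] slope_def R_def T_def)
qed

lemma VB_GDERIV:
  assumes "- e < snd z"
  shows "GDERIV (VB e) z :> VBr (Rad e z) (snd z + e) *\<^sub>R gradR e z + VBt (Rad e z) (snd z + e) *\<^sub>R (0, 1)"
proof -
  define R T where "R = Rad e z" and "T = snd z + e"
  have p: "0 < R" "0 < T" using assms Rad_pos[OF assms] by (auto simp: R_def T_def)
  have "((\<lambda>p. - \<mu> * snd p / (fst p)\<^sup>2 + h (snd p / fst p) * ((fst p)\<^sup>2 - (snd p)\<^sup>2) / fst p ^ 3) has_derivative (\<lambda>(r, t). VBr R T * r + VBt R T * t)) (at (R, T))"
    using p by (auto intro!: derivative_eq_intros slope_comp_derivative)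
      (simp add: VBr_def VBt_def fun_eq_iff field_simps power2_eq_square power3_eq_cube eval_nat_numeral)
  from two_variable_GDERIV[OF assms this[unfolded R_def T_def]]
  show ?thesis by (simp add: VB_def[abs_def] slope_def R_def T_def)
qed

lemma V_grad_continuous:
  "continuous_on {z. - e < snd z} (\<lambda>z. VAr (Rad e z) (snd z + e) *\<^sub>R gradR e z + VAt (Rad e z) (snd z + e) *\<^sub>R (0, 1))"
  "continuous_on {z. - e < snd z} (\<lambda>z. VBr (Rad e z) (snd z + e) *\<^sub>R gradR e z + VBt (Rad e z) (snd z + e) *\<^sub>R (0, 1))"
  unfolding VAr_def VAt_def VBr_def VBt_def slope_def[symmetric]
  by (intro continuous_intros Rad_continuous gradR_continuous slope_comp_continuous hp_continuous DERIV_isCont[OF h_DERIV];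
      simp add: Rad_nonzero)+

text \<open>The horizontal part of grad R pairs with x to (R^2 - T^2)/R, its vertical part is T/R,
  and 2 \<mu> + 1 is the divergence of x. Hence the left side is div F plus the squared dual length
  of F. Setting T = s R makes every term scale like R^(-2), and what is left is the Riccati
  equation.\<close>

lemma divergence_identity:
  assumes "0 < R" "0 < T"
  defines "A \<equiv> - \<mu> / R\<^sup>2 - h (T / R) * T / R ^ 3" and "B \<equiv> - \<mu> * T / R\<^sup>2 + h (T / R) * (R\<^sup>2 - T\<^sup>2) / R ^ 3"
  shows "(2 * \<mu> + 1) * A + VAr R T * ((R\<^sup>2 - T\<^sup>2) / R) + VBr R T * (T / R) + VBt R T
    + A\<^sup>2 * (R\<^sup>2 - T\<^sup>2) + B\<^sup>2 = - \<kappa>\<^sup>2 / R\<^sup>2"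
proof -
  define s where "s = T / R"
  have T: "T = s * R" using assms by (simp add: s_def)
  have ri: "(1 - s\<^sup>2) * (hp s + (h s)\<^sup>2) = (2 * \<mu> + 1) * s * h s + (\<mu>\<^sup>2 - \<kappa>\<^sup>2)"
    using assms by (intro riccati) (simp add: s_def divide_pos_pos less_trans[of _ 0])
  have e: "A = (- \<mu> - h s * s) / R\<^sup>2" "B = (- \<mu> * s + h s * (1 - s\<^sup>2)) / R"
    "VAr R T * ((R\<^sup>2 - T\<^sup>2) / R) = (2 * \<mu> + hp s * s\<^sup>2 + 3 * h s * s) * (1 - s\<^sup>2) / R\<^sup>2"
    "VBr R T * (T / R) = (2 * \<mu> * s - hp s * s * (1 - s\<^sup>2) + h s * (3 * s\<^sup>2 - 1)) * s / R\<^sup>2"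
    "VBt R T = (- \<mu> + hp s * (1 - s\<^sup>2) - 2 * h s * s) / R\<^sup>2"
    "R\<^sup>2 - T\<^sup>2 = (1 - s\<^sup>2) * R\<^sup>2"
    using assms(1) unfolding A_def B_def VAr_def VBr_def VBt_def s_def[symmetric] unfolding T
    by (simp_all add: field_simps power2_eq_square power3_eq_cube eval_nat_numeral)
  have "(2 * \<mu> + 1) * (- \<mu> - h s * s) + (2 * \<mu> + hp s * s\<^sup>2 + 3 * h s * s) * (1 - s\<^sup>2)
    + (2 * \<mu> * s - hp s * s * (1 - s\<^sup>2) + h s * (3 * s\<^sup>2 - 1)) * s + (- \<mu> + hp s * (1 - s\<^sup>2) - 2 * h s * s)
    + (- \<mu> - h s * s)\<^sup>2 * (1 - s\<^sup>2) + (- \<mu> * s + h s * (1 - s\<^sup>2))\<^sup>2 = - \<kappa>\<^sup>2"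
    using ri by algebra
  then have "((2 * \<mu> + 1) * (- \<mu> - h s * s) + (2 * \<mu> + hp s * s\<^sup>2 + 3 * h s * s) * (1 - s\<^sup>2)
    + (2 * \<mu> * s - hp s * s * (1 - s\<^sup>2) + h s * (3 * s\<^sup>2 - 1)) * s + (- \<mu> + hp s * (1 - s\<^sup>2) - 2 * h s * s)
    + (- \<mu> - h s * s)\<^sup>2 * (1 - s\<^sup>2) + (- \<mu> * s + h s * (1 - s\<^sup>2))\<^sup>2) / R\<^sup>2 = - \<kappa>\<^sup>2 / R\<^sup>2" by simp
  moreover have "A\<^sup>2 * (R\<^sup>2 - T\<^sup>2) = (- \<mu> - h s * s)\<^sup>2 * (1 - s\<^sup>2) / R\<^sup>2" "B\<^sup>2 = (- \<mu> * s + h s * (1 - s\<^sup>2))\<^sup>2 / R\<^sup>2"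
    using assms(1) unfolding e(1,2,6) by (simp_all add: power_divide power2_eq_square)
  moreover have "(2 * \<mu> + 1) * A = (2 * \<mu> + 1) * (- \<mu> - h s * s) / R\<^sup>2" by (simp add: e(1))
  ultimately show ?thesis unfolding e(3,4,5) by (simp only: add_divide_distrib)
qed

lemma VA_continuous: "continuous_on {z. - e < snd z} (VA e)"
  unfolding VA_def
  by (intro continuous_intros Rad_continuous slope_comp_continuous DERIV_isCont[OF h_DERIV]; simp add: Rad_nonzero)

lemma VB_continuous: "continuous_on {z. - e < snd z} (VB e)"
  unfolding VB_def
  by (intro continuous_intros Rad_continuous slope_comp_continuous DERIV_isCont[OF h_DERIV]; simp add: Rad_nonzero)

text \<open>The divergence theorem for u^2 F: the divergence is replaced by means of
  \<open>divergence_identity\<close>, and the only boundary contribution is the normal component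
  \<open>VB\<close> at t = 0.\<close>

lemma field_identity:
  assumes u: "C1c e u g" and e: "0 < e"
  shows "(LINT z:half_space|lborel. 2 * u z * (VA e z * (fst z \<bullet> fst (g z)) + VB e z * snd (g z)))
    = (LINT z:half_space|lborel. (u z)\<^sup>2 * (\<kappa>\<^sup>2 / (Rad e z)\<^sup>2 + (VA e z)\<^sup>2 * (H0 (fst z))\<^sup>2 + (VB e z)\<^sup>2))
      + (LINT x|lborel. - VB e (x, 0) * (u (x, 0))\<^sup>2)"
proof -
  obtain \<rho> where \<rho>: "\<And>z. \<rho> < norm z \<Longrightarrow> u z = 0" "\<And>z. \<rho> < norm z \<Longrightarrow> - e < snd z \<Longrightarrow> g z = 0"
    using C1c_radius[OF u] by metis
  have uc: "continuous_on {z. - e < snd z} u" by (rule C1c_continuous[OF u])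
  have gc: "continuous_on {z. - e < snd z} g" using u by (simp add: C1c_def)
  note int = upper_integrable(1)[OF _ e, of _ \<rho>]
  define v where "v z = u z * u z" for z
  define dv where "dv z = u z *\<^sub>R g z + u z *\<^sub>R g z" for z
  have v: "C1c e v dv" unfolding v_def[abs_def] dv_def[abs_def] by (rule C1c_mult[OF u C1c_GDERIV[OF u] gc])
  define gA where "gA z = VAr (Rad e z) (snd z + e) *\<^sub>R gradR e z + VAt (Rad e z) (snd z + e) *\<^sub>R (0, 1)" for z :: "'a \<times> real"
  define gB where "gB z = VBr (Rad e z) (snd z + e) *\<^sub>R gradR e z + VBt (Rad e z) (snd z + e) *\<^sub>R (0, 1)" for z :: "'a \<times> real"
  define GA where "GA z = v z *\<^sub>R gA z + VA e z *\<^sub>R dv z" for z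
  define GB where "GB z = v z *\<^sub>R gB z + VB e z *\<^sub>R dv z" for z
  have gAc: "continuous_on {z. - e < snd z} gA" and gBc: "continuous_on {z. - e < snd z} gB"
    unfolding gA_def[abs_def] gB_def[abs_def] by (rule V_grad_continuous)+
  have A: "C1c e (\<lambda>z. v z * VA e z) GA"
    unfolding GA_def[abs_def] by (rule C1c_mult[OF v VA_GDERIV[of e, folded gA_def] gAc])
  have B: "C1c e (\<lambda>z. v z * VB e z) GB"
    unfolding GB_def[abs_def] by (rule C1c_mult[OF v VB_GDERIV[of e, folded gB_def] gBc])
  have vc: "continuous_on {z. - e < snd z} v" by (rule C1c_continuous[OF v])
  have dvc: "continuous_on {z. - e < snd z} dv" using v by (simp add: C1c_def)
  have GAc: "continuous_on {z. - e < snd z} GA" using A by (simp add: C1c_def)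
  have GBc: "continuous_on {z. - e < snd z} GB" using B by (simp add: C1c_def)
  have z0: "v z = 0" "dv z = 0" "GA z = 0" "GB z = 0" if "\<rho> < norm z" "- e < snd z" for z
    using that \<rho> by (simp_all add: v_def dv_def GA_def GB_def)
  let ?I1 = "\<lambda>z. real DIM('a) * (v z * VA e z) + fst z \<bullet> fst (GA z)"
  have i1: "set_integrable lborel half_space ?I1"
    by (rule int) (use z0 in \<open>auto intro!: continuous_intros vc VA_continuous GAc\<close>)
  have i2: "set_integrable lborel half_space (\<lambda>z. snd (GB z))"
    by (rule int) (use z0 in \<open>auto intro!: continuous_intros GBc\<close>)
  have 1: "(LINT z:half_space|lborel. ?I1 z) = 0"
  proof -
    \<comment> \<open>\<open>?b b\<close> is the derivative of v VA (x . b) in the direction b. Its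
      integral vanishes by horizontal translation, and the sum over the basis is the horizontal
      divergence of v F.\<close>
    let ?b = "\<lambda>b z. v z * VA e z + (fst z \<bullet> b) * (fst (GA z) \<bullet> b)"
    have ib: "set_integrable lborel half_space (?b b)" for b
      by (rule int) (use z0 in \<open>auto intro!: continuous_intros vc VA_continuous GAc\<close>)
    have b0: "(LINT z:half_space|lborel. ?b b z) = 0" if "b \<in> Basis" for b
    proof -
      have D: "GDERIV (\<lambda>z. fst z \<bullet> b) z :> (b, 0)" for z :: "'a \<times> real"
        unfolding gderiv_def
        by (rule has_derivative_eq_rhs[OF has_derivative_inner_left[OF has_derivative_fst[OF has_derivative_ident]]])
          (simp add: inner_prod_def)
      have "C1c e (\<lambda>z. (v z * VA e z) * (fst z \<bullet> b)) (\<lambda>z. (v z * VA e z) *\<^sub>R (b, 0) + (fst z \<bullet> b) *\<^sub>R GA z)"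
        by (rule C1c_mult[OF A D]) (rule continuous_on_const)
      from integral_tangential[OF this e, of b] show ?thesis
        using that by (simp add: inner_add_left inner_Basis)
    qed
    have "?I1 = (\<lambda>z. \<Sum>b\<in>Basis. ?b b z)"
      by (rule ext, subst euclidean_inner) (simp add: sum.distrib)
    then have "(LINT z:half_space|lborel. ?I1 z) = (LINT z|lborel. (\<Sum>b\<in>Basis. indicator half_space z *\<^sub>R ?b b z))"
      by (simp only: set_lebesgue_integral_def scaleR_sum_right)
    also have "\<dots> = (\<Sum>b\<in>Basis. (LINT z|lborel. indicator half_space z *\<^sub>R ?b b z))"
      using ib unfolding set_integrable_def by (intro Bochner_Integration.integral_sum)
    also have "\<dots> = 0" using b0 by (simp add: set_lebesgue_integral_def)
    finally show ?thesis .
  qed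
  have 2: "(LINT z:half_space|lborel. snd (GB z)) = - (LINT x|lborel. v (x, 0) * VB e (x, 0))"
    by (rule integral_normal[OF B e])
  let ?Q = "\<lambda>z. (u z)\<^sup>2 * (\<kappa>\<^sup>2 / (Rad e z)\<^sup>2 + (VA e z)\<^sup>2 * (H0 (fst z))\<^sup>2 + (VB e z)\<^sup>2)"
  have iQ: "set_integrable lborel half_space ?Q"
  proof (rule int)
    have "continuous_on {z. - e < snd z} (\<lambda>z. H0 (fst z))"
      by (rule continuous_on_compose2[OF dual_continuous[of UNIV] continuous_on_fst[OF continuous_on_id]]) simp
    then show "continuous_on {z. - e < snd z} ?Q"
      by (intro continuous_intros uc VA_continuous VB_continuous Rad_continuous) (auto simp: Rad_nonzero)
  qed (use \<rho> in auto)
  have pw: "2 * u z * (VA e z * (fst z \<bullet> fst (g z)) + VB e z * snd (g z)) = ?I1 z + snd (GB z) + ?Q z"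
    if "z \<in> half_space" for z
  proof -
    have sz: "- e < snd z" using that e by (simp add: half_space_def)
    define R T where "R = Rad e z" and "T = snd z + e"
    have p: "0 < R" "0 < T" using sz Rad_pos[OF sz] by (auto simp: R_def T_def)
    have r2: "(H0 (fst z))\<^sup>2 = R\<^sup>2 - T\<^sup>2" by (simp add: R_def T_def Rad_square)
    have gr: "fst z \<bullet> fst (gradR e z) = (R\<^sup>2 - T\<^sup>2) / R" "snd (gradR e z) = T / R"
      using dual_grad_inner[of "fst z"] by (simp_all add: gradR_def r2 R_def[symmetric] T_def[symmetric] inner_commute)
    have ga: "fst z \<bullet> fst (gA z) = VAr R T * ((R\<^sup>2 - T\<^sup>2) / R)"
      by (simp add: gA_def inner_add_right gr R_def[symmetric] T_def[symmetric])
    have gb: "snd (gB z) = VBr R T * (T / R) + VBt R T"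
      by (simp add: gB_def gr R_def[symmetric] T_def[symmetric])
    have VAB: "VA e z = - \<mu> / R\<^sup>2 - h (T / R) * T / R ^ 3" "VB e z = - \<mu> * T / R\<^sup>2 + h (T / R) * (R\<^sup>2 - T\<^sup>2) / R ^ 3"
      by (simp_all add: VA_def VB_def slope_def R_def T_def)
    have div: "real DIM('a) * VA e z + VAr R T * ((R\<^sup>2 - T\<^sup>2) / R) + VBr R T * (T / R) + VBt R T
        + (VA e z)\<^sup>2 * (R\<^sup>2 - T\<^sup>2) + (VB e z)\<^sup>2 = - \<kappa>\<^sup>2 / R\<^sup>2"
      using divergence_identity[OF p] by (simp only: VAB dim_mu)
    have "?I1 z + snd (GB z) = v z * (real DIM('a) * VA e z + fst z \<bullet> fst (gA z) + snd (gB z))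
        + 2 * u z * (VA e z * (fst z \<bullet> fst (g z)) + VB e z * snd (g z))"
      by (simp add: GA_def GB_def dv_def inner_add_right algebra_simps)
    also have "real DIM('a) * VA e z + fst z \<bullet> fst (gA z) + snd (gB z)
        = - (\<kappa>\<^sup>2 / (Rad e z)\<^sup>2 + (VA e z)\<^sup>2 * (H0 (fst z))\<^sup>2 + (VB e z)\<^sup>2)"
      using div unfolding ga gb r2 R_def[symmetric] by simp
    finally have *: "?I1 z + snd (GB z) = v z * - (\<kappa>\<^sup>2 / (Rad e z)\<^sup>2 + (VA e z)\<^sup>2 * (H0 (fst z))\<^sup>2 + (VB e z)\<^sup>2)
        + 2 * u z * (VA e z * (fst z \<bullet> fst (g z)) + VB e z * snd (g z))" .
    show ?thesis unfolding * by (simp add: v_def power2_eq_square algebra_simps)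
  qed
  have "(LINT z:half_space|lborel. 2 * u z * (VA e z * (fst z \<bullet> fst (g z)) + VB e z * snd (g z)))
      = (LINT z:half_space|lborel. ?I1 z + snd (GB z) + ?Q z)"
    by (rule set_lebesgue_integral_cong) (use pw in \<open>auto simp: half_space_borel\<close>)
  also have "\<dots> = (LINT z:half_space|lborel. ?I1 z) + (LINT z:half_space|lborel. snd (GB z)) + (LINT z:half_space|lborel. ?Q z)"
    using set_integral_add[OF set_integral_add(1)[OF i1 i2] iQ] set_integral_add(2)[OF i1 i2] by simp
  finally show ?thesis unfolding 1 2 by (simp add: v_def power2_eq_square mult_ac)
qed

lemma Phi_sq: "(Phi H p)\<^sup>2 = (H (fst p))\<^sup>2 + (snd p)\<^sup>2"
  by (simp add: Phi_def case_prod_beta)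

lemma Phi_dual_sq: "(Phi H0 z)\<^sup>2 = (H0 (fst z))\<^sup>2 + (snd z)\<^sup>2"
  by (simp add: Phi_def case_prod_beta)

lemma Phi_sq_continuous: "continuous_on S g \<Longrightarrow> continuous_on S (\<lambda>z. (Phi H (g z))\<^sup>2)"
  unfolding Phi_sq by (intro continuous_intros continuous_on_compose2[OF H_cont]) auto

lemma C1c_shifted_inequality:
  assumes u: "C1c e u g" and e: "0 < e"
  shows "(LINT z:half_space|lborel. (u z)\<^sup>2 * (\<kappa>\<^sup>2 / (Rad e z)\<^sup>2)) + (LINT x|lborel. - VB e (x, 0) * (u (x, 0))\<^sup>2)
    \<le> (LINT z:half_space|lborel. (Phi H (g z))\<^sup>2)"
proof -
  obtain \<rho> where \<rho>: "\<And>z. \<rho> < norm z \<Longrightarrow> u z = 0" "\<And>z. \<rho> < norm z \<Longrightarrow> - e < snd z \<Longrightarrow> g z = 0"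
    using C1c_radius[OF u] by metis
  have uc: "continuous_on {z. - e < snd z} u" by (rule C1c_continuous[OF u])
  have gc: "continuous_on {z. - e < snd z} g" using u by (simp add: C1c_def)
  have Hc: "continuous_on {z. - e < snd z} (\<lambda>z. H0 (fst z))"
    by (rule continuous_on_compose2[OF dual_continuous[of UNIV] continuous_on_fst[OF continuous_on_id]]) simp
  note int = upper_integrable(1)[OF _ e, of _ \<rho>]
  let ?P = "\<lambda>z. (u z)\<^sup>2 * (\<kappa>\<^sup>2 / (Rad e z)\<^sup>2)" and ?W = "\<lambda>z. (u z)\<^sup>2 * ((VA e z)\<^sup>2 * (H0 (fst z))\<^sup>2 + (VB e z)\<^sup>2)"
    and ?F = "\<lambda>z. 2 * u z * (VA e z * (fst z \<bullet> fst (g z)) + VB e z * snd (g z))"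
  have iP: "set_integrable lborel half_space ?P"
    by (rule int) (use \<rho> in \<open>auto intro!: continuous_intros uc Rad_continuous simp: Rad_nonzero\<close>)
  have iW: "set_integrable lborel half_space ?W"
    by (rule int) (use \<rho> in \<open>auto intro!: continuous_intros uc VA_continuous VB_continuous Hc\<close>)
  have iF: "set_integrable lborel half_space ?F"
    by (rule int) (use \<rho> in \<open>auto intro!: continuous_intros uc gc VA_continuous VB_continuous\<close>)
  have iH: "set_integrable lborel half_space (\<lambda>z. (Phi H (g z))\<^sup>2)"
    by (rule int[OF Phi_sq_continuous[OF gc]]) (use \<rho> in \<open>auto simp: Phi_sq\<close>)
  have "?F z - ?W z \<le> (Phi H (g z))\<^sup>2" for z
  proof -
    \<comment> \<open>The dual norm of the horizontal part of u F. Young's inequality is applied to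
      the horizontal and the vertical component separately, which matches the Pythagorean form of
      \<Phi>.\<close>
    define y where "y = \<bar>u z * VA e z\<bar> * H0 (fst z)"
    have "2 * u z * VA e z * (fst z \<bullet> fst (g z)) \<le> 2 * \<bar>u z * VA e z\<bar> * \<bar>fst z \<bullet> fst (g z)\<bar>"
      using abs_ge_self[of "u z * VA e z * (fst z \<bullet> fst (g z))"] by (simp add: abs_mult)
    also have "\<dots> \<le> 2 * \<bar>u z * VA e z\<bar> * (H (fst (g z)) * H0 (fst z))"
      using abs_inner_le_dual[of "fst (g z)" "fst z"] by (intro mult_left_mono) (auto simp: inner_commute)
    also have "\<dots> = 2 * y * H (fst (g z))" by (simp add: y_def)
    also have "\<dots> \<le> y\<^sup>2 + (H (fst (g z)))\<^sup>2" by (rule sum_squares_bound)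
    finally have "2 * u z * VA e z * (fst z \<bullet> fst (g z)) \<le> (u z)\<^sup>2 * (VA e z)\<^sup>2 * (H0 (fst z))\<^sup>2 + (H (fst (g z)))\<^sup>2"
      by (simp add: y_def power_mult_distrib)
    moreover have "2 * (u z * VB e z) * snd (g z) \<le> (u z * VB e z)\<^sup>2 + (snd (g z))\<^sup>2" by (rule sum_squares_bound)
    ultimately show ?thesis by (simp add: Phi_sq algebra_simps power_mult_distrib)
  qed
  then have "(LINT z:half_space|lborel. ?F z - ?W z) \<le> (LINT z:half_space|lborel. (Phi H (g z))\<^sup>2)"
    by (intro set_integral_mono set_integral_diff iF iW iH)
  moreover have "(LINT z:half_space|lborel. (u z)\<^sup>2 * (\<kappa>\<^sup>2 / (Rad e z)\<^sup>2 + (VA e z)\<^sup>2 * (H0 (fst z))\<^sup>2 + (VB e z)\<^sup>2))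
      = (LINT z:half_space|lborel. ?P z) + (LINT z:half_space|lborel. ?W z)"
    unfolding set_integral_add(2)[OF iP iW, symmetric] by (simp only: distrib_left add.assoc)
  ultimately show ?thesis
    using field_identity[OF u e] set_integral_diff(2)[OF iF iW] by simp
qed

text \<open>Both terms of \<open>VB\<close> are nonpositive at t = 0 because the profile is
  decreasing. The sign is what Fatou's lemma requires of the boundary integrand.\<close>

lemma VB_boundary_nonneg: assumes "0 < e" shows "0 \<le> - VB e (x, 0)"
proof -
  have p: "0 < Rad e (x, 0)" using assms by (intro Rad_pos) simp
  have "- (1/2) < slope e (x, 0)" using slope_bounds(1)[of e "(x, 0)"] assms by simp
  then have "h (slope e (x, 0)) \<le> 0" using h_nonpos by simp
  moreover have "0 \<le> (Rad e (x, 0))\<^sup>2 - e\<^sup>2" by (simp add: Rad_square)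
  ultimately have "h (slope e (x, 0)) * ((Rad e (x, 0))\<^sup>2 - e\<^sup>2) / Rad e (x, 0) ^ 3 \<le> 0"
    using p by (intro divide_nonpos_pos mult_nonpos_nonneg) auto
  moreover have "0 \<le> \<mu> * e / (Rad e (x, 0))\<^sup>2" using mu_pos(1) assms by simp
  ultimately show ?thesis by (simp add: VB_def)
qed

text \<open>Extended nonnegative integrals are used so that finiteness of the two singular integrals
  is part of the conclusion.\<close>

lemma test_inequality:
  assumes u: "test_function UNIV u"
  shows "(\<integral>\<^sup>+ x. ennreal (K * ((u (x, 0))\<^sup>2 / H0 x)) \<partial>lborel)
      + (\<integral>\<^sup>+ z. ennreal (indicator half_space z * (\<kappa>\<^sup>2 * ((u z)\<^sup>2 / (Phi H0 z)\<^sup>2))) \<partial>lborel)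
    \<le> ennreal (LINT z:half_space|lborel. (Phi H (grad u z))\<^sup>2)"
proof -
  define e where "e i = inverse (real (Suc i))" for i
  have e: "0 < e i" for i by (simp add: e_def)
  have elim: "e \<longlonglongrightarrow> 0" unfolding e_def by (rule LIMSEQ_inverse_real_of_nat)
  have u1: "C1c (e i) u (grad u)" for i by (rule test_function_C1c[OF u])
  obtain \<rho> where \<rho>: "\<And>z. \<rho> < norm z \<Longrightarrow> u z = 0" using C1c_radius[OF u1[of 0]] by metis
  have uc: "continuous_on S u" for S by (rule smooth_continuous[OF test_function_smooth[OF u]])
  let ?A = "\<lambda>i x. - VB (e i) (x, 0) * (u (x, 0))\<^sup>2" and ?B = "\<lambda>i z. (u z)\<^sup>2 * (\<kappa>\<^sup>2 / (Rad (e i) z)\<^sup>2)"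
  have Bc: "continuous_on {z. - e i < snd z} (?B i)" for i
    by (intro continuous_intros uc Rad_continuous) (auto simp: Rad_nonzero)
  have iB: "set_integrable lborel half_space (?B i)" for i
    by (rule upper_integrable(1)[OF Bc e, of \<rho>]) (use \<rho> in auto)
  have Ac: "continuous_on {z. - e i < snd z} (\<lambda>z. - VB (e i) z * (u z)\<^sup>2)" for i
    by (intro continuous_intros uc VB_continuous)
  have iA: "integrable lborel (?A i)" for i
    by (rule upper_integrable(2)[OF Ac e, of \<rho>]) (use \<rho> in auto)
  have A0: "0 \<le> ?A i x" for i x by (intro mult_nonneg_nonneg VB_boundary_nonneg e) simp
  have "(\<integral>\<^sup>+ x. ennreal (?A i x) \<partial>lborel) + (\<integral>\<^sup>+ z. ennreal (indicator half_space z * ?B i z) \<partial>lborel)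
    \<le> ennreal (LINT z:half_space|lborel. (Phi H (grad u z))\<^sup>2)" for i
  proof -
    have "(\<integral>\<^sup>+ x. ennreal (?A i x) \<partial>lborel) = ennreal (LINT x|lborel. ?A i x)"
      by (rule nn_integral_eq_integral[OF iA]) (use A0 in auto)
    moreover have "(\<integral>\<^sup>+ z. ennreal (indicator half_space z * ?B i z) \<partial>lborel) = ennreal (LINT z:half_space|lborel. ?B i z)"
      using iB[of i] unfolding set_integrable_def set_lebesgue_integral_def by (subst nn_integral_eq_integral) auto
    moreover have "0 \<le> (LINT x|lborel. ?A i x)" using A0 by (intro Bochner_Integration.integral_nonneg) auto
    moreover have "0 \<le> (LINT z:half_space|lborel. ?B i z)"
      unfolding set_lebesgue_integral_def by (intro Bochner_Integration.integral_nonneg) auto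
    ultimately show ?thesis
      using C1c_shifted_inequality[OF u1 e, of i] by (simp add: ennreal_plus[symmetric] ennreal_leI add.commute del: ennreal_plus)
  qed
  then have "(\<integral>\<^sup>+ x. ennreal (K * ((u (x, 0))\<^sup>2 / H0 x)) \<partial>lborel)
      + (\<integral>\<^sup>+ z. ennreal (indicator half_space z * (\<kappa>\<^sup>2 * ((u z)\<^sup>2 / (Phi H0 z)\<^sup>2))) \<partial>lborel)
    \<le> liminf (\<lambda>i. ennreal (LINT z:half_space|lborel. (Phi H (grad u z))\<^sup>2))"
  proof (rule fatou_two[rotated 2])
    show "(\<lambda>x. ennreal (?A i x)) \<in> borel_measurable lborel" for i using iA[of i] by measurable
    show "(\<lambda>z. ennreal (indicator half_space z * ?B i z)) \<in> borel_measurable lborel" for i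
      using measurable_compose[OF borel_measurable_integrable[OF iB[of i, unfolded set_integrable_def]] measurable_ennreal]
      by simp
    show "AE x in lborel. ennreal (K * ((u (x, 0))\<^sup>2 / H0 x)) \<le> liminf (\<lambda>i. ennreal (?A i x))"
    proof (rule AE_I2)
      fix x
      show "ennreal (K * ((u (x, 0))\<^sup>2 / H0 x)) \<le> liminf (\<lambda>i. ennreal (?A i x))"
      \<comment> \<open>At the origin the left side is 0, since division by zero gives 0.\<close>
      proof (cases "x = 0")
        case False
        then have r: "0 < H0 x" by (rule dual_pos)
        have R: "(\<lambda>i. Rad (e i) (x, 0)) \<longlonglongrightarrow> sqrt ((H0 x)\<^sup>2 + (0 + 0)\<^sup>2)"
          unfolding Rad_def fst_conv snd_conv by (intro tendsto_intros elim)
        then have R: "(\<lambda>i. Rad (e i) (x, 0)) \<longlonglongrightarrow> H0 x" using r by simp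
        have "(\<lambda>i. slope (e i) (x, 0)) \<longlonglongrightarrow> (0 + 0) / H0 x"
          unfolding slope_def snd_conv using r by (intro tendsto_intros elim R) auto
        then have "(\<lambda>i. h (slope (e i) (x, 0))) \<longlonglongrightarrow> h 0"
          by (intro isCont_tendsto_compose[OF DERIV_isCont[OF h_DERIV]]) auto
        then have "(\<lambda>i. ?A i x) \<longlonglongrightarrow> - (- \<mu> * (0 + 0) / (H0 x)\<^sup>2 + h 0 * ((H0 x)\<^sup>2 - (0 + 0)\<^sup>2) / H0 x ^ 3) * (u (x, 0))\<^sup>2"
          unfolding VB_def snd_conv using r by (intro tendsto_intros R elim) auto
        also have "- (- \<mu> * (0 + 0) / (H0 x)\<^sup>2 + h 0 * ((H0 x)\<^sup>2 - (0 + 0)\<^sup>2) / H0 x ^ 3) * (u (x, 0))\<^sup>2 = K * ((u (x, 0))\<^sup>2 / H0 x)"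
          using r by (simp add: h_0 power2_eq_square power3_eq_cube)
        finally show ?thesis by (intro le_liminf_of_tendsto tendsto_ennrealI)
      qed simp
    qed
    show "AE z in lborel. ennreal (indicator half_space z * (\<kappa>\<^sup>2 * ((u z)\<^sup>2 / (Phi H0 z)\<^sup>2))) \<le> liminf (\<lambda>i. ennreal (indicator half_space z * ?B i z))"
    proof (rule AE_I2)
      fix z :: "'a \<times> real"
      show "ennreal (indicator half_space z * (\<kappa>\<^sup>2 * ((u z)\<^sup>2 / (Phi H0 z)\<^sup>2))) \<le> liminf (\<lambda>i. ennreal (indicator half_space z * ?B i z))"
      proof (cases "z \<in> half_space")
        case True
        then have p: "0 < (Phi H0 z)\<^sup>2" by (auto simp: Phi_dual_sq half_space_def intro!: add_nonneg_pos)
        have "(\<lambda>i. (Rad (e i) z)\<^sup>2) \<longlonglongrightarrow> (H0 (fst z))\<^sup>2 + (snd z + 0)\<^sup>2"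
          unfolding Rad_square by (intro tendsto_intros elim)
        then have "(\<lambda>i. (Rad (e i) z)\<^sup>2) \<longlonglongrightarrow> (Phi H0 z)\<^sup>2" by (simp add: Phi_dual_sq)
        then have "(\<lambda>i. \<kappa>\<^sup>2 / (Rad (e i) z)\<^sup>2) \<longlonglongrightarrow> \<kappa>\<^sup>2 / (Phi H0 z)\<^sup>2"
          using p by (intro tendsto_divide tendsto_const) auto
        then have "(\<lambda>i. indicator half_space z * ?B i z) \<longlonglongrightarrow> indicator half_space z * ((u z)\<^sup>2 * (\<kappa>\<^sup>2 / (Phi H0 z)\<^sup>2))"
          by (intro tendsto_mult tendsto_const)
        then show ?thesis by (intro le_liminf_of_tendsto tendsto_ennrealI) (simp add: mult.commute)
      qed simp
    qed
  qed
  then show ?thesis by (simp add: Liminf_const)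
qed

end

section \<open>Weak gradients\<close>

text \<open>At a geometric rate the squared errors are summable in the mean, hence summable almost
  everywhere; no subsequence has to be extracted.\<close>

lemma fast_L2_AE:
  fixes f :: "nat \<Rightarrow> 'b \<Rightarrow> real"
  assumes [measurable]: "\<And>i. f i \<in> borel_measurable M" "F \<in> borel_measurable M"
    and le: "\<And>i. (\<integral>\<^sup>+ x. ennreal ((f i x - F x)\<^sup>2) \<partial>M) \<le> ennreal ((1/4) ^ i)"
  shows "AE x in M. (\<lambda>i. f i x) \<longlonglongrightarrow> F x"
proof -
  have "(\<integral>\<^sup>+ x. (\<Sum>i. ennreal ((f i x - F x)\<^sup>2)) \<partial>M) = (\<Sum>i. \<integral>\<^sup>+ x. ennreal ((f i x - F x)\<^sup>2) \<partial>M)"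
    by (rule nn_integral_suminf) measurable
  also have "\<dots> \<le> (\<Sum>i. ennreal ((1/4) ^ i))" by (intro suminf_le le) auto
  also have "\<dots> = ennreal (\<Sum>i. (1/4) ^ i)" by (intro suminf_ennreal2 summable_geometric) auto
  also have "\<dots> < top" by simp
  finally have "AE x in M. (\<Sum>i. ennreal ((f i x - F x)\<^sup>2)) \<noteq> \<infinity>"
    by (intro nn_integral_noteq_infinite) auto
  then show ?thesis
  proof (rule AE_mp, intro AE_I2 impI)
    fix x assume "(\<Sum>i. ennreal ((f i x - F x)\<^sup>2)) \<noteq> \<infinity>"
    then have "summable (\<lambda>i. (f i x - F x)\<^sup>2)" by (intro summable_suminf_not_top) auto
    then have "(\<lambda>i. sqrt ((f i x - F x)\<^sup>2)) \<longlonglongrightarrow> sqrt 0" by (intro tendsto_intros summable_LIMSEQ_zero)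
    then have "(\<lambda>i. f i x - F x) \<longlonglongrightarrow> 0" by (simp add: tendsto_rabs_zero_iff)
    then show "(\<lambda>i. f i x) \<longlonglongrightarrow> F x" by (simp add: LIM_zero_iff)
  qed
qed

abbreviation half_measure :: "('a::euclidean_space \<times> real) measure" where
  "half_measure \<equiv> lebesgue_on half_space"

lemma half_space_lebesgue [measurable]: "half_space \<in> sets lebesgue"
  by (intro sets_completionI_sets) (simp add: half_space_borel)

lemma set_integrable_half: "set_integrable lebesgue half_space f \<longleftrightarrow> integrable half_measure f"
  and set_integral_half: "(LINT z:half_space|lebesgue. f z) = integral\<^sup>L half_measure f"
  for f :: "'a::euclidean_space \<times> real \<Rightarrow> 'b::euclidean_space"
  by (simp_all add: set_integrable_def set_lebesgue_integral_def integrable_restrict_space integral_restrict_space half_space_lebesgue)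

lemma set_measurable_half: "set_borel_measurable lebesgue half_space f \<longleftrightarrow> f \<in> borel_measurable half_measure"
  for f :: "'a::euclidean_space \<times> real \<Rightarrow> 'b::euclidean_space"
  by (simp add: set_borel_measurable_def borel_measurable_restrict_space_iff half_space_lebesgue)

lemma AE_half: "(AE z in half_measure. P z) \<longleftrightarrow> (AE z in lebesgue. z \<in> half_space \<longrightarrow> P z)"
  by (rule AE_restrict_space_iff) (simp add: half_space_lebesgue)

lemma nn_integral_half: "(\<integral>\<^sup>+ z. f z \<partial>half_measure) = (\<integral>\<^sup>+ z. f z * indicator half_space z \<partial>lebesgue)"
  by (rule nn_integral_restrict_space) (simp add: half_space_lebesgue)

lemma L2_on_half: "L2_on half_space f \<longleftrightarrow> f \<in> borel_measurable half_measure \<and> integrable half_measure (\<lambda>z. (norm (f z))\<^sup>2)"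
  by (simp add: L2_on_def set_measurable_half set_integrable_half)

lemma borel_half: "f \<in> borel_measurable borel \<Longrightarrow> f \<in> borel_measurable half_measure"
  by (intro measurable_restrict_space1 measurable_completion) simp

lemma conv_bounded:
  assumes k: "kernel k" and s: "ball_integrable s" "\<And>x. \<bar>s x\<bar> \<le> 1" shows "\<bar>conv k s z\<bar> \<le> 1"
proof -
  have t: "test_function UNIV k" and nn: "\<And>x. 0 \<le> k x" using k by (auto simp: kernel_def)
  have "\<bar>conv k s z\<bar> \<le> (LINT w|lborel. norm (s w * k (w - z)))"
    unfolding conv_def using integral_norm_bound[of lborel "\<lambda>w. s w * k (w - z)"] by simp
  also have "\<dots> \<le> (LINT w|lborel. k (w - z))"
    using s(2) nn by (intro integral_mono integrable_norm conv_integrable s(1) t kernel_shift_integrable)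
      (auto simp: abs_mult intro: mult_left_le_one_le)
  finally show ?thesis using kernel_integral_shift[OF k] by simp
qed

text \<open>On a compact set the sign of d is mollified to test functions bounded by 1 that converge
  almost everywhere. Testing d with them and passing to the limit makes the integral of |d| over
  that set vanish; such sets exhaust the half-space.\<close>

lemma fundamental_lemma:
  fixes d :: "'a::euclidean_space \<times> real \<Rightarrow> real"
  assumes d: "locally_integrable half_space d"
    and d0: "\<And>\<phi>. test_function half_space \<phi> \<Longrightarrow> (LINT z:half_space|lebesgue. d z * \<phi> z) = 0"
  shows "AE z in lebesgue. z \<in> half_space \<longrightarrow> d z = 0"
proof -
  define C where "C n = cball 0 (real n) \<inter> {z::'a \<times> real. 1 / real (Suc n) \<le> snd z}" for n
  have "AE z in lebesgue. z \<in> C n \<longrightarrow> d z = 0" for n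
  proof -
    \<comment> \<open>\<open>C n\<close> has distance at least 1/(n+1) from the boundary. Kernels of
      half that radius spread its points only over \<open>C'\<close>, which is still compact inside
      the half-space.\<close>
    define C' where "C' = cball 0 (real n + 1) \<inter> {z::'a \<times> real. 1 / (2 * real (Suc n)) \<le> snd z}"
    have cC: "compact (C n)" "compact C'"
      unfolding C_def C'_def by (intro compact_Int_closed closed_Collect_le continuous_intros compact_cball)+
    have Ch: "C n \<subseteq> half_space" "C' \<subseteq> half_space"
    proof -
      have "{z::'a \<times> real. c \<le> snd z} \<subseteq> half_space" if "0 < c" for c
        using that by (auto simp: half_space_def)
      from this[of "1 / real (Suc n)"] this[of "1 / (2 * real (Suc n))"]
      show "C n \<subseteq> half_space" "C' \<subseteq> half_space" unfolding C_def C'_def by (auto simp del: of_nat_Suc)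
    qed
    have sC [measurable]: "C n \<in> sets borel" using cC(1) by (simp add: borel_compact)
    have iC: "set_integrable lebesgue (C n) d" "set_integrable lebesgue C' d"
      using d cC Ch by (auto simp: locally_integrable_def)
    have "(\<lambda>z. sgn (indicator (C n) z *\<^sub>R d z)) \<in> borel_measurable lebesgue"
    proof -
      have "(sgn :: real \<Rightarrow> real) \<in> borel_measurable borel"
        by (rule borel_measurable_mono) (auto simp: mono_def sgn_real_def)
      then show ?thesis
        by (rule measurable_compose[OF borel_measurable_integrable[OF iC(1)[unfolded set_integrable_def]]])
    qed
    then obtain s' where s': "s' \<in> borel_measurable lborel" "AE z in lborel. sgn (indicator (C n) z *\<^sub>R d z) = s' z"
      using completion_ex_borel_measurable_real by metis
    \<comment> \<open>The Borel version s' agrees with the sign only almost everywhere. Clamping and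
      cutting give the bound 1 and the support condition at every point.\<close>
    define s where "s z = indicator (C n) z * clamp_real 1 (s' z)" for z
    have sm: "s \<in> borel_measurable borel"
      unfolding s_def using s'(1) by (intro borel_measurable_times borel_measurable_indicator measurable_compose[OF _ measurable_clamp_real]) auto
    have s1: "\<bar>s z\<bar> \<le> 1" for z using clamp_real(1)[of 1 "s' z"] by (auto simp: s_def indicator_def)
    have s0: "s z = 0" if "z \<notin> C n" for z using that by (simp add: s_def)
    have L: "L2b s"
      by (rule L2b_bounded[OF sm s1, of "real n"]) (auto simp: C_def intro: s0)
    note si = L2b_ball_integrable[OF L]
    have sgn: "AE z in lebesgue. s z = indicator (C n) z * sgn (d z)"
    proof -
      have "AE z in lborel. s z = indicator (C n) z * sgn (d z)"
        using s'(2) by eventually_elim (auto simp: s_def indicator_def clamp_real_def sgn_real_def split: if_splits)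
      then show ?thesis by (simp add: AE_completion_iff)
    qed
    have "\<forall>j::nat. \<exists>k. kernel k \<and> (\<forall>z. k z \<noteq> 0 \<longrightarrow> norm z \<le> 1 / (2 * real (Suc n))) \<and>
        (\<integral>\<^sup>+ x. ennreal ((conv k s x - s x)\<^sup>2) \<partial>lborel) \<le> ennreal ((1/4) ^ j)"
    proof
      fix j :: nat
      obtain \<epsilon> where \<epsilon>: "0 < \<epsilon>" "\<And>k. kernel k \<Longrightarrow> (\<And>z. k z \<noteq> 0 \<Longrightarrow> norm z \<le> \<epsilon>) \<Longrightarrow>
        (\<integral>\<^sup>+ x. ennreal ((conv k s x - s x)\<^sup>2) \<partial>lborel) \<le> ennreal ((1/4) ^ j)"
        using conv_L2_tendsto[OF L, of "(1/4) ^ j"] by auto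
      define r where "r = min \<epsilon> (1 / (2 * real (Suc n)))"
      have "0 < r" using \<epsilon>(1) by (simp add: r_def)
      then obtain k where k: "kernel k" "\<And>z. k z \<noteq> 0 \<Longrightarrow> z \<in> ball (0::'a \<times> real) r" using kernel_exists by metis
      have "norm z \<le> \<epsilon> \<and> norm z \<le> 1 / (2 * real (Suc n))" if "k z \<noteq> 0" for z
        using k(2)[OF that] by (simp add: r_def)
      then show "\<exists>k. kernel k \<and> (\<forall>z. k z \<noteq> 0 \<longrightarrow> norm z \<le> 1 / (2 * real (Suc n))) \<and>
        (\<integral>\<^sup>+ x. ennreal ((conv k s x - s x)\<^sup>2) \<partial>lborel) \<le> ennreal ((1/4) ^ j)"
        using k(1) \<epsilon>(2)[OF k(1)] by blast
    qed
    from choice[OF this] obtain k where k: "\<And>j. kernel (k j)" "\<And>j z. k j z \<noteq> 0 \<Longrightarrow> norm z \<le> 1 / (2 * real (Suc n))"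
      "\<And>j. (\<integral>\<^sup>+ x. ennreal ((conv (k j) s x - s x)\<^sup>2) \<partial>lborel) \<le> ennreal ((1/4) ^ j)" by blast
    define \<phi> where "\<phi> j = conv (k j) s" for j
    have sm\<phi>: "smooth (\<phi> j)" for j unfolding \<phi>_def by (rule smooth_conv[OF si]) (use k(1) in \<open>auto simp: kernel_def\<close>)
    have m\<phi>: "\<phi> j \<in> borel_measurable borel" for j by (intro borel_measurable_continuous_onI smooth_continuous sm\<phi>)
    have supp: "z \<in> C'" if "\<phi> j z \<noteq> 0" for j z
    proof (rule ccontr)
      assume z: "z \<notin> C'"
      have "s w = 0 \<or> k j (w - z) = 0" for w
      proof (rule ccontr)
        assume "\<not> (s w = 0 \<or> k j (w - z) = 0)"
        then have w: "w \<in> C n" "norm (w - z) \<le> 1 / (2 * real (Suc n))" using s0 k(2) by blast+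
        have "norm z \<le> norm w + norm (w - z)" using norm_triangle_ineq4[of w "w - z"] by simp
        moreover have "1 / (2 * real (Suc n)) \<le> 1" by simp
        moreover have "norm w \<le> real n" using w(1) by (simp add: C_def)
        ultimately have "norm z \<le> real n + 1" using w(2) by linarith
        moreover have "snd w - snd z \<le> norm (w - z)" using norm_snd_le[of "snd (w - z)" "fst (w - z)"] unfolding prod.collapse by simp
        then have "1 / real (Suc n) - 1 / (2 * real (Suc n)) \<le> snd z" using w by (simp add: C_def)
        then have "1 / (2 * real (Suc n)) \<le> snd z" by (simp add: field_simps)
        ultimately show False using z by (simp add: C'_def)
      qed
      then have "(\<lambda>w. s w * k j (w - z)) = (\<lambda>w. 0)" by auto
      then have "\<phi> j z = 0" unfolding \<phi>_def conv_def by simp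
      with that show False by simp
    qed
    have "test_function half_space (\<phi> j)" for j
      by (rule test_functionI[OF sm\<phi> cC(2) Ch(2) supp])
    then have z: "(LINT z|lebesgue. indicator half_space z * (d z * \<phi> j z)) = 0" for j
      using d0 by (simp add: set_lebesgue_integral_def)
    have AEc: "AE z in lebesgue. (\<lambda>j. \<phi> j z) \<longlonglongrightarrow> s z"
    proof -
      have "AE z in lborel. (\<lambda>j. \<phi> j z) \<longlonglongrightarrow> s z"
        by (rule fast_L2_AE) (use m\<phi> sm k(3) in \<open>auto simp: \<phi>_def\<close>)
      then show ?thesis by (simp add: AE_completion_iff)
    qed
    have mCd: "(\<lambda>z. indicator C' z *\<^sub>R d z) \<in> borel_measurable lebesgue"
      using iC(2) unfolding set_integrable_def by auto
    have eqC': "indicator half_space z * (d z * \<phi> j z) = (indicator C' z *\<^sub>R d z) * \<phi> j z" for z j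
      using supp[of j z] Ch(2) by (auto simp: indicator_def)
    have CC: "C n \<subseteq> C'"
    proof
      fix z assume "z \<in> C n"
      moreover have "1 / (2 * real (Suc n)) \<le> 1 / real (Suc n)" by (simp add: field_simps)
      ultimately show "z \<in> C'" unfolding C_def C'_def by auto
    qed
    have eqs: "indicator half_space z * (d z * s z) = (indicator C' z *\<^sub>R d z) * s z" for z
      using s0[of z] Ch CC by (auto simp: indicator_def)
    have mleb: "f \<in> borel_measurable borel \<Longrightarrow> f \<in> borel_measurable lebesgue" for f :: "'a \<times> real \<Rightarrow> real"
      by (intro measurable_completion) simp
    have "(\<lambda>j. LINT z|lebesgue. indicator half_space z * (d z * \<phi> j z)) \<longlonglongrightarrow> (LINT z|lebesgue. indicator half_space z * (d z * s z))"
    proof (rule integral_dominated_convergence)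
      show "integrable lebesgue (\<lambda>z. norm (indicator C' z *\<^sub>R d z))"
        using iC(2) unfolding set_integrable_def by (rule integrable_norm)
      show "(\<lambda>z. indicator half_space z * (d z * s z)) \<in> borel_measurable lebesgue"
        unfolding eqs by (intro borel_measurable_times mCd mleb sm)
      show "(\<lambda>z. indicator half_space z * (d z * \<phi> j z)) \<in> borel_measurable lebesgue" for j
        unfolding eqC' by (intro borel_measurable_times mCd mleb m\<phi>)
      show "AE z in lebesgue. (\<lambda>j. indicator half_space z * (d z * \<phi> j z)) \<longlonglongrightarrow> indicator half_space z * (d z * s z)"
        using AEc by eventually_elim (intro tendsto_intros)
      show "AE z in lebesgue. norm (indicator half_space z * (d z * \<phi> j z)) \<le> norm (indicator C' z *\<^sub>R d z)" for j
      proof (rule AE_I2)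
        fix z
        have "\<bar>\<phi> j z\<bar> \<le> 1" unfolding \<phi>_def by (rule conv_bounded[OF k(1) si s1])
        then show "norm (indicator half_space z * (d z * \<phi> j z)) \<le> norm (indicator C' z *\<^sub>R d z)"
          unfolding eqC' by (simp add: abs_mult mult_left_le)
      qed
    qed
    then have "(LINT z|lebesgue. indicator half_space z * (d z * s z)) = 0"
      unfolding z using LIMSEQ_unique tendsto_const by blast
    moreover have "(LINT z|lebesgue. indicator half_space z * (d z * s z)) = (LINT z|lebesgue. norm (indicator (C n) z *\<^sub>R d z))"
    proof (rule integral_cong_AE)
      show "(\<lambda>z. indicator half_space z * (d z * s z)) \<in> borel_measurable lebesgue"
        unfolding eqs by (intro borel_measurable_times mCd mleb sm)
      show "(\<lambda>z. norm (indicator (C n) z *\<^sub>R d z)) \<in> borel_measurable lebesgue"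
        by (rule borel_measurable_integrable[OF integrable_norm[OF iC(1)[unfolded set_integrable_def]]])
      show "AE z in lebesgue. indicator half_space z * (d z * s z) = norm (indicator (C n) z *\<^sub>R d z)"
        using sgn by eventually_elim (use Ch(1) in \<open>auto simp: indicator_def abs_sgn mult.commute\<close>)
    qed
    ultimately have "AE z in lebesgue. norm (indicator (C n) z *\<^sub>R d z) = 0"
      using integral_nonneg_eq_0_iff_AE[of lebesgue "\<lambda>z. norm (indicator (C n) z *\<^sub>R d z)"] integrable_norm[OF iC(1)[unfolded set_integrable_def]]
      by simp
    then show ?thesis by eventually_elim (auto simp: indicator_def)
  qed
  then have "AE z in lebesgue. \<forall>n. z \<in> C n \<longrightarrow> d z = 0" by (subst AE_all_countable) blast
  then show ?thesis
  proof (rule AE_mp, intro AE_I2 impI)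
    fix z :: "'a \<times> real" assume a: "\<forall>n. z \<in> C n \<longrightarrow> d z = 0" and z: "z \<in> half_space"
    obtain n1 :: nat where n1: "norm z < real n1" using reals_Archimedean2 by blast
    obtain n2 :: nat where n2: "1 / snd z < real n2" using reals_Archimedean2 by blast
    define n where "n = max n1 n2"
    have "0 < snd z" using z by (simp add: half_space_def)
    moreover have "1 / snd z \<le> real (Suc n)" using n2 by (simp add: n_def)
    ultimately have "1 / real (Suc n) \<le> snd z" by (simp add: field_simps)
    moreover have "norm z \<le> real n" using n1 by (simp add: n_def)
    ultimately show "d z = 0" using a by (auto simp: C_def)
  qed
qed

lemma locally_integrable_diff:
  "locally_integrable S f \<Longrightarrow> locally_integrable S g \<Longrightarrow> locally_integrable S (\<lambda>z. f z - g z)"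
  by (auto simp: locally_integrable_def intro!: set_integral_diff)

lemma locally_integrable_inner:
  "locally_integrable S f \<Longrightarrow> locally_integrable S (\<lambda>z. f z \<bullet> b)"
  unfolding locally_integrable_def set_integrable_def
  by (auto simp flip: inner_scaleR_left)

lemma locally_integrable_scale:
  fixes f :: "'a::euclidean_space \<Rightarrow> 'b::euclidean_space" and \<psi> :: "'a \<Rightarrow> real"
  assumes "locally_integrable S f" "continuous_on UNIV \<psi>"
  shows "locally_integrable S (\<lambda>z. \<psi> z *\<^sub>R f z)"
  unfolding locally_integrable_def
proof (intro allI impI)
  fix C assume C: "compact C \<and> C \<subseteq> S"
  have "bounded (\<psi> ` C)"
    using C by (intro compact_imp_bounded compact_continuous_image continuous_on_subset[OF assms(2)]) auto
  then obtain M where M: "\<forall>z\<in>C. \<bar>\<psi> z\<bar> \<le> M" by (auto simp: bounded_iff)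
  have i: "integrable lebesgue (\<lambda>z. indicator C z *\<^sub>R f z)" using assms(1) C by (simp add: locally_integrable_def set_integrable_def)
  have m: "\<psi> \<in> borel_measurable lebesgue"
    by (intro measurable_completion) (simp add: assms(2) borel_measurable_continuous_onI)
  show "set_integrable lebesgue C (\<lambda>z. \<psi> z *\<^sub>R f z)"
    unfolding set_integrable_def
  proof (rule Bochner_Integration.integrable_bound)
    show "integrable lebesgue (\<lambda>z. M *\<^sub>R (indicator C z *\<^sub>R f z))" by (intro integrable_scaleR_right i)
    have "(\<lambda>z. \<psi> z *\<^sub>R (indicator C z *\<^sub>R f z)) \<in> borel_measurable lebesgue"
      using m borel_measurable_integrable[OF i] by (rule borel_measurable_scaleR)
    then show "(\<lambda>z. indicator C z *\<^sub>R \<psi> z *\<^sub>R f z) \<in> borel_measurable lebesgue" by (simp add: mult.commute)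
    show "AE z in lebesgue. norm (indicator C z *\<^sub>R \<psi> z *\<^sub>R f z) \<le> norm (M *\<^sub>R (indicator C z *\<^sub>R f z))"
      using M by (intro AE_I2) (force simp: indicator_def intro!: mult_right_mono)
  qed
qed

lemma locally_integrable_add:
  "locally_integrable S f \<Longrightarrow> locally_integrable S g \<Longrightarrow> locally_integrable S (\<lambda>z. f z + g z)"
  by (auto simp: locally_integrable_def intro!: set_integral_add)

lemma locally_integrable_test:
  fixes f :: "'a::euclidean_space \<times> real \<Rightarrow> real"
  assumes f: "locally_integrable half_space f" and \<phi>: "test_function half_space \<phi>"
  shows "set_integrable lebesgue half_space (\<lambda>z. f z * \<phi> z)"
proof -
  obtain C where C: "compact C" "C \<subseteq> half_space" "\<And>z. z \<notin> C \<Longrightarrow> \<phi> z = 0" using test_function_support[OF \<phi>] by metis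
  have "locally_integrable half_space (\<lambda>z. \<phi> z *\<^sub>R f z)"
    by (intro locally_integrable_scale f smooth_continuous test_function_smooth[OF \<phi>])
  then have "set_integrable lebesgue C (\<lambda>z. \<phi> z *\<^sub>R f z)" using C by (simp add: locally_integrable_def)
  moreover have "(\<lambda>z. indicator C z *\<^sub>R (\<phi> z *\<^sub>R f z)) = (\<lambda>z. indicator half_space z *\<^sub>R (f z * \<phi> z))"
  proof
    show "indicator C z *\<^sub>R (\<phi> z *\<^sub>R f z) = indicator half_space z *\<^sub>R (f z * \<phi> z)" for z
      using C(2,3) by (cases "z \<in> C") (auto simp: mult.commute)
  qed
  ultimately show ?thesis unfolding set_integrable_def by (simp only:)
qed

lemma weak_gradientD:
  assumes "has_weak_gradient half_space u g" "test_function half_space \<phi>" "b \<in> Basis"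
  shows "(LINT z:half_space|lebesgue. u z * frechet_derivative \<phi> (at z) b) = - (LINT z:half_space|lebesgue. (g z \<bullet> b) * \<phi> z)"
  using assms by (auto simp: has_weak_gradient_def)

lemma weak_gradient_unique:
  assumes "has_weak_gradient half_space u g" "has_weak_gradient half_space u h"
  shows "AE z in half_measure. g z = h z"
proof -
  have l: "locally_integrable half_space g" "locally_integrable half_space h" using assms by (auto simp: has_weak_gradient_def)
  have "AE z in lebesgue. z \<in> half_space \<longrightarrow> (g z - h z) \<bullet> b = 0" if b: "b \<in> Basis" for b
  proof (rule fundamental_lemma)
    show "locally_integrable half_space (\<lambda>z. (g z - h z) \<bullet> b)"
      by (intro locally_integrable_inner locally_integrable_diff l)
    fix \<phi> :: "'a \<times> real \<Rightarrow> real" assume \<phi>: "test_function half_space \<phi>"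
    have "(LINT z:half_space|lebesgue. (g z - h z) \<bullet> b * \<phi> z)
      = (LINT z:half_space|lebesgue. (g z \<bullet> b) * \<phi> z - (h z \<bullet> b) * \<phi> z)"
      by (simp add: inner_diff_left left_diff_distrib)
    also have "\<dots> = (LINT z:half_space|lebesgue. (g z \<bullet> b) * \<phi> z) - (LINT z:half_space|lebesgue. (h z \<bullet> b) * \<phi> z)"
      by (intro set_integral_diff locally_integrable_test locally_integrable_inner l \<phi>)
    also have "\<dots> = 0" using weak_gradientD[OF assms(1) \<phi> b] weak_gradientD[OF assms(2) \<phi> b] by simp
    finally show "(LINT z:half_space|lebesgue. (g z - h z) \<bullet> b * \<phi> z) = 0" .
  qed
  then have "\<forall>b\<in>Basis. AE z in half_measure. (g z - h z) \<bullet> b = 0" by (simp add: AE_half)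
  then have "AE z in half_measure. \<forall>b\<in>Basis. (g z - h z) \<bullet> b = 0" by (simp add: AE_finite_all)
  then show ?thesis by eventually_elim (simp add: euclidean_eq_iff[of "g _"] inner_diff_left)
qed

lemma weak_gradient_diff:
  assumes "has_weak_gradient half_space u g" "has_weak_gradient half_space v h"
  shows "has_weak_gradient half_space (\<lambda>z. u z - v z) (\<lambda>z. g z - h z)"
  unfolding has_weak_gradient_def
proof (intro conjI allI impI ballI)
  have l: "locally_integrable half_space g" "locally_integrable half_space h" "locally_integrable half_space u" "locally_integrable half_space v"
    using assms by (auto simp: has_weak_gradient_def)
  then show "locally_integrable half_space (\<lambda>z. u z - v z)" "locally_integrable half_space (\<lambda>z. g z - h z)"
    by (auto intro: locally_integrable_diff)
  fix \<phi> :: "'a \<times> real \<Rightarrow> real" and b :: "'a \<times> real" assume \<phi>: "test_function half_space \<phi>" and b: "b \<in> Basis"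
  have "(LINT z:half_space|lebesgue. (u z - v z) * frechet_derivative \<phi> (at z) b) =
     (LINT z:half_space|lebesgue. u z * frechet_derivative \<phi> (at z) b) - (LINT z:half_space|lebesgue. v z * frechet_derivative \<phi> (at z) b)"
    unfolding left_diff_distrib by (intro set_integral_diff locally_integrable_test l test_function_partial[OF \<phi> b])
  moreover have "(LINT z:half_space|lebesgue. (g z - h z) \<bullet> b * \<phi> z) =
     (LINT z:half_space|lebesgue. (g z \<bullet> b) * \<phi> z) - (LINT z:half_space|lebesgue. (h z \<bullet> b) * \<phi> z)"
    unfolding left_diff_distrib inner_diff_left by (intro set_integral_diff locally_integrable_test locally_integrable_inner l \<phi>)
  ultimately show "(LINT z:half_space|lebesgue. (u z - v z) * frechet_derivative \<phi> (at z) b) =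
     - (LINT z:half_space|lebesgue. (g z - h z) \<bullet> b * \<phi> z)"
    using weak_gradientD[OF assms(1) \<phi> b] weak_gradientD[OF assms(2) \<phi> b] by simp
qed

text \<open>The product \<phi> \<theta> is again a test function, and applying the weak identity of
  u to it gives the product rule.\<close>

lemma weak_gradient_mult:
  assumes u: "has_weak_gradient half_space u g" and \<theta>: "smooth \<theta>"
  shows "has_weak_gradient half_space (\<lambda>z. \<theta> z *\<^sub>R u z) (\<lambda>z. \<theta> z *\<^sub>R g z + u z *\<^sub>R grad \<theta> z)"
  unfolding has_weak_gradient_def
proof (intro conjI allI impI ballI)
  have l: "locally_integrable half_space g" "locally_integrable half_space u" using u by (auto simp: has_weak_gradient_def)
  have lb: "locally_integrable half_space (\<lambda>z. frechet_derivative \<theta> (at z) b *\<^sub>R u z)" if "b \<in> Basis" for b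
    by (intro locally_integrable_scale l smooth_continuous smooth_partial \<theta> that)
  have "locally_integrable half_space (\<lambda>z. u z *\<^sub>R grad \<theta> z)"
    unfolding locally_integrable_def
  proof (intro allI impI)
    fix C :: "('a \<times> real) set" assume C: "compact C \<and> C \<subseteq> half_space"
    have "integrable lebesgue (\<lambda>z. \<Sum>b\<in>Basis. (indicator C z *\<^sub>R (frechet_derivative \<theta> (at z) b *\<^sub>R u z)) *\<^sub>R b)"
      using lb C by (intro Bochner_Integration.integrable_sum integrable_scaleR_left) (auto simp: locally_integrable_def set_integrable_def)
    then show "set_integrable lebesgue C (\<lambda>z. u z *\<^sub>R grad \<theta> z)"
      by (simp add: set_integrable_def grad_def scaleR_sum_right mult_ac)
  qed
  moreover have "locally_integrable half_space (\<lambda>z. \<theta> z *\<^sub>R g z)"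
    by (intro locally_integrable_scale l smooth_continuous \<theta>)
  ultimately show "locally_integrable half_space (\<lambda>z. \<theta> z *\<^sub>R g z + u z *\<^sub>R grad \<theta> z)"
    by (rule locally_integrable_add[rotated])
  show "locally_integrable half_space (\<lambda>z. \<theta> z *\<^sub>R u z)" by (intro locally_integrable_scale l smooth_continuous \<theta>)
  fix \<phi> :: "'a \<times> real \<Rightarrow> real" and b :: "'a \<times> real" assume \<phi>: "test_function half_space \<phi>" and b: "b \<in> Basis"
  have t: "test_function half_space (\<lambda>z. \<phi> z * \<theta> z)" by (rule test_function_mult[OF \<phi> \<theta>])
  have D: "frechet_derivative (\<lambda>z. \<phi> z * \<theta> z) (at z) b = \<phi> z * frechet_derivative \<theta> (at z) b + frechet_derivative \<phi> (at z) b * \<theta> z" for z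
    using fun_cong[OF frechet_derivative_at[OF has_derivative_mult[OF smooth_has_derivative[OF test_function_smooth[OF \<phi>], of z] smooth_has_derivative[OF \<theta>, of z]]], of b]
    by simp
  have "(LINT z:half_space|lebesgue. \<theta> z *\<^sub>R u z * frechet_derivative \<phi> (at z) b)
     = (LINT z:half_space|lebesgue. u z * frechet_derivative (\<lambda>z. \<phi> z * \<theta> z) (at z) b - (frechet_derivative \<theta> (at z) b *\<^sub>R u z) * \<phi> z)"
    unfolding D by (simp add: algebra_simps)
  also have "\<dots> = (LINT z:half_space|lebesgue. u z * frechet_derivative (\<lambda>z. \<phi> z * \<theta> z) (at z) b)
     - (LINT z:half_space|lebesgue. (frechet_derivative \<theta> (at z) b *\<^sub>R u z) * \<phi> z)"
    by (intro set_integral_diff locally_integrable_test l test_function_partial[OF t b] lb b \<phi>)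
  also have "(LINT z:half_space|lebesgue. u z * frechet_derivative (\<lambda>z. \<phi> z * \<theta> z) (at z) b) = - (LINT z:half_space|lebesgue. (g z \<bullet> b) * (\<phi> z * \<theta> z))"
    by (rule weak_gradientD[OF u t b])
  also have "- (LINT z:half_space|lebesgue. (g z \<bullet> b) * (\<phi> z * \<theta> z)) - (LINT z:half_space|lebesgue. (frechet_derivative \<theta> (at z) b *\<^sub>R u z) * \<phi> z)
     = - (LINT z:half_space|lebesgue. (g z \<bullet> b) * (\<phi> z * \<theta> z) + (frechet_derivative \<theta> (at z) b *\<^sub>R u z) * \<phi> z)"
    using set_integral_add(2)[OF locally_integrable_test[OF locally_integrable_inner[OF l(1)] t] locally_integrable_test[OF lb[OF b] \<phi>]]
    by simp
  also have "\<dots> = - (LINT z:half_space|lebesgue. (\<theta> z *\<^sub>R g z + u z *\<^sub>R grad \<theta> z) \<bullet> b * \<phi> z)"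
    using b by (simp add: inner_add_left grad_inner algebra_simps)
  finally show "(LINT z:half_space|lebesgue. \<theta> z *\<^sub>R u z * frechet_derivative \<phi> (at z) b) = - (LINT z:half_space|lebesgue. (\<theta> z *\<^sub>R g z + u z *\<^sub>R grad \<theta> z) \<bullet> b * \<phi> z)" .
qed

section \<open>Approximation by mollification from above the boundary\<close>

text \<open>Averaging over points strictly above \<open>z\<close> stays inside the half-space, so no extension of \<open>u\<close> across the
  boundary is needed.\<close>

lemma kernel_upper:
  assumes "0 < \<epsilon>"
  obtains k :: "'a::euclidean_space \<times> real \<Rightarrow> real" where "kernel k" "\<And>z. k z \<noteq> 0 \<Longrightarrow> norm z \<le> \<epsilon> \<and> \<epsilon> / 4 \<le> snd z"
proof -
  obtain k :: "'a \<times> real \<Rightarrow> real" where k: "kernel k" "\<And>z. k z \<noteq> 0 \<Longrightarrow> z \<in> ball (0, \<epsilon> / 2) (\<epsilon> / 4)"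
    using kernel_exists[of "\<epsilon> / 4" "(0::'a, \<epsilon> / 2)"] assms by auto
  have "norm z \<le> \<epsilon> \<and> \<epsilon> / 4 \<le> snd z" if "k z \<noteq> 0" for z
  proof -
    have d: "norm (z - (0, \<epsilon> / 2)) < \<epsilon> / 4" using k(2)[OF that] by (simp add: dist_norm norm_minus_commute)
    have "norm z \<le> norm (z - (0, \<epsilon> / 2)) + norm ((0::'a), \<epsilon> / 2)" using norm_triangle_ineq[of "z - (0, \<epsilon> / 2)" "(0, \<epsilon> / 2)"] by simp
    moreover have "norm ((0::'a), \<epsilon> / 2) = \<epsilon> / 2" using assms by (simp add: norm_Pair)
    moreover have "\<bar>snd z - \<epsilon> / 2\<bar> \<le> norm (z - (0, \<epsilon> / 2))"
      using norm_snd_le[of "snd (z - (0, \<epsilon> / 2))" "fst (z - (0, \<epsilon> / 2))"] unfolding prod.collapse by simp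
    ultimately show ?thesis using d assms by (auto simp: abs_le_iff)
  qed
  with k(1) show thesis by (rule that)
qed

text \<open>The extension by 0 gets a Borel representative on the whole space, the kind of function
  that \<open>conv\<close> is applied to.\<close>

lemma L2_borel_version:
  fixes f :: "'a::euclidean_space \<times> real \<Rightarrow> real"
  assumes "f \<in> borel_measurable half_measure" "integrable half_measure (\<lambda>z. (f z)\<^sup>2)"
  obtains fb where "L2b fb" "AE z in lebesgue. fb z = indicator half_space z * f z"
proof -
  have m: "(\<lambda>z. indicator half_space z *\<^sub>R f z) \<in> borel_measurable lebesgue"
    using assms(1) by (simp add: borel_measurable_restrict_space_iff half_space_lebesgue)
  then obtain fb where fb: "fb \<in> borel_measurable lborel" "AE z in lborel. indicator half_space z *\<^sub>R f z = fb z"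
    using completion_ex_borel_measurable_real by metis
  have ae: "AE z in lebesgue. fb z = indicator half_space z * f z"
    using fb(2) by (simp add: AE_completion_iff eq_commute)
  have i: "integrable lebesgue (\<lambda>z. indicator half_space z *\<^sub>R (f z)\<^sup>2)"
    using assms(2) by (simp add: integrable_restrict_space half_space_lebesgue)
  have fm: "(\<lambda>z. (fb z)\<^sup>2) \<in> borel_measurable lborel" using fb(1) by simp
  have "integrable lebesgue (\<lambda>z. (fb z)\<^sup>2)"
  proof (rule Bochner_Integration.integrable_cong_AE_imp[OF i])
    show "(\<lambda>z. (fb z)\<^sup>2) \<in> borel_measurable lebesgue" by (rule measurable_completion[OF fm])
    show "AE z in lebesgue. indicator half_space z *\<^sub>R (f z)\<^sup>2 = (fb z)\<^sup>2"
      using ae by eventually_elim (simp add: indicator_def)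
  qed
  then have "L2b fb" using fb(1) fm by (simp add: L2b_def integrable_completion)
  then show thesis using ae by (rule that)
qed

text \<open>For z in the half-space the translated kernel is supported strictly above z, hence is a
  test function of the half-space itself. The weak identity applies to it directly: the jump of the
  extension by 0 at the boundary is never sampled, and its sign cancels that of differentiating
  \<open>conv\<close>.\<close>

lemma conv_weak_gradient:
  assumes u: "has_weak_gradient half_space u g" and k: "kernel k" "\<And>z. k z \<noteq> 0 \<Longrightarrow> norm z \<le> \<epsilon> \<and> \<epsilon> / 4 \<le> snd z" "0 < \<epsilon>"
    and ub: "ball_integrable ub" "AE z in lebesgue. ub z = indicator half_space z * u z"
    and gb: "ball_integrable gb" "AE z in lebesgue. gb z = indicator half_space z * (g z \<bullet> b)"
    and b: "b \<in> Basis" and z: "z \<in> half_space"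
  shows "frechet_derivative (conv k ub) (at z) b = conv k gb z"
proof -
  have t: "test_function UNIV k" using k by (auto simp: kernel_def)
  have sk: "smooth k" by (rule test_function_smooth[OF t])
  have l: "locally_integrable half_space u" "locally_integrable half_space g" using u by (auto simp: has_weak_gradient_def)
  define \<phi> where "\<phi> w = k (w + (- z))" for w
  have \<phi>: "test_function half_space \<phi>"
  proof (rule test_functionI)
    show "smooth \<phi>" unfolding \<phi>_def by (rule smooth_shift[OF sk])
    have cc: "compact (cball 0 \<epsilon> \<inter> {y::'a \<times> real. \<epsilon> / 4 \<le> snd y})"
      by (intro compact_Int_closed closed_Collect_le continuous_intros compact_cball)
    show "compact ((+) z ` (cball 0 \<epsilon> \<inter> {y. \<epsilon> / 4 \<le> snd y}))"
      by (rule compact_translation[OF cc])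
    show "(+) z ` (cball 0 \<epsilon> \<inter> {y. \<epsilon> / 4 \<le> snd y}) \<subseteq> half_space"
      using z k(3) by (auto simp: half_space_def)
    show "w \<in> (+) z ` (cball 0 \<epsilon> \<inter> {y. \<epsilon> / 4 \<le> snd y})" if "\<phi> w \<noteq> 0" for w
      by (rule image_eqI[of _ _ "w - z"]) (use k(2)[of "w - z"] that in \<open>auto simp: \<phi>_def\<close>)
  qed
  have D\<phi>: "frechet_derivative \<phi> (at w) = frechet_derivative k (at (w - z))" for w
    using frechet_derivative_at[OF frechet_derivative_shift[OF sk, of "- z" w]] by (simp add: \<phi>_def[abs_def])
  have "frechet_derivative (conv k ub) (at z) b = - (LINT w|lborel. ub w * frechet_derivative k (at (w - z)) b)"
    by (subst frechet_derivative_at[OF conv_has_derivative[OF ub(1) t], symmetric]) simp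
  also have "(LINT w|lborel. ub w * frechet_derivative k (at (w - z)) b) = (LINT w|lebesgue. ub w * frechet_derivative k (at (w - z)) b)"
    using borel_measurable_integrable[OF conv_integrable[OF ub(1) test_function_partial[OF t b]]]
    by (intro integral_completion[symmetric])
  also have "\<dots> = (LINT w|lebesgue. indicator half_space w *\<^sub>R (u w * frechet_derivative \<phi> (at w) b))"
  proof (rule integral_cong_AE)
    show "(\<lambda>w. ub w * frechet_derivative k (at (w - z)) b) \<in> borel_measurable lebesgue"
      by (rule measurable_completion[OF borel_measurable_integrable[OF conv_integrable[OF ub(1) test_function_partial[OF t b]]]])
    show "(\<lambda>w. indicator half_space w *\<^sub>R (u w * frechet_derivative \<phi> (at w) b)) \<in> borel_measurable lebesgue"
      using locally_integrable_test[OF l(1) test_function_partial[OF \<phi> b]] unfolding set_integrable_def by (rule borel_measurable_integrable)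
    show "AE w in lebesgue. ub w * frechet_derivative k (at (w - z)) b = indicator half_space w *\<^sub>R (u w * frechet_derivative \<phi> (at w) b)"
      using ub(2) by eventually_elim (simp add: D\<phi>)
  qed
  also have "- \<dots> = (LINT w|lebesgue. indicator half_space w *\<^sub>R ((g w \<bullet> b) * \<phi> w))"
    using weak_gradientD[OF u \<phi> b] by (simp add: set_lebesgue_integral_def)
  also have "\<dots> = (LINT w|lebesgue. gb w * k (w - z))"
  proof (rule integral_cong_AE)
    show "(\<lambda>w. gb w * k (w - z)) \<in> borel_measurable lebesgue"
      by (rule measurable_completion[OF borel_measurable_integrable[OF conv_integrable[OF gb(1) t]]])
    show "(\<lambda>w. indicator half_space w *\<^sub>R ((g w \<bullet> b) * \<phi> w)) \<in> borel_measurable lebesgue"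
      using locally_integrable_test[OF locally_integrable_inner[OF l(2)] \<phi>] unfolding set_integrable_def by (rule borel_measurable_integrable)
    show "AE w in lebesgue. indicator half_space w *\<^sub>R ((g w \<bullet> b) * \<phi> w) = gb w * k (w - z)"
      using gb(2) by eventually_elim (simp add: \<phi>_def)
  qed
  also have "\<dots> = conv k gb z"
    unfolding conv_def using borel_measurable_integrable[OF conv_integrable[OF gb(1) t]]
    by (intro integral_completion)
  finally show ?thesis .
qed

lemma half_error_le:
  fixes f fb \<psi> :: "'a::euclidean_space \<times> real \<Rightarrow> real"
  assumes ae: "AE z in lebesgue. fb z = indicator half_space z * f z"
    and eq: "\<And>z. z \<in> half_space \<Longrightarrow> \<psi> z = \<psi>' z"
  shows "(\<integral>\<^sup>+ z. ennreal ((\<psi> z - f z)\<^sup>2) \<partial>half_measure) \<le> (\<integral>\<^sup>+ z. ennreal ((\<psi>' z - fb z)\<^sup>2) \<partial>lborel)"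
proof -
  have "(\<integral>\<^sup>+ z. ennreal ((\<psi> z - f z)\<^sup>2) \<partial>half_measure) \<le> (\<integral>\<^sup>+ z. ennreal ((\<psi>' z - fb z)\<^sup>2) \<partial>lebesgue)"
    unfolding nn_integral_half
    by (intro nn_integral_mono_AE eventually_mono[OF ae]) (auto simp: indicator_def eq)
  then show ?thesis by (simp add: nn_integral_completion)
qed

lemma mollify_density:
  fixes u :: "'a::euclidean_space \<times> real \<Rightarrow> real"
  assumes u: "has_weak_gradient half_space u g" and L: "L2_on half_space u" "L2_on half_space g"
    and R: "\<And>z. z \<in> half_space \<Longrightarrow> R < norm z \<Longrightarrow> u z = 0" and \<delta>: "0 < \<delta>"
  obtains \<psi> where "test_function UNIV \<psi>" "(\<integral>\<^sup>+ z. ennreal ((\<psi> z - u z)\<^sup>2) \<partial>half_measure) \<le> ennreal \<delta>"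
    "\<And>b. b \<in> Basis \<Longrightarrow> (\<integral>\<^sup>+ z. ennreal ((frechet_derivative \<psi> (at z) b - g z \<bullet> b)\<^sup>2) \<partial>half_measure) \<le> ennreal \<delta>"
proof -
  have um: "u \<in> borel_measurable half_measure" "integrable half_measure (\<lambda>z. (u z)\<^sup>2)" using L by (auto simp: L2_on_half)
  have gm: "(\<lambda>z. g z \<bullet> b) \<in> borel_measurable half_measure" "integrable half_measure (\<lambda>z. (g z \<bullet> b)\<^sup>2)" if "b \<in> Basis" for b
  proof -
    show m: "(\<lambda>z. g z \<bullet> b) \<in> borel_measurable half_measure" using L by (auto simp: L2_on_half)
    show "integrable half_measure (\<lambda>z. (g z \<bullet> b)\<^sup>2)"
      by (rule Bochner_Integration.integrable_bound[of _ "\<lambda>z. (norm (g z))\<^sup>2"])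
         (use L m that Basis_le_norm in \<open>auto simp: L2_on_half abs_le_square_iff[symmetric]\<close>)
  qed
  obtain u1 where u1: "L2b u1" "AE z in lebesgue. u1 z = indicator half_space z * u z" using L2_borel_version[OF um] by metis
  \<comment> \<open>The Borel version vanishes beyond R only almost everywhere; cutting once more
    gives the mollification honest compact support.\<close>
  define ub where "ub z = indicator (cball 0 R) z * u1 z" for z
  have ub: "L2b ub"
    unfolding L2b_def
  proof
    show m: "ub \<in> borel_measurable borel"
      unfolding ub_def using u1(1) by (intro borel_measurable_times borel_measurable_indicator) (auto simp: L2b_def)
    show "integrable lborel (\<lambda>z. (ub z)\<^sup>2)"
      by (rule Bochner_Integration.integrable_bound[of _ "\<lambda>z. (u1 z)\<^sup>2"]) (use u1(1) m in \<open>auto simp: L2b_def ub_def indicator_def\<close>)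
  qed
  have ubae: "AE z in lebesgue. ub z = indicator half_space z * u z"
    using u1(2) by eventually_elim (auto simp: ub_def indicator_def R)
  have ub0: "ub z = 0" if "R < norm z" for z using that by (simp add: ub_def)
  have "\<forall>b\<in>Basis. \<exists>gb. L2b gb \<and> (AE z in lebesgue. gb z = indicator half_space z * (g z \<bullet> b))"
    using L2_borel_version[OF gm] by metis
  from bchoice[OF this] obtain gb where gb: "\<And>b. b \<in> Basis \<Longrightarrow> L2b (gb b)"
    "\<And>b. b \<in> Basis \<Longrightarrow> AE z in lebesgue. gb b z = indicator half_space z * (g z \<bullet> b)" by blast
  obtain \<epsilon>0 where \<epsilon>0: "0 < \<epsilon>0" "\<And>k. kernel k \<Longrightarrow> (\<And>z. k z \<noteq> 0 \<Longrightarrow> norm z \<le> \<epsilon>0) \<Longrightarrow>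
      (\<integral>\<^sup>+ x. ennreal ((conv k ub x - ub x)\<^sup>2) \<partial>lborel) \<le> ennreal \<delta>" using conv_L2_tendsto[OF ub \<delta>] by metis
  have "\<forall>b\<in>Basis. \<exists>\<epsilon>. 0 < \<epsilon> \<and> (\<forall>k. kernel k \<longrightarrow> (\<forall>z. k z \<noteq> 0 \<longrightarrow> norm z \<le> \<epsilon>) \<longrightarrow>
      (\<integral>\<^sup>+ x. ennreal ((conv k (gb b) x - gb b x)\<^sup>2) \<partial>lborel) \<le> ennreal \<delta>)"
  proof
    fix b :: "'a \<times> real" assume "b \<in> Basis"
    from conv_L2_tendsto[OF gb(1)[OF this] \<delta>] show "\<exists>\<epsilon>. 0 < \<epsilon> \<and> (\<forall>k. kernel k \<longrightarrow> (\<forall>z. k z \<noteq> 0 \<longrightarrow> norm z \<le> \<epsilon>) \<longrightarrow>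
      (\<integral>\<^sup>+ x. ennreal ((conv k (gb b) x - gb b x)\<^sup>2) \<partial>lborel) \<le> ennreal \<delta>)" by blast
  qed
  from bchoice[OF this] obtain \<epsilon>b where \<epsilon>b: "\<And>b. b \<in> Basis \<Longrightarrow> 0 < \<epsilon>b b" "\<And>b k. b \<in> Basis \<Longrightarrow> kernel k \<Longrightarrow> (\<And>z. k z \<noteq> 0 \<Longrightarrow> norm z \<le> \<epsilon>b b) \<Longrightarrow>
      (\<integral>\<^sup>+ x. ennreal ((conv k (gb b) x - gb b x)\<^sup>2) \<partial>lborel) \<le> ennreal \<delta>" by blast
  \<comment> \<open>A single kernel has to serve the function and all components of its
    gradient.\<close>
  define \<epsilon> where "\<epsilon> = min \<epsilon>0 (Min (\<epsilon>b ` Basis))"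
  have \<epsilon>: "0 < \<epsilon>" "\<epsilon> \<le> \<epsilon>0" "\<And>b. b \<in> Basis \<Longrightarrow> \<epsilon> \<le> \<epsilon>b b"
    using \<epsilon>0(1) \<epsilon>b(1) by (auto simp: \<epsilon>_def min_le_iff_disj)
  obtain k :: "'a \<times> real \<Rightarrow> real" where k: "kernel k" "\<And>z. k z \<noteq> 0 \<Longrightarrow> norm z \<le> \<epsilon> \<and> \<epsilon> / 4 \<le> snd z"
    using kernel_upper[OF \<epsilon>(1)] by metis
  have t: "test_function UNIV k" using k by (auto simp: kernel_def)
  note ubi = L2b_ball_integrable[OF ub] and gbi = L2b_ball_integrable[OF gb(1)]
  have supp: "conv k ub z = 0" if "R + \<epsilon> < norm z" for z
    by (rule conv_support[of R ub k \<epsilon> z]) (use ub0 k(2) that in auto)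
  show thesis
  proof (rule that[of "conv k ub"])
    show "test_function UNIV (conv k ub)"
      by (rule test_functionI[of _ "cball 0 (R + \<epsilon>)"]) (use smooth_conv[OF ubi t] supp in \<open>auto simp: not_le[symmetric]\<close>)
    have "(\<integral>\<^sup>+ z. ennreal ((conv k ub z - u z)\<^sup>2) \<partial>half_measure) \<le> (\<integral>\<^sup>+ z. ennreal ((conv k ub z - ub z)\<^sup>2) \<partial>lborel)"
      by (rule half_error_le[OF ubae]) simp
    also have "\<dots> \<le> ennreal \<delta>" by (rule \<epsilon>0(2)[OF k(1)]) (use k(2) \<epsilon>(2) in force)
    finally show "(\<integral>\<^sup>+ z. ennreal ((conv k ub z - u z)\<^sup>2) \<partial>half_measure) \<le> ennreal \<delta>" .
    fix b :: "'a \<times> real" assume b: "b \<in> Basis"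
    have "(\<integral>\<^sup>+ z. ennreal ((frechet_derivative (conv k ub) (at z) b - g z \<bullet> b)\<^sup>2) \<partial>half_measure)
       \<le> (\<integral>\<^sup>+ z. ennreal ((conv k (gb b) z - gb b z)\<^sup>2) \<partial>lborel)"
      by (rule half_error_le[OF gb(2)[OF b]])
         (rule conv_weak_gradient[OF u k \<epsilon>(1) ubi ubae gbi[OF b] gb(2)[OF b] b])
    also have "\<dots> \<le> ennreal \<delta>" by (rule \<epsilon>b(2)[OF b k(1)]) (use k(2) \<epsilon>(3)[OF b] in force)
    finally show "(\<integral>\<^sup>+ z. ennreal ((frechet_derivative (conv k ub) (at z) b - g z \<bullet> b)\<^sup>2) \<partial>half_measure) \<le> ennreal \<delta>" .
  qed
qed

section \<open>Density of test functions, traces and the inequality\<close>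

lemma flat_exp_2_bound: "\<bar>flat_exp 2 x\<bar> \<le> 4"
proof (cases "0 < x")
  case True
  define y where "y = inverse x"
  have y: "0 < y" using True by (simp add: y_def)
  have "y / 2 \<le> exp (y / 2)" using exp_ge_add_one_self[of "y / 2"] by linarith
  then have "(y / 2)\<^sup>2 \<le> (exp (y / 2))\<^sup>2" using y by (intro power_mono) simp_all
  also have "(exp (y / 2))\<^sup>2 = exp y" by (simp add: exp_double[symmetric])
  finally have "y\<^sup>2 \<le> 4 * exp y" by (simp add: power_divide)
  then have "y\<^sup>2 * exp (- y) \<le> 4" by (simp add: exp_minus field_simps)
  then show ?thesis using True by (simp add: flat_exp_def y_def)
qed (simp add: flat_exp_def)

text \<open>The factor exp 1 normalises the value at the origin to 1. The support has radius n + 1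
  and the values tend to 1 pointwise without being constant on any ball, which is enough for
  dominated convergence.\<close>

definition cutoff :: "nat \<Rightarrow> 'a::euclidean_space \<Rightarrow> real" where
  "cutoff n z = exp 1 * flat_exp 0 (1 - ((1 / real (Suc n))\<^sup>2) * (z \<bullet> z))"

lemma cutoff_GDERIV:
  "GDERIV (cutoff n) z :> (exp 1 * flat_exp 2 (1 - ((1 / real (Suc n))\<^sup>2) * (z \<bullet> z)) * (- 2 * (1 / real (Suc n))\<^sup>2)) *\<^sub>R z"
proof -
  let ?c = "(1 / real (Suc n))\<^sup>2"
  have "((\<lambda>z. 1 - ?c * (z \<bullet> z)) has_derivative (\<lambda>v. v \<bullet> ((- 2 * ?c) *\<^sub>R z))) (at z)"
    by (rule derivative_eq_intros refl | simp add: inner_commute mult_ac)+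
  then have "GDERIV (\<lambda>z. 1 - ?c * (z \<bullet> z)) z :> (- 2 * ?c) *\<^sub>R z" by (simp add: gderiv_def)
  moreover have "DERIV (\<lambda>x. exp 1 * flat_exp 0 x) (1 - ?c * (z \<bullet> z)) :> exp 1 * flat_exp 2 (1 - ?c * (z \<bullet> z))"
    using DERIV_cmult[OF flat_exp_DERIV[of 0 "1 - ?c * (z \<bullet> z)"], of "exp 1"] by (simp add: numeral_2_eq_2)
  ultimately have "GDERIV (\<lambda>z. exp 1 * flat_exp 0 (1 - ?c * (z \<bullet> z))) z :> (exp 1 * flat_exp 2 (1 - ?c * (z \<bullet> z))) *\<^sub>R ((- 2 * ?c) *\<^sub>R z)"
    by (rule GDERIV_DERIV_compose)
  then show ?thesis by (simp add: cutoff_def[abs_def])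
qed

lemma smooth_cutoff: "smooth (cutoff n)"
proof -
  let ?c = "(1 / real (Suc n))\<^sup>2"
  have "smooth (\<lambda>z::'a. 1 - ?c * (z \<bullet> z))"
  proof (rule smoothI)
    show "((\<lambda>z::'a. 1 - ?c * (z \<bullet> z)) has_derivative (\<lambda>v. (- 2 * ?c) * ((x - 0) \<bullet> v))) (at x)" for x
      by (rule derivative_eq_intros refl | simp add: inner_commute mult_ac)+
  qed (intro smooth_mult smooth_const smooth_affine)
  then show ?thesis unfolding cutoff_def[abs_def] by (intro smooth_mult smooth_const smooth_flat_exp)
qed

lemma gderiv_unique: "GDERIV f z :> a \<Longrightarrow> GDERIV f z :> b \<Longrightarrow> a = b"
proof -
  assume "GDERIV f z :> a" "GDERIV f z :> b"
  then have "(\<lambda>h. h \<bullet> a) = (\<lambda>h. h \<bullet> b)" unfolding gderiv_def by (rule has_derivative_unique)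
  then have "\<And>h. h \<bullet> a = h \<bullet> b" by (rule fun_cong)
  then show "a = b" using vector_eq_ldot by blast
qed

lemma cutoff_range: "0 \<le> cutoff n z" "cutoff n z \<le> 1" "real (Suc n) < norm z \<Longrightarrow> cutoff n z = 0"
proof -
  let ?c = "(1 / real (Suc n))\<^sup>2"
  have z: "z \<bullet> z = (norm z)\<^sup>2" by (simp add: power2_norm_eq_inner)
  show "0 \<le> cutoff n z" by (simp add: cutoff_def flat_exp_def)
  show "cutoff n z \<le> 1"
  proof (cases "0 < 1 - ?c * (z \<bullet> z)")
    case True
    have "1 - ?c * (z \<bullet> z) \<le> 1" unfolding z by simp
    then have "1 \<le> inverse (1 - ?c * (z \<bullet> z))" using True by (rule one_le_inverse[rotated])
    then show ?thesis using True by (simp add: cutoff_def flat_exp_def mult_exp_exp)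
  qed (simp add: cutoff_def flat_exp_def)
  assume "real (Suc n) < norm z"
  then have "(1 / real (Suc n)) * norm z > 1" by (simp add: field_simps del: of_nat_Suc)
  then have "((1 / real (Suc n)) * norm z)\<^sup>2 > 1" by (simp add: one_less_power del: of_nat_Suc)
  then have "1 < ?c * (z \<bullet> z)" by (simp only: z power_mult_distrib)
  then have "\<not> 0 < 1 - ?c * (z \<bullet> z)" by linarith
  then show "cutoff n z = 0" by (simp add: cutoff_def flat_exp_def del: of_nat_Suc)
qed

lemma cutoff_tendsto: "(\<lambda>n. cutoff n z) \<longlonglongrightarrow> 1"
proof -
  have "(\<lambda>n. 1 / real (Suc n)) \<longlonglongrightarrow> 0" using LIMSEQ_inverse_real_of_nat by (simp add: inverse_eq_divide)
  then have l: "(\<lambda>n. 1 - (1 / real (Suc n))\<^sup>2 * (z \<bullet> z)) \<longlonglongrightarrow> 1 - 0\<^sup>2 * (z \<bullet> z)" by (intro tendsto_intros)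
  have "isCont (flat_exp 0) 1" by (rule DERIV_isCont[OF flat_exp_DERIV])
  from isCont_tendsto_compose[OF this] l have "(\<lambda>n. flat_exp 0 (1 - (1 / real (Suc n))\<^sup>2 * (z \<bullet> z))) \<longlonglongrightarrow> flat_exp 0 1" by simp
  then have "(\<lambda>n. cutoff n z) \<longlonglongrightarrow> exp 1 * flat_exp 0 1" unfolding cutoff_def by (intro tendsto_intros)
  then show ?thesis by (simp add: flat_exp_def mult_exp_exp)
qed

lemma cutoff_grad_bound: "norm (grad (cutoff n) z) \<le> 8 * exp 1 * (1 / real (Suc n))"
proof -
  let ?c = "(1 / real (Suc n))\<^sup>2"
  have g: "grad (cutoff n) z = (exp 1 * flat_exp 2 (1 - ?c * (z \<bullet> z)) * (- 2 * ?c)) *\<^sub>R z"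
    by (rule gderiv_unique[OF smooth_GDERIV[OF smooth_cutoff] cutoff_GDERIV])
  show ?thesis
  proof (cases "real (Suc n) < norm z")
    case True
    have "open {z::'a. real (Suc n) < norm z}" by (intro open_Collect_less continuous_intros)
    then have "GDERIV (cutoff n) z :> 0"
      unfolding gderiv_def inner_zero_right
      by (rule has_derivative_transform_within_open[OF has_derivative_const[of 0]]) (use True cutoff_range(3) in auto)
    then have "grad (cutoff n) z = 0" by (rule gderiv_unique[OF smooth_GDERIV[OF smooth_cutoff]])
    then show ?thesis by simp
  next
    case False
    then have "(1 / real (Suc n)) * norm z \<le> 1" by (simp add: field_simps del: of_nat_Suc)
    then have "(1 / real (Suc n)) * ((1 / real (Suc n)) * norm z) \<le> (1 / real (Suc n)) * 1" by (intro mult_left_mono) auto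
    then have c: "?c * norm z \<le> 1 / real (Suc n)" by (simp add: power2_eq_square mult.assoc)
    have "norm (grad (cutoff n) z) = exp 1 * \<bar>flat_exp 2 (1 - ?c * (z \<bullet> z))\<bar> * 2 * (?c * norm z)"
      unfolding g by (simp add: abs_mult)
    also have "\<dots> \<le> exp 1 * 4 * 2 * (1 / real (Suc n))"
      using c by (intro mult_mono flat_exp_2_bound) auto
    finally show ?thesis by simp
  qed
qed

lemma nn_sq_triangle:
  fixes f g h :: "'b \<Rightarrow> 'c::euclidean_space"
  assumes [measurable]: "f \<in> borel_measurable M" "g \<in> borel_measurable M" "h \<in> borel_measurable M"
    and "(\<integral>\<^sup>+ x. ennreal ((norm (f x - g x))\<^sup>2) \<partial>M) \<le> ennreal a" "(\<integral>\<^sup>+ x. ennreal ((norm (g x - h x))\<^sup>2) \<partial>M) \<le> ennreal b"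
    and ab: "0 \<le> a" "0 \<le> b"
  shows "(\<integral>\<^sup>+ x. ennreal ((norm (f x - h x))\<^sup>2) \<partial>M) \<le> ennreal (2 * a + 2 * b)"
proof -
  have "(norm (f x - h x))\<^sup>2 \<le> 2 * (norm (f x - g x))\<^sup>2 + 2 * (norm (g x - h x))\<^sup>2" for x
  proof -
    have "norm (f x - h x) \<le> norm (f x - g x) + norm (g x - h x)" using norm_triangle_ineq[of "f x - g x" "g x - h x"] by simp
    then have "(norm (f x - h x))\<^sup>2 \<le> (norm (f x - g x) + norm (g x - h x))\<^sup>2" by (intro power_mono) auto
    also have "\<dots> \<le> 2 * (norm (f x - g x))\<^sup>2 + 2 * (norm (g x - h x))\<^sup>2"
      using sum_squares_bound[of "norm (f x - g x)" "norm (g x - h x)"] by (simp add: power2_sum)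
    finally show ?thesis .
  qed
  then have "(\<integral>\<^sup>+ x. ennreal ((norm (f x - h x))\<^sup>2) \<partial>M) \<le> (\<integral>\<^sup>+ x. 2 * ennreal ((norm (f x - g x))\<^sup>2) + 2 * ennreal ((norm (g x - h x))\<^sup>2) \<partial>M)"
    by (intro nn_integral_mono)
       (simp add: ennreal_mult'[of 2, simplified, symmetric] ennreal_plus[symmetric] ennreal_leI del: ennreal_plus)
  also have "\<dots> = 2 * (\<integral>\<^sup>+ x. ennreal ((norm (f x - g x))\<^sup>2) \<partial>M) + 2 * (\<integral>\<^sup>+ x. ennreal ((norm (g x - h x))\<^sup>2) \<partial>M)"
    by (simp add: nn_integral_add nn_integral_cmult)
  also have "\<dots> \<le> 2 * ennreal a + 2 * ennreal b" by (intro add_mono mult_left_mono assms) auto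
  also have "\<dots> = ennreal (2 * a + 2 * b)" using ab
    by (simp add: ennreal_mult'[of 2, simplified, symmetric] ennreal_plus[symmetric] del: ennreal_plus)
  finally show ?thesis .
qed

lemma dominated_nn_le:
  fixes F :: "nat \<Rightarrow> 'b \<Rightarrow> real"
  assumes "\<And>n. F n \<in> borel_measurable M" "integrable M w" "\<And>n x. x \<in> space M \<Longrightarrow> 0 \<le> F n x \<and> F n x \<le> w x"
    "\<And>x. x \<in> space M \<Longrightarrow> (\<lambda>n. F n x) \<longlonglongrightarrow> 0" "0 < \<delta>"
  shows "\<forall>\<^sub>F n in sequentially. (\<integral>\<^sup>+ x. ennreal (F n x) \<partial>M) \<le> ennreal \<delta>"
proof -
  have "(\<lambda>n. LINT x|M. F n x) \<longlonglongrightarrow> (LINT x|M. 0)"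
    by (rule integral_dominated_convergence[of _ _ _ w]) (use assms in auto)
  then have "\<forall>\<^sub>F n in sequentially. (LINT x|M. F n x) < \<delta>"
    by (rule order_tendstoD) (use assms(5) in simp)
  moreover
  have "integrable M (F n)" for n
  proof (rule Bochner_Integration.integrable_bound[OF assms(2) assms(1)], intro AE_I2)
    show "norm (F n x) \<le> norm (w x)" if "x \<in> space M" for x using assms(3)[OF that, of n] by simp
  qed
  then have "(\<integral>\<^sup>+ x. ennreal (F n x) \<partial>M) = ennreal (LINT x|M. F n x)" for n
    by (rule nn_integral_eq_integral) (intro AE_I2, use assms(3) in simp)
  ultimately show ?thesis by (auto elim!: eventually_mono intro!: ennreal_leI)
qed

text \<open>Cutting off first produces the bounded support that mollification from above asks for.
  The product rule adds u grad (\<open>cutoff\<close> n), which is of order 1/(n+1) times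
  |u|.\<close>

lemma smooth_density:
  fixes u :: "'a::euclidean_space \<times> real \<Rightarrow> real"
  assumes u: "has_weak_gradient half_space u g" and L: "L2_on half_space u" "L2_on half_space g" and \<delta>: "0 < \<delta>"
  obtains \<psi> where "test_function UNIV \<psi>" "(\<integral>\<^sup>+ z. ennreal ((\<psi> z - u z)\<^sup>2) \<partial>half_measure) \<le> ennreal \<delta>"
    "(\<integral>\<^sup>+ z. ennreal ((norm (grad \<psi> z - g z))\<^sup>2) \<partial>half_measure) \<le> ennreal \<delta>"
proof -
  have um [measurable]: "u \<in> borel_measurable half_measure" and ui: "integrable half_measure (\<lambda>z. (u z)\<^sup>2)"
    and gm [measurable]: "g \<in> borel_measurable half_measure" and gi: "integrable half_measure (\<lambda>z. (norm (g z))\<^sup>2)" using L by (auto simp: L2_on_half)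
  have cm [measurable]: "cutoff n \<in> borel_measurable half_measure" for n
    by (intro borel_half borel_measurable_continuous_onI smooth_continuous smooth_cutoff)
  have dm [measurable]: "grad (cutoff n) \<in> borel_measurable half_measure" for n
    by (intro measurable_restrict_space1 measurable_completion)
       (simp add: borel_measurable_continuous_onI smooth_grad_continuous smooth_cutoff)
  define v where "v n z = cutoff n z *\<^sub>R u z" for n z
  define k where "k n z = cutoff n z *\<^sub>R g z + u z *\<^sub>R grad (cutoff n) z" for n z
  have vm [measurable]: "v n \<in> borel_measurable half_measure" and km [measurable]: "k n \<in> borel_measurable half_measure" for n
    unfolding v_def k_def by measurable
  have c1: "\<bar>cutoff n z - 1\<bar> \<le> 1" for n and z :: "'a \<times> real" using cutoff_range(1,2)[of n z] by auto
  have 1: "\<forall>\<^sub>F n in sequentially. (\<integral>\<^sup>+ z. ennreal ((norm (v n z - u z))\<^sup>2) \<partial>half_measure) \<le> ennreal (\<delta> / 4)"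
  proof (rule dominated_nn_le)
    show "integrable half_measure (\<lambda>z. (u z)\<^sup>2)" by (rule ui)
    have e: "norm (v n z - u z) = \<bar>cutoff n z - 1\<bar> * \<bar>u z\<bar>" for n z
      by (simp add: v_def abs_mult[symmetric] algebra_simps)
    show "0 \<le> (norm (v n z - u z))\<^sup>2 \<and> (norm (v n z - u z))\<^sup>2 \<le> (u z)\<^sup>2" for n z
    proof -
      have "norm (v n z - u z) \<le> \<bar>u z\<bar>" unfolding e using c1[of n z] by (intro mult_left_le_one_le) auto
      then have "(norm (v n z - u z))\<^sup>2 \<le> \<bar>u z\<bar>\<^sup>2" by (intro power_mono) auto
      then show ?thesis by simp
    qed
    show "(\<lambda>n. (norm (v n z - u z))\<^sup>2) \<longlonglongrightarrow> 0" for z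
    proof -
      have "(\<lambda>n. (\<bar>cutoff n z - 1\<bar> * \<bar>u z\<bar>)\<^sup>2) \<longlonglongrightarrow> (\<bar>1 - 1\<bar> * \<bar>u z\<bar>)\<^sup>2" by (intro tendsto_intros cutoff_tendsto)
      then show ?thesis unfolding e by simp
    qed
  qed (use \<delta> in \<open>measurable, auto\<close>)
  have 2: "\<forall>\<^sub>F n in sequentially. (\<integral>\<^sup>+ z. ennreal ((norm (k n z - g z))\<^sup>2) \<partial>half_measure) \<le> ennreal (\<delta> / 4)"
  proof (rule dominated_nn_le)
    show "integrable half_measure (\<lambda>z. 2 * (norm (g z))\<^sup>2 + 2 * (8 * exp 1)\<^sup>2 * (u z)\<^sup>2)"
      using ui gi by simp
    have e: "norm (k n z - g z) \<le> \<bar>cutoff n z - 1\<bar> * norm (g z) + \<bar>u z\<bar> * (8 * exp 1 * (1 / real (Suc n)))" for n z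
    proof -
      have "k n z - g z = (cutoff n z - 1) *\<^sub>R g z + u z *\<^sub>R grad (cutoff n) z" by (simp add: k_def algebra_simps)
      then have "norm (k n z - g z) \<le> \<bar>cutoff n z - 1\<bar> * norm (g z) + \<bar>u z\<bar> * norm (grad (cutoff n) z)"
        using norm_triangle_ineq[of "(cutoff n z - 1) *\<^sub>R g z" "u z *\<^sub>R grad (cutoff n) z"] by simp
      also have "\<bar>u z\<bar> * norm (grad (cutoff n) z) \<le> \<bar>u z\<bar> * (8 * exp 1 * (1 / real (Suc n)))"
        by (intro mult_left_mono cutoff_grad_bound) auto
      finally show ?thesis by simp
    qed
    show "0 \<le> (norm (k n z - g z))\<^sup>2 \<and> (norm (k n z - g z))\<^sup>2 \<le> 2 * (norm (g z))\<^sup>2 + 2 * (8 * exp 1)\<^sup>2 * (u z)\<^sup>2" for n z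
    proof -
      have "\<bar>cutoff n z - 1\<bar> * norm (g z) \<le> norm (g z)" using c1[of n z] by (intro mult_left_le_one_le) auto
      moreover have "\<bar>u z\<bar> * (8 * exp 1 * (1 / real (Suc n))) \<le> \<bar>u z\<bar> * (8 * exp 1 * 1)"
        by (intro mult_left_mono) auto
      ultimately have "norm (k n z - g z) \<le> norm (g z) + \<bar>u z\<bar> * (8 * exp 1)" using e[of n z] by simp
      then have "(norm (k n z - g z))\<^sup>2 \<le> (norm (g z) + \<bar>u z\<bar> * (8 * exp 1))\<^sup>2" by (intro power_mono) auto
      also have "\<dots> \<le> 2 * (norm (g z))\<^sup>2 + 2 * (\<bar>u z\<bar> * (8 * exp 1))\<^sup>2"
        using sum_squares_bound[of "norm (g z)" "\<bar>u z\<bar> * (8 * exp 1)"] by (simp add: power2_sum)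
      finally show ?thesis by (simp add: power_mult_distrib mult_ac)
    qed
    show "(\<lambda>n. (norm (k n z - g z))\<^sup>2) \<longlonglongrightarrow> 0" for z
    proof -
      have i: "(\<lambda>n. 1 / real (Suc n)) \<longlonglongrightarrow> 0" using LIMSEQ_inverse_real_of_nat by (simp add: inverse_eq_divide)
      have "(\<lambda>n. \<bar>cutoff n z - 1\<bar> * norm (g z) + \<bar>u z\<bar> * (8 * exp 1 * (1 / real (Suc n)))) \<longlonglongrightarrow> \<bar>1 - 1\<bar> * norm (g z) + \<bar>u z\<bar> * (8 * exp 1 * 0)"
        by (intro tendsto_intros cutoff_tendsto i)
      then have r: "(\<lambda>n. \<bar>cutoff n z - 1\<bar> * norm (g z) + \<bar>u z\<bar> * (8 * exp 1 * (1 / real (Suc n)))) \<longlonglongrightarrow> 0" by simp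
      have "(\<lambda>n. norm (k n z - g z)) \<longlonglongrightarrow> 0"
        by (rule tendsto_sandwich[OF _ _ tendsto_const r]) (use e in auto)
      then show ?thesis using tendsto_power[of "\<lambda>n. norm (k n z - g z)" 0 sequentially 2] by simp
    qed
  qed (use \<delta> in \<open>measurable, auto\<close>)
  obtain n where n: "(\<integral>\<^sup>+ z. ennreal ((norm (v n z - u z))\<^sup>2) \<partial>half_measure) \<le> ennreal (\<delta> / 4)"
    "(\<integral>\<^sup>+ z. ennreal ((norm (k n z - g z))\<^sup>2) \<partial>half_measure) \<le> ennreal (\<delta> / 4)"
    using eventually_happens'[OF _ eventually_conj[OF 1 2]] by auto
  have w: "has_weak_gradient half_space (v n) (k n)"
    unfolding v_def[abs_def] k_def[abs_def] by (rule weak_gradient_mult[OF u smooth_cutoff])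
  \<comment> \<open>Square integrability of the cut-off pair is read off from its finite L^2
    distance to the original pair.\<close>
  have fin: "integrable M (\<lambda>x. (norm (F x))\<^sup>2)" if F [measurable]: "F \<in> borel_measurable M" "G \<in> borel_measurable M" and
    "integrable M (\<lambda>x. (norm (G x))\<^sup>2)" "(\<integral>\<^sup>+ x. ennreal ((norm (F x - G x))\<^sup>2) \<partial>M) \<le> ennreal d" "0 \<le> d"
    for M :: "('a \<times> real) measure" and F G :: "'a \<times> real \<Rightarrow> 'c::euclidean_space" and d
  proof -
    have "(\<integral>\<^sup>+ x. ennreal ((norm (G x - 0))\<^sup>2) \<partial>M) \<le> ennreal (LINT x|M. (norm (G x))\<^sup>2)"
      by (subst nn_integral_eq_integral) (use that in auto)
    moreover have "0 \<le> (LINT x|M. (norm (G x))\<^sup>2)" by (intro Bochner_Integration.integral_nonneg) auto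
    ultimately have "(\<integral>\<^sup>+ x. ennreal ((norm (F x - 0))\<^sup>2) \<partial>M) \<le> ennreal (2 * d + 2 * (LINT x|M. (norm (G x))\<^sup>2))"
      using that by (intro nn_sq_triangle[of F M G "\<lambda>_. 0"]) auto
    also have "\<dots> < \<infinity>" by simp
    finally show ?thesis by (intro integrableI_bounded) auto
  qed
  have Lv: "L2_on half_space (v n)" "L2_on half_space (k n)"
    using fin[OF vm um _ n(1)] fin[OF km gm _ n(2)] ui gi \<delta> by (auto simp: L2_on_half)
  \<comment> \<open>The squared gradient error is a sum of m component errors, so each component is
    allowed only the m-th part of \<delta>/4.\<close>
  define m where "m = real DIM('a \<times> real)"
  have m: "1 \<le> m" unfolding m_def using DIM_positive[where 'a="'a \<times> real"] by linarith
  obtain \<psi> where \<psi>: "test_function UNIV \<psi>" "(\<integral>\<^sup>+ z. ennreal ((\<psi> z - v n z)\<^sup>2) \<partial>half_measure) \<le> ennreal (\<delta> / (4 * m))"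
    "\<And>b. b \<in> Basis \<Longrightarrow> (\<integral>\<^sup>+ z. ennreal ((frechet_derivative \<psi> (at z) b - k n z \<bullet> b)\<^sup>2) \<partial>half_measure) \<le> ennreal (\<delta> / (4 * m))"
    using mollify_density[OF w Lv, of "real (Suc n)" "\<delta> / (4 * m)"] cutoff_range(3) \<delta> m by (auto simp: v_def)
  have sm: "smooth \<psi>" by (rule test_function_smooth[OF \<psi>(1)])
  have \<psi>m [measurable]: "\<psi> \<in> borel_measurable half_measure"
    by (intro borel_half borel_measurable_continuous_onI smooth_continuous sm)
  have \<psi>dm [measurable]: "(\<lambda>z. frechet_derivative \<psi> (at z) b) \<in> borel_measurable half_measure" if "b \<in> Basis" for b
    by (intro borel_half borel_measurable_continuous_onI smooth_continuous smooth_partial sm that)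
  have gr [measurable]: "grad \<psi> \<in> borel_measurable half_measure"
    by (intro measurable_restrict_space1 measurable_completion)
       (simp add: borel_measurable_continuous_onI smooth_grad_continuous sm)
  have d4: "\<delta> / (4 * m) \<le> \<delta> / 4" using \<delta> m by (simp add: field_simps)
  have "(\<integral>\<^sup>+ z. ennreal ((norm (grad \<psi> z - k n z))\<^sup>2) \<partial>half_measure) =
      (\<integral>\<^sup>+ z. (\<Sum>b\<in>Basis. ennreal ((frechet_derivative \<psi> (at z) b - k n z \<bullet> b)\<^sup>2)) \<partial>half_measure)"
  proof (rule nn_integral_cong)
    fix z
    have "(norm (grad \<psi> z - k n z))\<^sup>2 = (\<Sum>b\<in>Basis. (frechet_derivative \<psi> (at z) b - k n z \<bullet> b)\<^sup>2)"
      unfolding power2_norm_eq_inner by (subst euclidean_inner) (simp add: inner_diff_left grad_inner power2_eq_square)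
    then show "ennreal ((norm (grad \<psi> z - k n z))\<^sup>2) = (\<Sum>b\<in>Basis. ennreal ((frechet_derivative \<psi> (at z) b - k n z \<bullet> b)\<^sup>2))" by simp
  qed
  also have "\<dots> = (\<Sum>b\<in>Basis. (\<integral>\<^sup>+ z. ennreal ((frechet_derivative \<psi> (at z) b - k n z \<bullet> b)\<^sup>2) \<partial>half_measure))"
    by (rule nn_integral_sum) measurable
  also have "\<dots> \<le> (\<Sum>b\<in>(Basis :: ('a \<times> real) set). ennreal (\<delta> / (4 * m)))" by (intro sum_mono \<psi>(3))
  also have "\<dots> = ennreal (m * (\<delta> / (4 * m)))" unfolding sum_constant m_def
    using \<delta> by (subst ennreal_mult) (auto simp: ennreal_of_nat_eq_real_of_nat)
  also have "m * (\<delta> / (4 * m)) = \<delta> / 4" using m by simp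
  finally have 3: "(\<integral>\<^sup>+ z. ennreal ((norm (grad \<psi> z - k n z))\<^sup>2) \<partial>half_measure) \<le> ennreal (\<delta> / 4)" .
  have 4: "(\<integral>\<^sup>+ z. ennreal ((norm (\<psi> z - v n z))\<^sup>2) \<partial>half_measure) \<le> ennreal (\<delta> / 4)"
    using \<psi>(2) order_trans[OF _ ennreal_leI[OF d4]] by simp
  show thesis
  proof (rule that[OF \<psi>(1)])
    show "(\<integral>\<^sup>+ z. ennreal ((\<psi> z - u z)\<^sup>2) \<partial>half_measure) \<le> ennreal \<delta>"
      using nn_sq_triangle[OF \<psi>m vm um 4 n(1)] \<delta> by simp
    show "(\<integral>\<^sup>+ z. ennreal ((norm (grad \<psi> z - g z))\<^sup>2) \<partial>half_measure) \<le> ennreal \<delta>"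
      using nn_sq_triangle[OF gr km gm 3 n(2)] \<delta> by simp
  qed
qed

section \<open>Existence of traces\<close>

lemma L2_limit_exists:
  fixes F :: "nat \<Rightarrow> 'a::euclidean_space \<Rightarrow> real"
  assumes [measurable]: "\<And>k. F k \<in> borel_measurable lborel"
    and le: "\<And>k j. (\<integral>\<^sup>+ x. ennreal ((F k x - F j x)\<^sup>2) \<partial>lborel) \<le> ennreal (C * (1/16) ^ k + C * (1/16) ^ j)" and C: "0 \<le> C"
  obtains f where "f \<in> borel_measurable lborel" "\<And>k. (\<integral>\<^sup>+ x. ennreal ((F k x - f x)\<^sup>2) \<partial>lborel) \<le> ennreal (C * (1/16) ^ k)"
proof -
  define f where "f x = lim (\<lambda>k. F k x)" for x
  have fm [measurable]: "f \<in> borel_measurable lborel" unfolding f_def by measurable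
  \<comment> \<open>The squared increments decay like 16^(-k) in the mean, so even with weights 2^k
    they are summable almost everywhere.\<close>
  define d where "d k x = F (Suc k) x - F k x" for k x
  have "(\<integral>\<^sup>+ x. (\<Sum>k. ennreal (2 ^ k * (d k x)\<^sup>2)) \<partial>lborel) = (\<Sum>k. \<integral>\<^sup>+ x. ennreal (2 ^ k * (d k x)\<^sup>2) \<partial>lborel)"
    unfolding d_def by (rule nn_integral_suminf) measurable
  also have "\<dots> \<le> (\<Sum>k. ennreal (2 * C * (1/8) ^ k))"
  proof (intro suminf_le allI)
    fix k
    have "(\<integral>\<^sup>+ x. ennreal (2 ^ k * (d k x)\<^sup>2) \<partial>lborel) = ennreal (2 ^ k) * (\<integral>\<^sup>+ x. ennreal ((F (Suc k) x - F k x)\<^sup>2) \<partial>lborel)"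
      unfolding d_def by (subst nn_integral_cmult[symmetric]) (auto simp: ennreal_mult)
    also have "\<dots> \<le> ennreal (2 ^ k) * ennreal (C * (1/16) ^ Suc k + C * (1/16) ^ k)" by (intro mult_left_mono le) auto
    also have "\<dots> = ennreal (2 ^ k * (C * (1/16) ^ Suc k + C * (1/16) ^ k))" using C by (subst ennreal_mult) auto
    also have "2 ^ k * (C * (1/16) ^ Suc k + C * (1/16) ^ k) \<le> 2 ^ k * (2 * C * (1/16) ^ k)"
      using C by (intro mult_left_mono) (auto simp: mult_left_le_one_le)
    also have "2 ^ k * (2 * C * (1/16) ^ k) = 2 * C * (1/8::real) ^ k"
      by (simp add: power_divide power_mult_distrib[symmetric] field_simps)
    finally show "(\<integral>\<^sup>+ x. ennreal (2 ^ k * (d k x)\<^sup>2) \<partial>lborel) \<le> ennreal (2 * C * (1/8) ^ k)"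
      by (simp add: ennreal_leI)
  qed auto
  also have "\<dots> = ennreal (\<Sum>k. 2 * C * (1/8) ^ k)"
    using C by (intro suminf_ennreal2 summable_mult summable_geometric) auto
  also have "\<dots> < top" by simp
  finally have "AE x in lborel. (\<Sum>k. ennreal (2 ^ k * (d k x)\<^sup>2)) \<noteq> \<infinity>"
    by (intro nn_integral_noteq_infinite) (auto simp: d_def)
  then have lim: "AE x in lborel. (\<lambda>k. F k x) \<longlonglongrightarrow> f x"
  proof (rule AE_mp, intro AE_I2 impI)
    fix x assume "(\<Sum>k. ennreal (2 ^ k * (d k x)\<^sup>2)) \<noteq> \<infinity>"
    then have "summable (\<lambda>k. 2 ^ k * (d k x)\<^sup>2)" by (intro summable_suminf_not_top) auto
    then have "summable (\<lambda>k. (1/2) ^ k + 2 ^ k * (d k x)\<^sup>2)" by (intro summable_add summable_geometric) auto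
    \<comment> \<open>Either |d| is at most 2^(-k), or 2^k |d| >= 1 and then |d| <= 2^k d^2.\<close>
    moreover have "norm (d k x) \<le> (1/2) ^ k + 2 ^ k * (d k x)\<^sup>2" for k
    proof (cases "\<bar>d k x\<bar> \<le> (1/2) ^ k")
      case True
      moreover have "0 \<le> 2 ^ k * (d k x)\<^sup>2" by simp
      ultimately show ?thesis unfolding real_norm_def by linarith
    next
      case False
      then have "1 \<le> 2 ^ k * \<bar>d k x\<bar>" by (simp add: power_divide field_simps)
      then have "\<bar>d k x\<bar> * 1 \<le> \<bar>d k x\<bar> * (2 ^ k * \<bar>d k x\<bar>)" by (intro mult_left_mono) auto
      then have "\<bar>d k x\<bar> \<le> 2 ^ k * (d k x)\<^sup>2" by (simp add: power2_eq_square mult_ac)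
      moreover have "(0::real) \<le> (1/2) ^ k" by simp
      ultimately show ?thesis unfolding real_norm_def by linarith
    qed
    ultimately have "summable (\<lambda>k. d k x)" by (rule summable_comparison_test'[where N=0])
    then have "(\<lambda>n. F 0 x + (\<Sum>k<n. d k x)) \<longlonglongrightarrow> F 0 x + suminf (\<lambda>k. d k x)" by (intro tendsto_intros summable_LIMSEQ)
    moreover have "F 0 x + (\<Sum>k<n. d k x) = F n x" for n
      unfolding d_def by (subst sum_lessThan_telescope) simp
    ultimately have "convergent (\<lambda>n. F n x)" by (auto simp: convergent_def)
    then show "(\<lambda>k. F k x) \<longlonglongrightarrow> f x" by (simp add: f_def convergent_LIMSEQ_iff)
  qed
  have "(\<integral>\<^sup>+ x. ennreal ((F k x - f x)\<^sup>2) \<partial>lborel) \<le> ennreal (C * (1/16) ^ k)" for k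
  proof -
    have "(\<integral>\<^sup>+ x. ennreal ((F k x - f x)\<^sup>2) \<partial>lborel) \<le> (\<integral>\<^sup>+ x. liminf (\<lambda>j. ennreal ((F k x - F j x)\<^sup>2)) \<partial>lborel)"
      by (rule nn_integral_mono_AE, rule eventually_mono[OF lim]) (intro le_liminf_of_tendsto tendsto_intros)
    also have "\<dots> \<le> liminf (\<lambda>j. \<integral>\<^sup>+ x. ennreal ((F k x - F j x)\<^sup>2) \<partial>lborel)" by (rule nn_integral_liminf) measurable
    also have "\<dots> \<le> liminf (\<lambda>j. ennreal (C * (1/16) ^ k + C * (1/16) ^ j))" by (intro Liminf_mono always_eventually allI le)
    also have "\<dots> = ennreal (C * (1/16) ^ k + C * 0)"
    proof (rule lim_imp_Liminf)
      have "(\<lambda>j. C * (1/16) ^ k + C * (1/16) ^ j) \<longlonglongrightarrow> C * (1/16) ^ k + C * 0"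
        by (intro tendsto_intros LIMSEQ_power_zero) simp
      then show "(\<lambda>j. ennreal (C * (1/16) ^ k + C * (1/16) ^ j)) \<longlonglongrightarrow> ennreal (C * (1/16) ^ k + C * 0)"
        by (rule tendsto_ennrealI)
    qed simp
    finally show ?thesis by simp
  qed
  with fm show thesis by (rule that)
qed

lemma half_measurable_AE:
  fixes f :: "'a::euclidean_space \<times> real \<Rightarrow> 'b::euclidean_space"
  assumes "f \<in> borel_measurable half_measure" "AE z in half_measure. f z = h z"
  shows "h \<in> borel_measurable half_measure"
proof -
  have "(\<lambda>z. indicator half_space z *\<^sub>R f z) \<in> borel_measurable lebesgue"
    using assms(1) by (simp add: borel_measurable_restrict_space_iff half_space_lebesgue)
  moreover have "AE z in lebesgue. indicator half_space z *\<^sub>R f z = indicator half_space z *\<^sub>R h z"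
    using assms(2) unfolding AE_half by eventually_elim (auto simp: indicator_def)
  ultimately have "(\<lambda>z. indicator half_space z *\<^sub>R h z) \<in> borel_measurable lebesgue" by (rule borel_measurable_AE)
  then show ?thesis by (simp add: borel_measurable_restrict_space_iff half_space_lebesgue)
qed

text \<open>The gradient picked by \<open>weak_gradient\<close> need not be the square-integrable
  one that membership in W^{1,2} provides. Uniqueness almost everywhere and completeness of Lebesgue
  measure carry measurability and integrability over to it.\<close>

lemma weak_gradient_props:
  assumes u: "u \<in> W12 half_space"
  shows "has_weak_gradient half_space u (weak_gradient half_space u)" "L2_on half_space (weak_gradient half_space u)" "L2_on half_space u"
    "\<And>g. has_weak_gradient half_space u g \<Longrightarrow> AE z in half_measure. weak_gradient half_space u z = g z"
proof -
  obtain g where g: "has_weak_gradient half_space u g" "L2_on half_space g" using u by (auto simp: W12_def)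
  show 1: "has_weak_gradient half_space u (weak_gradient half_space u)"
    unfolding weak_gradient_def by (rule someI[of _ g]) (rule g)
  show u: "AE z in half_measure. weak_gradient half_space u z = g z" if "has_weak_gradient half_space u g" for g
    by (rule weak_gradient_unique[OF 1 that])
  have ae: "AE z in half_measure. g z = weak_gradient half_space u z" by (rule weak_gradient_unique[OF g(1) 1])
  have m: "weak_gradient half_space u \<in> borel_measurable half_measure"
    using half_measurable_AE[OF _ ae] g(2) by (simp add: L2_on_half)
  have "integrable half_measure (\<lambda>z. (norm (weak_gradient half_space u z))\<^sup>2)"
    by (rule integrable_cong_AE_imp[of _ "\<lambda>z. (norm (g z))\<^sup>2"])
       (use g(2) m ae in \<open>auto simp: L2_on_half elim!: eventually_mono\<close>)
  with m show "L2_on half_space (weak_gradient half_space u)" by (simp add: L2_on_half)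
  show "L2_on half_space u" using assms by (simp add: W12_def)
qed

lemma W12_norm_sq:
  assumes "has_weak_gradient half_space v k" "L2_on half_space v" "L2_on half_space k"
  shows "ennreal ((W12_norm half_space v)\<^sup>2) = (\<integral>\<^sup>+ z. ennreal ((v z)\<^sup>2) \<partial>half_measure) + (\<integral>\<^sup>+ z. ennreal ((norm (k z))\<^sup>2) \<partial>half_measure)"
proof -
  have v: "v \<in> W12 half_space" using assms by (auto simp: W12_def)
  note p = weak_gradient_props[OF v]
  have i: "integrable half_measure (\<lambda>z. (v z)\<^sup>2)" "integrable half_measure (\<lambda>z. (norm (weak_gradient half_space v z))\<^sup>2)"
    using p(2,3) by (auto simp: L2_on_half)
  have "(\<integral>\<^sup>+ z. ennreal ((norm (k z))\<^sup>2) \<partial>half_measure) = (\<integral>\<^sup>+ z. ennreal ((norm (weak_gradient half_space v z))\<^sup>2) \<partial>half_measure)"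
    by (rule nn_integral_cong_AE, rule eventually_mono[OF p(4)[OF assms(1)]]) simp
  also have "\<dots> = ennreal (LINT z|half_measure. (norm (weak_gradient half_space v z))\<^sup>2)"
    by (rule nn_integral_eq_integral[OF i(2)]) simp
  finally have "(\<integral>\<^sup>+ z. ennreal ((norm (k z))\<^sup>2) \<partial>half_measure) = ennreal (LINT z|half_measure. (norm (weak_gradient half_space v z))\<^sup>2)" .
  moreover have "(\<integral>\<^sup>+ z. ennreal ((v z)\<^sup>2) \<partial>half_measure) = ennreal (LINT z|half_measure. (v z)\<^sup>2)"
    by (rule nn_integral_eq_integral[OF i(1)]) simp
  ultimately show ?thesis
    by (simp add: W12_norm_def set_integral_half ennreal_plus[symmetric] Bochner_Integration.integral_nonneg del: ennreal_plus)
qed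

lemma L2_on_half_diff:
  fixes f h :: "'a::euclidean_space \<times> real \<Rightarrow> 'b::euclidean_space"
  assumes "L2_on half_space f" "L2_on half_space h" shows "L2_on half_space (\<lambda>z. f z - h z)"
proof -
  have [measurable]: "f \<in> borel_measurable half_measure" "h \<in> borel_measurable half_measure"
    and i: "integrable half_measure (\<lambda>z. (norm (f z))\<^sup>2)" "integrable half_measure (\<lambda>z. (norm (h z))\<^sup>2)"
    using assms by (auto simp: L2_on_half)
  have "integrable half_measure (\<lambda>z. (norm (f z - h z))\<^sup>2)"
  proof (rule Bochner_Integration.integrable_bound)
    show "integrable half_measure (\<lambda>z. 2 * (norm (f z))\<^sup>2 + 2 * (norm (h z))\<^sup>2)" using i by simp
    have "(norm (f z - h z))\<^sup>2 \<le> 2 * (norm (f z))\<^sup>2 + 2 * (norm (h z))\<^sup>2" for z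
    proof -
      have "(norm (f z - h z))\<^sup>2 \<le> (norm (f z) + norm (h z))\<^sup>2" by (intro power_mono norm_triangle_ineq4) auto
      also have "\<dots> \<le> 2 * (norm (f z))\<^sup>2 + 2 * (norm (h z))\<^sup>2"
        using sum_squares_bound[of "norm (f z)" "norm (h z)"] by (simp add: power2_sum)
      finally show ?thesis .
    qed
    then show "AE z in half_measure. norm ((norm (f z - h z))\<^sup>2) \<le> norm (2 * (norm (f z))\<^sup>2 + 2 * (norm (h z))\<^sup>2)"
      by (intro AE_I2) simp
  qed measurable
  then show ?thesis by (simp add: L2_on_half)
qed

lemma test_function_W12:
  assumes "test_function UNIV \<phi>"
  shows "has_weak_gradient half_space \<phi> (grad \<phi>)" "L2_on half_space \<phi>" "L2_on half_space (grad \<phi>)"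
  using C1c_has_weak_gradient[OF test_function_C1c[OF assms, of 1]] C1c_L2_on[OF test_function_C1c[OF assms, of 1]] by auto

lemma W12_distance:
  assumes u: "has_weak_gradient half_space u g" "L2_on half_space u" "L2_on half_space g"
    and v: "has_weak_gradient half_space v k" "L2_on half_space v" "L2_on half_space k"
  shows "ennreal ((W12_norm half_space (\<lambda>z. v z - u z))\<^sup>2) =
    (\<integral>\<^sup>+ z. ennreal ((v z - u z)\<^sup>2) \<partial>half_measure) + (\<integral>\<^sup>+ z. ennreal ((norm (k z - g z))\<^sup>2) \<partial>half_measure)"
  by (rule W12_norm_sq) (intro weak_gradient_diff L2_on_half_diff u v)+

lemma trace_bound:
  assumes u: "C1c e u g" "0 < e"
  shows "(\<integral>\<^sup>+ x. ennreal ((u (x, 0))\<^sup>2) \<partial>lborel) \<le> (\<integral>\<^sup>+ z. ennreal ((u z)\<^sup>2) \<partial>half_measure) + (\<integral>\<^sup>+ z. ennreal ((norm (g z))\<^sup>2) \<partial>half_measure)"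
proof -
  obtain R where R: "\<And>z. R < norm z \<Longrightarrow> u z = 0" using C1c_radius[OF u(1)] by metis
  have uc: "continuous_on {z. - e < snd z} u" by (rule C1c_continuous[OF u(1)])
  have gc: "continuous_on {z. - e < snd z} g" using u by (simp add: C1c_def)
  have "integrable lborel (\<lambda>x. (u (x, 0))\<^sup>2)"
    by (rule upper_integrable(2)[OF _ u(2), of "\<lambda>z. (u z)\<^sup>2" R]) (use R in \<open>auto intro!: continuous_intros uc\<close>)
  then have "(\<integral>\<^sup>+ x. ennreal ((u (x, 0))\<^sup>2) \<partial>lborel) = ennreal (LINT x|lborel. (u (x, 0))\<^sup>2)"
    by (rule nn_integral_eq_integral) simp
  also have "\<dots> \<le> ennreal ((LINT z:half_space|lborel. (u z)\<^sup>2) + (LINT z:half_space|lborel. (norm (g z))\<^sup>2))"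
    by (intro ennreal_leI C1c_trace_inequality[OF u])
  also have "(LINT z:half_space|lborel. (u z)\<^sup>2) = (LINT z|half_measure. (u z)\<^sup>2)"
    unfolding set_integral_half[symmetric] by (rule half_space_lebesgue_lborel(1)[OF _ u(2), symmetric]) (intro continuous_intros uc)
  also have "(LINT z:half_space|lborel. (norm (g z))\<^sup>2) = (LINT z|half_measure. (norm (g z))\<^sup>2)"
    unfolding set_integral_half[symmetric] by (rule half_space_lebesgue_lborel(1)[OF _ u(2), symmetric]) (intro continuous_intros gc)
  also have "ennreal ((LINT z|half_measure. (u z)\<^sup>2) + (LINT z|half_measure. (norm (g z))\<^sup>2))
     = ennreal (LINT z|half_measure. (u z)\<^sup>2) + ennreal (LINT z|half_measure. (norm (g z))\<^sup>2)"
    by (intro ennreal_plus Bochner_Integration.integral_nonneg) auto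
  also have "ennreal (LINT z|half_measure. (u z)\<^sup>2) = (\<integral>\<^sup>+ z. ennreal ((u z)\<^sup>2) \<partial>half_measure)"
    by (rule nn_integral_eq_integral[symmetric]) (use C1c_L2_on[OF u] in \<open>auto simp: L2_on_half\<close>)
  also have "ennreal (LINT z|half_measure. (norm (g z))\<^sup>2) = (\<integral>\<^sup>+ z. ennreal ((norm (g z))\<^sup>2) \<partial>half_measure)"
    by (rule nn_integral_eq_integral[symmetric]) (use C1c_L2_on[OF u] in \<open>auto simp: L2_on_half\<close>)
  finally show ?thesis .
qed

text \<open>Test functions that approach u at a geometric rate have boundary restrictions that form
  a fast Cauchy sequence, by the trace bound. Their L^2 limit is a trace, so the choice in
  \<open>boundary_trace\<close> succeeds.\<close>

lemma has_trace_boundary_trace: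
  fixes u :: "'a::euclidean_space \<times> real \<Rightarrow> real"
  assumes u: "u \<in> W12 half_space" shows "has_trace u (boundary_trace u)"
proof -
  obtain g where g: "has_weak_gradient half_space u g" "L2_on half_space g" and Lu: "L2_on half_space u" using u by (auto simp: W12_def)
  have "\<forall>k. \<exists>\<psi>. test_function UNIV \<psi> \<and> (\<integral>\<^sup>+ z. ennreal ((\<psi> z - u z)\<^sup>2) \<partial>half_measure) \<le> ennreal ((1/16) ^ k)
    \<and> (\<integral>\<^sup>+ z. ennreal ((norm (grad \<psi> z - g z))\<^sup>2) \<partial>half_measure) \<le> ennreal ((1/16) ^ k)"
  proof
    fix k :: nat
    have "0 < (1/16::real) ^ k" by simp
    from smooth_density[OF g(1) Lu g(2) this]
    show "\<exists>\<psi>. test_function UNIV \<psi> \<and> (\<integral>\<^sup>+ z. ennreal ((\<psi> z - u z)\<^sup>2) \<partial>half_measure) \<le> ennreal ((1/16) ^ k)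
    \<and> (\<integral>\<^sup>+ z. ennreal ((norm (grad \<psi> z - g z))\<^sup>2) \<partial>half_measure) \<le> ennreal ((1/16) ^ k)" by blast
  qed
  from choice[OF this] obtain \<phi> where \<phi>: "\<And>k. test_function UNIV (\<phi> k)"
    "\<And>k. (\<integral>\<^sup>+ z. ennreal ((\<phi> k z - u z)\<^sup>2) \<partial>half_measure) \<le> ennreal ((1/16) ^ k)"
    "\<And>k. (\<integral>\<^sup>+ z. ennreal ((norm (grad (\<phi> k) z - g z))\<^sup>2) \<partial>half_measure) \<le> ennreal ((1/16) ^ k)" by blast
  note w = test_function_W12[OF \<phi>(1)]
  have m [measurable]: "\<phi> k \<in> borel_measurable half_measure" "grad (\<phi> k) \<in> borel_measurable half_measure"
    "u \<in> borel_measurable half_measure" "g \<in> borel_measurable half_measure" for k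
    using w Lu g(2) by (auto simp: L2_on_half)
  have le: "(\<integral>\<^sup>+ x. ennreal ((\<phi> k (x, 0) - \<phi> j (x, 0))\<^sup>2) \<partial>lborel) \<le> ennreal (4 * (1/16) ^ k + 4 * (1/16) ^ j)" for k j
  proof -
    have "(\<integral>\<^sup>+ x. ennreal ((\<phi> k (x, 0) - \<phi> j (x, 0))\<^sup>2) \<partial>lborel)
      \<le> (\<integral>\<^sup>+ z. ennreal ((norm (\<phi> k z - \<phi> j z))\<^sup>2) \<partial>half_measure) + (\<integral>\<^sup>+ z. ennreal ((norm (grad (\<phi> k) z - grad (\<phi> j) z))\<^sup>2) \<partial>half_measure)"
      using trace_bound[OF C1c_diff[OF test_function_C1c[OF \<phi>(1)[of k], of 1] test_function_C1c[OF \<phi>(1)[of j], of 1]]] by simp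
    also have "\<dots> \<le> ennreal (2 * (1/16) ^ k + 2 * (1/16) ^ j) + ennreal (2 * (1/16) ^ k + 2 * (1/16) ^ j)"
    proof (intro add_mono nn_sq_triangle[where g=u] nn_sq_triangle[where g=g])
      show "(\<integral>\<^sup>+ z. ennreal ((norm (u z - \<phi> j z))\<^sup>2) \<partial>half_measure) \<le> ennreal ((1/16) ^ j)"
        using \<phi>(2)[of j] by (simp add: power2_commute)
      show "(\<integral>\<^sup>+ z. ennreal ((norm (g z - grad (\<phi> j) z))\<^sup>2) \<partial>half_measure) \<le> ennreal ((1/16) ^ j)"
        using \<phi>(3)[of j] by (simp add: norm_minus_commute)
    qed (use \<phi> m in auto)
    also have "\<dots> = ennreal (4 * (1/16) ^ k + 4 * (1/16) ^ j)" by (subst ennreal_plus[symmetric]) auto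
    finally show ?thesis .
  qed
  have tm: "(\<lambda>x. \<phi> k (x, 0)) \<in> borel_measurable lborel" for k
    using continuous_on_compose2[OF smooth_continuous[OF test_function_smooth[OF \<phi>(1)], of UNIV k], of UNIV "\<lambda>x. (x, 0)"]
    by (simp add: borel_measurable_continuous_onI continuous_on_Pair)
  obtain f where f: "f \<in> borel_measurable lborel"
    "\<And>k. (\<integral>\<^sup>+ x. ennreal ((\<phi> k (x, 0) - f x)\<^sup>2) \<partial>lborel) \<le> ennreal (4 * (1/16) ^ k)"
    using L2_limit_exists[of "\<lambda>k x. \<phi> k (x, 0)" 4, OF tm le zero_le_numeral] by blast
  have di: "integrable lborel (\<lambda>x. (\<phi> k (x, 0) - f x)\<^sup>2)" for k
    by (rule integrableI_bounded) (use tm f le_less_trans[OF f(2)[of k]] in auto)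
  have "has_trace u f"
    unfolding has_trace_def
  proof (intro conjI exI[of _ \<phi>] allI)
    show "L2_on UNIV f"
    proof -
      have "integrable lborel (\<lambda>x. (\<phi> 0 (x, 0))\<^sup>2)"
      proof -
        obtain R where R: "\<And>z. R < norm z \<Longrightarrow> \<phi> 0 z = 0" using C1c_radius[OF test_function_C1c[OF \<phi>(1)]] by metis
        show ?thesis
          using upper_integrable(2)[OF continuous_on_power[OF smooth_continuous[OF test_function_smooth[OF \<phi>(1)]]] zero_less_one, of R 0 2] R
          by simp
      qed
      then have a: "L2b (\<lambda>x. \<phi> 0 (x, 0))" using tm[of 0] by (simp add: L2b_def)
      have b: "L2b (\<lambda>x. \<phi> 0 (x, 0) - f x)" using di[of 0] tm[of 0] f(1) by (simp add: L2b_def)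
      from L2b_diff[OF a b] have "L2b f" by simp
      then show ?thesis
        by (auto simp: L2b_def L2_on_def set_borel_measurable_def set_integrable_def integrable_completion intro: measurable_completion)
    qed
    have "(\<lambda>k. W12_norm half_space (\<lambda>z. \<phi> k z - u z)) \<longlonglongrightarrow> 0"
    proof -
      have "(W12_norm half_space (\<lambda>z. \<phi> k z - u z))\<^sup>2 \<le> 2 * (1/16) ^ k" for k
      proof -
        have "ennreal ((W12_norm half_space (\<lambda>z. \<phi> k z - u z))\<^sup>2) \<le> ennreal ((1/16) ^ k) + ennreal ((1/16) ^ k)"
          unfolding W12_distance[OF g(1) Lu g(2) w] by (intro add_mono \<phi>)
        also have "\<dots> = ennreal (2 * (1/16) ^ k)" by (subst ennreal_plus[symmetric]) auto
        finally show ?thesis by simp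
      qed
      moreover have "0 \<le> W12_norm half_space (\<lambda>z. \<phi> k z - u z)" for k
        unfolding W12_norm_def set_integral_half by (intro real_sqrt_ge_zero add_nonneg_nonneg Bochner_Integration.integral_nonneg) auto
      ultimately have le: "\<bar>W12_norm half_space (\<lambda>z. \<phi> k z - u z)\<bar> \<le> sqrt (2 * (1/16) ^ k)" for k
        by (simp add: real_le_rsqrt)
      have "(\<lambda>k. sqrt (2 * (1/16) ^ k)) \<longlonglongrightarrow> sqrt (2 * 0)" by (intro tendsto_intros LIMSEQ_power_zero) simp
      then have up: "(\<lambda>k. sqrt (2 * (1/16) ^ k)) \<longlonglongrightarrow> 0" by (simp only: mult_zero_right real_sqrt_zero)
      show ?thesis
        by (rule Lim_null_comparison[OF _ up], rule always_eventually, rule allI, unfold real_norm_def, rule le)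
    qed
    then show "(\<lambda>k. W12_norm half_space (\<lambda>z. \<phi> k z - u z)) \<longlonglongrightarrow> 0" .
    have e: "(LINT x|lebesgue. (\<phi> k (x, 0) - f x)\<^sup>2) = (LINT x|lborel. (\<phi> k (x, 0) - f x)\<^sup>2)" for k
      by (rule integral_completion) (use di in auto)
    have nn: "0 \<le> (LINT x|lborel. (\<phi> k (x, 0) - f x)\<^sup>2)" for k by (intro Bochner_Integration.integral_nonneg) simp
    have le: "\<bar>LINT x|lborel. (\<phi> k (x, 0) - f x)\<^sup>2\<bar> \<le> 4 * (1/16) ^ k" for k
      using f(2)[of k] nn_integral_eq_integral[OF di[of k]] nn[of k] by simp
    have "(\<lambda>k. 4 * (1/16::real) ^ k) \<longlonglongrightarrow> 4 * 0" by (intro tendsto_intros LIMSEQ_power_zero) simp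
    then have up: "(\<lambda>k. 4 * (1/16::real) ^ k) \<longlonglongrightarrow> 0" by (simp only: mult_zero_right)
    show "(\<lambda>k. LINT x|lebesgue. (\<phi> k (x, 0) - f x)\<^sup>2) \<longlonglongrightarrow> 0"
      unfolding e by (rule Lim_null_comparison[OF _ up], rule always_eventually, rule allI, unfold real_norm_def, rule le)
  qed (use u \<phi>(1) in auto)
  then show ?thesis unfolding boundary_trace_def by (rule someI[of "has_trace u"])
qed

lemma has_trace_approx:
  assumes tr: "has_trace u f" and g: "has_weak_gradient half_space u g" "L2_on half_space g" and d: "0 < \<delta>"
  obtains \<phi> where "test_function UNIV \<phi>" "(\<integral>\<^sup>+ z. ennreal ((\<phi> z - u z)\<^sup>2) \<partial>half_measure) \<le> ennreal \<delta>"
    "(\<integral>\<^sup>+ z. ennreal ((norm (grad \<phi> z - g z))\<^sup>2) \<partial>half_measure) \<le> ennreal \<delta>"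
    "(\<integral>\<^sup>+ x. ennreal ((\<phi> (x, 0) - f x)\<^sup>2) \<partial>lebesgue) \<le> ennreal \<delta>"
proof -
  obtain \<phi> :: "nat \<Rightarrow> 'a \<times> real \<Rightarrow> real" where \<phi>: "\<And>k. test_function UNIV (\<phi> k)"
    "(\<lambda>k. W12_norm half_space (\<lambda>z. \<phi> k z - u z)) \<longlonglongrightarrow> 0" "(\<lambda>k. LINT x|lebesgue. (\<phi> k (x, 0) - f x)\<^sup>2) \<longlonglongrightarrow> 0"
    and Lu: "L2_on half_space u" and Lf: "L2_on UNIV f"
  proof -
    from tr have 1: "u \<in> W12 half_space" "L2_on UNIV f"
      and 2: "\<exists>\<phi> :: nat \<Rightarrow> 'a \<times> real \<Rightarrow> real. (\<forall>k. test_function UNIV (\<phi> k)) \<and>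
        (\<lambda>k. W12_norm half_space (\<lambda>z. \<phi> k z - u z)) \<longlonglongrightarrow> 0 \<and>
        (\<lambda>k. LINT x|lebesgue. (\<phi> k (x, 0) - f x)\<^sup>2) \<longlonglongrightarrow> 0"
      unfolding has_trace_def by (rule conjunct1, rule conjunct1[OF conjunct2], rule conjunct2[OF conjunct2])
    from 1(1) have "L2_on half_space u" by (simp add: W12_def)
    with 1(2) 2 that show thesis by blast
  qed
  have "(\<lambda>k. (W12_norm half_space (\<lambda>z. \<phi> k z - u z))\<^sup>2) \<longlonglongrightarrow> 0\<^sup>2" by (intro tendsto_intros \<phi>(2))
  then have 1: "\<forall>\<^sub>F k in sequentially. (W12_norm half_space (\<lambda>z. \<phi> k z - u z))\<^sup>2 < \<delta>" by (rule order_tendstoD) (use d in simp)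
  have 2: "\<forall>\<^sub>F k in sequentially. (LINT x|lebesgue. (\<phi> k (x, 0) - f x)\<^sup>2) < \<delta>" by (rule order_tendstoD[OF \<phi>(3)]) (use d in simp)
  obtain k where k: "(W12_norm half_space (\<lambda>z. \<phi> k z - u z))\<^sup>2 < \<delta>" "(LINT x|lebesgue. (\<phi> k (x, 0) - f x)\<^sup>2) < \<delta>"
    using eventually_happens'[OF _ eventually_conj[OF 1 2]] by auto
  have "(\<integral>\<^sup>+ z. ennreal ((\<phi> k z - u z)\<^sup>2) \<partial>half_measure) + (\<integral>\<^sup>+ z. ennreal ((norm (grad (\<phi> k) z - g z))\<^sup>2) \<partial>half_measure) \<le> ennreal \<delta>"
    unfolding W12_distance[OF g(1) Lu g(2) test_function_W12[OF \<phi>(1)], symmetric] using k(1) by (intro ennreal_leI) simp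
  then have 3: "(\<integral>\<^sup>+ z. ennreal ((\<phi> k z - u z)\<^sup>2) \<partial>half_measure) \<le> ennreal \<delta>"
    "(\<integral>\<^sup>+ z. ennreal ((norm (grad (\<phi> k) z - g z))\<^sup>2) \<partial>half_measure) \<le> ennreal \<delta>"
    by (auto intro: order_trans[rotated])
  have fm [measurable]: "f \<in> borel_measurable lebesgue" and fi: "integrable lebesgue (\<lambda>x. (f x)\<^sup>2)"
    using Lf by (auto simp: L2_on_def set_borel_measurable_def set_integrable_def)
  have pi: "integrable lborel (\<lambda>x. (\<phi> k (x, 0))\<^sup>2)"
  proof -
    obtain R where R: "\<And>z. R < norm z \<Longrightarrow> \<phi> k z = 0" using C1c_radius[OF test_function_C1c[OF \<phi>(1)]] by metis
    show ?thesis
      using upper_integrable(2)[OF continuous_on_power[OF smooth_continuous[OF test_function_smooth[OF \<phi>(1)]]] zero_less_one, of R k 2] R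
      by simp
  qed
  have pm [measurable]: "(\<lambda>x. \<phi> k (x, 0)) \<in> borel_measurable lebesgue"
    using continuous_on_compose2[OF smooth_continuous[OF test_function_smooth[OF \<phi>(1)], of UNIV k], of UNIV "\<lambda>x. (x, 0)"]
    by (intro measurable_completion) (simp add: borel_measurable_continuous_onI continuous_on_Pair)
  have pi': "integrable lebesgue (\<lambda>x. (\<phi> k (x, 0))\<^sup>2)" using pi by (simp add: integrable_completion)
  have "integrable lebesgue (\<lambda>x. (\<phi> k (x, 0) - f x)\<^sup>2)"
  proof (rule Bochner_Integration.integrable_bound)
    show "integrable lebesgue (\<lambda>x. 2 * (\<phi> k (x, 0))\<^sup>2 + 2 * (f x)\<^sup>2)" using pi' fi by simp
    have "(\<phi> k (x, 0) - f x)\<^sup>2 \<le> 2 * (\<phi> k (x, 0))\<^sup>2 + 2 * (f x)\<^sup>2" for x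
      using sum_squares_bound[of "\<phi> k (x, 0)" "- f x"] by (simp add: power2_diff)
    then show "AE x in lebesgue. norm ((\<phi> k (x, 0) - f x)\<^sup>2) \<le> norm (2 * (\<phi> k (x, 0))\<^sup>2 + 2 * (f x)\<^sup>2)" by (intro AE_I2) simp
  qed measurable
  then have "(\<integral>\<^sup>+ x. ennreal ((\<phi> k (x, 0) - f x)\<^sup>2) \<partial>lebesgue) = ennreal (LINT x|lebesgue. (\<phi> k (x, 0) - f x)\<^sup>2)"
    by (rule nn_integral_eq_integral) simp
  also have "\<dots> \<le> ennreal \<delta>" using k(2) by (intro ennreal_leI) simp
  finally show thesis using that[OF \<phi>(1) 3] by simp
qed

lemma young_sq: "0 < \<epsilon> \<Longrightarrow> (a + b)\<^sup>2 \<le> (1 + \<epsilon>) * a\<^sup>2 + (1 + 1 / \<epsilon>) * (b::real)\<^sup>2"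
proof -
  assume e: "0 < \<epsilon>"
  have "0 \<le> (\<epsilon> * a - b)\<^sup>2 / \<epsilon>" using e by simp
  also have "\<dots> = \<epsilon> * a\<^sup>2 - 2 * a * b + b\<^sup>2 / \<epsilon>" using e by (simp add: power2_eq_square field_simps)
  finally show ?thesis by (simp add: power2_sum algebra_simps)
qed

section \<open>The inequality on the Sobolev space\<close>

context finsler_hardy
begin

lemma Phi_bound: obtains C where "0 < C" "\<And>p. (Phi H p)\<^sup>2 \<le> C * (norm p)\<^sup>2"
proof -
  obtain c C where C: "0 < c" "c \<le> C" "\<And>x. H x \<le> C * norm x" using H_bounds by metis
  have "(Phi H p)\<^sup>2 \<le> (C\<^sup>2 + 1) * (norm p)\<^sup>2" for p
  proof -
    have "(H (fst p))\<^sup>2 \<le> (C * norm (fst p))\<^sup>2" by (intro power_mono C H_nonneg)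
    moreover have "(norm p)\<^sup>2 = (norm (fst p))\<^sup>2 + (snd p)\<^sup>2"
      by (simp add: norm_prod_def)
    ultimately show ?thesis by (simp add: Phi_sq power_mult_distrib algebra_simps) (smt (verit) zero_le_power2 mult_nonneg_nonneg)
  qed
  moreover have "0 < C\<^sup>2 + 1" by (smt (verit) zero_le_power2)
  ultimately show thesis using that by blast
qed

text \<open>The weight \<epsilon> keeps the coefficient of the limiting energy arbitrarily close to
  1 and moves the loss to the error term.\<close>

lemma Phi_young: "0 < \<epsilon> \<Longrightarrow> (Phi H p)\<^sup>2 \<le> (1 + \<epsilon>) * (Phi H q)\<^sup>2 + (1 + 1 / \<epsilon>) * (Phi H (p - q))\<^sup>2"
proof -
  assume e: "0 < \<epsilon>"
  have "H (fst p) \<le> H (fst q) + H (fst (p - q))" using H_triangle[of "fst q" "fst (p - q)"] by simp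
  then have "(H (fst p))\<^sup>2 \<le> (H (fst q) + H (fst (p - q)))\<^sup>2" by (intro power_mono H_nonneg)
  also have "\<dots> \<le> (1 + \<epsilon>) * (H (fst q))\<^sup>2 + (1 + 1 / \<epsilon>) * (H (fst (p - q)))\<^sup>2" by (rule young_sq[OF e])
  finally have "(H (fst p))\<^sup>2 \<le> \<dots>" .
  moreover have "(snd p)\<^sup>2 \<le> (1 + \<epsilon>) * (snd q)\<^sup>2 + (1 + 1 / \<epsilon>) * (snd (p - q))\<^sup>2"
    using young_sq[OF e, of "snd q" "snd (p - q)"] by simp
  ultimately show ?thesis unfolding Phi_sq distrib_left by linarith
qed

lemma Phi_measurable: "g \<in> borel_measurable M \<Longrightarrow> (\<lambda>z. (Phi H (g z))\<^sup>2) \<in> borel_measurable M"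
  by (rule measurable_compose[of g M borel "\<lambda>p. (Phi H p)\<^sup>2"])
     (assumption, intro borel_measurable_continuous_onI Phi_sq_continuous continuous_on_id)

lemma Phi_integrable:
  assumes "L2_on half_space g" shows "integrable half_measure (\<lambda>z. (Phi H (g z))\<^sup>2)"
proof -
  obtain C where C: "0 < C" "\<And>p. (Phi H p)\<^sup>2 \<le> C * (norm p)\<^sup>2" using Phi_bound by metis
  show ?thesis
  proof (rule Bochner_Integration.integrable_bound)
    show "integrable half_measure (\<lambda>z. C * (norm (g z))\<^sup>2)" using assms by (simp add: L2_on_half)
    show "AE z in half_measure. norm ((Phi H (g z))\<^sup>2) \<le> norm (C * (norm (g z))\<^sup>2)"
      using C by (intro AE_I2) simp
  qed (use assms in \<open>auto simp: L2_on_half intro: Phi_measurable\<close>)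
qed

text \<open>Along approximations that converge almost everywhere the left side is lower
  semicontinuous by Fatou's lemma, whereas the energy on the right converges.\<close>

lemma W12_inequality:
  assumes tr: "has_trace u \<tau>" and g: "has_weak_gradient half_space u g" "L2_on half_space g"
  shows "(\<integral>\<^sup>+ x. ennreal (K * ((\<tau> x)\<^sup>2 / H0 x)) \<partial>lebesgue)
      + (\<integral>\<^sup>+ z. ennreal (\<kappa>\<^sup>2 * ((u z)\<^sup>2 / (Phi H0 z)\<^sup>2)) \<partial>half_measure)
    \<le> ennreal (LINT z|half_measure. (Phi H (g z))\<^sup>2)"
proof -
  define G where "G = (LINT z|half_measure. (Phi H (g z))\<^sup>2)"
  have G0: "0 \<le> G" unfolding G_def by (intro Bochner_Integration.integral_nonneg) auto
  obtain C where C: "0 < C" "\<And>p. (Phi H p)\<^sup>2 \<le> C * (norm p)\<^sup>2" using Phi_bound by metis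
  have "\<forall>k. \<exists>\<phi>. test_function UNIV \<phi> \<and> (\<integral>\<^sup>+ z. ennreal ((\<phi> z - u z)\<^sup>2) \<partial>half_measure) \<le> ennreal ((1/4) ^ k) \<and>
    (\<integral>\<^sup>+ z. ennreal ((norm (grad \<phi> z - g z))\<^sup>2) \<partial>half_measure) \<le> ennreal ((1/4) ^ k) \<and>
    (\<integral>\<^sup>+ x. ennreal ((\<phi> (x, 0) - \<tau> x)\<^sup>2) \<partial>lebesgue) \<le> ennreal ((1/4) ^ k)"
  proof
    fix k :: nat
    have "0 < (1/4::real) ^ k" by simp
    from has_trace_approx[OF tr g this]
    show "\<exists>\<phi>. test_function UNIV \<phi> \<and> (\<integral>\<^sup>+ z. ennreal ((\<phi> z - u z)\<^sup>2) \<partial>half_measure) \<le> ennreal ((1/4) ^ k) \<and>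
    (\<integral>\<^sup>+ z. ennreal ((norm (grad \<phi> z - g z))\<^sup>2) \<partial>half_measure) \<le> ennreal ((1/4) ^ k) \<and>
    (\<integral>\<^sup>+ x. ennreal ((\<phi> (x, 0) - \<tau> x)\<^sup>2) \<partial>lebesgue) \<le> ennreal ((1/4) ^ k)" by blast
  qed
  from choice[OF this] obtain \<phi> where \<phi>: "\<And>k. test_function UNIV (\<phi> k)"
    "\<And>k. (\<integral>\<^sup>+ z. ennreal ((\<phi> k z - u z)\<^sup>2) \<partial>half_measure) \<le> ennreal ((1/4) ^ k)"
    "\<And>k. (\<integral>\<^sup>+ z. ennreal ((norm (grad (\<phi> k) z - g z))\<^sup>2) \<partial>half_measure) \<le> ennreal ((1/4) ^ k)"
    "\<And>k. (\<integral>\<^sup>+ x. ennreal ((\<phi> k (x, 0) - \<tau> x)\<^sup>2) \<partial>lebesgue) \<le> ennreal ((1/4) ^ k)" by blast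
  have Lu: "L2_on half_space u" and Lf: "L2_on UNIV \<tau>"
    using tr unfolding has_trace_def by (auto simp: W12_def)
  note w = test_function_W12[OF \<phi>(1)]
  have pm: "\<phi> k \<in> borel_measurable borel" for k by (rule test_function_measurable[OF \<phi>(1)])
  have sm: "(\<lambda>x. \<phi> k (x, 0)) \<in> borel_measurable borel" for k
    using measurable_compose[OF _ pm, of "\<lambda>x. (x, 0)" borel k] by (simp add: borel_measurable_continuous_onI continuous_on_Pair)
  have um: "u \<in> borel_measurable half_measure" using Lu by (simp add: L2_on_half)
  have fm: "\<tau> \<in> borel_measurable lebesgue" using Lf by (simp add: L2_on_def set_borel_measurable_def)
  have slm: "(\<lambda>x. \<phi> k (x, 0)) \<in> borel_measurable lebesgue" for k by (intro measurable_completion) (simp add: sm)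
  have AE1: "AE z in half_measure. (\<lambda>k. \<phi> k z) \<longlonglongrightarrow> u z"
    by (rule fast_L2_AE[OF _ um \<phi>(2)]) (rule borel_half[OF pm])
  have AE2: "AE x in lebesgue. (\<lambda>k. \<phi> k (x, 0)) \<longlonglongrightarrow> \<tau> x"
    by (rule fast_L2_AE[OF slm fm \<phi>(4)])
  have "H0 \<in> borel_measurable borel" by (intro borel_measurable_continuous_onI dual_continuous)
  then have H0m: "H0 \<in> borel_measurable lebesgue" by (intro measurable_completion) simp
  have "(\<lambda>z. (Phi H0 z)\<^sup>2) \<in> borel_measurable borel"
    unfolding Phi_dual_sq
    by (intro borel_measurable_continuous_onI continuous_intros continuous_on_compose2[OF dual_continuous[of UNIV]]) auto
  then have Phm: "(\<lambda>z. (Phi H0 z)\<^sup>2) \<in> borel_measurable half_measure" by (rule borel_half)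
  \<comment> \<open>Young's weight is 2^(-k): the error coefficient then grows like 2^k, while the
    squared gradient error is at most 4^(-k), so the product tends to 0.\<close>
  have step: "(\<integral>\<^sup>+ x. ennreal (K * ((\<phi> k (x, 0))\<^sup>2 / H0 x)) \<partial>lebesgue)
      + (\<integral>\<^sup>+ z. ennreal (\<kappa>\<^sup>2 * ((\<phi> k z)\<^sup>2 / (Phi H0 z)\<^sup>2)) \<partial>half_measure)
    \<le> ennreal ((1 + (1/2) ^ k) * G + (1 + 1 / (1/2) ^ k) * (C * (1/4) ^ k))" for k
  proof -
    have gL: "L2_on half_space (grad (\<phi> k))" by (rule w)
    have i1: "integrable half_measure (\<lambda>z. (Phi H (grad (\<phi> k) z))\<^sup>2)" by (rule Phi_integrable[OF gL])
    have i2: "integrable half_measure (\<lambda>z. (Phi H (g z))\<^sup>2)" by (rule Phi_integrable[OF g(2)])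
    have dL: "L2_on half_space (\<lambda>z. grad (\<phi> k) z - g z)" by (rule L2_on_half_diff[OF gL g(2)])
    then have i3: "integrable half_measure (\<lambda>z. (norm (grad (\<phi> k) z - g z))\<^sup>2)" by (simp add: L2_on_half)
    have d: "(LINT z|half_measure. (norm (grad (\<phi> k) z - g z))\<^sup>2) \<le> (1/4) ^ k"
      using \<phi>(3)[of k] nn_integral_eq_integral[OF i3] by (simp add: Bochner_Integration.integral_nonneg)
    have "(LINT z|half_measure. (Phi H (grad (\<phi> k) z))\<^sup>2)
      \<le> (LINT z|half_measure. (1 + (1/2) ^ k) * (Phi H (g z))\<^sup>2 + (1 + 1 / (1/2) ^ k) * (C * (norm (grad (\<phi> k) z - g z))\<^sup>2))"
    proof (rule integral_mono[OF i1])
      show "integrable half_measure (\<lambda>z. (1 + (1/2) ^ k) * (Phi H (g z))\<^sup>2 + (1 + 1 / (1/2) ^ k) * (C * (norm (grad (\<phi> k) z - g z))\<^sup>2))"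
        by (intro Bochner_Integration.integrable_add integrable_mult_right i2 i3)
      fix z
      have "(Phi H (grad (\<phi> k) z))\<^sup>2 \<le> (1 + (1/2) ^ k) * (Phi H (g z))\<^sup>2 + (1 + 1 / (1/2) ^ k) * (Phi H (grad (\<phi> k) z - g z))\<^sup>2"
        by (rule Phi_young) simp
      also have "\<dots> \<le> (1 + (1/2) ^ k) * (Phi H (g z))\<^sup>2 + (1 + 1 / (1/2) ^ k) * (C * (norm (grad (\<phi> k) z - g z))\<^sup>2)"
        by (intro add_left_mono mult_left_mono C) (simp add: add_nonneg_nonneg)
      finally show "(Phi H (grad (\<phi> k) z))\<^sup>2 \<le> (1 + (1/2) ^ k) * (Phi H (g z))\<^sup>2 + (1 + 1 / (1/2) ^ k) * (C * (norm (grad (\<phi> k) z - g z))\<^sup>2)" .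
    qed
    also have "\<dots> = (1 + (1/2) ^ k) * G + (1 + 1 / (1/2) ^ k) * (C * (LINT z|half_measure. (norm (grad (\<phi> k) z - g z))\<^sup>2))"
      unfolding G_def using i2 i3 by (simp add: Bochner_Integration.integral_add)
    also have "\<dots> \<le> (1 + (1/2) ^ k) * G + (1 + 1 / (1/2) ^ k) * (C * (1/4) ^ k)"
      using C(1) d by (intro add_left_mono mult_left_mono) (auto simp: add_nonneg_nonneg)
    finally have le: "(LINT z|half_measure. (Phi H (grad (\<phi> k) z))\<^sup>2) \<le> (1 + (1/2) ^ k) * G + (1 + 1 / (1/2) ^ k) * (C * (1/4) ^ k)" .
    have "(LINT z:half_space|lborel. (Phi H (grad (\<phi> k) z))\<^sup>2) = (LINT z|half_measure. (Phi H (grad (\<phi> k) z))\<^sup>2)"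
      unfolding set_integral_half[symmetric]
      by (rule half_space_lebesgue_lborel(1)[of 1, symmetric]) (auto intro!: Phi_sq_continuous smooth_grad_continuous test_function_smooth[OF \<phi>(1)])
    moreover have "(\<integral>\<^sup>+ z. ennreal (indicator half_space z * (\<kappa>\<^sup>2 * ((\<phi> k z)\<^sup>2 / (Phi H0 z)\<^sup>2))) \<partial>lborel)
       = (\<integral>\<^sup>+ z. ennreal (\<kappa>\<^sup>2 * ((\<phi> k z)\<^sup>2 / (Phi H0 z)\<^sup>2)) \<partial>half_measure)"
      unfolding nn_integral_half nn_integral_completion by (intro nn_integral_cong) (simp add: indicator_def)
    ultimately show ?thesis
      using order_trans[OF test_inequality[OF \<phi>(1)[of k]] ennreal_leI] le by (simp add: nn_integral_completion)
  qed
  \<comment> \<open>Written with the inverse of d the convergence also covers d = 0, where both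
    sides are 0.\<close>
  have p1: "ennreal (c * (l\<^sup>2 / d)) \<le> liminf (\<lambda>k. ennreal (c * ((X k)\<^sup>2 / d)))"
    if "X \<longlonglongrightarrow> l" for X l and c d :: real
  proof -
    have "(\<lambda>k. c * ((X k)\<^sup>2 * inverse d)) \<longlonglongrightarrow> c * (l\<^sup>2 * inverse d)" by (intro tendsto_intros that)
    then show ?thesis unfolding divide_inverse by (intro le_liminf_of_tendsto tendsto_ennrealI)
  qed
  have "(\<integral>\<^sup>+ x. ennreal (K * ((\<tau> x)\<^sup>2 / H0 x)) \<partial>lebesgue) + (\<integral>\<^sup>+ z. ennreal (\<kappa>\<^sup>2 * ((u z)\<^sup>2 / (Phi H0 z)\<^sup>2)) \<partial>half_measure)
    \<le> liminf (\<lambda>k. ennreal ((1 + (1/2) ^ k) * G + (1 + 1 / (1/2) ^ k) * (C * (1/4) ^ k)))"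
  proof (rule fatou_two[OF _ _ step])
    show "(\<lambda>x. ennreal (K * ((\<phi> k (x, 0))\<^sup>2 / H0 x))) \<in> borel_measurable lebesgue" for k
      using slm H0m by measurable
    show "(\<lambda>z. ennreal (\<kappa>\<^sup>2 * ((\<phi> k z)\<^sup>2 / (Phi H0 z)\<^sup>2))) \<in> borel_measurable half_measure" for k
      using Phm borel_half[OF pm] by measurable
    show "AE x in lebesgue. ennreal (K * ((\<tau> x)\<^sup>2 / H0 x)) \<le> liminf (\<lambda>k. ennreal (K * ((\<phi> k (x, 0))\<^sup>2 / H0 x)))"
      using AE2 by eventually_elim (rule p1)
    show "AE z in half_measure. ennreal (\<kappa>\<^sup>2 * ((u z)\<^sup>2 / (Phi H0 z)\<^sup>2)) \<le> liminf (\<lambda>k. ennreal (\<kappa>\<^sup>2 * ((\<phi> k z)\<^sup>2 / (Phi H0 z)\<^sup>2)))"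
      using AE1 by eventually_elim (rule p1)
  qed
  also have "\<dots> = ennreal G"
  proof (rule lim_imp_Liminf)
    have e: "(1 + (1/2) ^ k) * G + (1 + 1 / (1/2) ^ k) * (C * (1/4) ^ k) = (1 + (1/2) ^ k) * G + C * ((1/4) ^ k + (1/2) ^ k)" for k :: nat
    proof -
      have "(1/4::real) ^ k = (1/2) ^ k * (1/2) ^ k" by (simp add: power_mult_distrib[symmetric])
      then show ?thesis by (simp add: field_simps)
    qed
    have "(\<lambda>k. (1 + (1/2) ^ k) * G + C * ((1/4) ^ k + (1/2) ^ k)) \<longlonglongrightarrow> (1 + 0) * G + C * (0 + 0)"
      by (intro tendsto_intros LIMSEQ_power_zero) auto
    then show "(\<lambda>k. ennreal ((1 + (1/2) ^ k) * G + (1 + 1 / (1/2) ^ k) * (C * (1/4) ^ k))) \<longlonglongrightarrow> ennreal G"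
      unfolding e by (intro tendsto_ennrealI) simp
  qed simp
  finally show ?thesis unfolding G_def .
qed

end

section \<open>Sharpness\<close>

lemma max_square_DERIV: "DERIV (\<lambda>y::real. (max 0 y)\<^sup>2) y :> 2 * max 0 y"
proof -
  consider "y > 0" | "y < 0" | "y = 0" by linarith
  then show ?thesis
  proof cases
    case 1
    have "DERIV (\<lambda>y::real. y\<^sup>2) y :> 2 * y" by (auto intro!: derivative_eq_intros)
    moreover have "\<forall>\<^sub>F x in nhds y. x\<^sup>2 = (max 0 x)\<^sup>2"
      using eventually_nhds_in_open[of "{0<..}" y] 1 by (auto elim!: eventually_mono)
    ultimately show ?thesis using 1 DERIV_cong_ev[of y y "\<lambda>y. y\<^sup>2" "\<lambda>y. (max 0 y)\<^sup>2" "2 * y" "2 * y"] by simp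
  next
    case 2
    have "\<forall>\<^sub>F x in nhds y. 0 = (max 0 x)\<^sup>2"
      using eventually_nhds_in_open[of "{..<0}" y] 2 by (auto elim!: eventually_mono)
    then show ?thesis using 2 DERIV_cong_ev[of y y "\<lambda>y. 0" "\<lambda>y. (max 0 y)\<^sup>2" 0 0] by simp
  next
    case 3
    have "((\<lambda>h::real. (max 0 h)\<^sup>2 / h) \<longlongrightarrow> 0) (at 0)"
    proof (rule Lim_null_comparison[of _ "\<lambda>h. \<bar>h\<bar>"])
      have "norm ((max 0 h)\<^sup>2 / h) \<le> \<bar>h\<bar>" for h :: real by (auto simp: max_def power2_eq_square)
      then show "\<forall>\<^sub>F h in at 0. norm ((max 0 h)\<^sup>2 / h) \<le> \<bar>h::real\<bar>" by simp
      show "((\<lambda>h::real. \<bar>h\<bar>) \<longlongrightarrow> 0) (at 0)" by (rule tendsto_eq_intros refl | simp)+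
    qed
    then show ?thesis using 3 by (simp add: DERIV_def)
  qed
qed

text \<open>A cut-off that is 1 up to 0 and vanishes from 1 on. Squares of positive parts are C^1,
  which is the regularity required by \<open>C1c\<close>.\<close>

definition step :: "real \<Rightarrow> real" where "step y = (max 0 (1 - (max 0 y)\<^sup>2))\<^sup>2"
definition step' :: "real \<Rightarrow> real" where "step' y = - 4 * max 0 (1 - (max 0 y)\<^sup>2) * max 0 y"

lemma step_DERIV: "DERIV step y :> step' y"
proof -
  have "DERIV (\<lambda>y. 1 - (max 0 y)\<^sup>2) y :> - (2 * max 0 y)"
    by (rule DERIV_cong[OF DERIV_diff[OF DERIV_const max_square_DERIV]]) simp
  from DERIV_chain2[OF max_square_DERIV this] show ?thesis
    unfolding step_def[abs_def] step'_def by (rule DERIV_cong) simp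
qed

lemma step'_continuous: "continuous_on S step'" unfolding step'_def by (intro continuous_intros)

lemma step_values: "y \<le> 0 \<Longrightarrow> step y = 1" "1 \<le> y \<Longrightarrow> step y = 0" "0 \<le> step y" "step y \<le> 1"
  "y \<le> 0 \<Longrightarrow> step' y = 0" "1 \<le> y \<Longrightarrow> step' y = 0" "(step' y)\<^sup>2 \<le> 16"
proof -
  have m: "0 \<le> max 0 (1 - (max 0 y)\<^sup>2)" "max 0 (1 - (max 0 y)\<^sup>2) \<le> 1" by auto
  have o: "1 - (max 0 y)\<^sup>2 \<le> 0" if "1 \<le> y" using that one_le_power[of y 2] by simp
  show "y \<le> 0 \<Longrightarrow> step y = 1" "0 \<le> step y" "y \<le> 0 \<Longrightarrow> step' y = 0" by (auto simp: step_def step'_def)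
  show "1 \<le> y \<Longrightarrow> step y = 0" "1 \<le> y \<Longrightarrow> step' y = 0" using o by (auto simp: step_def step'_def)
  show "step y \<le> 1" using m by (simp add: step_def power_le_one)
  show "(step' y)\<^sup>2 \<le> 16"
  proof (cases "1 \<le> y")
    case True then show ?thesis using o by (simp add: step'_def)
  next
    case False
    then have "max 0 (1 - (max 0 y)\<^sup>2) * max 0 y \<le> 1 * 1" using m by (intro mult_mono) auto
    moreover have "0 \<le> max 0 (1 - (max 0 y)\<^sup>2) * max 0 y" by simp
    ultimately have "(max 0 (1 - (max 0 y)\<^sup>2) * max 0 y)\<^sup>2 \<le> 1" by (intro power_le_one) auto
    then show ?thesis by (simp add: step'_def power_mult_distrib)
  qed
qed

section \<open>Truncated ground states and their energy\<close>

context finsler_hardy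
begin

text \<open>The boundary integral of the squared ground state diverges logarithmically, whereas a cut-off in \<open>ln R\<close> costs
  only a bounded amount of energy; this drives the quotient to \<open>K\<close>.\<close>

definition "ground z = Rad 1 z powr (- \<mu>) * f (slope 1 z)"
definition "extremal L z = ground z * step (2 * ln (Rad 1 z) - L)"
text \<open>The part of the gradient that falls on the cut-off, as the coefficient of R grad R =
  (\<open>dual_grad\<close> x, t + 1). The factor 2 / R^2 comes from differentiating 2 ln R.\<close>

definition "defect L z = 2 * ground z * step' (2 * ln (Rad 1 z) - L) / (Rad 1 z)\<^sup>2"
definition "extremal_grad L z = ((extremal L z * VA 1 z + defect L z) *\<^sub>R dual_grad (fst z),
    extremal L z * VB 1 z + defect L z * (snd z + 1))"

lemma extremal_GDERIV:
  assumes z: "- 1 < snd z" shows "GDERIV (extremal L) z :> extremal_grad L z"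
proof -
  define R T where "R = Rad 1 z" and "T = snd z + 1"
  have p: "0 < R" "0 < T" using z Rad_pos[OF z] by (auto simp: R_def T_def)
  have s: "- 1/2 < T / R" using p by (simp add: less_trans[of _ 0])
  let ?y = "2 * ln R - L" and ?P = "R powr (- \<mu>)"
  let ?Gr = "(- \<mu> * ?P / R * f (T / R) + ?P * (f1 (T / R) * (- T / R\<^sup>2))) * step ?y + ?P * f (T / R) * (step' ?y * (2 / R))"
  let ?Gt = "?P * (f1 (T / R) / R) * step ?y"
  have d1: "((\<lambda>p. f (snd p / fst p)) has_derivative (\<lambda>(r, t). f1 (T / R) * (t / R - T * r / R\<^sup>2))) (at (R, T))"
  proof -
    have "((\<lambda>p. snd p / fst p) has_derivative (\<lambda>(r, t). t / R - T * r / R\<^sup>2)) (at (R, T))"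
      using p by (auto intro!: derivative_eq_intros simp: fun_eq_iff field_simps power2_eq_square)
    moreover have "(f has_derivative (\<lambda>v. f1 (T / R) * v)) (at (snd (R, T) / fst (R, T)))"
      using f_DERIV[of "T / R"] s by (simp add: has_field_derivative_def)
    ultimately show ?thesis by (rule has_derivative_eq_rhs[OF has_derivative_compose]) auto
  qed
  have fst: "(fst has_derivative fst) (at (R, T))" by (rule has_derivative_fst[OF has_derivative_ident])
  have d2: "((\<lambda>p. fst p powr (- \<mu>)) has_derivative (\<lambda>v. (- \<mu> * ?P / R) * fst v)) (at (R, T))"
  proof -
    have "DERIV (\<lambda>r. r powr (- \<mu>)) (fst (R, T)) :> - \<mu> * ?P / R"
      using p by (auto intro!: derivative_eq_intros simp: powr_diff)
    from has_derivative_compose[OF fst this[unfolded has_field_derivative_def]] show ?thesis .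
  qed
  have d3: "((\<lambda>p. step (2 * ln (fst p) - L)) has_derivative (\<lambda>v. step' ?y * (2 / R) * fst v)) (at (R, T))"
  proof -
    have "DERIV (\<lambda>r. 2 * ln r - L) (fst (R, T)) :> 2 / R" using p by (auto intro!: derivative_eq_intros)
    from has_derivative_compose[OF fst DERIV_chain2[OF step_DERIV this, unfolded has_field_derivative_def]]
    show ?thesis by simp
  qed
  have "((\<lambda>p. fst p powr (- \<mu>) * f (snd p / fst p) * step (2 * ln (fst p) - L)) has_derivative (\<lambda>(r, t). ?Gr * r + ?Gt * t)) (at (R, T))"
    by (rule has_derivative_eq_rhs[OF has_derivative_mult[OF has_derivative_mult[OF d2 d1] d3]])
       (simp add: fun_eq_iff algebra_simps)
  from two_variable_GDERIV[OF z this[unfolded R_def T_def]]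
  have "GDERIV (extremal L) z :> ?Gr *\<^sub>R gradR 1 z + ?Gt *\<^sub>R (0, 1)"
    by (simp add: extremal_def[abs_def] ground_def slope_def R_def T_def)
  moreover have "?Gr *\<^sub>R gradR 1 z + ?Gt *\<^sub>R (0, 1) = extremal_grad L z"
  proof -
    \<comment> \<open>Writing f' as h f lets the ground state factor out, so that the remaining
      coefficients are exactly \<open>VA\<close> and \<open>VB\<close>.\<close>
    have f: "f1 (T / R) = h (T / R) * f (T / R)" using f_pos[of "T / R"] s by (simp add: h_def)
    have sl: "slope 1 z = T / R" by (simp add: slope_def R_def T_def)
    have u: "extremal L z = ?P * f (T / R) * step ?y" by (simp add: extremal_def ground_def sl R_def)
    have w: "defect L z = 2 * (?P * f (T / R)) * step' ?y / R\<^sup>2" by (simp add: defect_def ground_def sl R_def)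
    have A: "VA 1 z = - \<mu> / R\<^sup>2 - h (T / R) * T / R ^ 3" by (simp add: VA_def sl R_def T_def)
    have B: "VB 1 z = - \<mu> * T / R\<^sup>2 + h (T / R) * (R\<^sup>2 - T\<^sup>2) / R ^ 3" by (simp add: VB_def sl R_def T_def)
    have 1: "?Gr / R = extremal L z * VA 1 z + defect L z"
      unfolding u w A f using p by (simp add: field_simps power2_eq_square power3_eq_cube)
    have 2: "?Gr / R * T + ?Gt = extremal L z * VB 1 z + defect L z * T"
      unfolding u w B f using p by (simp add: field_simps power2_eq_square power3_eq_cube)
    have g: "gradR 1 z = (1 / R) *\<^sub>R (dual_grad (fst z), T)" by (simp add: gradR_def R_def T_def)
    have "?Gr *\<^sub>R gradR 1 z + ?Gt *\<^sub>R (0, 1) = ((?Gr / R) *\<^sub>R dual_grad (fst z), ?Gr / R * T + ?Gt)"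
      unfolding g by simp
    also have "\<dots> = extremal_grad L z" unfolding 2 unfolding 1 by (simp add: extremal_grad_def T_def)
    finally show ?thesis .
  qed
  ultimately show ?thesis by simp
qed

lemma Rad_ge: obtains c where "0 < c" "\<And>e z. c * norm (fst z) \<le> Rad e z" "\<And>e z. \<bar>snd z + e\<bar> \<le> Rad e z"
  "\<And>e z. H0 (fst z) \<le> Rad e z"
proof -
  obtain c where c: "0 < c" "\<And>x. c * norm x \<le> H0 x" using dual_bounds by metis
  have 1: "H0 (fst z) \<le> Rad e z" for e and z :: "'a \<times> real" unfolding Rad_def by (rule real_le_rsqrt) simp
  have 2: "\<bar>snd z + e\<bar> \<le> Rad e z" for e and z :: "'a \<times> real" unfolding Rad_def by (rule real_le_rsqrt) simp
  show thesis by (rule that[OF c(1) order_trans[OF c(2) 1] 2 1])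
qed

lemma Rad_1_ge_1: "0 \<le> snd z \<Longrightarrow> 1 \<le> Rad 1 z"
  unfolding Rad_def using one_le_power[of "snd z + 1" 2] by (intro real_le_rsqrt) (simp add: add_increasing)

lemma ground_continuous: "continuous_on {z. - 1 < snd z} ground"
  unfolding ground_def
  by (intro continuous_intros Rad_continuous slope_comp_continuous DERIV_isCont[OF f_DERIV]; simp add: Rad_nonzero)

lemma defect_continuous: "continuous_on {z. - 1 < snd z} (defect L)"
proof -
  have "continuous_on {z. - 1 < snd z} (\<lambda>z. step' (2 * ln (Rad 1 z) - L))"
    by (rule continuous_on_compose2[OF step'_continuous[of UNIV]]) (auto intro!: continuous_intros Rad_continuous simp: Rad_nonzero)
  then show ?thesis unfolding defect_def
    by (intro continuous_on_mult continuous_on_divide continuous_on_const continuous_on_power ground_continuous Rad_continuous) (simp_all add: Rad_nonzero)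
qed

lemma extremal_continuous: "continuous_on {z. - 1 < snd z} (extremal L)"
proof -
  have "continuous_on UNIV step" by (intro continuous_at_imp_continuous_on ballI DERIV_isCont[OF step_DERIV])
  then have "continuous_on {z. - 1 < snd z} (\<lambda>z. step (2 * ln (Rad 1 z) - L))"
    by (rule continuous_on_compose2) (auto intro!: continuous_intros Rad_continuous simp: Rad_nonzero)
  then show ?thesis unfolding extremal_def by (intro continuous_on_mult ground_continuous)
qed

lemma large_Rad: assumes "exp ((L + 1) / 2) \<le> Rad 1 z" shows "1 \<le> 2 * ln (Rad 1 z) - L"
proof -
  have "ln (exp ((L + 1) / 2)) \<le> ln (Rad 1 z)" using assms by (subst ln_le_cancel_iff) (auto intro: less_le_trans[OF exp_gt_zero])
  then show ?thesis by simp
qed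

lemma extremal_C1c: "C1c 1 (extremal L) (extremal_grad L)"
proof -
  obtain c where c: "0 < c" "\<And>e z. c * norm (fst z) \<le> Rad e z" "\<And>e z. \<bar>snd z + e\<bar> \<le> Rad e z" using Rad_ge by metis
  define E where "E = exp ((L + 1) / 2)"
  have "extremal L z = 0" if z: "E / c + E + 1 < norm z" for z
  proof -
    have "E \<le> Rad 1 z"
    proof (rule ccontr)
      assume "\<not> E \<le> Rad 1 z"
      then have "c * norm (fst z) < E" "\<bar>snd z + 1\<bar> < E" using c(2)[of z 1] c(3)[of z 1] by linarith+
      then have "norm (fst z) < E / c" "norm (snd z) < E + 1" using c(1) by (auto simp: field_simps)
      moreover have "norm z \<le> norm (fst z) + norm (snd z)" using norm_Pair_le[of "fst z" "snd z"] by simp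
      ultimately show False using z by linarith
    qed
    then show ?thesis using step_values(2)[OF large_Rad] by (simp add: extremal_def E_def)
  qed
  moreover have "continuous_on {z. - 1 < snd z} (extremal_grad L)"
    unfolding extremal_grad_def
    by (intro continuous_intros extremal_continuous VA_continuous VB_continuous defect_continuous
        continuous_on_compose2[OF dual_grad_continuous[of UNIV]]) auto
  ultimately show ?thesis unfolding C1c_def using extremal_GDERIV by blast
qed

text \<open>Both parts of the gradient are horizontally multiples of \<open>dual_grad\<close>, so
  \<open>H\<close> acts on them like a Euclidean norm along one line. The statement is then (a +
  d)^2 = 2 a (a + d) - a^2 + d^2, that is Young's inequality with its exact remainder.\<close>

lemma extremal_pointwise:
  assumes "- 1 < snd z"
  shows "(Phi H (extremal_grad L z))\<^sup>2 = 2 * extremal L z * (VA 1 z * (fst z \<bullet> fst (extremal_grad L z)) + VB 1 z * snd (extremal_grad L z))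
    - (extremal L z)\<^sup>2 * ((VA 1 z)\<^sup>2 * (H0 (fst z))\<^sup>2 + (VB 1 z)\<^sup>2) + (defect L z)\<^sup>2 * (Rad 1 z)\<^sup>2"
proof -
  have H: "(H (k *\<^sub>R dual_grad (fst z)))\<^sup>2 = k\<^sup>2 * (H0 (fst z))\<^sup>2" for k
    by (simp add: H_scale H_dual_grad power_mult_distrib)
  have q: "fst z \<bullet> dual_grad (fst z) = (H0 (fst z))\<^sup>2" using dual_grad_inner[of "fst z"] by (simp add: inner_commute)
  show ?thesis
    unfolding Phi_sq extremal_grad_def fst_conv snd_conv H inner_scaleR_right q Rad_square
    by (simp add: power2_eq_square algebra_simps)
qed

text \<open>The defect lives in the shell L < 2 ln R < L + 1. There its squared length is of order
  R^(-2 \<mu> - 2) and the shell has volume of order R^(2 \<mu> + 2), so the bound does not depend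
  on L.\<close>

lemma defect_bound:
  obtains C where "0 \<le> C" "\<And>L. (LINT z:half_space|lborel. (defect L z)\<^sup>2 * (Rad 1 z)\<^sup>2) \<le> C"
proof -
  obtain c where c: "0 < c" "\<And>e z. c * norm (fst z) \<le> Rad e z" "\<And>e z. \<bar>snd z + e\<bar> \<le> Rad e z" using Rad_ge by metis
  define d where "d = DIM('a \<times> real)"
  have d: "real d = 2 * \<mu> + 2" using dim_mu by (simp add: d_def)
  define \<omega> where "\<omega> = unit_ball_vol (real d)"
  have \<omega>: "0 \<le> \<omega>" by (simp add: \<omega>_def)
  \<comment> \<open>Converts R into the Euclidean norm: |x| <= R / c and |t| <= R.\<close>
  define a where "a = 1 / c + 1"
  have a: "0 < a" using c(1) by (simp add: a_def add_pos_pos)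
  have f0: "0 < f 0" by (rule f_pos) simp
  let ?C = "64 * (f 0)\<^sup>2 * \<omega> * a ^ d * exp (\<mu> + 1)"
  show thesis
  proof (rule that[of ?C])
    show "0 \<le> ?C" using \<omega> a by simp
    fix L :: real
    define E where "E = exp ((L + 1) / 2)"
    \<comment> \<open>64 = 4 * 16, from the squared factor 2 of the defect and the bound 16 for
      \<open>step'\<close> squared; the exponential bounds R^(-2 \<mu> - 2) on the inner edge of the
      shell.\<close>
    define M where "M = 64 * (f 0)\<^sup>2 * exp (- L * (\<mu> + 1))"
    have M0: "0 \<le> M" by (simp add: M_def)
    have pw: "indicator half_space z *\<^sub>R ((defect L z)\<^sup>2 * (Rad 1 z)\<^sup>2) \<le> M * indicator (cball 0 (a * E)) z" for z
    proof (cases "z \<in> half_space \<and> step' (2 * ln (Rad 1 z) - L) \<noteq> 0")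
      case False
      then have "indicator half_space z *\<^sub>R ((defect L z)\<^sup>2 * (Rad 1 z)\<^sup>2) = 0" by (auto simp: defect_def)
      then show ?thesis using M0 by (simp only:) simp
    next
      case True
      then have z: "0 < snd z" by (simp add: half_space_def)
      then have R: "1 \<le> Rad 1 z" by (intro Rad_1_ge_1) simp
      have y: "0 < 2 * ln (Rad 1 z) - L" "2 * ln (Rad 1 z) - L < 1"
        using True step_values(5,6)[of "2 * ln (Rad 1 z) - L"] by (meson not_le)+
      have "Rad 1 z < E" using y(2) large_Rad[of L z] unfolding E_def by (meson not_le)
      moreover have "norm z \<le> norm (fst z) + norm (snd z)" using norm_Pair_le[of "fst z" "snd z"] by simp
      moreover have "norm (fst z) \<le> Rad 1 z / c" using c(1) c(2)[of z 1] by (simp add: field_simps)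
      moreover have "norm (snd z) \<le> Rad 1 z" using c(3)[of z 1] z by simp
      ultimately have "norm z \<le> Rad 1 z / c + Rad 1 z" by linarith
      also have "\<dots> = a * Rad 1 z" by (simp add: a_def algebra_simps)
      also have "\<dots> \<le> a * E" using a \<open>Rad 1 z < E\<close> by simp
      finally have zb: "z \<in> cball 0 (a * E)" by simp
      have "f (slope 1 z) \<le> f 0" "0 \<le> f (slope 1 z)"
        using f_antimono[of 0 "slope 1 z"] slope_bounds(1)[of 1 z] z f_pos[of "slope 1 z"] by auto
      then have fs: "(f (slope 1 z))\<^sup>2 \<le> (f 0)\<^sup>2" by (intro power_mono)
      have P: "(Rad 1 z powr (- \<mu>))\<^sup>2 / (Rad 1 z)\<^sup>2 = exp (- (2 * (\<mu> + 1)) * ln (Rad 1 z))"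
      proof -
        have "(Rad 1 z powr (- \<mu>))\<^sup>2 = exp (- (2 * \<mu>) * ln (Rad 1 z))"
          using R by (simp add: powr_def exp_double[symmetric])
        moreover have "(Rad 1 z)\<^sup>2 = exp (2 * ln (Rad 1 z))" using R by (simp add: exp_double)
        ultimately show ?thesis by (simp add: exp_diff[symmetric] algebra_simps)
      qed
      have "L * (\<mu> + 1) \<le> (2 * ln (Rad 1 z)) * (\<mu> + 1)" using y(1) mu_pos(1) by (intro mult_right_mono) auto
      then have PL: "(Rad 1 z powr (- \<mu>))\<^sup>2 / (Rad 1 z)\<^sup>2 \<le> exp (- L * (\<mu> + 1))" unfolding P by (simp add: algebra_simps)
      have "(defect L z)\<^sup>2 * (Rad 1 z)\<^sup>2 = 4 * (((Rad 1 z powr (- \<mu>))\<^sup>2 / (Rad 1 z)\<^sup>2) * ((f (slope 1 z))\<^sup>2 * (step' (2 * ln (Rad 1 z) - L))\<^sup>2))"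
        using R by (simp add: defect_def ground_def power_mult_distrib power_divide field_simps power2_eq_square)
      also have "\<dots> \<le> 4 * (exp (- L * (\<mu> + 1)) * ((f 0)\<^sup>2 * 16))"
        by (intro mult_left_mono mult_mono PL fs step_values(7)) auto
      finally show ?thesis using zb True by (simp add: M_def mult_ac)
    qed
    have "(LINT z:half_space|lborel. (defect L z)\<^sup>2 * (Rad 1 z)\<^sup>2) \<le> (LINT z|lborel. M * indicator (cball (0::'a \<times> real) (a * E)) z)"
      unfolding set_lebesgue_integral_def
    proof (rule integral_mono)
      show i: "integrable lborel (\<lambda>z. M * indicator (cball (0::'a \<times> real) (a * E)) z)"
        by (intro integrable_mult_right integrable_cball)
      show "integrable lborel (\<lambda>z. indicator half_space z *\<^sub>R ((defect L z)\<^sup>2 * (Rad 1 z)\<^sup>2))"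
      proof (rule Bochner_Integration.integrable_bound[OF i])
        have "continuous_on {z. - 1 < snd z} (\<lambda>z. (defect L z)\<^sup>2 * (Rad 1 z)\<^sup>2)"
          by (intro continuous_intros defect_continuous Rad_continuous)
        from half_space_measurable[OF this] show "(\<lambda>z. indicator half_space z *\<^sub>R ((defect L z)\<^sup>2 * (Rad 1 z)\<^sup>2)) \<in> borel_measurable lborel" by simp
        show "AE z in lborel. norm (indicator half_space z *\<^sub>R ((defect L z)\<^sup>2 * (Rad 1 z)\<^sup>2)) \<le> norm (M * indicator (cball 0 (a * E)) z)"
          using pw M0 by (intro AE_I2) simp
      qed
    qed (use pw in auto)
    also have "\<dots> = M * measure lborel (cball (0::'a \<times> real) (a * E))" by simp
    also have "measure lborel (cball (0::'a \<times> real) (a * E)) = \<omega> * (a * E) ^ d"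
      using content_cball[of "a * E" "0::'a \<times> real"] a by (simp add: \<omega>_def d_def E_def)
    also have "M * (\<omega> * (a * E) ^ d) = ?C"
    proof -
      have "E ^ d = exp ((L + 1) / 2 * real d)" by (simp add: E_def exp_of_nat_mult[symmetric] mult.commute)
      also have "\<dots> = exp ((L + 1) * (\<mu> + 1))" unfolding d by (simp add: algebra_simps add_divide_distrib)
      finally have "exp (- L * (\<mu> + 1)) * E ^ d = exp (\<mu> + 1)" by (simp add: mult_exp_exp algebra_simps)
      then show ?thesis by (simp add: M_def power_mult_distrib mult_ac)
    qed
    finally show "(LINT z:half_space|lborel. (defect L z)\<^sup>2 * (Rad 1 z)\<^sup>2) \<le> ?C" .
  qed
qed

text \<open>The same integration by parts as for the inequality, now with equality, so that the
  entire excess energy is the integral of the squared defect.\<close>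

lemma extremal_energy:
  "(LINT z:half_space|lborel. (Phi H (extremal_grad L z))\<^sup>2)
    = (LINT z:half_space|lborel. (extremal L z)\<^sup>2 * (\<kappa>\<^sup>2 / (Rad 1 z)\<^sup>2)) + (LINT x|lborel. - VB 1 (x, 0) * (extremal L (x, 0))\<^sup>2)
      + (LINT z:half_space|lborel. (defect L z)\<^sup>2 * (Rad 1 z)\<^sup>2)"
proof -
  let ?u = "extremal L" and ?g = "extremal_grad L"
  note u = extremal_C1c[of L]
  obtain \<rho> where \<rho>: "\<And>z. \<rho> < norm z \<Longrightarrow> ?u z = 0" "\<And>z. \<rho> < norm z \<Longrightarrow> - 1 < snd z \<Longrightarrow> ?g z = 0"
    using C1c_radius[OF u] by metis
  have uc: "continuous_on {z. - 1 < snd z} ?u" by (rule C1c_continuous[OF u])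
  have gc: "continuous_on {z. - 1 < snd z} ?g" using u by (simp add: C1c_def)
  have Hc: "continuous_on {z. - 1 < snd z} (\<lambda>z. H0 (fst z))"
    by (rule continuous_on_compose2[OF dual_continuous[of UNIV] continuous_on_fst[OF continuous_on_id]]) simp
  note int = upper_integrable(1)[OF _ zero_less_one, of _ \<rho>]
  let ?F = "\<lambda>z. 2 * ?u z * (VA 1 z * (fst z \<bullet> fst (?g z)) + VB 1 z * snd (?g z))"
    and ?P = "\<lambda>z. (?u z)\<^sup>2 * (\<kappa>\<^sup>2 / (Rad 1 z)\<^sup>2)"
    and ?W = "\<lambda>z. (?u z)\<^sup>2 * ((VA 1 z)\<^sup>2 * (H0 (fst z))\<^sup>2 + (VB 1 z)\<^sup>2)"
    and ?D = "\<lambda>z. (defect L z)\<^sup>2 * (Rad 1 z)\<^sup>2"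
  have iF: "set_integrable lborel half_space ?F"
    by (rule int) (use \<rho> in \<open>auto intro!: continuous_intros uc gc VA_continuous VB_continuous\<close>)
  have iP: "set_integrable lborel half_space ?P"
    by (rule int) (use \<rho> in \<open>auto intro!: continuous_intros uc Rad_continuous simp: Rad_nonzero\<close>)
  have iW: "set_integrable lborel half_space ?W"
    by (rule int) (use \<rho> in \<open>auto intro!: continuous_intros uc VA_continuous VB_continuous Hc\<close>)
  have iH: "set_integrable lborel half_space (\<lambda>z. (Phi H (?g z))\<^sup>2)"
    by (rule int[OF Phi_sq_continuous[OF gc]]) (use \<rho> in \<open>auto simp: Phi_sq\<close>)
  have pw: "?D z = (Phi H (?g z))\<^sup>2 - (?F z - ?W z)" if "z \<in> half_space" for z
    using extremal_pointwise[of z L] that by (simp add: half_space_def)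
  have "(LINT z:half_space|lborel. ?D z) = (LINT z:half_space|lborel. (Phi H (?g z))\<^sup>2 - (?F z - ?W z))"
    by (rule set_lebesgue_integral_cong) (use pw in \<open>auto simp: half_space_borel\<close>)
  also have "\<dots> = (LINT z:half_space|lborel. (Phi H (?g z))\<^sup>2) - ((LINT z:half_space|lborel. ?F z) - (LINT z:half_space|lborel. ?W z))"
    using set_integral_diff(2)[OF iH set_integral_diff(1)[OF iF iW]] set_integral_diff(2)[OF iF iW] by simp
  finally have D: "(LINT z:half_space|lborel. (Phi H (?g z))\<^sup>2) = (LINT z:half_space|lborel. ?D z) + ((LINT z:half_space|lborel. ?F z) - (LINT z:half_space|lborel. ?W z))"
    by simp
  have PW: "(LINT z:half_space|lborel. (?u z)\<^sup>2 * (\<kappa>\<^sup>2 / (Rad 1 z)\<^sup>2 + (VA 1 z)\<^sup>2 * (H0 (fst z))\<^sup>2 + (VB 1 z)\<^sup>2))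
      = (LINT z:half_space|lborel. ?P z) + (LINT z:half_space|lborel. ?W z)"
    unfolding set_integral_add(2)[OF iP iW, symmetric] by (simp only: distrib_left add.assoc)
  show ?thesis unfolding D field_identity[OF u zero_less_one] PW by simp
qed

section \<open>Asymptotics on the boundary\<close>

lemma h_boundary: obtains M where "0 \<le> M" "\<And>s. 0 \<le> s \<Longrightarrow> s \<le> 1 \<Longrightarrow> - h s \<le> K + M * s"
proof -
  have "continuous_on {0..1} hp" by (intro continuous_at_imp_continuous_on ballI hp_continuous) simp
  then have "bounded (hp ` {0..1})" by (intro compact_imp_bounded compact_continuous_image) auto
  then obtain M where M: "\<forall>s\<in>{0..1}. \<bar>hp s\<bar> \<le> M" by (auto simp: bounded_iff)
  have M0: "0 \<le> M" using M by force
  have "norm (h s - h 0) \<le> M * norm (s - 0)" if "0 \<le> s" "s \<le> 1" for s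
  proof (rule field_differentiable_bound[of "{0..1}"])
    show "(h has_field_derivative hp x) (at x within {0..1})" if "x \<in> {0..1}" for x
      using h_DERIV[of x] that by (auto intro: has_field_derivative_at_within)
  qed (use M that in auto)
  then have "- h s \<le> K + M * s" if "0 \<le> s" "s \<le> 1" for s using that by (force simp: h_0)
  with M0 show thesis by (rule that)
qed

text \<open>On the boundary the shifted slope is 1/R, so the Lipschitz bound for h makes the
  coefficient K / R up to O(R^(-2)), and R >= H^0. The error gains one power of R over the main
  term, whose integral diverges only logarithmically.\<close>

lemma boundary_bound:
  obtains C where "0 \<le> C" "\<And>x. x \<noteq> 0 \<Longrightarrow> - VB 1 (x, 0) \<le> K / H0 x + C / (Rad 1 (x, 0))\<^sup>2"
proof -
  obtain M where M: "0 \<le> M" "\<And>s. 0 \<le> s \<Longrightarrow> s \<le> 1 \<Longrightarrow> - h s \<le> K + M * s" using h_boundary by metis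
  show thesis
  proof (rule that[of "\<mu> + M"])
    show "0 \<le> \<mu> + M" using mu_pos M by simp
    fix x :: 'a assume x: "x \<noteq> 0"
    define R where "R = Rad 1 (x, 0)"
    have R: "1 \<le> R" unfolding R_def by (rule Rad_1_ge_1) simp
    have r: "0 < H0 x" "H0 x \<le> R" using dual_pos[OF x] Rad_ge[of "H0 x \<le> R"] by (auto simp: R_def)
    have VB: "- VB 1 (x, 0) = \<mu> / R\<^sup>2 + (- h (1 / R)) * ((R\<^sup>2 - 1) / R ^ 3)"
      by (simp add: VB_def slope_def R_def)
    have q: "0 \<le> (R\<^sup>2 - 1) / R ^ 3" "(R\<^sup>2 - 1) / R ^ 3 \<le> 1 / R"
      using R one_le_power[OF R, of 2] by (auto simp: field_simps power2_eq_square power3_eq_cube)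
    have "(- h (1 / R)) * ((R\<^sup>2 - 1) / R ^ 3) \<le> (K + M * (1 / R)) * ((R\<^sup>2 - 1) / R ^ 3)"
      using M(2)[of "1 / R"] R by (intro mult_right_mono q) auto
    also have "\<dots> \<le> (K + M * (1 / R)) * (1 / R)" using M(1) K_pos R by (intro mult_left_mono q) auto
    also have "\<dots> = K / R + M / R\<^sup>2" using R by (simp add: field_simps power2_eq_square)
    also have "K / R \<le> K / H0 x" using r K_pos by (intro divide_left_mono) auto
    finally show "- VB 1 (x, 0) \<le> K / H0 x + (\<mu> + M) / (Rad 1 (x, 0))\<^sup>2"
      unfolding VB by (simp add: R_def add_divide_distrib)
  qed
qed

text \<open>The decay exponent 2 \<mu> + 1 equals the dimension of the boundary, so every dyadic
  shell contributes at least a fixed amount. Linear growth in m is the logarithmic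
  divergence.\<close>

lemma dyadic_growth:
  obtains c C where "0 < c" "0 < C" "\<And>m x. norm x < 2 ^ m \<Longrightarrow> Rad 1 (x, 0) \<le> C * 2 ^ m"
    "\<And>m. c * real m \<le> (LINT x|lborel. indicator (ball 0 (2 ^ m)) x * Rad 1 (x, 0) powr (- (2 * \<mu> + 1)))"
    "\<And>m. integrable lborel (\<lambda>x. indicator (ball 0 (2 ^ m)) x * Rad 1 (x, 0) powr (- (2 * \<mu> + 1)))"
proof -
  obtain L where L: "0 < L" "\<And>x. H0 x \<le> L * norm x" using dual_Lipschitz by metis
  define C where "C = sqrt (L\<^sup>2 + 1)"
  have C: "0 < C" by (simp add: C_def add_nonneg_pos)
  have RC: "Rad 1 (x, 0) \<le> C * 2 ^ m" if "norm x < 2 ^ m" for x m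
  proof -
    have "(H0 x)\<^sup>2 \<le> (L * 2 ^ m)\<^sup>2"
      using L(2)[of x] dual_nonneg[of x] that L(1) by (intro power_mono) (auto intro: order_trans[OF _ mult_left_mono])
    moreover have "(1::real) \<le> (2 ^ m)\<^sup>2" by (intro one_le_power) simp
    ultimately have "(H0 x)\<^sup>2 + 1 \<le> (L\<^sup>2 + 1) * (2 ^ m)\<^sup>2" unfolding power_mult_distrib distrib_right by linarith
    then have "sqrt ((H0 x)\<^sup>2 + 1) \<le> sqrt ((L\<^sup>2 + 1) * (2 ^ m)\<^sup>2)" by (rule real_sqrt_le_mono)
    then show ?thesis by (simp add: Rad_def C_def real_sqrt_mult)
  qed
  define g where "g x = Rad 1 (x, 0) powr (- (2 * \<mu> + 1))" for x :: 'a
  have R1: "1 \<le> Rad 1 (x, 0)" for x :: 'a by (rule Rad_1_ge_1) simp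
  have g01: "0 \<le> g x" "g x \<le> 1" for x
    using R1[of x] mu_pos(1) powr_mono2'[of "- (2 * \<mu> + 1)" 1 "Rad 1 (x, 0)"] by (auto simp: g_def)
  have gc: "continuous_on UNIV g"
    unfolding g_def
  proof (intro continuous_intros)
    show "continuous_on UNIV (\<lambda>x::'a. Rad 1 (x, 0))"
      by (rule continuous_on_compose2[OF Rad_continuous[of UNIV]]) (auto intro!: continuous_intros)
    show "\<forall>x::'a\<in>UNIV. Rad 1 (x, 0) \<noteq> 0" using R1 by (metis not_one_le_zero)
  qed
  then have [measurable]: "g \<in> borel_measurable borel" by (rule borel_measurable_continuous_onI)
  have ig: "integrable lborel (\<lambda>x. indicator (ball 0 (2 ^ m)) x * g x)" for m
    by (rule Bochner_Integration.integrable_bound[OF integrable_cball[of 0 "2 ^ m"]])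
       (use g01 in \<open>auto simp: indicator_def\<close>)
  define n where "n = DIM('a)"
  have n: "real n = 2 * \<mu> + 1" "1 \<le> n" using dim_mu dim by (simp_all add: n_def)
  define \<omega> where "\<omega> = unit_ball_vol (real n)"
  have \<omega>: "0 < \<omega>" by (simp add: \<omega>_def)
  define c where "c = (C * 2) powr (- (2 * \<mu> + 1)) * \<omega>"
  have c: "0 < c" using C \<omega> by (simp add: c_def)
  have vol: "measure lborel (ball (0::'a) r) = \<omega> * r ^ n" if "0 \<le> r" for r
    using content_ball[OF that, of "0::'a"] by (simp add: \<omega>_def n_def)
  have "c * real m \<le> (LINT x|lborel. indicator (ball 0 (2 ^ m)) x * g x)" for m
  proof (induction m)
    case 0
    show ?case using g01 by (simp add: Bochner_Integration.integral_nonneg)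
  next
    case (Suc m)
    \<comment> \<open>The smallest value that the integrand is guaranteed to have on the ball of
      radius 2^(m+1). The shell has volume at least that of the inner ball, since 2^n >= 2.\<close>
    let ?k = "(C * 2 ^ Suc m) powr (- (2 * \<mu> + 1))"
    have "(LINT x|lborel. indicator (ball 0 (2 ^ m)) x * g x + ?k * (indicator (ball 0 (2 ^ Suc m)) x - indicator (ball 0 (2 ^ m)) x))
      \<le> (LINT x|lborel. indicator (ball 0 (2 ^ Suc m)) x * g x)"
    proof (rule integral_mono)
      have ib: "integrable lborel (indicator (ball (0::'a) r) :: 'a \<Rightarrow> real)" for r
        using emeasure_bounded_finite[OF bounded_ball] by (intro integrable_real_indicator) auto
      show "integrable lborel (\<lambda>x. indicator (ball 0 (2 ^ m)) x * g x + ?k * (indicator (ball 0 (2 ^ Suc m)) x - indicator (ball 0 (2 ^ m)) x))"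
        by (intro Bochner_Integration.integrable_add ig integrable_mult_right Bochner_Integration.integrable_diff ib)
      fix x :: 'a
      have "?k \<le> g x" if "norm x < 2 ^ Suc m"
        unfolding g_def using RC[OF that] R1[of x] mu_pos(1) by (intro powr_mono2') auto
      moreover have "norm x < 2 ^ Suc m" if "norm x < 2 ^ m"
        by (rule less_le_trans[OF that]) simp
      ultimately show "indicator (ball 0 (2 ^ m)) x * g x + ?k * (indicator (ball 0 (2 ^ Suc m)) x - indicator (ball 0 (2 ^ m)) x)
          \<le> indicator (ball 0 (2 ^ Suc m)) x * g x"
        by (auto simp: indicator_def)
    qed (rule ig)
    moreover have "(LINT x|lborel. indicator (ball 0 (2 ^ m)) x * g x + ?k * (indicator (ball 0 (2 ^ Suc m)) x - indicator (ball (0::'a) (2 ^ m)) x))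
       = (LINT x|lborel. indicator (ball 0 (2 ^ m)) x * g x) + ?k * (\<omega> * (2 ^ Suc m) ^ n - \<omega> * (2 ^ m) ^ n)"
    proof -
      have ib: "integrable lborel (indicator (ball (0::'a) r) :: 'a \<Rightarrow> real)" for r
        using emeasure_bounded_finite[OF bounded_ball] by (intro integrable_real_indicator) auto
      show ?thesis using ig ib by (simp add: Bochner_Integration.integral_add Bochner_Integration.integral_diff vol)
    qed
    moreover have "c \<le> ?k * (\<omega> * (2 ^ Suc m) ^ n - \<omega> * (2 ^ m) ^ n)"
    proof -
      have "(2::real) ^ 1 \<le> 2 ^ n" using n(2) by (intro power_increasing) auto
      then have "\<omega> * (2 ^ m) ^ n * 2 \<le> \<omega> * (2 ^ m) ^ n * 2 ^ n" using \<omega> by (intro mult_left_mono) auto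
      then have 1: "\<omega> * (2 ^ m) ^ n \<le> \<omega> * (2 ^ Suc m) ^ n - \<omega> * (2 ^ m) ^ n" by (simp add: power_mult_distrib mult_ac)
      have "?k = (C * 2) powr (- (2 * \<mu> + 1)) * (2 ^ m) powr (- real n)"
        using C by (simp add: powr_mult n(1) mult.assoc[symmetric])
      moreover have "(2 ^ m) powr (- real n) * (2 ^ m) ^ n = (1::real)"
        by (simp add: powr_minus powr_realpow)
      ultimately have "c = ?k * (\<omega> * (2 ^ m) ^ n)" by (simp add: c_def)
      also have "\<dots> \<le> ?k * (\<omega> * (2 ^ Suc m) ^ n - \<omega> * (2 ^ m) ^ n)" using 1 by (intro mult_left_mono) auto
      finally show ?thesis .
    qed
    ultimately show ?case using Suc by (simp add: algebra_simps)
  qed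
  with c C RC ig show thesis unfolding g_def using that by blast
qed

lemma W12_integrable_boundary:
  assumes tr: "has_trace u \<tau>" and g: "has_weak_gradient half_space u g" "L2_on half_space g"
  shows "integrable lebesgue (\<lambda>x. (\<tau> x)\<^sup>2 / H0 x)"
proof -
  have "(\<integral>\<^sup>+ x. ennreal (K * ((\<tau> x)\<^sup>2 / H0 x)) \<partial>lebesgue) \<le> ennreal (LINT z|half_measure. (Phi H (g z))\<^sup>2)"
    by (rule order_trans[OF _ W12_inequality[OF assms]]) simp
  also have "\<dots> < \<infinity>" by simp
  finally have fin: "(\<integral>\<^sup>+ x. ennreal (norm (K * ((\<tau> x)\<^sup>2 / H0 x))) \<partial>lebesgue) < \<infinity>"
    using K_pos dual_nonneg by (simp add: abs_mult)
  have "\<tau> \<in> borel_measurable lebesgue" using tr by (simp add: has_trace_def L2_on_def set_borel_measurable_def)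
  moreover have "H0 \<in> borel_measurable lebesgue"
    by (intro measurable_completion) (simp add: borel_measurable_continuous_onI dual_continuous)
  ultimately have "integrable lebesgue (\<lambda>x. K * ((\<tau> x)\<^sup>2 / H0 x))" by (intro integrableI_bounded fin) measurable
  then have "integrable lebesgue (\<lambda>x. (1 / K) * (K * ((\<tau> x)\<^sup>2 / H0 x)))" by (rule integrable_mult_right)
  then show ?thesis using K_pos by simp
qed

lemma Phi_dual_measurable: "(\<lambda>z. (Phi H0 z)\<^sup>2) \<in> borel_measurable half_measure"
  unfolding Phi_dual_sq
  by (intro borel_half borel_measurable_continuous_onI continuous_intros continuous_on_compose2[OF dual_continuous[of UNIV]]) auto

lemma W12_integrable_hardy:
  assumes tr: "has_trace u \<tau>" and g: "has_weak_gradient half_space u g" "L2_on half_space g" and k: "0 < \<kappa>"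
  shows "integrable half_measure (\<lambda>z. (u z)\<^sup>2 / (Phi H0 z)\<^sup>2)"
proof -
  have "(\<integral>\<^sup>+ z. ennreal (\<kappa>\<^sup>2 * ((u z)\<^sup>2 / (Phi H0 z)\<^sup>2)) \<partial>half_measure) \<le> ennreal (LINT z|half_measure. (Phi H (g z))\<^sup>2)"
    by (rule order_trans[OF _ W12_inequality[OF assms(1-3)]]) simp
  also have "\<dots> < \<infinity>" by simp
  finally have fin: "(\<integral>\<^sup>+ z. ennreal (norm (\<kappa>\<^sup>2 * ((u z)\<^sup>2 / (Phi H0 z)\<^sup>2))) \<partial>half_measure) < \<infinity>"
    by (simp add: abs_mult)
  have "u \<in> borel_measurable half_measure" using tr by (simp add: has_trace_def W12_def L2_on_half)
  then have "integrable half_measure (\<lambda>z. \<kappa>\<^sup>2 * ((u z)\<^sup>2 / (Phi H0 z)\<^sup>2))"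
    using Phi_dual_measurable by (intro integrableI_bounded fin) measurable
  then have "integrable half_measure (\<lambda>z. (1 / \<kappa>\<^sup>2) * (\<kappa>\<^sup>2 * ((u z)\<^sup>2 / (Phi H0 z)\<^sup>2)))" by (rule integrable_mult_right)
  then show ?thesis using k by simp
qed

text \<open>Integrability of the Hardy term is an assumption because for \<kappa> = 0 the extended
  inequality carries no information about it.\<close>

lemma W12_real_inequality:
  assumes tr: "has_trace u \<tau>" and g: "has_weak_gradient half_space u g" "L2_on half_space g"
    and i: "integrable half_measure (\<lambda>z. (u z)\<^sup>2 / (Phi H0 z)\<^sup>2)"
  shows "K * (LINT x|lebesgue. (\<tau> x)\<^sup>2 / H0 x) \<le> (LINT z|half_measure. (Phi H (g z))\<^sup>2) - \<kappa>\<^sup>2 * (LINT z|half_measure. (u z)\<^sup>2 / (Phi H0 z)\<^sup>2)"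
proof -
  have ib: "integrable lebesgue (\<lambda>x. (\<tau> x)\<^sup>2 / H0 x)" by (rule W12_integrable_boundary[OF tr g])
  have n: "0 \<le> (\<tau> x)\<^sup>2 / H0 x" for x using dual_nonneg by simp
  have n1: "0 \<le> (LINT x|lebesgue. K * ((\<tau> x)\<^sup>2 / H0 x))" using n K_pos by (intro Bochner_Integration.integral_nonneg mult_nonneg_nonneg) auto
  have n2: "0 \<le> (LINT z|half_measure. \<kappa>\<^sup>2 * ((u z)\<^sup>2 / (Phi H0 z)\<^sup>2))" by (intro Bochner_Integration.integral_nonneg) auto
  have n3: "0 \<le> (LINT z|half_measure. (Phi H (g z))\<^sup>2)" by (intro Bochner_Integration.integral_nonneg) auto
  have "(\<integral>\<^sup>+ x. ennreal (K * ((\<tau> x)\<^sup>2 / H0 x)) \<partial>lebesgue) = ennreal (LINT x|lebesgue. K * ((\<tau> x)\<^sup>2 / H0 x))"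
    by (intro nn_integral_eq_integral integrable_mult_right ib AE_I2 mult_nonneg_nonneg n less_imp_le[OF K_pos])
  moreover have "(\<integral>\<^sup>+ z. ennreal (\<kappa>\<^sup>2 * ((u z)\<^sup>2 / (Phi H0 z)\<^sup>2)) \<partial>half_measure) = ennreal (LINT z|half_measure. \<kappa>\<^sup>2 * ((u z)\<^sup>2 / (Phi H0 z)\<^sup>2))"
    by (intro nn_integral_eq_integral integrable_mult_right i AE_I2) auto
  ultimately have "ennreal ((LINT x|lebesgue. K * ((\<tau> x)\<^sup>2 / H0 x)) + (LINT z|half_measure. \<kappa>\<^sup>2 * ((u z)\<^sup>2 / (Phi H0 z)\<^sup>2)))
     \<le> ennreal (LINT z|half_measure. (Phi H (g z))\<^sup>2)"
    using W12_inequality[OF tr g] n1 n2 by (simp add: ennreal_plus)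
  then have "(LINT x|lebesgue. K * ((\<tau> x)\<^sup>2 / H0 x)) + (LINT z|half_measure. \<kappa>\<^sup>2 * ((u z)\<^sup>2 / (Phi H0 z)\<^sup>2)) \<le> (LINT z|half_measure. (Phi H (g z))\<^sup>2)"
    using n3 by (simp only: ennreal_le_iff)
  then show ?thesis unfolding integral_mult_right_zero by linarith
qed

text \<open>Up to K D the excess consists of the defect and of C2 times the integral of u^2 / R^2
  over the boundary. The first is bounded, the second is at most (C2 / A) D plus a constant, and D
  tends to infinity with m, so both fit into \<epsilon> D.\<close>

lemma extremal_quotient:
  assumes hardy: "\<And>L. integrable half_measure (\<lambda>z. (extremal L z)\<^sup>2 / (Phi H0 z)\<^sup>2)"
    and bd: "\<And>L. integrable lborel (\<lambda>x. (extremal L (x, 0))\<^sup>2 / H0 x)" and \<epsilon>: "0 < \<epsilon>"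
  obtains L where "0 < (LINT x|lborel. (extremal L (x, 0))\<^sup>2 / H0 x)"
    "(LINT z:half_space|lborel. (Phi H (extremal_grad L z))\<^sup>2) - \<kappa>\<^sup>2 * (LINT z|half_measure. (extremal L z)\<^sup>2 / (Phi H0 z)\<^sup>2)
      \<le> (K + \<epsilon>) * (LINT x|lborel. (extremal L (x, 0))\<^sup>2 / H0 x)"
proof -
  obtain C1 where C1: "0 \<le> C1" "\<And>L. (LINT z:half_space|lborel. (defect L z)\<^sup>2 * (Rad 1 z)\<^sup>2) \<le> C1" by (rule defect_bound) blast
  obtain C2 where C2: "0 \<le> C2" "\<And>x. x \<noteq> 0 \<Longrightarrow> - VB 1 (x, 0) \<le> K / H0 x + C2 / (Rad 1 (x, 0))\<^sup>2" by (rule boundary_bound) blast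
  obtain c C where cC: "0 < c" "0 < C" "\<And>m x. norm x < 2 ^ m \<Longrightarrow> Rad 1 (x, 0) \<le> C * 2 ^ m"
    "\<And>m. c * real m \<le> (LINT x|lborel. indicator (ball 0 (2 ^ m)) x * Rad 1 (x, 0) powr (- (2 * \<mu> + 1)))"
    "\<And>m. integrable lborel (\<lambda>x. indicator (ball 0 (2 ^ m)) x * Rad 1 (x, 0) powr (- (2 * \<mu> + 1)))"
    by (rule dyadic_growth) blast
  obtain r where r: "0 < r" "\<And>e z. r * norm (fst z) \<le> Rad e z" "\<And>e z. H0 (fst z) \<le> Rad e z" using Rad_ge by metis
  obtain c0 where c0: "0 < c0" "\<And>x. c0 * norm x \<le> H0 x" using dual_bounds by metis
  have f0: "0 < f 0" "0 < f 1" by (auto intro: f_pos)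
  \<comment> \<open>A threshold for H^0 beyond which u^2 / R^2 is at most u^2 / H^0 divided by A; it
    is large enough for C2 / A to use up only half of \<epsilon>.\<close>
  define A where "A = max 1 (2 * C2 / \<epsilon>)"
  have A: "1 \<le> A" "C2 / A \<le> \<epsilon> / 2" using \<epsilon> by (auto simp: A_def field_simps max_def)
  define V where "V = measure lborel (cball (0::'a) (A / c0))"
  \<comment> \<open>All errors that do not grow with m; the next choice of m makes D exceed 2 Q /
    \<epsilon>.\<close>
  define Q where "Q = C2 * ((f 0)\<^sup>2 * V) + C1"
  obtain m :: nat where m: "max 1 (2 * Q / \<epsilon>) / ((f 1)\<^sup>2 * c) < real m" using reals_Archimedean2 by blast
  \<comment> \<open>On the ball of radius 2^m the distance R is at most C 2^m, so the cut-off is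
    still 1 there.\<close>
  define L where "L = 2 * ln (C * 2 ^ m)"
  define u0 where "u0 x = extremal L (x, 0)" for x
  define D where "D = (LINT x|lborel. (u0 x)\<^sup>2 / H0 x)"
  define R where "R x = Rad 1 (x, 0)" for x :: 'a
  have R1: "1 \<le> R x" for x unfolding R_def by (rule Rad_1_ge_1) simp
  have sl: "0 < slope 1 (x, 0)" "slope 1 (x, 0) \<le> 1" for x :: 'a using slope_bounds[of 1 "(x, 0)"] by auto
  have fs: "f 1 \<le> f (slope 1 (x, 0))" "f (slope 1 (x, 0)) \<le> f 0" for x :: 'a
    using f_antimono[of "slope 1 (x, 0)" 1] f_antimono[of 0 "slope 1 (x, 0)"] sl[of x] by auto
  have AE0: "AE x in lborel. x \<noteq> (0::'a)" by (rule AE_lborel_singleton)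
  have DL: "(f 1)\<^sup>2 * (c * real m) \<le> D"
  proof -
    have "(f 1)\<^sup>2 * (c * real m) \<le> (f 1)\<^sup>2 * (LINT x|lborel. indicator (ball 0 (2 ^ m)) x * R x powr (- (2 * \<mu> + 1)))"
      using cC(4)[of m] by (intro mult_left_mono) (auto simp: R_def)
    also have "\<dots> = (LINT x|lborel. (f 1)\<^sup>2 * (indicator (ball 0 (2 ^ m)) x * R x powr (- (2 * \<mu> + 1))))" by simp
    also have "\<dots> \<le> D" unfolding D_def
    proof (rule integral_mono_AE)
      show "integrable lborel (\<lambda>x. (f 1)\<^sup>2 * (indicator (ball 0 (2 ^ m)) x * R x powr (- (2 * \<mu> + 1))))"
        using cC(5)[of m] by (intro integrable_mult_right) (simp add: R_def)
      show "integrable lborel (\<lambda>x. (u0 x)\<^sup>2 / H0 x)" using bd by (simp add: u0_def)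
      show "AE x in lborel. (f 1)\<^sup>2 * (indicator (ball 0 (2 ^ m)) x * R x powr (- (2 * \<mu> + 1))) \<le> (u0 x)\<^sup>2 / H0 x"
        using AE0
      proof eventually_elim
        case (elim x)
        show ?case
        proof (cases "norm x < 2 ^ m")
          case True
          have "ln (R x) \<le> ln (C * 2 ^ m)" using cC(2) cC(3)[OF True] R1[of x] by (subst ln_le_cancel_iff) (auto simp: R_def)
          then have "step (2 * ln (R x) - L) = 1" by (intro step_values(1)) (simp add: L_def)
          then have u: "(u0 x)\<^sup>2 = (R x powr (- \<mu>))\<^sup>2 * (f (slope 1 (x, 0)))\<^sup>2"
            by (simp add: u0_def extremal_def ground_def R_def power_mult_distrib)
          have H: "0 < H0 x" "H0 x \<le> R x" using dual_pos[OF elim] r(3)[of "(x, 0)" 1] by (auto simp: R_def)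
          have "R x powr (- (2 * \<mu> + 1)) = (R x powr (- \<mu>))\<^sup>2 * (1 / R x)"
          proof -
            have "- (2 * \<mu> + 1) = - \<mu> + - \<mu> - 1" by simp
            then have "R x powr (- (2 * \<mu> + 1)) = R x powr (- \<mu>) * R x powr (- \<mu>) / R x powr 1" by (simp only: powr_diff powr_add)
            then show ?thesis using R1[of x] by (simp add: power2_eq_square)
          qed
          also have "\<dots> \<le> (R x powr (- \<mu>))\<^sup>2 * (1 / H0 x)"
            using H by (intro mult_left_mono divide_left_mono) auto
          finally have "(f 1)\<^sup>2 * R x powr (- (2 * \<mu> + 1)) \<le> (f (slope 1 (x, 0)))\<^sup>2 * ((R x powr (- \<mu>))\<^sup>2 * (1 / H0 x))"
            using fs(1)[of x] f0 by (intro mult_mono power_mono) auto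
          then show ?thesis using True unfolding u by (simp add: mult_ac)
        qed (use dual_nonneg in simp)
      qed
    qed
    finally show ?thesis .
  qed
  have cf: "0 < (f 1)\<^sup>2 * c" using f0 cC(1) by simp
  have "max 1 (2 * Q / \<epsilon>) < (f 1)\<^sup>2 * (c * real m)" using m unfolding pos_divide_less_eq[OF cf] by (simp only: mult_ac)
  then have D: "max 1 (2 * Q / \<epsilon>) < D" using DL by linarith
  then have D0: "0 < D" and DQ: "Q \<le> \<epsilon> / 2 * D" using \<epsilon> by (auto simp: field_simps)
  note u = extremal_C1c[of L]
  obtain \<rho> where \<rho>: "\<And>z. \<rho> < norm z \<Longrightarrow> extremal L z = 0" using C1c_radius[OF u] by metis
  have uc: "continuous_on {z. - 1 < snd z} (extremal L)" by (rule C1c_continuous[OF u])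
  have iR: "integrable lborel (\<lambda>x. (u0 x)\<^sup>2 / (R x)\<^sup>2)"
    unfolding u0_def R_def
    by (rule upper_integrable(2)[of 1 "\<lambda>z. (extremal L z)\<^sup>2 / (Rad 1 z)\<^sup>2" \<rho>])
       (use \<rho> in \<open>auto intro!: continuous_intros uc Rad_continuous simp: Rad_nonzero\<close>)
  have iV: "integrable lborel (\<lambda>x. - VB 1 (x, 0) * (u0 x)\<^sup>2)"
    unfolding u0_def
    by (rule upper_integrable(2)[of 1 "\<lambda>z. - VB 1 z * (extremal L z)\<^sup>2" \<rho>])
       (use \<rho> in \<open>auto intro!: continuous_intros uc VB_continuous\<close>)
  have iD: "integrable lborel (\<lambda>x. (u0 x)\<^sup>2 / H0 x)" using bd by (simp add: u0_def)
  have b1: "(LINT x|lborel. - VB 1 (x, 0) * (u0 x)\<^sup>2) \<le> K * D + C2 * (LINT x|lborel. (u0 x)\<^sup>2 / (R x)\<^sup>2)"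
  proof -
    have "(LINT x|lborel. - VB 1 (x, 0) * (u0 x)\<^sup>2) \<le> (LINT x|lborel. K * ((u0 x)\<^sup>2 / H0 x) + C2 * ((u0 x)\<^sup>2 / (R x)\<^sup>2))"
    proof (rule integral_mono_AE[OF iV])
      show "integrable lborel (\<lambda>x. K * ((u0 x)\<^sup>2 / H0 x) + C2 * ((u0 x)\<^sup>2 / (R x)\<^sup>2))"
        by (intro Bochner_Integration.integrable_add integrable_mult_right iD iR)
      show "AE x in lborel. - VB 1 (x, 0) * (u0 x)\<^sup>2 \<le> K * ((u0 x)\<^sup>2 / H0 x) + C2 * ((u0 x)\<^sup>2 / (R x)\<^sup>2)"
        using AE0
      proof eventually_elim
        case (elim x)
        from mult_right_mono[OF C2(2)[OF elim], of "(u0 x)\<^sup>2"] show ?case by (simp add: R_def algebra_simps)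
      qed
    qed
    also have "\<dots> = K * D + C2 * (LINT x|lborel. (u0 x)\<^sup>2 / (R x)\<^sup>2)"
      unfolding D_def by (simp only: Bochner_Integration.integral_add[OF integrable_mult_right[OF iD] integrable_mult_right[OF iR]] integral_mult_right_zero)
    finally show ?thesis .
  qed
  have b2: "(LINT x|lborel. (u0 x)\<^sup>2 / (R x)\<^sup>2) \<le> D / A + (f 0)\<^sup>2 * V"
  proof -
    have "(LINT x|lborel. (u0 x)\<^sup>2 / (R x)\<^sup>2) \<le> (LINT x|lborel. (u0 x)\<^sup>2 / H0 x / A + (f 0)\<^sup>2 * indicator (cball 0 (A / c0)) x)"
    proof (rule integral_mono_AE[OF iR])
      show "integrable lborel (\<lambda>x. (u0 x)\<^sup>2 / H0 x / A + (f 0)\<^sup>2 * indicator (cball 0 (A / c0)) x)"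
        by (intro Bochner_Integration.integrable_add integrable_divide integrable_mult_right iD integrable_cball)
      show "AE x in lborel. (u0 x)\<^sup>2 / (R x)\<^sup>2 \<le> (u0 x)\<^sup>2 / H0 x / A + (f 0)\<^sup>2 * indicator (cball 0 (A / c0)) x"
        using AE0
      proof eventually_elim
        case (elim x)
        have H: "0 < H0 x" "H0 x \<le> R x" using dual_pos[OF elim] r(3)[of "(x, 0)" 1] by (auto simp: R_def)
        show ?case
        \<comment> \<open>Far out R^2 >= A H^0. Near the origin the truncated ground state is at
          most f 0 and R >= 1, which costs a constant times the volume of a fixed ball.\<close>
        proof (cases "A \<le> H0 x")
          case True
          have "H0 x * A \<le> R x * R x" using True H A by (intro mult_mono) auto
          then have "(u0 x)\<^sup>2 / (R x)\<^sup>2 \<le> (u0 x)\<^sup>2 / (H0 x * A)" using H A by (intro divide_left_mono) (auto simp: power2_eq_square)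
          then show ?thesis by (simp add: add_increasing2)
        next
          case False
          then have xb: "x \<in> cball 0 (A / c0)" using c0(2)[of x] c0(1) by (simp add: field_simps)
          have "\<bar>u0 x\<bar> \<le> 1 * f 0 * 1"
            unfolding u0_def extremal_def ground_def abs_mult
            using fs[of x] f0 R1[of x] mu_pos(1) step_values(3,4) powr_mono2'[of "- \<mu>" 1 "R x"]
            by (intro mult_mono) (auto simp: R_def)
          then have "(u0 x)\<^sup>2 \<le> (f 0)\<^sup>2" using f0 by (simp add: abs_le_square_iff[symmetric])
          moreover have "(u0 x)\<^sup>2 / (R x)\<^sup>2 \<le> (u0 x)\<^sup>2 / 1" using R1[of x] one_le_power[OF R1[of x], of 2] by (intro divide_left_mono) auto
          moreover have "0 \<le> (u0 x)\<^sup>2 / H0 x / A" using H A by simp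
          ultimately show ?thesis using xb by simp
        qed
      qed
    qed
    also have "\<dots> = D / A + (f 0)\<^sup>2 * V"
      unfolding D_def V_def
      by (subst Bochner_Integration.integral_add[OF integrable_divide[OF iD] integrable_mult_right[OF integrable_cball]], unfold integral_divide_zero integral_mult_right_zero) simp
    finally show ?thesis .
  qed
  \<comment> \<open>The shifted distance exceeds the true one, so the subtracted Hardy integral is
    at least the one that appears in the energy identity.\<close>
  have b3: "(LINT z:half_space|lborel. (extremal L z)\<^sup>2 * (\<kappa>\<^sup>2 / (Rad 1 z)\<^sup>2)) \<le> \<kappa>\<^sup>2 * (LINT z|half_measure. (extremal L z)\<^sup>2 / (Phi H0 z)\<^sup>2)"
  proof -
    have c: "continuous_on {z. - 1 < snd z} (\<lambda>z. (extremal L z)\<^sup>2 * (\<kappa>\<^sup>2 / (Rad 1 z)\<^sup>2))"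
      by (intro continuous_intros uc Rad_continuous) (simp add: Rad_nonzero)
    have i: "integrable half_measure (\<lambda>z. (extremal L z)\<^sup>2 * (\<kappa>\<^sup>2 / (Rad 1 z)\<^sup>2))"
      unfolding set_integrable_half[symmetric] half_space_lebesgue_lborel(2)[OF c zero_less_one]
      by (rule upper_integrable(1)[OF c zero_less_one, of \<rho>]) (simp add: \<rho>)
    have "(LINT z:half_space|lborel. (extremal L z)\<^sup>2 * (\<kappa>\<^sup>2 / (Rad 1 z)\<^sup>2)) = (LINT z|half_measure. (extremal L z)\<^sup>2 * (\<kappa>\<^sup>2 / (Rad 1 z)\<^sup>2))"
      by (simp only: half_space_lebesgue_lborel(1)[OF c zero_less_one, symmetric] set_integral_half)
    also have "\<dots> \<le> (LINT z|half_measure. \<kappa>\<^sup>2 * ((extremal L z)\<^sup>2 / (Phi H0 z)\<^sup>2))"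
    proof (rule integral_mono[OF i])
      show "integrable half_measure (\<lambda>z. \<kappa>\<^sup>2 * ((extremal L z)\<^sup>2 / (Phi H0 z)\<^sup>2))" by (intro integrable_mult_right hardy)
      fix z :: "'a \<times> real" assume "z \<in> space half_measure"
      then have z: "0 < snd z" by (simp add: half_space_def)
      have "0 < (Phi H0 z)\<^sup>2" using z by (auto simp: Phi_dual_sq intro!: add_nonneg_pos)
      moreover have "(Phi H0 z)\<^sup>2 \<le> (Rad 1 z)\<^sup>2" using z by (auto simp: Phi_dual_sq Rad_square intro!: power_mono)
      ultimately have "(\<kappa>\<^sup>2 * (extremal L z)\<^sup>2) / (Rad 1 z)\<^sup>2 \<le> (\<kappa>\<^sup>2 * (extremal L z)\<^sup>2) / (Phi H0 z)\<^sup>2"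
        by (intro divide_left_mono mult_pos_pos) (linarith | simp)+
      then show "(extremal L z)\<^sup>2 * (\<kappa>\<^sup>2 / (Rad 1 z)\<^sup>2) \<le> \<kappa>\<^sup>2 * ((extremal L z)\<^sup>2 / (Phi H0 z)\<^sup>2)" by (simp add: mult.commute)
    qed
    finally show ?thesis unfolding integral_mult_right_zero .
  qed
  have "C2 * (LINT x|lborel. (u0 x)\<^sup>2 / (R x)\<^sup>2) \<le> C2 * (D / A + (f 0)\<^sup>2 * V)" by (intro mult_left_mono b2 C2)
  also have "\<dots> = (C2 / A) * D + C2 * ((f 0)\<^sup>2 * V)" by (simp add: algebra_simps)
  also have "(C2 / A) * D \<le> \<epsilon> / 2 * D" using A D0 by (intro mult_right_mono) auto
  finally have "C2 * (LINT x|lborel. (u0 x)\<^sup>2 / (R x)\<^sup>2) + C1 \<le> \<epsilon> / 2 * D + \<epsilon> / 2 * D" using DQ unfolding Q_def by linarith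
  then have "(LINT z:half_space|lborel. (Phi H (extremal_grad L z))\<^sup>2) - \<kappa>\<^sup>2 * (LINT z|half_measure. (extremal L z)\<^sup>2 / (Phi H0 z)\<^sup>2) \<le> K * D + \<epsilon> * D"
    using extremal_energy[of L] C1(2)[of L] b1 b3 unfolding u0_def by linarith
  then show thesis using that[of L] D0 by (simp add: D_def u0_def distrib_right)
qed

end

text \<open>An abstract trace and the classical restriction are both close to the restriction of one
  test function, the latter by the trace bound for the difference. Their distance is therefore below
  every \<delta>.\<close>

lemma C1c_trace:
  assumes u: "C1c e u g" "0 < e" and tr: "has_trace u \<tau>"
  shows "AE x in lebesgue. \<tau> x = u (x, 0)"
proof -
  have um: "(\<lambda>x. u (x, 0)) \<in> borel_measurable lebesgue"
  proof -
    have "continuous_on UNIV (\<lambda>x. u (x, 0))"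
      by (rule continuous_on_compose2[OF C1c_continuous[OF u(1)]]) (use u(2) in \<open>auto intro!: continuous_intros\<close>)
    then show ?thesis by (intro measurable_completion) (simp add: borel_measurable_continuous_onI)
  qed
  have tm: "\<tau> \<in> borel_measurable lebesgue" using tr by (simp add: has_trace_def L2_on_def set_borel_measurable_def)
  have "(\<integral>\<^sup>+ x. ennreal ((norm (\<tau> x - u (x, 0)))\<^sup>2) \<partial>lebesgue) \<le> 0"
  proof (rule ennreal_le_epsilon)
    fix \<delta> :: real assume d: "0 < \<delta>"
    obtain \<phi> where \<phi>: "test_function UNIV \<phi>" "(\<integral>\<^sup>+ z. ennreal ((\<phi> z - u z)\<^sup>2) \<partial>half_measure) \<le> ennreal (\<delta> / 8)"
      "(\<integral>\<^sup>+ z. ennreal ((norm (grad \<phi> z - g z))\<^sup>2) \<partial>half_measure) \<le> ennreal (\<delta> / 8)"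
      "(\<integral>\<^sup>+ x. ennreal ((\<phi> (x, 0) - \<tau> x)\<^sup>2) \<partial>lebesgue) \<le> ennreal (\<delta> / 8)"
      using has_trace_approx[OF tr C1c_has_weak_gradient[OF u] C1c_L2_on(2)[OF u], of "\<delta> / 8"] d by auto
    have pm: "(\<lambda>x. \<phi> (x, 0)) \<in> borel_measurable lebesgue"
      using continuous_on_compose2[OF smooth_continuous[OF test_function_smooth[OF \<phi>(1)], of UNIV], of UNIV "\<lambda>x. (x, 0)"]
      by (intro measurable_completion) (simp add: borel_measurable_continuous_onI continuous_on_Pair)
    have "(\<integral>\<^sup>+ x. ennreal ((\<phi> (x, 0) - u (x, 0))\<^sup>2) \<partial>lborel) \<le> ennreal (\<delta> / 8) + ennreal (\<delta> / 8)"
      using trace_bound[OF C1c_diff[OF test_function_C1c[OF \<phi>(1)] u(1)] u(2)] \<phi>(2,3) by (meson add_mono order_trans)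
    also have "\<dots> = ennreal (\<delta> / 4)" using d by (simp add: ennreal_plus[symmetric] del: ennreal_plus)
    finally have 1: "(\<integral>\<^sup>+ x. ennreal ((norm (\<phi> (x, 0) - u (x, 0)))\<^sup>2) \<partial>lebesgue) \<le> ennreal (\<delta> / 4)"
      by (simp add: nn_integral_completion)
    have 2: "(\<integral>\<^sup>+ x. ennreal ((norm (\<tau> x - \<phi> (x, 0)))\<^sup>2) \<partial>lebesgue) \<le> ennreal (\<delta> / 8)"
      using \<phi>(4) by (simp add: power2_commute)
    have "(\<integral>\<^sup>+ x. ennreal ((norm (\<tau> x - u (x, 0)))\<^sup>2) \<partial>lebesgue) \<le> ennreal (2 * (\<delta> / 8) + 2 * (\<delta> / 4))"
      by (rule nn_sq_triangle[OF tm pm um 2 1]) (use d in auto)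
    also have "\<dots> \<le> 0 + ennreal \<delta>" using d by (simp add: ennreal_leI)
    finally show "(\<integral>\<^sup>+ x. ennreal ((norm (\<tau> x - u (x, 0)))\<^sup>2) \<partial>lebesgue) \<le> 0 + ennreal \<delta>" .
  qed
  then have "AE x in lebesgue. ennreal ((norm (\<tau> x - u (x, 0)))\<^sup>2) = 0"
    using tm um by (subst (asm) le_zero_eq, subst (asm) nn_integral_0_iff_AE) auto
  then show ?thesis by eventually_elim simp
qed

theorem theorem1p1:
  fixes N :: nat and H :: "real ^ 'n \<Rightarrow> real" and \<beta> :: real
  assumes "N \<ge> 3" and "CARD('n) = N - 1"
    and "Finsler_norm H"
    and "2 \<le> \<beta>" and "\<beta> < real N"
  shows "(\<forall>u \<in> W12 half_space.
            integrable lebesgue (\<lambda>x. (boundary_trace u x)\<^sup>2 / Phi (dual_norm H) (x, 0)) \<and>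
            set_integrable lebesgue half_space (\<lambda>z. (Phi H (weak_gradient half_space u z))\<^sup>2) \<and>
            set_integrable lebesgue half_space (\<lambda>z. (u z)\<^sup>2 / (Phi (dual_norm H) z)\<^sup>2) \<and>
            K_const N \<beta> * (LINT x|lebesgue. (boundary_trace u x)\<^sup>2 / Phi (dual_norm H) (x, 0))
              \<le> (LINT z:half_space|lebesgue. (Phi H (weak_gradient half_space u z))\<^sup>2)
                 - (\<beta> - 2)\<^sup>2 / 4 *
                   (LINT z:half_space|lebesgue. (u z)\<^sup>2 / (Phi (dual_norm H) z)\<^sup>2))
       \<and> K_const N \<beta> =
           (INF u \<in> {u \<in> W12 half_space. \<not> (AE x in lebesgue. boundary_trace u x = 0)}.
              ((LINT z:half_space|lebesgue. (Phi H (weak_gradient half_space u z))\<^sup>2)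
                 - (\<beta> - 2)\<^sup>2 / 4 *
                   (LINT z:half_space|lebesgue. (u z)\<^sup>2 / (Phi (dual_norm H) z)\<^sup>2))
              / (LINT x|lebesgue. (boundary_trace u x)\<^sup>2 / Phi (dual_norm H) (x, 0)))"
    (is "(\<forall>u \<in> W12 half_space. ?I u) \<and> ?K = (INF u \<in> ?A. (?G u - ?c * ?W u) / ?B u)")
proof -
  define k where "k = (\<beta> - 2) / 2"
  have N: "real DIM(real ^ 'n) = real N - 1" "2 \<le> DIM(real ^ 'n)" using assms(1,2) by (auto simp: of_nat_diff)
  interpret finsler_hardy H k
    by (intro finsler_hardy.intro finsler.intro finsler_hardy_axioms.intro assms(3) N(2))
       (use assms(4,5) N(1) in \<open>simp_all add: k_def\<close>)
  \<comment> \<open>For \<open>\<kappa> = 0\<close> the inequality does not control the Hardy integral; a larger parameter does.\<close>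
  interpret W: finsler_hardy H "(k + \<mu>) / 2"
    by (intro finsler_hardy.intro finsler.intro finsler_hardy_axioms.intro assms(3) N(2))
       (use kappa_nonneg kappa_less mu_pos(2) \<mu>_def in argo)+
  have mu: "\<mu> = (real N - 2) / 2" using N(1) by (simp add: \<mu>_def)
  have K: "?K = K"
  proof -
    have *: "(real N + \<beta>) / 4 - 1 / 2 = (\<mu> + k + 1) / 2" "(real N - \<beta>) / 4 + 1 / 2 = (\<mu> - k + 1) / 2"
      "(real N + \<beta>) / 4 - 1 = (\<mu> + k) / 2" "(real N - \<beta>) / 4 = (\<mu> - k) / 2"
      by (simp_all add: mu k_def field_simps)
    show ?thesis unfolding K_const_def K_def * by (simp only: add_divide_distrib)
  qed
  have c: "?c = k\<^sup>2" by (simp add: k_def power_divide)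
  have P0: "Phi H0 (x, 0) = H0 x" for x using dual_nonneg[of x] by (simp add: Phi_def)
  have I: "integrable lebesgue (\<lambda>x. (boundary_trace u x)\<^sup>2 / H0 x)"
    "integrable half_measure (\<lambda>z. (Phi H (weak_gradient half_space u z))\<^sup>2)"
    "integrable half_measure (\<lambda>z. (u z)\<^sup>2 / (Phi H0 z)\<^sup>2)"
    "K * ?B u \<le> ?G u - ?c * ?W u" if u: "u \<in> W12 half_space" for u
  proof -
    note t = has_trace_boundary_trace[OF u] and g = weak_gradient_props(1,2)[OF u]
    show "integrable lebesgue (\<lambda>x. (boundary_trace u x)\<^sup>2 / H0 x)" by (rule W12_integrable_boundary[OF t g])
    show "integrable half_measure (\<lambda>z. (Phi H (weak_gradient half_space u z))\<^sup>2)" by (rule Phi_integrable[OF g(2)])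
    show i: "integrable half_measure (\<lambda>z. (u z)\<^sup>2 / (Phi H0 z)\<^sup>2)"
      by (rule W.W12_integrable_hardy[OF t g]) (use kappa_nonneg mu_pos in simp)
    show "K * ?B u \<le> ?G u - ?c * ?W u"
      using W12_real_inequality[OF t g i] unfolding P0 c set_integral_half .
  qed
  have lower: "?K \<le> (?G u - ?c * ?W u) / ?B u" if u: "u \<in> ?A" for u
  proof -
    have uW: "u \<in> W12 half_space" using u by simp
    have n: "0 \<le> (boundary_trace u x)\<^sup>2 / H0 x" for x using dual_nonneg by simp
    have ne: "AE x in lebesgue. x \<noteq> (0::real ^ 'n)" by (rule AE_completion[OF AE_lborel_singleton])
    \<comment> \<open>The weight is positive off the origin, so a vanishing integral would force the
      trace to vanish almost everywhere.\<close>
    have "?B u \<noteq> 0"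
    proof
      assume "?B u = 0"
      then have "AE x in lebesgue. (boundary_trace u x)\<^sup>2 / H0 x = 0"
        unfolding P0 using integral_nonneg_eq_0_iff_AE[OF I(1)[OF uW]] n by simp
      then have "AE x in lebesgue. boundary_trace u x = 0"
        using ne by eventually_elim (auto dest: dual_pos)
      then show False using u by simp
    qed
    moreover have "0 \<le> ?B u" unfolding P0 by (intro Bochner_Integration.integral_nonneg n)
    ultimately have "0 < ?B u" by linarith
    then show ?thesis using I(4)[OF uW] by (simp add: K pos_le_divide_eq)
  qed
  have upper: "\<exists>u\<in>?A. (?G u - ?c * ?W u) / ?B u \<le> ?K + \<epsilon>" if \<epsilon>: "0 < \<epsilon>" for \<epsilon>
  proof -
    note C = extremal_C1c
    note W = C1c_W12[OF C zero_less_one]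
    \<comment> \<open>The quotient is formed with chosen representatives of trace and weak gradient;
      almost everywhere equality with the classical ones makes the explicit computation
      apply.\<close>
    have ae: "AE x in lebesgue. boundary_trace (extremal L) x = extremal L (x, 0)" for L
      by (rule C1c_trace[OF C zero_less_one has_trace_boundary_trace[OF W]])
    have m: "(\<lambda>x. (extremal L (x, 0))\<^sup>2 / H0 x) \<in> borel_measurable lborel" for L
    proof -
      have "continuous_on UNIV (\<lambda>x. extremal L (x, 0))"
        by (rule continuous_on_compose2[OF C1c_continuous[OF C]]) (auto intro!: continuous_intros)
      then show ?thesis
        using dual_continuous[of UNIV] by (auto dest!: borel_measurable_continuous_onI)
    qed
    \<comment> \<open>Finiteness at the singularity of 1/H^0 is inherited from the inequality for
      W^{1,2} instead of being computed.\<close>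
    have i: "integrable lborel (\<lambda>x. (extremal L (x, 0))\<^sup>2 / H0 x)" for L
    proof -
      have "integrable lebesgue (\<lambda>x. (extremal L (x, 0))\<^sup>2 / H0 x)"
        by (rule integrable_cong_AE_imp[OF I(1)[OF W[of L]] measurable_completion[OF m]]) (use ae[of L] in \<open>eventually_elim, simp\<close>)
      then show ?thesis using integrable_completion[OF m] by simp
    qed
    obtain L where L: "0 < (LINT x|lborel. (extremal L (x, 0))\<^sup>2 / H0 x)"
      "(LINT z:half_space|lborel. (Phi H (extremal_grad L z))\<^sup>2) - k\<^sup>2 * (LINT z|half_measure. (extremal L z)\<^sup>2 / (Phi H0 z)\<^sup>2)
        \<le> (K + \<epsilon>) * (LINT x|lborel. (extremal L (x, 0))\<^sup>2 / H0 x)"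
      by (rule extremal_quotient[OF I(3)[OF W] i \<epsilon>])
    let ?u = "extremal L"
    have B: "?B ?u = (LINT x|lborel. (?u (x, 0))\<^sup>2 / H0 x)"
    proof -
      have "?B ?u = (LINT x|lebesgue. (?u (x, 0))\<^sup>2 / H0 x)"
        unfolding P0
        by (rule integral_cong_AE[OF borel_measurable_integrable[OF I(1)[OF W]] measurable_completion[OF m]])
           (use ae[of L] in \<open>eventually_elim, simp\<close>)
      then show ?thesis by (simp add: integral_completion[OF m])
    qed
    have G: "?G ?u = (LINT z:half_space|lborel. (Phi H (extremal_grad L z))\<^sup>2)"
    proof -
      have "?G ?u = (LINT z|half_measure. (Phi H (extremal_grad L z))\<^sup>2)"
        unfolding set_integral_half
        by (rule integral_cong_AE[OF borel_measurable_integrable[OF I(2)[OF W]]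
              borel_measurable_integrable[OF Phi_integrable[OF C1c_L2_on(2)[OF C zero_less_one]]]])
           (use weak_gradient_props(4)[OF W C1c_has_weak_gradient[OF C zero_less_one], of L] in \<open>eventually_elim, simp\<close>)
      also have "\<dots> = (LINT z:half_space|lborel. (Phi H (extremal_grad L z))\<^sup>2)"
        unfolding set_integral_half[symmetric]
        by (rule half_space_lebesgue_lborel(1)[OF Phi_sq_continuous zero_less_one]) (use C[of L] in \<open>simp add: C1c_def\<close>)
      finally show ?thesis .
    qed
    have "?u \<in> ?A"
    proof -
      have "\<not> (AE x in lebesgue. boundary_trace ?u x = 0)"
      proof
        assume "AE x in lebesgue. boundary_trace ?u x = 0"
        then have "AE x in lebesgue. (boundary_trace ?u x)\<^sup>2 / H0 x = 0" by eventually_elim simp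
        then have "?B ?u = 0" unfolding P0 by (rule integral_eq_zero_AE)
        then show False using L(1) B by simp
      qed
      then show ?thesis using W by simp
    qed
    moreover have "(?G ?u - ?c * ?W ?u) / ?B ?u \<le> ?K + \<epsilon>"
      using L unfolding G c B set_integral_half K by (simp only: pos_divide_le_eq)
    ultimately show ?thesis by blast
  qed
  have "?K = (INF u \<in> ?A. (?G u - ?c * ?W u) / ?B u)"
  proof (rule antisym)
    have ne: "?A \<noteq> {}" using upper[OF zero_less_one] by blast
    show "?K \<le> (INF u \<in> ?A. (?G u - ?c * ?W u) / ?B u)" by (rule cINF_greatest[OF ne lower])
    have bdd: "bdd_below ((\<lambda>u. (?G u - ?c * ?W u) / ?B u) ` ?A)" by (rule bdd_belowI2[OF lower])
    show "(INF u \<in> ?A. (?G u - ?c * ?W u) / ?B u) \<le> ?K"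
    proof (rule field_le_epsilon)
      fix \<epsilon> :: real assume "0 < \<epsilon>"
      from upper[OF this] obtain u where "u \<in> ?A" "(?G u - ?c * ?W u) / ?B u \<le> ?K + \<epsilon>" by blast
      then show "(INF u \<in> ?A. (?G u - ?c * ?W u) / ?B u) \<le> ?K + \<epsilon>"
        using cINF_lower[OF bdd] order_trans by blast
    qed
  qed
  moreover have "\<forall>u \<in> W12 half_space. ?I u"
    using I by (simp add: P0 K set_integrable_half)
  ultimately show ?thesis by blast
qed

end
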